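(* Let $M$ be an o-minimal near-group and let $(P,\prec)$ be a linear order definable in $M$ (with parameters), where $P\subseteq M^k$ for some $k$, and let $n\defeq\dim(P)$ be its o-minimal dimension. Then there exists an $M$-definable map $g:P\to M^{2n+1}$ which is an order embedding of $(P,\prec)$ into $(M^{2n+1},<_{\mathrm{lex}})$, where $<_{\mathrm{lex}}$ is the lexicographic order induced by the order of $M$. Moreover, $g$ is uniformly definable over the parameters defining $P$ (and $\prec$), and for every odd $i\in\{1,3,\dots,2n+1\}$ the projection $\pi_i(g(P))$ of $g(P)$ onto the $i$-th coordinate is a finite set.
   Context: An ordered structure $M=(M,<,\dots)$ is called a near-group if $M$ has elimination of imaginaries and there is an $\emptyset$-definable order-reversing injection $\theta:M\to M$. (For example, an o-minimal ordered group with a definable positive element is an o-minimal near-group.) "$M$-definable" means definable in $M$ with parameters from $M$; $\dim$ denotes o-minimal dimension. $\pi_i:M^m\to M$ denotes projection onto the $i$-th coordinate.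
   Formalization: Uniform definability of g is over the parameters of P plus finitely many fixed constants from any given infinite set C; with no constants it fails, e.g. M=(Q,<,-x,1), P={-1,0,1}^2. If dcl(∅) is infinite, C=dcl(∅) gives the literal claim. O-minimal means dense without endpoints. *)

theory Defs
  imports Main
begin

text \<open>
  First-order structures expanding a linear order. The universe is the type \<open>'a\<close>, its order is
  the one of the class \<open>linorder\<close>, and the order symbol belongs to every language. Points of the
  cartesian power of exponent \<open>m\<close> are lists of length \<open>m\<close>.
\<close>

datatype 'f trm = Var nat | Fn 'f "'f trm list"

datatype ('f, 'r) fml =
    Equal "'f trm" "'f trm"
  | Less "'f trm" "'f trm"
  | Rel 'r "'f trm list"
  | Neg "('f, 'r) fml"
  | Conj "('f, 'r) fml" "('f, 'r) fml"
  | Ex nat "('f, 'r) fml"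

record ('f, 'r, 'a) fo_structure =
  fun_arity :: "'f \<Rightarrow> nat"
  rel_arity :: "'r \<Rightarrow> nat"
  fun_interp :: "'f \<Rightarrow> 'a list \<Rightarrow> 'a"
  rel_interp :: "'r \<Rightarrow> 'a list \<Rightarrow> bool"

primrec trm_vars :: "'f trm \<Rightarrow> nat set" where
  "trm_vars (Var i) = {i}"
| "trm_vars (Fn f ts) = \<Union> (set (map trm_vars ts))"

primrec free_vars :: "('f, 'r) fml \<Rightarrow> nat set" where
  "free_vars (Equal s t) = trm_vars s \<union> trm_vars t"
| "free_vars (Less s t) = trm_vars s \<union> trm_vars t"
| "free_vars (Rel r ts) = \<Union> (set (map trm_vars ts))"
| "free_vars (Neg \<phi>) = free_vars \<phi>"
| "free_vars (Conj \<phi> \<psi>) = free_vars \<phi> \<union> free_vars \<psi>"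
| "free_vars (Ex i \<phi>) = free_vars \<phi> - {i}"

primrec wf_trm :: "('f, 'r, 'a) fo_structure \<Rightarrow> 'f trm \<Rightarrow> bool" where
  "wf_trm M (Var i) = True"
| "wf_trm M (Fn f ts) = (length ts = fun_arity M f \<and> list_all id (map (wf_trm M) ts))"

primrec wf_fml :: "('f, 'r, 'a) fo_structure \<Rightarrow> ('f, 'r) fml \<Rightarrow> bool" where
  "wf_fml M (Equal s t) = (wf_trm M s \<and> wf_trm M t)"
| "wf_fml M (Less s t) = (wf_trm M s \<and> wf_trm M t)"
| "wf_fml M (Rel r ts) = (length ts = rel_arity M r \<and> list_all (wf_trm M) ts)"
| "wf_fml M (Neg \<phi>) = wf_fml M \<phi>"
| "wf_fml M (Conj \<phi> \<psi>) = (wf_fml M \<phi> \<and> wf_fml M \<psi>)"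
| "wf_fml M (Ex i \<phi>) = wf_fml M \<phi>"

primrec trm_val :: "('f, 'r, 'a) fo_structure \<Rightarrow> (nat \<Rightarrow> 'a) \<Rightarrow> 'f trm \<Rightarrow> 'a" where
  "trm_val M e (Var i) = e i"
| "trm_val M e (Fn f ts) = fun_interp M f (map (trm_val M e) ts)"

primrec sat :: "('f, 'r, 'a::linorder) fo_structure \<Rightarrow> (nat \<Rightarrow> 'a) \<Rightarrow> ('f, 'r) fml \<Rightarrow> bool" where
  "sat M e (Equal s t) = (trm_val M e s = trm_val M e t)"
| "sat M e (Less s t) = (trm_val M e s < trm_val M e t)"
| "sat M e (Rel r ts) = rel_interp M r (map (trm_val M e) ts)"
| "sat M e (Neg \<phi>) = (\<not> sat M e \<phi>)"
| "sat M e (Conj \<phi> \<psi>) = (sat M e \<phi> \<and> sat M e \<psi>)"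
| "sat M e (Ex i \<phi>) = (\<exists>a. sat M (e(i := a)) \<phi>)"

definition formula_in :: "('f, 'r, 'a) fo_structure \<Rightarrow> nat \<Rightarrow> ('f, 'r) fml \<Rightarrow> bool" where
  "formula_in M m \<phi> \<longleftrightarrow> wf_fml M \<phi> \<and> free_vars \<phi> \<subseteq> {..<m}"

definition tuples :: "nat \<Rightarrow> 'a list set" where
  "tuples m = {xs. length xs = m}"

text \<open>
  The variables \<open>0, \<dots>, m - 1\<close> stand for the coordinates, the following ones for the parameters
  \<open>as\<close>. Only used for \<open>formula_in M (m + length as) \<phi>\<close>, so that the values of \<open>nth\<close> beyond the end
  of the list play no role.
\<close>

definition solutions ::
  "('f, 'r, 'a::linorder) fo_structure \<Rightarrow> ('f, 'r) fml \<Rightarrow> nat \<Rightarrow> 'a list \<Rightarrow> 'a list set" where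
  "solutions M \<phi> m as = {xs \<in> tuples m. sat M (nth (xs @ as)) \<phi>}"

definition definable_over ::
  "('f, 'r, 'a::linorder) fo_structure \<Rightarrow> 'a set \<Rightarrow> nat \<Rightarrow> 'a list set \<Rightarrow> bool" where
  "definable_over M A m X \<longleftrightarrow>
     (\<exists>\<phi> as. set as \<subseteq> A \<and> formula_in M (m + length as) \<phi> \<and> X = solutions M \<phi> m as)"

definition graph_on :: "'a list set \<Rightarrow> ('a list \<Rightarrow> 'a list) \<Rightarrow> 'a list set" where
  "graph_on X f = {x @ f x | x. x \<in> X}"

definition definable_map_over ::
  "('f, 'r, 'a::linorder) fo_structure \<Rightarrow> 'a set \<Rightarrow> nat \<Rightarrow> 'a list set \<Rightarrow> nat
     \<Rightarrow> ('a list \<Rightarrow> 'a list) \<Rightarrow> bool" where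
  "definable_map_over M A m X l f \<longleftrightarrow>
     X \<subseteq> tuples m \<and> f ` X \<subseteq> tuples l \<and> definable_over M A (m + l) (graph_on X f)"

definition points_and_intervals :: "'a::linorder set set" where
  "points_and_intervals =
     range (\<lambda>a. {a}) \<union> {{a<..<b} | a b. a < b} \<union> range greaterThan \<union> range lessThan \<union> {UNIV}"

text \<open>As usual, o-minimal structures are dense without endpoints.\<close>

definition o_minimal :: "('f, 'r, 'a::linorder) fo_structure \<Rightarrow> bool" where
  "o_minimal M \<longleftrightarrow>
     (\<forall>x y :: 'a. x < y \<longrightarrow> (\<exists>z. x < z \<and> z < y)) \<and>
     (\<forall>x :: 'a. \<exists>y z. y < x \<and> x < z) \<and>
     (\<forall>X. definable_over M UNIV 1 X \<longrightarrow>
        (\<exists>\<I>. finite \<I> \<and> \<I> \<subseteq> points_and_intervals \<and> {x. [x] \<in> X} = \<Union> \<I>))"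

definition elim_imaginaries :: "('f, 'r, 'a::linorder) fo_structure \<Rightarrow> bool" where
  "elim_imaginaries M \<longleftrightarrow>
     (\<forall>m E. equiv (tuples m) E \<and> definable_over M {} (m + m) {x @ y | x y. (x, y) \<in> E} \<longrightarrow>
        (\<exists>l f. definable_map_over M {} m (tuples m) l f \<and>
           (\<forall>x\<in>tuples m. \<forall>y\<in>tuples m. (x, y) \<in> E \<longleftrightarrow> f x = f y)))"

definition near_group :: "('f, 'r, 'a::linorder) fo_structure \<Rightarrow> bool" where
  "near_group M \<longleftrightarrow>
     elim_imaginaries M \<and>
     (\<exists>\<theta> :: 'a \<Rightarrow> 'a. inj \<theta> \<and> antimono \<theta> \<and> definable_over M {} 2 {[x, \<theta> x] | x. True})"

definition has_interior :: "nat \<Rightarrow> 'a::linorder list set \<Rightarrow> bool" where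
  "has_interior d X \<longleftrightarrow>
     (\<exists>lo\<in>tuples d. \<exists>hi\<in>tuples d. (\<forall>j<d. lo ! j < hi ! j) \<and>
        {y \<in> tuples d. \<forall>j<d. lo ! j < y ! j \<and> y ! j < hi ! j} \<subseteq> X)"

text \<open>
  The o-minimal dimension of a subset of the power of exponent \<open>k\<close>: the largest \<open>d\<close> such that a
  projection onto \<open>d\<close> of the coordinates has nonempty interior. The supremum is a maximum for
  nonempty sets; the empty set, whose dimension is usually \<open>-\<infinity>\<close>, gets the value \<open>0\<close>.
\<close>

definition o_dim :: "nat \<Rightarrow> 'a::linorder list set \<Rightarrow> nat" where
  "o_dim k X =
     Sup {d. \<exists>js. length js = d \<and> sorted_wrt (<) js \<and> set js \<subseteq> {..<k} \<and>
           has_interior d ((\<lambda>x. map (nth x) js) ` X)}"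

definition lex_less :: "nat \<Rightarrow> ('a::linorder list \<times> 'a list) set" where
  "lex_less m = lexn {(a, b). a < b} m"

end

theory Submission
  imports Defs
begin

text \<open>
  The proof is by induction on the dimension \<open>n\<close> of the order. Call two points equivalent if the segment
  between them has dimension less than \<open>n\<close>. The classes are convex and have smaller dimension, so the
  induction hypothesis, applied uniformly to the family of classes, embeds each of them. It remains to embed
  the quotient \<open>Q\<close>, which exists by elimination of imaginaries, definably into the product of a finite set of
  parameters and \<open>M\<close>.

  Segments between distinct points of \<open>Q\<close> have preimages of full dimension \<open>n\<close>. Therefore a convex definable
  equivalence relation on \<open>Q\<close> has only finitely many nontrivial classes: infinitely many disjoint fat
  segments would have a preimage of dimension \<open>n + 1\<close>. Given a definable monotone curve in \<open>Q\<close>, send a point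
  to the supremum of the parameters at which the curve lies below it. This is strictly monotone where the curve
  has infinitely many points in every segment, and the failure set consists of finitely many convex pieces.
  It follows that \<open>Q\<close> is of dimension at most one and, up to a finite set, is covered by finitely many curves.
  So \<open>Q\<close> is cut into finitely many convex pieces, each of which maps strictly monotonically to \<open>M\<close>, after
  composition with \<open>\<theta>\<close> if the curve is decreasing. The position of the piece is recorded by one of the parameters.

  The tools are the monotonicity theorem for definable preorders, the additivity of dimension, and uniform
  finiteness.
\<close>

section \<open>Definable predicates and families\<close>

text \<open>The obstacle is uniformity. The induction hypothesis has to be applied to all classes of
  the thin equivalence at once, and the final formula may not depend on the order that is embedded.
  So what enters the induction is stated for parameter-free families indexed by environments, and
  every finite number chosen on the way (curves, monotone pieces, convex pieces of the quotient)
  needs a bound valid for all members; this is the use of uniform finiteness. Elimination of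
  imaginaries is applied to families as well, by appending the index to the points. The constant
  \<open>2 * n + 1\<close> counts two coordinates for each dimension, the label of a convex piece
  and the value of a cut map, and one label for the finite order that remains in dimension zero.
  Hence the labels are exactly the odd coordinates. They are entries of an increasing list
  \<open>c\<close> of parameters, whose length is fixed together with the formula. Dimension is
  defined by counting infinite fibres. Its additivity is then combinatorial, and o-minimality is
  what allows the coordinates to be permuted.\<close>

primrec rename_trm :: "(nat \<Rightarrow> nat) \<Rightarrow> 'f trm \<Rightarrow> 'f trm" where
  "rename_trm \<rho> (Var i) = Var (\<rho> i)"
| "rename_trm \<rho> (Fn f ts) = Fn f (map (rename_trm \<rho>) ts)"

lemma trm_val_rename: "trm_val M e (rename_trm \<rho> t) = trm_val M (\<lambda>i. e (\<rho> i)) t"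
  by (induction t) (auto simp: comp_def cong: map_cong)

lemma trm_vars_rename: "trm_vars (rename_trm \<rho> t) = \<rho> ` trm_vars t"
  by (induction t) auto

lemma wf_trm_rename: "wf_trm M t \<Longrightarrow> wf_trm M (rename_trm \<rho> t)"
  by (induction t) (auto simp: list_all_iff)

lemma finite_trm_vars: "finite (trm_vars t)"
  by (induction t) auto

lemma finite_free_vars: "finite (free_vars \<phi>)"
  by (induction \<phi>) (auto simp: finite_trm_vars)

lemma trm_val_cong: "(\<And>i. i \<in> trm_vars t \<Longrightarrow> e i = e' i) \<Longrightarrow> trm_val M e t = trm_val M e' t"
proof (induction t)
  case (Fn f ts)
  have "map (trm_val M e) ts = map (trm_val M e') ts"
    using Fn by (intro map_cong) auto
  then show ?case by (metis trm_val.simps(2))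
qed auto

lemma sat_cong: "(\<And>i. i \<in> free_vars \<phi> \<Longrightarrow> e i = e' i) \<Longrightarrow> sat M e \<phi> = sat M e' \<phi>"
proof (induction \<phi> arbitrary: e e')
  case (Equal s t)
  have "trm_val M e s = trm_val M e' s" "trm_val M e t = trm_val M e' t"
    using Equal by (auto intro!: trm_val_cong)
  then show ?case by simp
next
  case (Less s t)
  have "trm_val M e s = trm_val M e' s" "trm_val M e t = trm_val M e' t"
    using Less by (auto intro!: trm_val_cong)
  then show ?case by simp
next
  case (Rel r ts)
  have "map (trm_val M e) ts = map (trm_val M e') ts"
    using Rel by (intro map_cong trm_val_cong) auto
  then show ?case by (simp del: map_eq_conv)
next
  case (Neg \<phi>)
  have "sat M e \<phi> = sat M e' \<phi>" using Neg.prems by (intro Neg.IH) auto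
  then show ?case by simp
next
  case (Conj \<phi> \<psi>)
  have "sat M e \<phi> = sat M e' \<phi>" "sat M e \<psi> = sat M e' \<psi>"
    using Conj.prems by (intro Conj.IH; auto)+
  then show ?case by simp
next
  case (Ex x \<phi>)
  have "sat M (e(x := a)) \<phi> = sat M (e'(x := a)) \<phi>" for a
    using Ex.prems by (intro Ex.IH) auto
  then show ?case by simp
qed

text \<open>Capture is avoided by sending a bound variable to an index outside the image of the free
  variables. The choice of that index is why existence is claimed and no renaming function is
  defined. \<rho> may identify variables; this is used to merge several variables into a quantified
  one.\<close>

lemma rename_fml:
  fixes \<rho> :: "nat \<Rightarrow> nat"
  shows "\<exists>\<phi>'. (wf_fml M \<phi> \<longrightarrow> wf_fml M \<phi>') \<and> free_vars \<phi>' \<subseteq> \<rho> ` free_vars \<phi> \<and>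
    (\<forall>e. sat M e \<phi>' = sat M (\<lambda>i. e (\<rho> i)) \<phi>)"
proof (induction \<phi> arbitrary: \<rho>)
  case (Equal s t)
  show ?case
    by (rule exI[of _ "Equal (rename_trm \<rho> s) (rename_trm \<rho> t)"])
      (auto simp: trm_val_rename trm_vars_rename wf_trm_rename)
next
  case (Less s t)
  show ?case
    by (rule exI[of _ "Less (rename_trm \<rho> s) (rename_trm \<rho> t)"])
      (auto simp: trm_val_rename trm_vars_rename wf_trm_rename)
next
  case (Rel r ts)
  show ?case
    by (rule exI[of _ "Rel r (map (rename_trm \<rho>) ts)"])
      (auto simp: trm_val_rename trm_vars_rename wf_trm_rename list_all_iff comp_def)
next
  case (Neg \<phi>)
  then obtain \<phi>' where "(wf_fml M \<phi> \<longrightarrow> wf_fml M \<phi>') \<and> free_vars \<phi>' \<subseteq> \<rho> ` free_vars \<phi> \<and>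
    (\<forall>e. sat M e \<phi>' = sat M (\<lambda>i. e (\<rho> i)) \<phi>)" by blast
  then show ?case by (intro exI[of _ "Neg \<phi>'"]) auto
next
  case (Conj \<phi> \<psi>)
  obtain \<phi>' where "(wf_fml M \<phi> \<longrightarrow> wf_fml M \<phi>') \<and> free_vars \<phi>' \<subseteq> \<rho> ` free_vars \<phi> \<and>
    (\<forall>e. sat M e \<phi>' = sat M (\<lambda>i. e (\<rho> i)) \<phi>)" using Conj.IH(1) by blast
  moreover obtain \<psi>' where "(wf_fml M \<psi> \<longrightarrow> wf_fml M \<psi>') \<and> free_vars \<psi>' \<subseteq> \<rho> ` free_vars \<psi> \<and>
    (\<forall>e. sat M e \<psi>' = sat M (\<lambda>i. e (\<rho> i)) \<psi>)" using Conj.IH(2) by blast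
  ultimately show ?case by (intro exI[of _ "Conj \<phi>' \<psi>'"]) auto
next
  case (Ex x \<phi>)
  have "finite (\<rho> ` free_vars \<phi>)" by (simp add: finite_free_vars)
  then obtain j where j: "j \<notin> \<rho> ` free_vars \<phi>" by (meson ex_new_if_finite infinite_UNIV_nat)
  obtain \<phi>' where \<phi>': "wf_fml M \<phi> \<longrightarrow> wf_fml M \<phi>'" "free_vars \<phi>' \<subseteq> \<rho>(x := j) ` free_vars \<phi>"
    "\<forall>e. sat M e \<phi>' = sat M ((\<lambda>i. e ((\<rho>(x := j)) i))) \<phi>" using Ex.IH[of "\<rho>(x := j)"] by blast
  have "sat M (e(j := a)) \<phi>' = sat M ((\<lambda>i. e (\<rho> i))(x := a)) \<phi>" for e a
    using j by (auto simp: \<phi>'(3) intro!: sat_cong)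
  then show ?case using \<phi>'(1,2)
    by (intro exI[of _ "Ex j \<phi>'"]) (auto split: if_splits)
qed

section \<open>Atoms and the terms built from them\<close>

fun atom_val :: "(nat \<Rightarrow> 'a) \<Rightarrow> nat + 'a \<Rightarrow> 'a" where
  "atom_val e (Inl i) = e i"
| "atom_val e (Inr a) = a"

definition atoms :: "'a set \<Rightarrow> (nat + 'a) set" where
  "atoms A = range Inl \<union> Inr ` A"

lemma atoms_Inl[simp]: "Inl i \<in> atoms A" by (simp add: atoms_def)
lemma atoms_Inr[simp]: "Inr a \<in> atoms A \<longleftrightarrow> a \<in> A" by (auto simp: atoms_def)

text \<open>A single variable or a parameter from \<open>A\<close>; function symbols occur only
  inside formulas. Such terms stay of this form when the environment is replaced by one whose
  entries are again such terms.\<close>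

definition elt_term :: "'a set \<Rightarrow> ((nat \<Rightarrow> 'a) \<Rightarrow> 'a) \<Rightarrow> bool" where
  "elt_term A t \<longleftrightarrow> (\<exists>r\<in>atoms A. t = (\<lambda>e. atom_val e r))"

definition list_term :: "'a set \<Rightarrow> nat \<Rightarrow> ((nat \<Rightarrow> 'a) \<Rightarrow> 'a list) \<Rightarrow> bool" where
  "list_term A k L \<longleftrightarrow> (\<exists>ts. length ts = k \<and> list_all (elt_term A) ts \<and> L = (\<lambda>e. map (\<lambda>t. t e) ts))"

definition env_term :: "'a set \<Rightarrow> ((nat \<Rightarrow> 'a) \<Rightarrow> nat \<Rightarrow> 'a) \<Rightarrow> bool" where
  "env_term A s \<longleftrightarrow> (\<forall>i. elt_term A (\<lambda>e. s e i))"

text \<open>Syntax-directed closure rules: definability goals are solved by applying them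
  repeatedly, and a proof adds the rules for the sets and relations it has at hand.\<close>

named_theorems dfn

lemma elt_var[dfn]: "elt_term A (\<lambda>e. e i)"
  unfolding elt_term_def by (rule bexI[of _ "Inl i"]) auto

lemma elt_const[dfn]: "elt_term UNIV (\<lambda>e. a)"
  unfolding elt_term_def by (rule bexI[of _ "Inr a"]) auto

lemma env_termI[dfn]: "(\<And>i. elt_term A (\<lambda>e. s e i)) \<Longrightarrow> env_term A s"
  by (simp add: env_term_def)

lemma env_case:
  assumes "elt_term A t" "env_term A s"
  shows "env_term A (\<lambda>e i. case i of 0 \<Rightarrow> t e | Suc j \<Rightarrow> s e j)"
  unfolding env_term_def
proof
  fix i show "elt_term A (\<lambda>e. case i of 0 \<Rightarrow> t e | Suc j \<Rightarrow> s e j)"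
    using assms by (cases i) (simp_all add: env_term_def)
qed

lemma elt_subst: "elt_term A t \<Longrightarrow> env_term A s \<Longrightarrow> elt_term A (\<lambda>e. t (s e))"
  unfolding elt_term_def[of A t] env_term_def
proof (elim bexE)
  fix r assume r: "r \<in> atoms A" "t = (\<lambda>e. atom_val e r)" "\<forall>i. elt_term A (\<lambda>e. s e i)"
  then show ?thesis
  proof (cases r)
    case (Inr b)
    then have "(\<lambda>e. t (s e)) = (\<lambda>e. atom_val e r)" using r by auto
    then show ?thesis using r(1) unfolding elt_term_def by blast
  qed auto
qed

lemma list_upt[dfn]: "(\<And>i. elt_term A (\<lambda>e. F e i)) \<Longrightarrow> list_term A k (\<lambda>e. map (F e) [0..<k])"
  unfolding list_term_def
  by (rule exI[of _ "map (\<lambda>i e. F e i) [0..<k]"]) (auto simp: list_all_iff comp_def)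

lemma list_Nil[dfn]: "list_term A 0 (\<lambda>e. [])"
  by (simp add: list_term_def)

lemma list_Cons[dfn]: "elt_term A t \<Longrightarrow> list_term A k L \<Longrightarrow> list_term A (Suc k) (\<lambda>e. t e # L e)"
  unfolding list_term_def
proof (elim exE conjE)
  fix ts assume "elt_term A t" "length ts = k" "list_all (elt_term A) ts" "L = (\<lambda>e. map (\<lambda>t. t e) ts)"
  then show "\<exists>ts. length ts = Suc k \<and> list_all (elt_term A) ts \<and> (\<lambda>e. t e # L e) = (\<lambda>e. map (\<lambda>t. t e) ts)"
    by (intro exI[of _ "t # ts"]) auto
qed

lemma list_term_2[dfn]: "elt_term A t \<Longrightarrow> elt_term A s \<Longrightarrow> list_term A 2 (\<lambda>e. [t e, s e])"
  using list_Cons[OF _ list_Cons[OF _ list_Nil]] by (metis numeral_2_eq_2)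

lemma list_term_1[dfn]: "elt_term A t \<Longrightarrow> list_term A 1 (\<lambda>e. [t e])"
  using list_Cons[OF _ list_Nil] by (metis One_nat_def)

lemma list_append[dfn]:
  assumes "list_term A k L" "list_term A l L'" "m = k + l" shows "list_term A m (\<lambda>e. L e @ L' e)"
proof -
  obtain ts us where "length ts = k" "list_all (elt_term A) ts" "L = (\<lambda>e. map (\<lambda>t. t e) ts)"
    "length us = l" "list_all (elt_term A) us" "L' = (\<lambda>e. map (\<lambda>t. t e) us)"
    using assms unfolding list_term_def by auto
  then show ?thesis using assms(3) unfolding list_term_def
    by (intro exI[of _ "ts @ us"]) auto
qed

lemma list_tl[dfn]: "list_term A (Suc k) L \<Longrightarrow> list_term A k (\<lambda>e. tl (L e))"
  unfolding list_term_def
proof (elim exE conjE)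
  fix ts assume "length ts = Suc k" "list_all (elt_term A) ts" "L = (\<lambda>e. map (\<lambda>t. t e) ts)"
  then show "\<exists>ts. length ts = k \<and> list_all (elt_term A) ts \<and> (\<lambda>e. tl (L e)) = (\<lambda>e. map (\<lambda>t. t e) ts)"
    by (intro exI[of _ "tl ts"]) (auto simp: list_all_length map_tl nth_tl)
qed

lemma list_butlast[dfn]: "list_term A (Suc k) L \<Longrightarrow> list_term A k (\<lambda>e. butlast (L e))"
  unfolding list_term_def
proof (elim exE conjE)
  fix ts assume "length ts = Suc k" "list_all (elt_term A) ts" "L = (\<lambda>e. map (\<lambda>t. t e) ts)"
  then show "\<exists>ts. length ts = k \<and> list_all (elt_term A) ts \<and> (\<lambda>e. butlast (L e)) = (\<lambda>e. map (\<lambda>t. t e) ts)"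
    by (intro exI[of _ "butlast ts"]) (auto simp: list_all_iff map_butlast dest: in_set_butlastD)
qed

lemma list_take: "list_term A k L \<Longrightarrow> m \<le> k \<Longrightarrow> list_term A m (\<lambda>e. take m (L e))"
  unfolding list_term_def
proof (elim exE conjE)
  fix ts assume "m \<le> k" "length ts = k" "list_all (elt_term A) ts" "L = (\<lambda>e. map (\<lambda>t. t e) ts)"
  then show "\<exists>ts. length ts = m \<and> list_all (elt_term A) ts \<and> (\<lambda>e. take m (L e)) = (\<lambda>e. map (\<lambda>t. t e) ts)"
    by (intro exI[of _ "take m ts"]) (auto simp: list_all_iff take_map dest: in_set_takeD)
qed

lemma list_drop: "list_term A k L \<Longrightarrow> m + n = k \<Longrightarrow> list_term A m (\<lambda>e. drop n (L e))"
  unfolding list_term_def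
proof (elim exE conjE)
  fix ts assume "m + n = k" "length ts = k" "list_all (elt_term A) ts" "L = (\<lambda>e. map (\<lambda>t. t e) ts)"
  then show "\<exists>ts. length ts = m \<and> list_all (elt_term A) ts \<and> (\<lambda>e. drop n (L e)) = (\<lambda>e. map (\<lambda>t. t e) ts)"
    by (intro exI[of _ "drop n ts"]) (auto simp: list_all_iff drop_map dest: in_set_dropD)
qed

lemma list_update_term[dfn]:
  "list_term A k L \<Longrightarrow> elt_term A t \<Longrightarrow> list_term A k (\<lambda>e. (L e)[i := t e])"
  unfolding list_term_def
proof (elim exE conjE)
  fix ts assume "elt_term A t" "length ts = k" "list_all (elt_term A) ts" "L = (\<lambda>e. map (\<lambda>t. t e) ts)"
  then show "\<exists>ts. length ts = k \<and> list_all (elt_term A) ts \<and> (\<lambda>e. (L e)[i := t e]) = (\<lambda>e. map (\<lambda>t. t e) ts)"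
    by (intro exI[of _ "ts[i := t]"])
      (auto simp: list_all_iff map_update dest!: set_update_subset_insert[THEN subsetD])
qed

lemma elt_nth: "list_term A k L \<Longrightarrow> i < k \<Longrightarrow> elt_term A (\<lambda>e. L e ! i)"
  unfolding list_term_def by (auto simp: list_all_length)

lemma elt_hd[dfn]: "list_term A (Suc k) L \<Longrightarrow> elt_term A (\<lambda>e. hd (L e))"
  unfolding list_term_def
proof (elim exE conjE)
  fix ts assume *: "length ts = Suc k" "list_all (elt_term A) ts" "L = (\<lambda>e. map (\<lambda>t. t e) ts)"
  then have "ts \<noteq> []" by auto
  moreover from this have "hd ts \<in> set ts" by simp
  moreover have "(\<lambda>e. hd (L e)) = hd ts" using * \<open>ts \<noteq> []\<close> by (simp add: hd_map)
  ultimately show ?thesis using * by (auto simp: list_all_iff)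
qed

lemma elt_last[dfn]: "list_term A (Suc k) L \<Longrightarrow> elt_term A (\<lambda>e. last (L e))"
  unfolding list_term_def
proof (elim exE conjE)
  fix ts assume *: "length ts = Suc k" "list_all (elt_term A) ts" "L = (\<lambda>e. map (\<lambda>t. t e) ts)"
  then have "last ts \<in> set ts" "ts \<noteq> []" by (auto intro!: last_in_set)
  moreover from this have "(\<lambda>e. last (L e)) = last ts" using * by (simp add: last_map)
  ultimately show ?thesis using * by (auto simp: list_all_iff)
qed

lemma list_const[dfn]: "k = length xs \<Longrightarrow> list_term UNIV k (\<lambda>e. xs)"
  unfolding list_term_def
  by (intro exI[of _ "map (\<lambda>a e. a) xs"]) (auto simp: list_all_iff comp_def intro: elt_const)

lemma list_length: "list_term A k L \<Longrightarrow> length (L e) = k"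
  unfolding list_term_def by auto

text \<open>For fixed \<open>j\<close> this is first-order, by peeling off one point at a time as in
  \<open>ncard_Suc\<close>. It also excludes infinite sets, for which \<open>card\<close> is
  0.\<close>

definition ncard :: "nat \<Rightarrow> 'b set \<Rightarrow> bool" where
  "ncard j X \<longleftrightarrow> finite X \<and> card X = j"

lemma ncard_Suc: "ncard (Suc j) X \<longleftrightarrow> (\<exists>x. x \<in> X \<and> ncard j {y \<in> X. y \<noteq> x})"
proof -
  have eq: "{y \<in> X. y \<noteq> x} = X - {x}" for x by auto
  show ?thesis unfolding eq ncard_def
  proof
    assume *: "finite X \<and> card X = Suc j"
    then have "X \<noteq> {}" by auto
    then obtain x where "x \<in> X" by blast
    then show "\<exists>x. x \<in> X \<and> finite (X - {x}) \<and> card (X - {x}) = j" using * by (intro exI[of _ x]) simp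
  next
    assume "\<exists>x. x \<in> X \<and> finite (X - {x}) \<and> card (X - {x}) = j"
    then obtain x where x: "x \<in> X" "finite (X - {x})" "card (X - {x}) = j" by blast
    then have "finite X" by simp
    then show "finite X \<and> card X = Suc j" by (simp only: card.remove[OF _ x(1)] x(3))
  qed
qed

lemma ncard_0: "ncard 0 X \<longleftrightarrow> X = {}"
  by (auto simp: ncard_def)

section \<open>Closure of definable predicates under the logical operations\<close>

locale fo =
  fixes M :: "('f, 'r, 'a::linorder) fo_structure"
begin

text \<open>A predicate on environments, that is on assignments of all the variables, is definable if it
  is the truth value of a formula whose variables are replaced by atoms.\<close>

definition dfn :: "'a set \<Rightarrow> ((nat \<Rightarrow> 'a) \<Rightarrow> bool) \<Rightarrow> bool" where
  "dfn A P \<longleftrightarrow> (\<exists>\<phi> \<rho>. wf_fml M \<phi> \<and> range \<rho> \<subseteq> atoms A \<and> P = (\<lambda>e. sat M (\<lambda>i. atom_val e (\<rho> i)) \<phi>))"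

lemma dfnI:
  "wf_fml M \<phi> \<Longrightarrow> (\<And>i. \<rho> i \<in> atoms A) \<Longrightarrow> (\<And>e. P e \<longleftrightarrow> sat M (\<lambda>i. atom_val e (\<rho> i)) \<phi>) \<Longrightarrow> dfn A P"
  unfolding dfn_def by (intro exI[of _ \<phi>] exI[of _ \<rho>]) auto

lemma dfnE:
  assumes "dfn A P"
  obtains \<phi> \<rho> where "wf_fml M \<phi>" "\<forall>i. \<rho> i \<in> atoms A" "\<forall>e. P e \<longleftrightarrow> sat M (\<lambda>i. atom_val e (\<rho> i)) \<phi>"
proof -
  obtain \<phi> \<rho> where "wf_fml M \<phi>" "range \<rho> \<subseteq> atoms A" "P = (\<lambda>e. sat M (\<lambda>i. atom_val e (\<rho> i)) \<phi>)"
    using assms unfolding dfn_def by (elim exE conjE)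
  then show ?thesis by (intro that[of \<phi> \<rho>]) auto
qed

lemma dfn_mono: "dfn A P \<Longrightarrow> A \<subseteq> B \<Longrightarrow> dfn B P"
proof (erule dfnE)
  fix \<phi> \<rho> assume "A \<subseteq> B" "wf_fml M \<phi>" "\<forall>i. \<rho> i \<in> atoms A" "\<forall>e. P e \<longleftrightarrow> sat M (\<lambda>i. atom_val e (\<rho> i)) \<phi>"
  moreover have "atoms A \<subseteq> atoms B" using \<open>A \<subseteq> B\<close> by (auto simp: atoms_def)
  ultimately show ?thesis by (intro dfnI[of \<phi> \<rho>]) auto
qed

lemma dfn_subst:
  assumes "dfn A P" "env_term A s" shows "dfn A (\<lambda>e. P (s e))"
proof -
  obtain \<phi> \<rho> where 1: "wf_fml M \<phi>" "\<forall>i. \<rho> i \<in> atoms A" "\<forall>e. P e \<longleftrightarrow> sat M (\<lambda>i. atom_val e (\<rho> i)) \<phi>"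
    using assms(1) by (elim dfnE)
  note 1 = 1(1) 1(2)[rule_format] 1(3)[rule_format]
  have "\<exists>r\<in>atoms A. (\<lambda>e. atom_val (s e) (\<rho> i)) = (\<lambda>e. atom_val e r)" for i
    using elt_subst[OF _ assms(2), of "\<lambda>e. atom_val e (\<rho> i)"] 1(2)[of i]
    unfolding elt_term_def by blast
  then obtain \<rho>' where "\<And>i. \<rho>' i \<in> atoms A" "\<And>i. (\<lambda>e. atom_val (s e) (\<rho> i)) = (\<lambda>e. atom_val e (\<rho>' i))"
    by metis
  then have "atom_val (s e) (\<rho> i) = atom_val e (\<rho>' i)" for e i by (metis (no_types))
  then show ?thesis using \<open>\<And>i. \<rho>' i \<in> atoms A\<close> by (intro dfnI[OF 1(1), of \<rho>']) (simp_all add: 1(3))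
qed

lemma dfn_less[dfn]:
  assumes "elt_term A t" "elt_term A s" shows "dfn A (\<lambda>e. t e < s e)"
proof -
  obtain r r' where "r \<in> atoms A" "t = (\<lambda>e. atom_val e r)" "r' \<in> atoms A" "s = (\<lambda>e. atom_val e r')"
    using assms unfolding elt_term_def by blast
  then show ?thesis
    by (intro dfnI[of "Less (Var 0) (Var 1)" "\<lambda>i. if i = 0 then r else r'"]) auto
qed

lemma dfn_eq[dfn]:
  assumes "elt_term A t" "elt_term A s" shows "dfn A (\<lambda>e. t e = s e)"
proof -
  obtain r r' where "r \<in> atoms A" "t = (\<lambda>e. atom_val e r)" "r' \<in> atoms A" "s = (\<lambda>e. atom_val e r')"
    using assms unfolding elt_term_def by blast
  then show ?thesis
    by (intro dfnI[of "Equal (Var 0) (Var 1)" "\<lambda>i. if i = 0 then r else r'"]) auto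
qed

lemma dfn_not[dfn]: "dfn A P \<Longrightarrow> dfn A (\<lambda>e. \<not> P e)"
proof (erule dfnE)
  fix \<phi> \<rho> assume "wf_fml M \<phi>" "\<forall>i. \<rho> i \<in> atoms A" "\<forall>e. P e \<longleftrightarrow> sat M (\<lambda>i. atom_val e (\<rho> i)) \<phi>"
  then show ?thesis by (intro dfnI[of "Neg \<phi>" \<rho>]) auto
qed

lemma dfn_conj[dfn]:
  assumes "dfn A P" "dfn A Q" shows "dfn A (\<lambda>e. P e \<and> Q e)"
proof -
  obtain \<phi> \<rho> where 1: "wf_fml M \<phi>" "\<forall>i. \<rho> i \<in> atoms A" "\<forall>e. P e \<longleftrightarrow> sat M (\<lambda>i. atom_val e (\<rho> i)) \<phi>"
    using assms(1) by (elim dfnE)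
  note 1 = 1(1) 1(2)[rule_format] 1(3)[rule_format]
  obtain \<psi> \<sigma> where 2: "wf_fml M \<psi>" "\<forall>i. \<sigma> i \<in> atoms A" "\<forall>e. Q e \<longleftrightarrow> sat M (\<lambda>i. atom_val e (\<sigma> i)) \<psi>"
    using assms(2) by (elim dfnE)
  note 2 = 2(1) 2(2)[rule_format] 2(3)[rule_format]
  \<comment> \<open>The two formulas may attach different atoms to the same variable, so their
    variables are moved to the even and to the odd indices.\<close>
  obtain \<phi>' where 3: "wf_fml M \<phi>'" "\<And>e. sat M e \<phi>' = sat M (\<lambda>i. e (2 * i)) \<phi>"
    using rename_fml[of M \<phi> "\<lambda>i. 2 * i"] 1 by blast
  obtain \<psi>' where 4: "wf_fml M \<psi>'" "\<And>e. sat M e \<psi>' = sat M (\<lambda>i. e (2 * i + 1)) \<psi>"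
    using rename_fml[of M \<psi> "\<lambda>i. 2 * i + 1"] 2 by blast
  show ?thesis
    using 1 2 3 4
    by (intro dfnI[of "Conj \<phi>' \<psi>'" "\<lambda>i. if even i then \<rho> (i div 2) else \<sigma> (i div 2)"]) (auto simp: comp_def)
qed

text \<open>The premise follows the de Bruijn convention: the quantified element sits in slot 0 and
  the old environment is shifted by one. The rules for the other element binders have the same
  shape, so a binder can be stripped without naming a variable.\<close>

lemma dfn_ex[dfn]:
  assumes "dfn A (\<lambda>e. Q (\<lambda>i. e (Suc i)) (e 0))" shows "dfn A (\<lambda>e. \<exists>x. Q e x)"
proof -
  obtain \<phi> \<rho> where 1: "wf_fml M \<phi>" "\<forall>i. \<rho> i \<in> atoms A"
    "\<forall>e. Q (\<lambda>i. e (Suc i)) (e 0) \<longleftrightarrow> sat M (\<lambda>i. atom_val e (\<rho> i)) \<phi>"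
    using assms by (elim dfnE)
  note 1 = 1(1) 1(2)[rule_format] 1(3)[rule_format]
  \<comment> \<open>Several variables of \<phi> may be attached to slot 0. All of them become
    variable 0, the one that is then quantified.\<close>
  define \<sigma> where "\<sigma> i = (if \<rho> i = Inl 0 then 0 else Suc i)" for i
  obtain \<phi>' where 2: "wf_fml M \<phi>'" "\<And>e. sat M e \<phi>' = sat M (\<lambda>i. e (\<sigma> i)) \<phi>"
    using rename_fml[of M \<phi> \<sigma>] 1 by blast
  define \<tau> where "\<tau> i = (case i of 0 \<Rightarrow> Inl 0 | Suc j \<Rightarrow> (case \<rho> j of Inl m \<Rightarrow> Inl (m - 1) | Inr a \<Rightarrow> Inr a))"
    for i
  have \<tau>: "\<tau> i \<in> atoms A" for i
    using 1(2) by (auto simp: \<tau>_def split: nat.splits sum.splits) (metis atoms_Inr)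
  have *: "(\<lambda>i. ((\<lambda>i. atom_val e (\<tau> i))(0 := x)) (\<sigma> i)) = (\<lambda>i. atom_val (case_nat x e) (\<rho> i))" for e x
    by (auto simp: fun_eq_iff \<sigma>_def \<tau>_def split: sum.splits nat.splits)
  show ?thesis
    using 2(1) \<tau>
  proof (intro dfnI[of "Ex 0 \<phi>'" \<tau>])
    fix e
    have "Q e x \<longleftrightarrow> sat M ((\<lambda>i. atom_val e (\<tau> i))(0 := x)) \<phi>'" for x
      using 1(3)[of "case_nat x e"] by (simp add: 2(2) * del: fun_upd_apply)
    then show "(\<exists>x. Q e x) \<longleftrightarrow> sat M (\<lambda>i. atom_val e (\<tau> i)) (Ex 0 \<phi>')" by simp
  qed auto
qed

lemma dfn_const[dfn]: "dfn A (\<lambda>e. c)"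
proof (cases c)
  case True
  then show ?thesis by (intro dfnI[of "Equal (Var 0) (Var 0)" "\<lambda>i. Inl 0"]) auto
next
  case False
  then show ?thesis by (intro dfnI[of "Neg (Equal (Var 0) (Var 0))" "\<lambda>i. Inl 0"]) auto
qed

lemma dfn_cong: "dfn A P \<Longrightarrow> (\<And>e. P e \<longleftrightarrow> Q e) \<Longrightarrow> dfn A Q"
  by (subst (asm) ext[of P Q]) auto

lemma dfn_disj[dfn]:
  assumes "dfn A P" "dfn A Q" shows "dfn A (\<lambda>e. P e \<or> Q e)"
proof -
  have "dfn A (\<lambda>e. \<not> (\<not> P e \<and> \<not> Q e))" using assms by - (rule dfn | assumption)+
  then show ?thesis by (rule dfn_cong) auto
qed

lemma dfn_imp[dfn]:
  assumes "dfn A P" "dfn A Q" shows "dfn A (\<lambda>e. P e \<longrightarrow> Q e)"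
proof -
  have "dfn A (\<lambda>e. \<not> P e \<or> Q e)" using assms by - (rule dfn | assumption)+
  then show ?thesis by (rule dfn_cong) auto
qed

lemma dfn_iff[dfn]:
  assumes "dfn A P" "dfn A Q" shows "dfn A (\<lambda>e. P e \<longleftrightarrow> Q e)"
proof -
  have "dfn A (\<lambda>e. (P e \<longrightarrow> Q e) \<and> (Q e \<longrightarrow> P e))" using assms by - (rule dfn | assumption)+
  then show ?thesis by (rule dfn_cong) auto
qed

lemma dfn_all[dfn]:
  assumes "dfn A (\<lambda>e. Q (\<lambda>i. e (Suc i)) (e 0))" shows "dfn A (\<lambda>e. \<forall>x. Q e x)"
proof -
  have "dfn A (\<lambda>e. \<not> (\<exists>x. \<not> Q e x))" using assms by - (rule dfn | assumption)+
  then show ?thesis by (rule dfn_cong) auto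
qed

lemma dfn_le[dfn]:
  assumes "elt_term A t" "elt_term A s" shows "dfn A (\<lambda>e. t e \<le> s e)"
proof -
  have "dfn A (\<lambda>e. \<not> s e < t e)" using assms by - (rule dfn | assumption)+
  then show ?thesis by (rule dfn_cong) auto
qed

lemma dfn_ex_less[dfn]: "(\<And>i. i < (k :: nat) \<Longrightarrow> dfn A (P i)) \<Longrightarrow> dfn A (\<lambda>e. \<exists>i<k. P i e)"
proof (induction k)
  case (Suc k)
  have "dfn A (\<lambda>e. (\<exists>i<k. P i e) \<or> P k e)" using Suc by (intro dfn_disj Suc.IH) auto
  then show ?case by (rule dfn_cong) (auto simp: less_Suc_eq)
qed (simp add: dfn_const)

lemma dfn_all_less[dfn]:
  assumes "\<And>i. i < (k :: nat) \<Longrightarrow> dfn A (P i)" shows "dfn A (\<lambda>e. \<forall>i<k. P i e)"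
proof -
  have "dfn A (\<lambda>e. \<not> (\<exists>i<k. \<not> P i e))" using assms by (intro dfn_not dfn_ex_less)
  then show ?thesis by (rule dfn_cong) auto
qed

lemma dfn_list_eq[dfn]:
  assumes "list_term A k L" "list_term A k L'" shows "dfn A (\<lambda>e. L e = L' e)"
proof -
  have "dfn A (\<lambda>e. \<forall>i<k. L e ! i = L' e ! i)"
    using assms by (intro dfn_all_less dfn_eq elt_nth)
  then show ?thesis
    by (rule dfn_cong) (simp add: list_eq_iff_nth_eq list_length[OF assms(1)] list_length[OF assms(2)])
qed

lemma dfn_mem_list[dfn]:
  assumes "elt_term A t" "list_term A k L" shows "dfn A (\<lambda>e. t e \<in> set (L e))"
proof -
  have "dfn A (\<lambda>e. \<exists>i<k. L e ! i = t e)"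
    using assms by (intro dfn_ex_less dfn_eq elt_nth)
  then show ?thesis
    by (rule dfn_cong) (simp add: in_set_conv_nth list_length[OF assms(2)])
qed

text \<open>A quantifier over lists of length \<open>k\<close> is a block of \<open>k\<close>
  quantifiers over elements; the list occupies the first \<open>k\<close> slots.\<close>

lemma dfn_exl[dfn]:
  "dfn A (\<lambda>e. Q (\<lambda>i. e (k + i)) (map e [0..<k])) \<Longrightarrow> dfn A (\<lambda>e. \<exists>xs. length xs = k \<and> Q e xs)"
proof (induction k arbitrary: Q)
  case 0
  then show ?case by simp
next
  case (Suc k)
  have map_Suc: "map e [0..<Suc k] = e 0 # map (\<lambda>i. e (Suc i)) [0..<k]" for e :: "nat \<Rightarrow> 'a"
    by (metis map_upt_Suc)
  have "dfn A (\<lambda>e. \<exists>xs. length xs = k \<and> (\<exists>x. Q e (x # xs)))"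
  proof (rule Suc.IH, rule dfn_ex)
    let ?s = "\<lambda>(e::nat \<Rightarrow> 'a) i. if i = 0 then e 0 else if i \<le> k then e i else e i"
    show "dfn A (\<lambda>e. Q (\<lambda>i. e (Suc (k + i))) (e 0 # map (\<lambda>i. e (Suc i)) [0..<k]))"
      using Suc.prems by (simp only: map_Suc add_Suc)
  qed
  then show ?case
    by (rule dfn_cong) (auto simp: length_Suc_conv)
qed

lemma dfn_alll[dfn]:
  assumes "dfn A (\<lambda>e. Q (\<lambda>i. e (k + i)) (map e [0..<k]))" shows "dfn A (\<lambda>e. \<forall>xs. length xs = k \<longrightarrow> Q e xs)"
proof -
  have "dfn A (\<lambda>e. \<not> (\<exists>xs. length xs = k \<and> \<not> Q e xs))" using assms by - (rule dfn | assumption)+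
  then show ?thesis by (rule dfn_cong) auto
qed

text \<open>Environments have infinitely many slots, but a formula sees finitely many. Elimination
  of imaginaries and uniform finiteness speak of finite tuples, so their versions for families
  indexed by environments rest on this bound.\<close>

lemma dfn_finite_dep:
  assumes "dfn A P" obtains q where "\<And>e e'. (\<And>i. i < q \<Longrightarrow> e i = e' i) \<Longrightarrow> P e \<longleftrightarrow> P e'"
proof -
  obtain \<phi> \<rho> where 1: "wf_fml M \<phi>" "\<forall>i. \<rho> i \<in> atoms A" "\<forall>e. P e \<longleftrightarrow> sat M (\<lambda>i. atom_val e (\<rho> i)) \<phi>"
    using assms by (elim dfnE)
  note 1 = 1(1) 1(2)[rule_format] 1(3)[rule_format]
  define J where "J = {j. \<exists>i\<in>free_vars \<phi>. \<rho> i = Inl j}"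
  have "J \<subseteq> (\<lambda>i. projl (\<rho> i)) ` free_vars \<phi>" by (force simp: J_def)
  then have "finite J" by (meson finite_free_vars finite_imageI finite_subset)
  then obtain q where q: "\<forall>j\<in>J. j < q" by (meson finite_nat_set_iff_bounded)
  show ?thesis
  proof (rule that)
    fix e e' :: "nat \<Rightarrow> 'a" assume "\<And>i. i < q \<Longrightarrow> e i = e' i"
    then have "atom_val e (\<rho> i) = atom_val e' (\<rho> i)" if "i \<in> free_vars \<phi>" for i
      using q that by (cases "\<rho> i") (auto simp: J_def)
    then show "P e \<longleftrightarrow> P e'" unfolding 1(3) by (intro sat_cong) auto
  qed
qed

lemma dfn_sat:
  assumes "formula_in M k \<phi>" "list_term A k L" shows "dfn A (\<lambda>e. sat M (nth (L e)) \<phi>)"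
proof -
  have "\<exists>r\<in>atoms A. i < k \<longrightarrow> (\<lambda>e. L e ! i) = (\<lambda>e. atom_val e r)" for i
    using elt_nth[OF assms(2), of i] unfolding elt_term_def by (cases "i < k") (auto intro: exI[of _ "Inl 0"])
  then obtain \<rho> where \<rho>: "\<And>i. \<rho> i \<in> atoms A" "\<And>i. i < k \<Longrightarrow> (\<lambda>e. L e ! i) = (\<lambda>e. atom_val e (\<rho> i))"
    by metis
  show ?thesis
  proof (rule dfnI[of \<phi> \<rho>])
    fix e
    have "L e ! i = atom_val e (\<rho> i)" if "i \<in> free_vars \<phi>" for i
      using fun_cong[OF \<rho>(2)] that assms(1) by (auto simp: formula_in_def)
    then show "sat M (nth (L e)) \<phi> \<longleftrightarrow> sat M (\<lambda>i. atom_val e (\<rho> i)) \<phi>"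
      by (intro sat_cong) auto
  qed (use assms \<rho> in \<open>auto simp: formula_in_def\<close>)
qed

text \<open>Since the predicate depends on the first \<open>k\<close> slots alone, variables
  attached to later slots cannot matter; they are merged into variable 0, which is available because
  \<open>k > 0\<close>.\<close>

lemma dfn_formula:
  assumes "dfn {} (\<lambda>e. G (map e [0..<k]))" "k > 0"
  obtains \<chi> where "formula_in M k \<chi>" "\<And>xs. length xs = k \<Longrightarrow> sat M (nth xs) \<chi> \<longleftrightarrow> G xs"
proof -
  obtain \<phi> \<rho> where 1: "wf_fml M \<phi>" "\<forall>i. \<rho> i \<in> atoms ({} :: 'a set)"
    "\<forall>e. G (map e [0..<k]) \<longleftrightarrow> sat M (\<lambda>i. atom_val e (\<rho> i)) \<phi>"
    using assms(1) by (elim dfnE)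
  note 1 = 1(1) 1(2)[rule_format] 1(3)[rule_format]
  have "\<exists>j. \<rho> i = Inl j" for i using 1(2)[of i] by (auto simp: atoms_def)
  then obtain j where j: "\<And>i. \<rho> i = Inl (j i)" by metis
  obtain \<chi> where 2: "wf_fml M \<chi>" "free_vars \<chi> \<subseteq> (\<lambda>i. if j i < k then j i else 0) ` free_vars \<phi>"
    "\<And>e. sat M e \<chi> = sat M (\<lambda>i. e (if j i < k then j i else 0)) \<phi>"
    using rename_fml[of M \<phi> "\<lambda>i. if j i < k then j i else 0"] 1(1) by blast
  show ?thesis
  proof (rule that)
    show "formula_in M k \<chi>" using 2(1,2) assms(2) by (force simp: formula_in_def split: if_splits)
    fix xs :: "'a list" assume xs: "length xs = k"
    define e where "e i = (if i < k then xs ! i else xs ! 0)" for i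
    have "(\<lambda>i. xs ! (if j i < k then j i else 0)) = (\<lambda>i. atom_val e (\<rho> i))"
      by (auto simp: fun_eq_iff e_def j)
    moreover have "map e [0..<k] = xs" using xs by (auto simp: e_def intro: nth_equalityI)
    ultimately show "sat M (nth xs) \<chi> \<longleftrightarrow> G xs" using 1(3)[of e] by (simp add: 2(3))
  qed
qed

text \<open>The link to \<open>o_minimal\<close>: freezing all slots but the first turns their
  values into the parameters of a formula in one variable.\<close>

lemma dfn_section:
  assumes "dfn UNIV P"
  shows "definable_over M UNIV 1 {[x] |x. P (case_nat x e)}"
proof -
  obtain \<phi> \<rho> where 1: "wf_fml M \<phi>" "\<forall>i. \<rho> i \<in> atoms (UNIV :: 'a set)"
    "\<forall>e. P e \<longleftrightarrow> sat M (\<lambda>i. atom_val e (\<rho> i)) \<phi>"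
    using assms by (elim dfnE)
  note 1 = 1(1) 1(2)[rule_format] 1(3)[rule_format]
  define \<sigma> where "\<sigma> i = (if \<rho> i = Inl 0 then 0 else Suc i)" for i
  obtain \<chi> where 2: "wf_fml M \<chi>" "free_vars \<chi> \<subseteq> \<sigma> ` free_vars \<phi>" "\<And>e. sat M e \<chi> = sat M (\<lambda>i. e (\<sigma> i)) \<phi>"
    using rename_fml[of M \<phi> \<sigma>] 1(1) by blast
  obtain q where q: "\<And>i. i \<in> free_vars \<phi> \<Longrightarrow> i < q"
    using finite_free_vars[of \<phi>] by (meson finite_nat_set_iff_bounded)
  \<comment> \<open>The list holds the values of all variables below \<open>q\<close>. For variables
    attached to slot 0 the entry is a dummy, because \<sigma> sends them to variable 0.\<close>
  define as where "as = map (\<lambda>i. atom_val (case_nat (e 0) e) (\<rho> i)) [0..<q]"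
  have *: "sat M (nth ([x] @ as)) \<chi> \<longleftrightarrow> P (case_nat x e)" for x
    unfolding 1(3) 2(3)
  proof (rule sat_cong)
    fix i assume "i \<in> free_vars \<phi>"
    then have "i < q" by (rule q)
    then show "([x] @ as) ! \<sigma> i = atom_val (case_nat x e) (\<rho> i)"
      by (cases "\<rho> i") (auto simp: \<sigma>_def as_def split: nat.splits)
  qed
  have f: "formula_in M (1 + length as) \<chi>"
    using 2(1,2) q by (force simp: formula_in_def \<sigma>_def as_def split: if_splits)
  have "{[x] |x. P (case_nat x e)} = solutions M \<chi> 1 as"
    using * by (auto simp: solutions_def tuples_def length_Suc_conv)
  then show ?thesis unfolding definable_over_def using f by blast
qed

text \<open>In a definable family the first variables of the environment hold the points of the set or the arguments
  of the relation, and the remaining ones are the index of the family.\<close>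

definition dfam :: "'a set \<Rightarrow> nat \<Rightarrow> ((nat \<Rightarrow> 'a) \<Rightarrow> 'a list set) \<Rightarrow> bool" where
  "dfam A k X \<longleftrightarrow> dfn A (\<lambda>e. map e [0..<k] \<in> X (\<lambda>i. e (k + i)))"

definition drel :: "'a set \<Rightarrow> nat \<Rightarrow> nat \<Rightarrow> ((nat \<Rightarrow> 'a) \<Rightarrow> 'a list \<Rightarrow> 'a list \<Rightarrow> bool) \<Rightarrow> bool" where
  "drel A k l r \<longleftrightarrow> dfn A (\<lambda>e. r (\<lambda>i. e (k + (l + i))) (map e [0..<k]) (map (\<lambda>i. e (k + i)) [0..<l]))"

definition dfam1 :: "'a set \<Rightarrow> ((nat \<Rightarrow> 'a) \<Rightarrow> 'a set) \<Rightarrow> bool" where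
  "dfam1 A X \<longleftrightarrow> dfn A (\<lambda>e. e 0 \<in> X (\<lambda>i. e (Suc i)))"

definition drel1 :: "'a set \<Rightarrow> ((nat \<Rightarrow> 'a) \<Rightarrow> 'a \<Rightarrow> 'a \<Rightarrow> bool) \<Rightarrow> bool" where
  "drel1 A r \<longleftrightarrow> dfn A (\<lambda>e. r (\<lambda>i. e (Suc (Suc i))) (e 0) (e 1))"

text \<open>A relation between an element of \<open>M\<close>, the parameter, and a list. Being a
  relation it describes partial curves without default values.\<close>

definition dcurve :: "'a set \<Rightarrow> nat \<Rightarrow> ((nat \<Rightarrow> 'a) \<Rightarrow> 'a \<Rightarrow> 'a list \<Rightarrow> bool) \<Rightarrow> bool" where
  "dcurve A l r \<longleftrightarrow> dfn A (\<lambda>e. r (\<lambda>i. e (Suc (l + i))) (e 0) (map (\<lambda>i. e (Suc i)) [0..<l]))"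

lemma dfamI: "dfn A (\<lambda>e. map e [0..<k] \<in> X (\<lambda>i. e (k + i))) \<Longrightarrow> dfam A k X"
  by (simp add: dfam_def)

lemma drelI:
  "dfn A (\<lambda>e. r (\<lambda>i. e (k + (l + i))) (map e [0..<k]) (map (\<lambda>i. e (k + i)) [0..<l])) \<Longrightarrow> drel A k l r"
  by (simp add: drel_def)

lemma dfam1I: "dfn A (\<lambda>e. e 0 \<in> X (\<lambda>i. e (Suc i))) \<Longrightarrow> dfam1 A X"
  by (simp add: dfam1_def)

lemma drel1I: "dfn A (\<lambda>e. r (\<lambda>i. e (Suc (Suc i))) (e 0) (e 1)) \<Longrightarrow> drel1 A r"
  by (simp add: drel1_def)

lemma dcurveI:
  "dfn A (\<lambda>e. r (\<lambda>i. e (Suc (l + i))) (e 0) (map (\<lambda>i. e (Suc i)) [0..<l])) \<Longrightarrow> dcurve A l r"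
  by (simp add: dcurve_def)

lemma map_nth_if: "length xs = k \<Longrightarrow> map (\<lambda>i. if i < k then xs ! i else f i) [0..<k] = xs"
  by (auto intro: nth_equalityI)

text \<open>The working form of definability: point and index are replaced by arbitrary terms. The
  other rules ending in \<open>D\<close> do this for relations and curves, and those beginning with
  \<open>ds\<close> are for objects that do not vary with the index.\<close>

lemma dfamD:
  assumes "dfam A k X" "list_term A k L" "env_term A s" shows "dfn A (\<lambda>e. L e \<in> X (s e))"
proof -
  have "elt_term A (\<lambda>e. if i < k then L e ! i else s e (i - k))" for i
    using elt_nth[OF assms(2)] assms(3) by (cases "i < k") (simp_all add: env_term_def)
  then have "env_term A (\<lambda>e i. if i < k then L e ! i else s e (i - k))" by (simp add: env_term_def)
  from dfn_subst[OF assms(1)[unfolded dfam_def] this] show ?thesis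
    by (simp add: map_nth_if list_length[OF assms(2)])
qed

lemma drelD:
  assumes "drel A k l r" "list_term A k L" "list_term A l L'" "env_term A s"
  shows "dfn A (\<lambda>e. r (s e) (L e) (L' e))"
proof -
  let ?s = "\<lambda>e i. if i < k then L e ! i else if i < k + l then L' e ! (i - k) else s e (i - k - l)"
  have "elt_term A (\<lambda>e. ?s e i)" for i
    using elt_nth[OF assms(2)] elt_nth[OF assms(3)] assms(4)
    by (cases "i < k"; cases "i < k + l") (simp_all add: env_term_def)
  then have "env_term A ?s" by (simp add: env_term_def)
  from dfn_subst[OF assms(1)[unfolded drel_def] this] show ?thesis
    by (simp add: map_nth_if list_length[OF assms(2)] list_length[OF assms(3)] cong: if_cong)
qed

lemma dfam1D:
  assumes "dfam1 A X" "elt_term A t" "env_term A s" shows "dfn A (\<lambda>e. t e \<in> X (s e))"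
proof -
  have "env_term A (\<lambda>e i. case i of 0 \<Rightarrow> t e | Suc j \<Rightarrow> s e j)"
    using assms(2,3) by (intro env_case)
  from dfn_subst[OF assms(1)[unfolded dfam1_def] this] show ?thesis by simp
qed

lemma drel1D:
  assumes "drel1 A r" "elt_term A t" "elt_term A u" "env_term A s" shows "dfn A (\<lambda>e. r (s e) (t e) (u e))"
proof -
  have "env_term A (\<lambda>e i. case i of 0 \<Rightarrow> t e | Suc j \<Rightarrow> (case j of 0 \<Rightarrow> u e | Suc j \<Rightarrow> s e j))"
    using assms(2-) by (intro env_case)
  from dfn_subst[OF assms(1)[unfolded drel1_def] this] show ?thesis by simp
qed

lemma dcurveD:
  assumes "dcurve A l r" "elt_term A t" "list_term A l L" "env_term A s"
  shows "dfn A (\<lambda>e. r (s e) (t e) (L e))"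
proof -
  let ?s = "\<lambda>e i. case i of 0 \<Rightarrow> t e | Suc j \<Rightarrow> if j < l then L e ! j else s e (j - l)"
  have "env_term A ?s"
    unfolding env_term_def
  proof
    fix i show "elt_term A (\<lambda>e. ?s e i)"
    proof (cases i)
      case (Suc j)
      then show ?thesis
        using elt_nth[OF assms(3), of j] assms(4) by (cases "j < l") (simp_all add: env_term_def)
    qed (simp add: assms(2))
  qed
  from dfn_subst[OF assms(1)[unfolded dcurve_def] this] show ?thesis
    by (simp add: map_nth_if list_length[OF assms(3)])
qed

abbreviation dset :: "nat \<Rightarrow> 'a list set \<Rightarrow> bool" where "dset k X \<equiv> dfam UNIV k (\<lambda>_. X)"
abbreviation dset1 :: "'a set \<Rightarrow> bool" where "dset1 X \<equiv> dfam1 UNIV (\<lambda>_. X)"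

lemma env_id[dfn]: "env_term A (\<lambda>e. e)" by (simp add: env_term_def elt_var)

lemma dsetD: "dfam A k (\<lambda>_. X) \<Longrightarrow> list_term A k L \<Longrightarrow> dfn A (\<lambda>e. L e \<in> X)"
  using dfamD[OF _ _ env_id] .
lemma dsrelD: "drel A k l (\<lambda>_. r) \<Longrightarrow> list_term A k L \<Longrightarrow> list_term A l L' \<Longrightarrow> dfn A (\<lambda>e. r (L e) (L' e))"
  using drelD[OF _ _ _ env_id] .
lemma dset1D: "dfam1 A (\<lambda>_. X) \<Longrightarrow> elt_term A t \<Longrightarrow> dfn A (\<lambda>e. t e \<in> X)"
  using dfam1D[OF _ _ env_id] .
lemma dsrel1D: "drel1 A (\<lambda>_. r) \<Longrightarrow> elt_term A t \<Longrightarrow> elt_term A u \<Longrightarrow> dfn A (\<lambda>e. r (t e) (u e))"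
  using drel1D[OF _ _ _ env_id] .
lemma dscurveD: "dcurve A l (\<lambda>_. r) \<Longrightarrow> elt_term A t \<Longrightarrow> list_term A l L \<Longrightarrow> dfn A (\<lambda>e. r (t e) (L e))"
  using dcurveD[OF _ _ _ env_id] .

lemma env_const: "env_term UNIV (\<lambda>e. e0)" by (simp add: env_term_def elt_const)

text \<open>The values of the index become parameters, so each member of a parameter-free family is
  definable over the whole universe.\<close>

lemma dfam_inst: "dfam A k X \<Longrightarrow> dset k (X e0)"
  by (rule dfamI, rule dfamD[of UNIV]) (auto simp: dfam_def intro: dfn_mono[OF _ subset_UNIV] env_const list_upt elt_var)
lemma drel_inst: "drel A k l r \<Longrightarrow> drel UNIV k l (\<lambda>_. r e0)"
  by (rule drelI, rule drelD[of UNIV]) (auto simp: drel_def intro: dfn_mono[OF _ subset_UNIV] env_const list_upt elt_var)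
lemma dfam1_inst: "dfam1 A X \<Longrightarrow> dset1 (X e0)"
  by (rule dfam1I, rule dfam1D[of UNIV]) (auto simp: dfam1_def intro: dfn_mono[OF _ subset_UNIV] env_const list_upt elt_var)
lemma dcurve_inst: "dcurve A l r \<Longrightarrow> dcurve UNIV l (\<lambda>_. r e0)"
  by (rule dcurveI, rule dcurveD[of UNIV]) (auto simp: dcurve_def intro: dfn_mono[OF _ subset_UNIV] env_const list_upt elt_var)

lemma dfn_ncard[dfn]:
  "dfn A (\<lambda>e. Q (\<lambda>i. e (Suc i)) (e 0)) \<Longrightarrow> dfn A (\<lambda>e. ncard j {x. Q e x})"
proof (induction j arbitrary: Q)
  case 0
  have "dfn A (\<lambda>e. \<forall>x. \<not> Q e x)" using 0 by - (rule dfn | assumption)+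
  then show ?case by (rule dfn_cong) (auto simp: ncard_0)
next
  case (Suc j)
  have *: "dfn A (\<lambda>e. Q (s e) (t e))" if "env_term A s" "elt_term A t" for s t
  proof -
    have "env_term A (\<lambda>e i. case i of 0 \<Rightarrow> t e | Suc j \<Rightarrow> s e j)"
      using that by (intro env_case)
    from dfn_subst[OF Suc.prems this] show ?thesis by simp
  qed
  have "dfn A (\<lambda>e. \<exists>x. Q e x \<and> ncard j {y. Q e y \<and> y \<noteq> x})"
    by (rule dfn Suc.IH * | assumption)+
  then show ?case by (rule dfn_cong) (auto simp: ncard_Suc)
qed

lemma dfn_ncardl[dfn]:
  "dfn A (\<lambda>e. Q (\<lambda>i. e (k + i)) (map e [0..<k])) \<Longrightarrow> dfn A (\<lambda>e. ncard j {x. length x = k \<and> Q e x})"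
proof (induction j arbitrary: Q)
  case 0
  have "dfn A (\<lambda>e. \<forall>x. length x = k \<longrightarrow> \<not> Q e x)" using 0 by - (rule dfn | assumption)+
  then show ?case by (rule dfn_cong) (auto simp: ncard_0)
next
  case (Suc j)
  have d: "dfam A k (\<lambda>e. {x. Q e x})" using Suc.prems by (simp add: dfam_def)
  have *: "dfn A (\<lambda>e. Q (s e) (t e))" if "env_term A s" "list_term A k t" for s t
    using dfamD[OF d that(2,1)] by simp
  have "dfn A (\<lambda>e. \<exists>x. length x = k \<and> Q e x \<and> ncard j {y. length y = k \<and> Q e y \<and> y \<noteq> x})"
    by (rule dfn Suc.IH * | assumption)+
  then show ?case by (rule dfn_cong) (simp add: ncard_Suc conj_ac)
qed

end

section \<open>Definable preorders on intervals\<close>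

context fo
begin

lemma dfn_mem_Collect[dfn]: "dfn A (\<lambda>e. Q e (t e)) \<Longrightarrow> dfn A (\<lambda>e. t e \<in> {x. Q e x})"
  by simp

lemma dfn_mem_Int[dfn]: "dfn A (\<lambda>e. t e \<in> X e) \<Longrightarrow> dfn A (\<lambda>e. t e \<in> Y e) \<Longrightarrow> dfn A (\<lambda>e. t e \<in> X e \<inter> Y e)"
  using dfn_conj[of A "\<lambda>e. t e \<in> X e" "\<lambda>e. t e \<in> Y e"] by simp

declare dfamI[dfn] drelI[dfn] dfam1I[dfn] drel1I[dfn] dcurveI[dfn]

end

section \<open>Definable subsets of the line\<close>

locale omin = fo M for M :: "('f, 'r, 'a::linorder) fo_structure" +
  assumes omin: "o_minimal M"
begin

lemma dense_ex: "(x::'a) < y \<Longrightarrow> \<exists>z. x < z \<and> z < y"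
  using omin[unfolded o_minimal_def, THEN conjunct1] by blast

lemma gt_exa: "\<exists>y. (x::'a) < y" and lt_exa: "\<exists>y. y < (x::'a)"
  using omin[unfolded o_minimal_def, THEN conjunct2, THEN conjunct1, rule_format, of x] by blast+

lemma tame:
  assumes "dset1 X"
  obtains \<I> where "finite \<I>" "\<I> \<subseteq> points_and_intervals" "X = \<Union> \<I>"
proof -
  have "definable_over M UNIV 1 {[x] |x. x \<in> X}"
    using dfn_section[OF assms[unfolded dfam1_def]] by simp
  then obtain \<I> where "finite \<I>" "\<I> \<subseteq> points_and_intervals" "{x. [x] \<in> {[x] |x. x \<in> X}} = \<Union> \<I>"
    using omin[unfolded o_minimal_def, THEN conjunct2, THEN conjunct2, rule_format, of "{[x] |x. x \<in> X}"] by metis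
  moreover have "{x. [x] \<in> {[x] |x. x \<in> X}} = X" by auto
  ultimately show ?thesis using that by simp
qed

lemma points_and_intervals_cases:
  assumes "Y \<in> points_and_intervals"
  obtains a where "Y = {a}" | a b where "a < b" "Y = {a<..<b}" | a where "Y = {a<..}" | a where "Y = {..<a}" | "Y = UNIV"
  using assms unfolding points_and_intervals_def by blast

text \<open>Having a constant germ to the right of \<open>x\<close> holds for points and intervals
  and passes to finite unions.\<close>

lemma rgerm_set:
  assumes "dset1 X"
  shows "(\<exists>b. x < b \<and> (\<forall>y. x < y \<and> y < b \<longrightarrow> y \<in> X)) \<or> (\<exists>b. x < b \<and> (\<forall>y. x < y \<and> y < b \<longrightarrow> y \<notin> X))"
proof -
  obtain \<I> where I: "finite \<I>" "\<I> \<subseteq> points_and_intervals" "X = \<Union> \<I>" using assms by (rule tame)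
  have one: "(\<exists>b. x < b \<and> (\<forall>y. x < y \<and> y < b \<longrightarrow> y \<in> Y)) \<or> (\<exists>b. x < b \<and> (\<forall>y. x < y \<and> y < b \<longrightarrow> y \<notin> Y))"
    if Y: "Y \<in> points_and_intervals" for Y
    using Y
  proof (cases rule: points_and_intervals_cases)
    case (1 a)
    then show ?thesis using gt_exa[of x] by (cases "x < a") auto
  next
    case (2 a b)
    then show ?thesis using gt_exa[of x] by (cases "x < a"; cases "x < b") (auto intro: exI[of _ b] exI[of _ a])
  next
    case (3 a)
    then show ?thesis using gt_exa[of x] by (cases "x < a") (auto intro: exI[of _ a])
  next
    case (4 a)
    then show ?thesis using gt_exa[of x] by (cases "x < a") (auto intro: exI[of _ a])
  next
    case 5
    then show ?thesis using gt_exa[of x] by auto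
  qed
  show ?thesis using I(1,2) unfolding I(3)
  proof (induction \<I>)
    case empty
    then show ?case using gt_exa[of x] by auto
  next
    case (insert Y \<I>)
    have *: "\<exists>c. x < c \<and> c \<le> b \<and> c \<le> b'" if "x < b" "x < b'" for b b'
      using that by (intro exI[of _ "min b b'"]) auto
    from insert one[of Y] consider b where "x < b" "\<forall>y. x < y \<and> y < b \<longrightarrow> y \<in> Y"
      | b where "x < b" "\<forall>y. x < y \<and> y < b \<longrightarrow> y \<in> \<Union> \<I>"
      | b b' where "x < b" "\<forall>y. x < y \<and> y < b \<longrightarrow> y \<notin> Y" "x < b'" "\<forall>y. x < y \<and> y < b' \<longrightarrow> y \<notin> \<Union> \<I>"
      by blast
    then show ?case
    proof cases
      case 3
      then obtain c where "x < c" "c \<le> b" "c \<le> b'" using * by blast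
      then show ?thesis using 3 by (intro disjI2 exI[of _ c]) auto
    qed auto
  qed
qed

lemma lgerm_set:
  assumes "dset1 X"
  shows "(\<exists>b. b < x \<and> (\<forall>y. b < y \<and> y < x \<longrightarrow> y \<in> X)) \<or> (\<exists>b. b < x \<and> (\<forall>y. b < y \<and> y < x \<longrightarrow> y \<notin> X))"
proof -
  obtain \<I> where I: "finite \<I>" "\<I> \<subseteq> points_and_intervals" "X = \<Union> \<I>" using assms by (rule tame)
  have one: "(\<exists>b. b < x \<and> (\<forall>y. b < y \<and> y < x \<longrightarrow> y \<in> Y)) \<or> (\<exists>b. b < x \<and> (\<forall>y. b < y \<and> y < x \<longrightarrow> y \<notin> Y))"
    if Y: "Y \<in> points_and_intervals" for Y
    using Y
  proof (cases rule: points_and_intervals_cases)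
    case (1 a)
    then show ?thesis using lt_exa[of x] by (cases "a < x") auto
  next
    case (2 a b)
    then show ?thesis using lt_exa[of x] by (cases "a < x"; cases "b < x") (auto intro: exI[of _ b] exI[of _ a])
  next
    case (3 a)
    then show ?thesis using lt_exa[of x] by (cases "a < x") (auto intro: exI[of _ a])
  next
    case (4 a)
    then show ?thesis using lt_exa[of x] by (cases "a < x") (auto intro: exI[of _ a])
  next
    case 5
    then show ?thesis using lt_exa[of x] by auto
  qed
  show ?thesis using I(1,2) unfolding I(3)
  proof (induction \<I>)
    case empty
    then show ?case using lt_exa[of x] by auto
  next
    case (insert Y \<I>)
    have *: "\<exists>c. c < x \<and> b \<le> c \<and> b' \<le> c" if "b < x" "b' < x" for b b'
      using that by (intro exI[of _ "max b b'"]) auto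
    from insert one[of Y] consider b where "b < x" "\<forall>y. b < y \<and> y < x \<longrightarrow> y \<in> Y"
      | b where "b < x" "\<forall>y. b < y \<and> y < x \<longrightarrow> y \<in> \<Union> \<I>"
      | b b' where "b < x" "\<forall>y. b < y \<and> y < x \<longrightarrow> y \<notin> Y" "b' < x" "\<forall>y. b' < y \<and> y < x \<longrightarrow> y \<notin> \<Union> \<I>"
      by blast
    then show ?case
    proof cases
      case 3
      then obtain c where "c < x" "b \<le> c" "b' \<le> c" using * by blast
      then show ?thesis using 3 by (intro disjI2 exI[of _ c]) auto
    qed auto
  qed
qed

lemma bgerm_set:
  assumes "dset1 X"
  shows "(\<exists>b. \<forall>y. y < b \<longrightarrow> y \<in> X) \<or> (\<exists>b. \<forall>y. y < b \<longrightarrow> y \<notin> X)"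
proof -
  obtain \<I> where I: "finite \<I>" "\<I> \<subseteq> points_and_intervals" "X = \<Union> \<I>" using assms by (rule tame)
  have one: "(\<exists>b. \<forall>y. y < b \<longrightarrow> y \<in> Y) \<or> (\<exists>b. \<forall>y. y < b \<longrightarrow> y \<notin> Y)"
    if Y: "Y \<in> points_and_intervals" for Y
    using Y
  proof (cases rule: points_and_intervals_cases)
    case (2 a b)
    then show ?thesis by (intro disjI2 exI[of _ a]) auto
  next
    case (3 a)
    then show ?thesis by (intro disjI2 exI[of _ a]) auto
  qed auto
  show ?thesis using I(1,2) unfolding I(3)
  proof (induction \<I>)
    case (insert Y \<I>)
    from insert one[of Y] consider b where "\<forall>y. y < b \<longrightarrow> y \<in> Y"
      | b where "\<forall>y. y < b \<longrightarrow> y \<in> \<Union> \<I>"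
      | b b' where "\<forall>y. y < b \<longrightarrow> y \<notin> Y" "\<forall>y. y < b' \<longrightarrow> y \<notin> \<Union> \<I>"
      by blast
    then show ?case
    proof cases
      case 3
      then show ?thesis by (intro disjI2 exI[of _ "min b b'"]) auto
    qed auto
  qed auto
qed

text \<open>The order of \<open>M\<close> need not be complete, but definable sets have suprema.
  \<open>H\<close> also admits empty and unbounded pieces, which makes it stable under
  unions.\<close>

lemma sup_set:
  assumes "dset1 X" "x0 \<in> X" "\<forall>x\<in>X. x \<le> u"
  shows "\<exists>s. (\<forall>x\<in>X. x \<le> s) \<and> (\<forall>v. (\<forall>x\<in>X. x \<le> v) \<longrightarrow> s \<le> v)"
proof -
  obtain \<I> where I: "finite \<I>" "\<I> \<subseteq> points_and_intervals" "X = \<Union> \<I>" using assms(1) by (rule tame)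
  define H where "H Y \<longleftrightarrow> Y = {} \<or> (\<forall>u. \<exists>x\<in>Y. u < x) \<or>
    (\<exists>s. (\<forall>x\<in>Y. x \<le> s) \<and> (\<forall>v. (\<forall>x\<in>Y. x \<le> v) \<longrightarrow> s \<le> v))" for Y :: "'a set"
  have one: "H Y" if Y: "Y \<in> points_and_intervals" for Y
    using Y
  proof (cases rule: points_and_intervals_cases)
    case (1 a)
    then show ?thesis unfolding H_def by (intro disjI2) auto
  next
    case (2 a b)
    then show ?thesis unfolding H_def using dense_ex
    proof (intro disjI2 exI[of _ b] conjI allI impI)
      fix v assume v: "\<forall>x\<in>Y. x \<le> v"
      show "b \<le> v"
      proof (rule ccontr)
        assume "\<not> b \<le> v"
        then have "max a v < b" using 2 by auto
        then obtain z where "max a v < z" "z < b" using dense_ex by blast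
        then have "z \<in> Y" "v < z" using 2 by auto
        then show False using v by (meson not_le)
      qed
    qed auto
  next
    case (3 a)
    have "\<exists>x\<in>Y. u < x" for u using gt_exa[of "max u a"] 3 by auto
    then show ?thesis unfolding H_def by blast
  next
    case (4 b)
    then show ?thesis unfolding H_def
    proof (intro disjI2 exI[of _ b] conjI allI impI)
      fix v assume v: "\<forall>x\<in>Y. x \<le> v"
      show "b \<le> v"
      proof (rule ccontr)
        assume "\<not> b \<le> v"
        then have "v < b" by auto
        then obtain z where "v < z" "z < b" using dense_ex by blast
        then have "z \<in> Y" using 4 by auto
        then show False using v \<open>v < z\<close> by (meson not_le)
      qed
    qed auto
  next
    case 5
    then show ?thesis unfolding H_def using gt_exa by auto
  qed
  have "H (\<Union> \<I>)" using I(1,2)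
  proof (induction \<I>)
    case empty
    then show ?case by (simp add: H_def)
  next
    case (insert Y \<I>)
    then have h: "H Y" "H (\<Union> \<I>)" using one by auto
    have "H (Y \<union> \<Union> \<I>)"
    proof (cases "Y = {} \<or> \<Union> \<I> = {}")
      case True
      then show ?thesis using h by (elim disjE) (simp_all only: Un_empty_left Un_empty_right)
    next
      case False
      then consider "\<forall>u. \<exists>x\<in>Y. u < x" | "\<forall>u. \<exists>x\<in>\<Union> \<I>. u < x" |
        s t where "\<forall>x\<in>Y. x \<le> s" "\<forall>v. (\<forall>x\<in>Y. x \<le> v) \<longrightarrow> s \<le> v"
           "\<forall>x\<in>\<Union> \<I>. x \<le> t" "\<forall>v. (\<forall>x\<in>\<Union> \<I>. x \<le> v) \<longrightarrow> t \<le> v"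
        using h unfolding H_def by blast
      then show ?thesis
      proof cases
        case 1
        then show ?thesis unfolding H_def by blast
      next
        case 2
        then show ?thesis unfolding H_def by blast
      next
        case 3
        have "(\<forall>x\<in>Y \<union> \<Union> \<I>. x \<le> max s t)" using 3 by (auto simp: le_max_iff_disj)
        moreover have "\<forall>v. (\<forall>x\<in>Y \<union> \<Union> \<I>. x \<le> v) \<longrightarrow> max s t \<le> v"
        proof (intro allI impI)
          fix v assume "\<forall>x\<in>Y \<union> \<Union> \<I>. x \<le> v"
          then have "\<forall>x\<in>Y. x \<le> v" "\<forall>x\<in>\<Union> \<I>. x \<le> v" by blast+
          then have "s \<le> v" "t \<le> v" using 3 by blast+
          then show "max s t \<le> v" by simp
        qed
        ultimately show ?thesis unfolding H_def by blast
      qed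
    qed
    then show ?case by simp
  qed
  moreover have "\<not> (\<forall>u. \<exists>x\<in>X. u < x)" using assms(3) by (meson not_less)
  ultimately show ?thesis using assms(2) unfolding H_def I(3)[symmetric] by blast
qed

text \<open>One of the finitely many points and intervals that make up the set is infinite, hence an
  interval.\<close>

lemma interval_in_infinite_set:
  assumes "dset1 X" "infinite X" obtains a b where "a < b" "\<And>x. a < x \<Longrightarrow> x < b \<Longrightarrow> x \<in> X"
proof -
  obtain \<I> where I: "finite \<I>" "\<I> \<subseteq> points_and_intervals" "X = \<Union> \<I>" using assms(1) by (rule tame)
  then obtain Y where Y: "Y \<in> \<I>" "infinite Y" using assms(2) by auto
  have "Y \<in> points_and_intervals" using Y I by auto
  then have "\<exists>a b. a < b \<and> (\<forall>x. a < x \<and> x < b \<longrightarrow> x \<in> Y)"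
  proof (cases rule: points_and_intervals_cases)
    case (4 a)
    obtain c where "c < a" using lt_exa by blast
    then show ?thesis using 4 by (intro exI[of _ c] exI[of _ a]) auto
  next
    case (3 a)
    obtain c where "a < c" using gt_exa by blast
    then show ?thesis using 3 by (intro exI[of _ a] exI[of _ c]) auto
  qed (use Y(2) gt_exa in auto)
  then show ?thesis using that Y I(3) by blast
qed

lemma infinite_interval: "(a::'a) < b \<Longrightarrow> infinite {x. a < x \<and> x < b}"
proof
  assume ab: "a < b" and fin: "finite {x. a < x \<and> x < b}"
  obtain z where "a < z" "z < b" using dense_ex ab by blast
  then have "{x. a < x \<and> x < b} \<noteq> {}" by auto
  then have "Min {x. a < x \<and> x < b} \<in> {x. a < x \<and> x < b}" using fin Min_in by blast
  then obtain y where "a < y" "y < Min {x. a < x \<and> x < b}" "Min {x. a < x \<and> x < b} < b"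
    using dense_ex by blast
  moreover from this have "Min {x. a < x \<and> x < b} \<le> y" by (intro Min_le[OF fin]) auto
  ultimately show False by order
qed

lemma rgerm:
  "dfn UNIV (\<lambda>e. Q (e 0)) \<Longrightarrow>
   (\<exists>b. x < b \<and> (\<forall>y. x < y \<and> y < b \<longrightarrow> Q y)) \<or> (\<exists>b. x < b \<and> (\<forall>y. x < y \<and> y < b \<longrightarrow> \<not> Q y))"
  using rgerm_set[of "{y. Q y}" x] by (simp add: dfam1_def)

lemma lgerm:
  "dfn UNIV (\<lambda>e. Q (e 0)) \<Longrightarrow>
   (\<exists>b. b < x \<and> (\<forall>y. b < y \<and> y < x \<longrightarrow> Q y)) \<or> (\<exists>b. b < x \<and> (\<forall>y. b < y \<and> y < x \<longrightarrow> \<not> Q y))"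
  using lgerm_set[of "{y. Q y}" x] by (simp add: dfam1_def)

lemma sup_ex:
  "dfn UNIV (\<lambda>e. Q (e 0)) \<Longrightarrow> Q x0 \<Longrightarrow> \<forall>y. Q y \<longrightarrow> y \<le> u \<Longrightarrow>
   \<exists>s. (\<forall>y. Q y \<longrightarrow> y \<le> s) \<and> (\<forall>v. (\<forall>y. Q y \<longrightarrow> y \<le> v) \<longrightarrow> s \<le> v)"
  using sup_set[of "{y. Q y}" x0 u] by (simp add: dfam1_def)

lemma inf_ex:
  assumes "dfn UNIV (\<lambda>e. Q (e 0))" "Q x0" "\<forall>y. Q y \<longrightarrow> u \<le> y"
  shows "\<exists>s. (\<forall>y. Q y \<longrightarrow> s \<le> y) \<and> (\<forall>v. (\<forall>y. Q y \<longrightarrow> v \<le> y) \<longrightarrow> v \<le> s)"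
proof -
  have "dset1 {y. Q y}" using assms(1) by (simp add: dfam1_def)
  note [dfn] = dset1D[OF this, unfolded mem_Collect_eq]
  have "dfn UNIV (\<lambda>e. \<forall>y. Q y \<longrightarrow> e 0 \<le> y)"
    by (rule dfn)+
  from sup_ex[of "\<lambda>x. \<forall>y. Q y \<longrightarrow> x \<le> y", OF this assms(3), of x0] assms(2)
  show ?thesis by (metis (no_types, lifting))
qed

lemma interval_in_infinite:
  assumes "dfn UNIV (\<lambda>e. Q (e 0))" "infinite {x. Q x}" obtains a b where "a < b" "\<And>x. a < x \<Longrightarrow> x < b \<Longrightarrow> Q x"
  using interval_in_infinite_set[of "{x. Q x}"] assms by (auto simp: dfam1_def)

text \<open>Being infinite is first-order here, as it means to contain an interval. This is what
  makes dimension definable in families.\<close>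

lemma dfn_infinite[dfn]:
  assumes "dfn A (\<lambda>e. Q (\<lambda>i. e (Suc i)) (e 0))" shows "dfn A (\<lambda>e. infinite {x. Q e x})"
proof -
  have d: "dfam1 A (\<lambda>e. {x. Q e x})" using assms by (simp add: dfam1_def)
  note [dfn] = dfam1D[OF d, unfolded mem_Collect_eq]
  have "dfn A (\<lambda>e. \<exists>a b. a < b \<and> (\<forall>x. a < x \<and> x < b \<longrightarrow> Q e x))"
    by (rule dfn)+
  then show ?thesis
  proof (rule dfn_cong)
    fix e
    show "(\<exists>a b. a < b \<and> (\<forall>x. a < x \<and> x < b \<longrightarrow> Q e x)) \<longleftrightarrow> infinite {x. Q e x}"
    proof
      assume "\<exists>a b. a < b \<and> (\<forall>x. a < x \<and> x < b \<longrightarrow> Q e x)"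
      then obtain a b where ab: "a < b" "\<forall>x. a < x \<and> x < b \<longrightarrow> Q e x" by blast
      then have "{x. a < x \<and> x < b} \<subseteq> {x. Q e x}" by blast
      then show "infinite {x. Q e x}" using infinite_interval[OF ab(1)] infinite_super by blast
    next
      assume "infinite {x. Q e x}"
      then show "\<exists>a b. a < b \<and> (\<forall>x. a < x \<and> x < b \<longrightarrow> Q e x)"
        using interval_in_infinite_set[OF dfam1_inst[OF d, of e]] by (metis mem_Collect_eq)
    qed
  qed
qed

lemma dfn_finite[dfn]:
  "dfn A (\<lambda>e. Q (\<lambda>i. e (Suc i)) (e 0)) \<Longrightarrow> dfn A (\<lambda>e. finite {x. Q e x})"
  using dfn_not[OF dfn_infinite, of A Q] by simp

end

text \<open>Instantiated with the order of the structure and with its converse.\<close>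

locale directed = omin M + ord: linorder lteq lt
  for M :: "('f, 'r, 'a::linorder) fo_structure" and lteq :: "'a \<Rightarrow> 'a \<Rightarrow> bool" (infix "\<sqsubseteq>" 50)
    and lt :: "'a \<Rightarrow> 'a \<Rightarrow> bool" (infix "\<sqsubset>" 50) +
  assumes dfn_lt[dfn]: "elt_term A s \<Longrightarrow> elt_term A t \<Longrightarrow> dfn A (\<lambda>e. s e \<sqsubset> t e)"
    and dfn_lteq[dfn]: "elt_term A s \<Longrightarrow> elt_term A t \<Longrightarrow> dfn A (\<lambda>e. s e \<sqsubseteq> t e)"
    and dense: "x \<sqsubset> y \<Longrightarrow> \<exists>z. x \<sqsubset> z \<and> z \<sqsubset> y"
    and germ: "dfn UNIV (\<lambda>e. Q (e 0)) \<Longrightarrow>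
      (\<exists>b. b \<sqsubset> x \<and> (\<forall>y. b \<sqsubset> y \<and> y \<sqsubset> x \<longrightarrow> Q y)) \<or> (\<exists>b. b \<sqsubset> x \<and> (\<forall>y. b \<sqsubset> y \<and> y \<sqsubset> x \<longrightarrow> \<not> Q y))"
    and lub: "dfn UNIV (\<lambda>e. Q (e 0)) \<Longrightarrow> Q x0 \<Longrightarrow> \<forall>y. Q y \<longrightarrow> y \<sqsubseteq> u \<Longrightarrow>
      \<exists>s. (\<forall>y. Q y \<longrightarrow> y \<sqsubseteq> s) \<and> (\<forall>v. (\<forall>y. Q y \<longrightarrow> y \<sqsubseteq> v) \<longrightarrow> s \<sqsubseteq> v)"
begin

lemma between:
  "u \<sqsubset> y \<Longrightarrow> w \<sqsubset> y \<Longrightarrow> \<exists>x. u \<sqsubset> x \<and> w \<sqsubset> x \<and> x \<sqsubset> y"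
  "y \<sqsubset> u \<Longrightarrow> y \<sqsubset> w \<Longrightarrow> \<exists>x. y \<sqsubset> x \<and> x \<sqsubset> u \<and> x \<sqsubset> w"
  using dense ord.less_trans ord.linorder_cases[of u w] by metis+

text \<open>Every point of the interval is a strict local minimum of the preorder. Towards
  \<open>z\<close> the preorder can then neither stay above nor stay at the level of a point
  \<open>x\<close> near \<open>z\<close>; as germs are constant, it ends up strictly below
  \<open>x\<close>.\<close>

lemma tail_below:
  assumes d: "drel1 UNIV (\<lambda>_. le)"
    and tot: "\<And>x y. J x \<Longrightarrow> J y \<Longrightarrow> le x y \<or> le y x"
    and tr: "\<And>x y z. J x \<Longrightarrow> J y \<Longrightarrow> J z \<Longrightarrow> le x y \<Longrightarrow> le y z \<Longrightarrow> le x z"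
    and J: "\<And>x. J x \<longleftrightarrow> a \<sqsubset> x \<and> x \<sqsubset> z"
    and lm: "\<And>x. J x \<Longrightarrow> \<exists>u v. u \<sqsubset> x \<and> x \<sqsubset> v \<and> (\<forall>y. u \<sqsubset> y \<and> y \<sqsubset> v \<and> y \<noteq> x \<and> J y \<longrightarrow> \<not> le y x)"
    and az: "a \<sqsubset> z"
  shows "\<exists>w. w \<sqsubset> z \<and> a \<sqsubseteq> w \<and> (\<forall>x. w \<sqsubset> x \<and> x \<sqsubset> z \<longrightarrow> (\<exists>w'. w' \<sqsubset> z \<and> (\<forall>y. w' \<sqsubset> y \<and> y \<sqsubset> z \<longrightarrow> \<not> le x y)))"
proof -
  note [dfn] = dsrel1D[OF d]
  have mx: "\<exists>c. c \<sqsubset> z \<and> p \<sqsubseteq> c \<and> q \<sqsubseteq> c" if "p \<sqsubset> z" "q \<sqsubset> z" for p q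
    using that by (cases "p \<sqsubseteq> q") auto
  \<comment> \<open>\<open>U x\<close>: the points near \<open>z\<close> are strictly above
    \<open>x\<close>. \<open>V x\<close>: all later points are. The germ of \<open>U\<close> at
    \<open>z\<close> has to be false, and \<open>V\<close> serves to refute the alternative.\<close>
  define U where "U x \<longleftrightarrow> (\<exists>w. w \<sqsubset> z \<and> (\<forall>y. w \<sqsubset> y \<and> y \<sqsubset> z \<longrightarrow> \<not> le y x))" for x
  define V where "V x \<longleftrightarrow> (\<forall>y. x \<sqsubset> y \<and> y \<sqsubset> z \<longrightarrow> \<not> le y x)" for x
  have dU: "dfn UNIV (\<lambda>e. U (e 0))" unfolding U_def by (rule dfn)+
  have dV: "dfn UNIV (\<lambda>e. V (e 0))" unfolding V_def by (rule dfn)+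
  consider w where "w \<sqsubset> z" "\<forall>y. w \<sqsubset> y \<and> y \<sqsubset> z \<longrightarrow> U y" | w where "w \<sqsubset> z" "\<forall>y. w \<sqsubset> y \<and> y \<sqsubset> z \<longrightarrow> \<not> U y"
    using germ[OF dU, of z] by blast
  then show ?thesis
  proof cases
    case (1 w1)
    have False
    proof -
      consider w where "w \<sqsubset> z" "\<forall>y. w \<sqsubset> y \<and> y \<sqsubset> z \<longrightarrow> V y" | w where "w \<sqsubset> z" "\<forall>y. w \<sqsubset> y \<and> y \<sqsubset> z \<longrightarrow> \<not> V y"
        using germ[OF dV, of z] by blast
      then show False
      proof cases
        \<comment> \<open>Where \<open>V\<close> holds the preorder is strictly increasing, so
          \<open>y\<close> has smaller points to its left and is no local minimum.\<close>
        case (1 w2)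
        obtain w where w: "w \<sqsubset> z" "a \<sqsubseteq> w" "w2 \<sqsubseteq> w" using mx[OF az 1(1)] by blast
        obtain y where y: "w \<sqsubset> y" "y \<sqsubset> z" using w dense by blast
        have Jy: "J y" using y w unfolding J by auto
        obtain u v where uv: "u \<sqsubset> y" "\<forall>x. u \<sqsubset> x \<and> x \<sqsubset> v \<and> x \<noteq> y \<and> J x \<longrightarrow> \<not> le x y" "y \<sqsubset> v"
          using lm[OF Jy] by blast
        obtain x where x: "u \<sqsubset> x" "w \<sqsubset> x" "x \<sqsubset> y" using between(1)[OF uv(1) y(1)] by blast
        have "w2 \<sqsubset> x" "x \<sqsubset> z" using x w y by auto
        then have "V x" using 1(2) by blast
        then have "\<not> le y x" unfolding V_def using x y by auto
        moreover have "J x" using x w y unfolding J by auto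
        moreover have "\<not> le x y" using uv x \<open>J x\<close> by auto
        ultimately show False using tot Jy by blast
      next
        case (2 w2)
        obtain w0 where w0: "w0 \<sqsubset> z" "a \<sqsubseteq> w0" "w2 \<sqsubseteq> w0" using mx[OF az 2(1)] by blast
        obtain w where w: "w \<sqsubset> z" "w0 \<sqsubseteq> w" "w1 \<sqsubseteq> w" using mx[OF w0(1) 1(1)] by blast
        obtain x where x: "w \<sqsubset> x" "x \<sqsubset> z" using w dense by blast
        have Jx: "J x" using x w w0 unfolding J by auto
        have "U x" using 1 x w by auto
        then obtain w3 where w3: "w3 \<sqsubset> z" "\<forall>y. w3 \<sqsubset> y \<and> y \<sqsubset> z \<longrightarrow> \<not> le y x" unfolding U_def by blast
        \<comment> \<open>The supremum \<open>s\<close> of the points that are still at most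
          \<open>x\<close>. As a strict local minimum approached by such points, \<open>s\<close> is
          at most \<open>x\<close> itself. Since \<open>V s\<close> fails there is a later point at
          most \<open>s\<close>, which contradicts the choice of \<open>s\<close>.\<close>
        define B where "B y \<longleftrightarrow> x \<sqsubseteq> y \<and> y \<sqsubset> z \<and> le y x" for y
        have dB: "dfn UNIV (\<lambda>e. B (e 0))" unfolding B_def by (rule dfn)+
        have Bx: "B x" unfolding B_def using x tot[OF Jx Jx] by auto
        have ub: "\<forall>y. B y \<longrightarrow> y \<sqsubseteq> w3" unfolding B_def using w3 by (meson ord.not_le)
        obtain s where s: "\<forall>y. B y \<longrightarrow> y \<sqsubseteq> s" "\<forall>v. (\<forall>y. B y \<longrightarrow> y \<sqsubseteq> v) \<longrightarrow> s \<sqsubseteq> v"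
          using lub[OF dB Bx ub] by blast
        have "x \<sqsubseteq> s" "s \<sqsubseteq> w3" using s ub Bx by auto
        then have sz: "s \<sqsubset> z" using w3 by auto
        have "\<not> V x" using 2 x w w0 by auto
        then obtain y0 where "x \<sqsubset> y0" "B y0" unfolding V_def B_def by auto
        then have xs: "x \<sqsubset> s" using s(1) by auto
        have Js: "J s" using xs sz Jx unfolding J by auto
        have "le s x"
        proof (rule ccontr)
          assume n: "\<not> le s x"
          then have xles: "le x s" using tot Js Jx by blast
          obtain u v where uv: "u \<sqsubset> s" "s \<sqsubset> v" "\<forall>y. u \<sqsubset> y \<and> y \<sqsubset> v \<and> y \<noteq> s \<and> J y \<longrightarrow> \<not> le y s" using lm[OF Js] by blast
          have "\<not> (\<forall>y. B y \<longrightarrow> y \<sqsubseteq> u)" using s(2) uv(1) by (meson ord.not_le)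
          then obtain y where y: "B y" "u \<sqsubset> y" by (meson ord.not_le)
          have "J y" using y(1) Jx unfolding B_def J by auto
          moreover have "y \<noteq> s" using y(1) n unfolding B_def by auto
          moreover have "y \<sqsubset> v" using s(1) y(1) uv(2) by auto
          ultimately have "\<not> le y s" using uv(3) y(2) by blast
          moreover have "le y s" using tr[OF \<open>J y\<close> Jx Js _ xles] y(1) unfolding B_def by blast
          ultimately show False by blast
        qed
        have "\<not> V s" using 2 xs sz x w w0 by auto
        then obtain y' where y': "s \<sqsubset> y'" "y' \<sqsubset> z" "le y' s" unfolding V_def by blast
        have "J y'" using y' Js unfolding J by auto
        then have "B y'" unfolding B_def using tr[OF \<open>J y'\<close> Js Jx y'(3) \<open>le s x\<close>] y' xs by auto
        then show False using s(1) y'(1) by auto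
      qed
    qed
    then show ?thesis ..
  next
    case (2 w1)
    obtain w where w: "w \<sqsubset> z" "a \<sqsubseteq> w" "w1 \<sqsubseteq> w" using mx[OF az 2(1)] by blast
    have "\<exists>w'. w' \<sqsubset> z \<and> (\<forall>y. w' \<sqsubset> y \<and> y \<sqsubset> z \<longrightarrow> \<not> le x y)" if x: "w \<sqsubset> x" "x \<sqsubset> z" for x
    proof -
      have Jx: "J x" using x w unfolding J by auto
      have d1: "dfn UNIV (\<lambda>e. \<not> le (e 0) x)" and d2: "dfn UNIV (\<lambda>e. le x (e 0))" by (rule dfn)+
      have "\<not> U x" using 2 x w by auto
      then obtain w2 where w2: "w2 \<sqsubset> z" "\<forall>y. w2 \<sqsubset> y \<and> y \<sqsubset> z \<longrightarrow> le y x"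
        using germ[of "\<lambda>y. \<not> le y x", OF d1, of z] unfolding U_def by blast
      \<comment> \<open>If the points near \<open>z\<close> were equivalent to \<open>x\<close>,
        they would be equivalent to each other, which strict minimality forbids.\<close>
      show ?thesis
      proof (rule ccontr)
        assume "\<not> ?thesis"
        then obtain w3 where w3: "w3 \<sqsubset> z" "\<forall>y. w3 \<sqsubset> y \<and> y \<sqsubset> z \<longrightarrow> le x y"
          using germ[of "\<lambda>y. le x y", OF d2, of z] by blast
        obtain m0 where m0: "m0 \<sqsubset> z" "w2 \<sqsubseteq> m0" "w3 \<sqsubseteq> m0" using mx[OF w2(1) w3(1)] by blast
        obtain m where m: "m \<sqsubset> z" "m0 \<sqsubseteq> m" "a \<sqsubseteq> m" using mx[OF m0(1) az] by blast
        obtain y1 where y1: "m \<sqsubset> y1" "y1 \<sqsubset> z" using m dense by blast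
        have J1: "J y1" using y1 m unfolding J by auto
        obtain u v where uv: "u \<sqsubset> y1" "y1 \<sqsubset> v" "\<forall>y. u \<sqsubset> y \<and> y \<sqsubset> v \<and> y \<noteq> y1 \<and> J y \<longrightarrow> \<not> le y y1"
          using lm[OF J1] by blast
        obtain y2 where y2: "y1 \<sqsubset> y2" "y2 \<sqsubset> v" "y2 \<sqsubset> z" using between(2)[OF uv(2) y1(2)] by blast
        have J2: "J y2" using y2 J1 unfolding J by auto
        have "u \<sqsubset> y2" "y2 \<sqsubset> v" "y2 \<noteq> y1" using y2 uv(1) by auto
        then have "\<not> le y2 y1" using uv(3) J2 by blast
        moreover have "le y2 x" using w2(2) y2 y1 m m0 by auto
        moreover have "le x y1" using w3(2) y1 m m0 by auto
        ultimately show False using tr[OF J2 Jx J1] by blast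
      qed
    qed
    then show ?thesis using w by blast
  qed
qed

text \<open>Take \<open>s\<close> as the supremum of the points after \<open>x\<close> whose value
  is at or above that of \<open>x\<close>; by \<open>tail_below\<close> it stays away from
  \<open>z\<close>. So the level of \<open>x\<close> is crossed downwards at \<open>s\<close>.
  Crossings obtained from both directions of the line will contradict each other.\<close>

lemma drop_point:
  assumes d: "drel1 UNIV (\<lambda>_. le)"
    and tot: "\<And>x y. J x \<Longrightarrow> J y \<Longrightarrow> le x y \<or> le y x"
    and tr: "\<And>x y z. J x \<Longrightarrow> J y \<Longrightarrow> J z \<Longrightarrow> le x y \<Longrightarrow> le y z \<Longrightarrow> le x z"
    and J: "\<And>x. J x \<longleftrightarrow> a \<sqsubset> x \<and> x \<sqsubset> z"
    and lm: "\<And>x. J x \<Longrightarrow> \<exists>u v. u \<sqsubset> x \<and> x \<sqsubset> v \<and> (\<forall>y. u \<sqsubset> y \<and> y \<sqsubset> v \<and> y \<noteq> x \<and> J y \<longrightarrow> \<not> le y x)"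
    and az: "a \<sqsubset> z"
  shows "\<exists>s. J s \<and> (\<exists>x. J x \<and> (\<exists>u. u \<sqsubset> s \<and> (\<forall>y. u \<sqsubset> y \<and> y \<sqsubset> s \<longrightarrow> J y \<and> le x y)) \<and>
    (\<exists>v. s \<sqsubset> v \<and> (\<forall>y. s \<sqsubset> y \<and> y \<sqsubset> v \<longrightarrow> J y \<and> \<not> le x y)))"
proof -
  note [dfn] = dsrel1D[OF d]
  obtain w where w: "w \<sqsubset> z" "a \<sqsubseteq> w" "\<And>x. w \<sqsubset> x \<Longrightarrow> x \<sqsubset> z \<Longrightarrow> \<exists>w'. w' \<sqsubset> z \<and> (\<forall>y. w' \<sqsubset> y \<and> y \<sqsubset> z \<longrightarrow> \<not> le x y)"
  proof -
    have "\<exists>w. w \<sqsubset> z \<and> a \<sqsubseteq> w \<and> (\<forall>x. w \<sqsubset> x \<and> x \<sqsubset> z \<longrightarrow> (\<exists>w'. w' \<sqsubset> z \<and> (\<forall>y. w' \<sqsubset> y \<and> y \<sqsubset> z \<longrightarrow> \<not> le x y)))"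
      by (rule tail_below[of le J]) (fact d tot tr J lm az)+
    then show ?thesis using that by blast
  qed
  obtain x where x: "w \<sqsubset> x" "x \<sqsubset> z" using w dense by blast
  have Jx: "J x" using x w unfolding J by auto
  obtain w' where w': "w' \<sqsubset> z" "\<forall>y. w' \<sqsubset> y \<and> y \<sqsubset> z \<longrightarrow> \<not> le x y" using w(3)[OF x] by blast
  define B where "B y \<longleftrightarrow> x \<sqsubseteq> y \<and> y \<sqsubset> z \<and> le x y" for y
  have dB: "dfn UNIV (\<lambda>e. B (e 0))" unfolding B_def by (rule dfn)+
  have Bx: "B x" unfolding B_def using x tot[OF Jx Jx] by auto
  have ub: "\<forall>y. B y \<longrightarrow> y \<sqsubseteq> w'" unfolding B_def using w' by (meson ord.not_le)
  obtain s where s: "\<forall>y. B y \<longrightarrow> y \<sqsubseteq> s" "\<forall>v. (\<forall>y. B y \<longrightarrow> y \<sqsubseteq> v) \<longrightarrow> s \<sqsubseteq> v"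
    using lub[OF dB Bx ub] by blast
  have "s \<sqsubseteq> w'" using s ub by auto
  then have sz: "s \<sqsubset> z" using w' by auto
  obtain u v where uv: "u \<sqsubset> x" "x \<sqsubset> v" "\<forall>y. u \<sqsubset> y \<and> y \<sqsubset> v \<and> y \<noteq> x \<and> J y \<longrightarrow> \<not> le y x"
    using lm[OF Jx] by blast
  obtain y where y: "x \<sqsubset> y" "y \<sqsubset> v" "y \<sqsubset> z" using between(2)[OF uv(2) x(2)] by blast
  have Jy: "J y" using y Jx unfolding J by auto
  have "u \<sqsubset> y" "y \<sqsubset> v" "y \<noteq> x" using y uv(1) by auto
  then have "\<not> le y x" using uv(3) Jy by blast
  then have "B y" using y tot[OF Jx Jy] unfolding B_def by auto
  then have xs: "x \<sqsubset> s" using s(1) y by auto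
  have Js: "J s" using xs sz Jx unfolding J by auto
  have right: "\<not> le x y" if "s \<sqsubset> y" "y \<sqsubset> z" for y
  proof
    assume "le x y"
    then have "B y" unfolding B_def using that xs by auto
    then show False using s(1) that by auto
  qed
  \<comment> \<open>As a strict local minimum \<open>s\<close> lies below the points to its right,
    which are below \<open>x\<close>. So \<open>s\<close> is not in \<open>B\<close>, and
    \<open>B\<close> has to reach \<open>s\<close> from the left.\<close>
  obtain u2 v2 where uv2: "u2 \<sqsubset> s" "s \<sqsubset> v2" "\<forall>y. u2 \<sqsubset> y \<and> y \<sqsubset> v2 \<and> y \<noteq> s \<and> J y \<longrightarrow> \<not> le y s"
    using lm[OF Js] by blast
  obtain y2 where y2: "s \<sqsubset> y2" "y2 \<sqsubset> v2" "y2 \<sqsubset> z" using between(2)[OF uv2(2) sz] by blast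
  have J2: "J y2" using y2 Js unfolding J by auto
  have "u2 \<sqsubset> y2" "y2 \<sqsubset> v2" "y2 \<noteq> s" using y2 uv2(1) by auto
  then have "\<not> le y2 s" using uv2(3) J2 by blast
  then have "le s y2" using tot J2 Js by blast
  then have "\<not> le x s" using tr[OF Jx Js J2] right[of y2] y2 by auto
  then have nB: "\<not> B s" unfolding B_def by blast
  consider w4 where "w4 \<sqsubset> s" "\<forall>y. w4 \<sqsubset> y \<and> y \<sqsubset> s \<longrightarrow> B y" | w4 where "w4 \<sqsubset> s" "\<forall>y. w4 \<sqsubset> y \<and> y \<sqsubset> s \<longrightarrow> \<not> B y"
    using germ[OF dB, of s] by blast
  then show ?thesis
  proof cases
    case (1 w4)
    have "\<forall>y. w4 \<sqsubset> y \<and> y \<sqsubset> s \<longrightarrow> J y \<and> le x y" using 1 Jx unfolding B_def J by auto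
    moreover have "\<forall>y. s \<sqsubset> y \<and> y \<sqsubset> z \<longrightarrow> J y \<and> \<not> le x y" using right Js unfolding J by auto
    ultimately show ?thesis using Js Jx 1(1) sz by blast
  next
    case (2 w4)
    have "\<forall>y. B y \<longrightarrow> y \<sqsubseteq> w4"
    proof (intro allI impI)
      fix y assume "B y"
      then have "y \<sqsubseteq> s" "y \<noteq> s" using s(1) nB by auto
      then have "y \<sqsubset> s" by auto
      then show "y \<sqsubseteq> w4" using 2(2) \<open>B y\<close> by (meson ord.not_le)
    qed
    then have "s \<sqsubseteq> w4" using s(2) by blast
    then show ?thesis using 2(1) by auto
  qed
qed

end

section \<open>The monotonicity theorem for definable preorders\<close>

context omin
begin

interpretation left: directed M "(\<le>)" "(<)"
  by unfold_locales (rule dfn_less dfn_le dense_ex lgerm sup_ex; assumption)+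

interpretation right: directed M "(\<ge>)" "(>)"
proof unfold_locales
  show "(\<exists>b>x. \<forall>y. y < b \<and> x < y \<longrightarrow> Q y) \<or> (\<exists>b>x. \<forall>y. y < b \<and> x < y \<longrightarrow> \<not> Q y)" if "dfn UNIV (\<lambda>e. Q (e 0))" for Q x
    using rgerm[OF that, of x] by (simp only: conj_commute)
  show "\<exists>s. (\<forall>y. Q y \<longrightarrow> s \<le> y) \<and> (\<forall>v. (\<forall>y. Q y \<longrightarrow> v \<le> y) \<longrightarrow> v \<le> s)"
    if "dfn UNIV (\<lambda>e. Q (e 0))" "Q x0" "\<forall>y. Q y \<longrightarrow> u \<le> y" for Q x0 u using inf_ex[OF that] .
qed (use dense_ex in \<open>auto intro: dfn_less dfn_le\<close>)

text \<open>Downward crossings \<open>G\<close> occur arbitrarily close to \<open>a\<close>, hence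
  fill an interval \<open>(a, c)\<close>. The mirrored lemma on that interval gives a point where
  some level is crossed upwards. There both crossings meet, and for points \<open>y\<close> and
  \<open>z\<close> just beside it the preorder would read
  \<open>x' <= y < x <= z < x'\<close>.\<close>

lemma no_strict_local_minima:
  assumes d: "drel1 UNIV (\<lambda>_. le)"
    and tot: "\<And>x y. a < x \<Longrightarrow> x < b \<Longrightarrow> a < y \<Longrightarrow> y < b \<Longrightarrow> le x y \<or> le y x"
    and tr: "\<And>x y z. a < x \<Longrightarrow> x < b \<Longrightarrow> a < y \<Longrightarrow> y < b \<Longrightarrow> a < z \<Longrightarrow> z < b \<Longrightarrow> le x y \<Longrightarrow> le y z \<Longrightarrow> le x z"
    and lm: "\<And>x. a < x \<Longrightarrow> x < b \<Longrightarrow> \<exists>u v. u < x \<and> x < v \<and> (\<forall>y. u < y \<and> y < v \<and> y \<noteq> x \<and> a < y \<and> y < b \<longrightarrow> \<not> le y x)"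
    and ab: "a < b"
  shows False
proof -
  note [dfn] = dsrel1D[OF d]
  define G where "G s \<longleftrightarrow> (\<exists>x. (a < x \<and> x < b) \<and> (\<exists>u. u < s \<and> (\<forall>y. u < y \<and> y < s \<longrightarrow> (a < y \<and> y < b) \<and> le x y)) \<and>
    (\<exists>v. s < v \<and> (\<forall>y. s < y \<and> y < v \<longrightarrow> (a < y \<and> y < b) \<and> \<not> le x y)))" for s
  have dG: "dfn UNIV (\<lambda>e. G (e 0))" unfolding G_def by (rule dfn)+
  have drop: "\<exists>s. a < s \<and> s < c \<and> G s" if c: "a < c" "c \<le> b" for c
  proof -
    have "\<exists>s. (a < s \<and> s < c) \<and> (\<exists>x. (a < x \<and> x < c) \<and> (\<exists>u. u < s \<and> (\<forall>y. u < y \<and> y < s \<longrightarrow> (a < y \<and> y < c) \<and> le x y)) \<and>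
      (\<exists>v. s < v \<and> (\<forall>y. s < y \<and> y < v \<longrightarrow> (a < y \<and> y < c) \<and> \<not> le x y)))"
    proof (rule left.drop_point[of le "\<lambda>x. a < x \<and> x < c" a c])
      fix x assume x: "a < x \<and> x < c"
      obtain u v where uv: "u < x" "x < v" "\<forall>y. u < y \<and> y < v \<and> y \<noteq> x \<and> a < y \<and> y < b \<longrightarrow> \<not> le y x"
      proof -
        have "a < x" "x < b" using x c by auto
        from lm[OF this] show ?thesis using that by blast
      qed
      then show "\<exists>u v. u < x \<and> x < v \<and> (\<forall>y. u < y \<and> y < v \<and> y \<noteq> x \<and> a < y \<and> y < c \<longrightarrow> \<not> le y x)"
        using c by (intro exI[of _ u] exI[of _ v]) auto
    next
      fix x y assume "a < x \<and> x < c" "a < y \<and> y < c"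
      then show "le x y \<or> le y x" using tot[of x y] c by auto
    next
      fix x y z assume "a < x \<and> x < c" "a < y \<and> y < c" "a < z \<and> z < c" "le x y" "le y z"
      then show "le x z" using tr[of x y z] c by auto
    qed (use d c in auto)
    then obtain s x u v where "a < s" "s < c" "a < x" "x < c" "u < s" "s < v"
      "\<forall>y. u < y \<and> y < s \<longrightarrow> (a < y \<and> y < c) \<and> le x y" "\<forall>y. s < y \<and> y < v \<longrightarrow> (a < y \<and> y < c) \<and> \<not> le x y"
      by blast
    then show ?thesis unfolding G_def using c
      by (intro exI[of _ s] conjI exI[of _ x] exI[of _ u] exI[of _ v]) auto
  qed
  obtain c where c: "a < c" "c \<le> b" "\<And>y. a < y \<Longrightarrow> y < c \<Longrightarrow> G y"
  proof -
    consider c where "a < c" "\<forall>y. a < y \<and> y < c \<longrightarrow> G y" | c where "a < c" "\<forall>y. a < y \<and> y < c \<longrightarrow> \<not> G y"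
      using rgerm[OF dG, of a] by blast
    then show ?thesis
    proof cases
      case (1 c)
      then show ?thesis using ab by (intro that[of "min b c"]) auto
    next
      case (2 c)
      then show ?thesis using drop[of "min b c"] ab by auto
    qed
  qed
  have "\<exists>s. (s < c \<and> a < s) \<and> (\<exists>x. (x < c \<and> a < x) \<and> (\<exists>u. s < u \<and> (\<forall>y. y < u \<and> s < y \<longrightarrow> (y < c \<and> a < y) \<and> le x y)) \<and>
    (\<exists>v. v < s \<and> (\<forall>y. y < s \<and> v < y \<longrightarrow> (y < c \<and> a < y) \<and> \<not> le x y)))"
  proof (rule right.drop_point[of le "\<lambda>x. x < c \<and> a < x" c a])
    fix x assume x: "x < c \<and> a < x"
    obtain u v where uv: "u < x" "x < v" "\<forall>y. u < y \<and> y < v \<and> y \<noteq> x \<and> a < y \<and> y < b \<longrightarrow> \<not> le y x"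
    proof -
      have "a < x" "x < b" using x c by auto
      from lm[OF this] show ?thesis using that by blast
    qed
    then show "\<exists>u v. x < u \<and> v < x \<and> (\<forall>y. y < u \<and> v < y \<and> y \<noteq> x \<and> y < c \<and> a < y \<longrightarrow> \<not> le y x)"
      using c(1,2) by (intro exI[of _ v] exI[of _ u]) auto
  next
    fix x y assume "x < c \<and> a < x" "y < c \<and> a < y"
    then show "le x y \<or> le y x" using tot[of x y] c by auto
  next
    fix x y z assume "x < c \<and> a < x" "y < c \<and> a < y" "z < c \<and> a < z" "le x y" "le y z"
    then show "le x z" using tr[of x y z] c by auto
  qed (use d c in auto)
  then obtain s x u v where 2: "a < s" "s < c" "a < x" "x < c" "s < u" "v < s"
    "\<forall>y. y < u \<and> s < y \<longrightarrow> (y < c \<and> a < y) \<and> le x y" "\<forall>y. y < s \<and> v < y \<longrightarrow> (y < c \<and> a < y) \<and> \<not> le x y"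
    by blast
  have "G s" using c(3) 2 by blast
  then obtain x' u' v' where 1: "a < x'" "x' < b" "u' < s" "s < v'"
    "\<forall>y. u' < y \<and> y < s \<longrightarrow> (a < y \<and> y < b) \<and> le x' y" "\<forall>y. s < y \<and> y < v' \<longrightarrow> (a < y \<and> y < b) \<and> \<not> le x' y"
    unfolding G_def by blast
  obtain y where y: "max u' v < y" "y < s" using dense_ex[of "max u' v" s] 1 2 by auto
  obtain z where z: "s < z" "z < min u v'" using dense_ex[of s "min u v'"] 1 2 by auto
  have iy: "a < y" "y < b" and iz: "a < z" "z < b" and ix: "x < b" using y z 1 2 c(2) by auto
  have "le x' y" "\<not> le x y" "\<not> le x' z" "le x z" using y z 1 2 by auto
  moreover from this have "le y x" using tot[OF iy 2(3) ix] by blast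
  ultimately show False using tr[OF 1(1,2) iy 2(3) ix] tr[OF 1(1,2) 2(3) ix iz] by blast
qed

text \<open>Consider the infimum \<open>s\<close> of the later points that are at most
  \<open>x\<close>. If \<open>s\<close> is at most \<open>x\<close>, then so are its left
  neighbours; if not, its right neighbours are above \<open>s\<close> and so above \<open>x\<close>.
  Both contradict the choice of \<open>s\<close>. \<open>J\<close> may be any convex set; later it
  is a component of a definable set.\<close>

lemma locally_increasing_imp_increasing:
  assumes d: "drel1 UNIV (\<lambda>_. le)"
    and conv: "\<And>x y z. J x \<Longrightarrow> J z \<Longrightarrow> x < y \<Longrightarrow> y < z \<Longrightarrow> J y"
    and tot: "\<And>x y. J x \<Longrightarrow> J y \<Longrightarrow> le x y \<or> le y x"
    and tr: "\<And>x y z. J x \<Longrightarrow> J y \<Longrightarrow> J z \<Longrightarrow> le x y \<Longrightarrow> le y z \<Longrightarrow> le x z"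
    and R: "\<And>x. J x \<Longrightarrow> \<exists>v. x < v \<and> (\<forall>y. x < y \<and> y < v \<and> J y \<longrightarrow> \<not> le y x)"
    and L: "\<And>x. J x \<Longrightarrow> \<exists>u. u < x \<and> (\<forall>y. u < y \<and> y < x \<and> J y \<longrightarrow> \<not> le x y)"
    and x: "J x" "J x1" "x < x1"
  shows "\<not> le x1 x"
proof
  note [dfn] = dsrel1D[OF d]
  assume le1: "le x1 x"
  define B where "B y \<longleftrightarrow> x < y \<and> y \<le> x1 \<and> le y x" for y
  have dB: "dfn UNIV (\<lambda>e. B (e 0))" unfolding B_def by (rule dfn)+
  have Bx: "B x1" unfolding B_def using x le1 by auto
  have lb: "\<forall>y. B y \<longrightarrow> x \<le> y" unfolding B_def by auto
  obtain s where s: "\<forall>y. B y \<longrightarrow> s \<le> y" "\<forall>v. (\<forall>y. B y \<longrightarrow> v \<le> y) \<longrightarrow> v \<le> s"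
    using inf_ex[OF dB Bx lb] by blast
  have JB: "J y" if "x < y" "y \<le> x1" for y using conv[OF x(1,2)] that x(2) by (cases "y = x1") auto
  obtain v where v: "x < v" "\<forall>y. x < y \<and> y < v \<and> J y \<longrightarrow> \<not> le y x" using R[OF x(1)] by blast
  have "\<forall>y. B y \<longrightarrow> v \<le> y" using v JB unfolding B_def by (meson not_le)
  then have xs: "x < s" using s(2) v(1) by (meson less_le_trans)
  have sx1: "s \<le> x1" using s(1) Bx by blast
  have Js: "J s" using JB xs sx1 by blast
  show False
  proof (cases "le s x")
    case True
    obtain u where u: "u < s" "\<forall>y. u < y \<and> y < s \<and> J y \<longrightarrow> \<not> le s y" using L[OF Js] by blast
    obtain y where y: "max u x < y" "y < s" using dense_ex[of "max u x" s] u xs by auto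
    have Jy: "J y" using JB[of y] y sx1 by auto
    have "\<not> B y" using s(1) y by auto
    then have "\<not> le y x" unfolding B_def using y sx1 by auto
    then have "le s y" using tot[OF x(1) Jy] tr[OF Js x(1) Jy True] by blast
    then show False using u y Jy by auto
  next
    case False
    then have xs': "le x s" using tot[OF x(1) Js] by blast
    obtain v where v: "s < v" "\<forall>y. s < y \<and> y < v \<and> J y \<longrightarrow> \<not> le y s" using R[OF Js] by blast
    have "\<forall>y. B y \<longrightarrow> v \<le> y"
    proof (intro allI impI)
      fix y assume By: "B y"
      then have "s \<le> y" "y \<noteq> s" using s(1) False unfolding B_def by auto
      then have "s < y" by auto
      have Jy: "J y" using By JB unfolding B_def by blast
      have "le y s" using tr[OF Jy x(1) Js _ xs'] By unfolding B_def by blast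
      then show "v \<le> y" using v(2) \<open>s < y\<close> Jy by (meson not_le)
    qed
    then show False using s(2) v(1) by (meson not_le)
  qed
qed

lemma refine_interval:
  assumes "dfn UNIV (\<lambda>e. Q (e 0))" "a < b"
  obtains c where "a < c" "c \<le> b" "(\<forall>y. a < y \<and> y < c \<longrightarrow> Q y) \<or> (\<forall>y. a < y \<and> y < c \<longrightarrow> \<not> Q y)"
proof -
  from rgerm[OF assms(1), of a] obtain c where "a < c"
    "(\<forall>y. a < y \<and> y < c \<longrightarrow> Q y) \<or> (\<forall>y. a < y \<and> y < c \<longrightarrow> \<not> Q y)" by blast
  then show ?thesis using assms(2) by (intro that[of "min c b"]) auto
qed

text \<open>Stated for total preorders rather than functions to \<open>M\<close>, since it is also
  applied to curves in a definable order, whose values are not elements of \<open>M\<close>.\<close>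

lemma preorder_monotone_on_subinterval:
  assumes d: "drel1 UNIV (\<lambda>_. le)"
    and tot: "\<And>x y. a < x \<Longrightarrow> x < b \<Longrightarrow> a < y \<Longrightarrow> y < b \<Longrightarrow> le x y \<or> le y x"
    and tr: "\<And>x y z. a < x \<Longrightarrow> x < b \<Longrightarrow> a < y \<Longrightarrow> y < b \<Longrightarrow> a < z \<Longrightarrow> z < b \<Longrightarrow> le x y \<Longrightarrow> le y z \<Longrightarrow> le x z"
    and ab: "a < b"
  obtains c d where "a \<le> c" "c < d" "d \<le> b"
    "(\<forall>x y. c < x \<and> x < y \<and> y < d \<longrightarrow> le x y \<and> le y x) \<or>
     (\<forall>x y. c < x \<and> x < y \<and> y < d \<longrightarrow> \<not> le y x) \<or> (\<forall>x y. c < x \<and> x < y \<and> y < d \<longrightarrow> \<not> le x y)"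
proof -
  note main = that
  note [dfn] = dsrel1D[OF d]
  \<comment> \<open>\<open>R1\<close> and \<open>R2\<close>: the points just right of
    \<open>x\<close> are strictly above or strictly below it. \<open>L1\<close> and
    \<open>L2\<close>: those just left of \<open>x\<close> are strictly below or strictly above it.
    On a subinterval each of the four holds everywhere or nowhere. If both conditions for one side
    fail at \<open>x0\<close>, the points close to it on that side are equivalent to it.\<close>
  define R1 where "R1 x \<longleftrightarrow> (\<exists>v. x < v \<and> (\<forall>y. x < y \<and> y < v \<longrightarrow> \<not> le y x))" for x
  define R2 where "R2 x \<longleftrightarrow> (\<exists>v. x < v \<and> (\<forall>y. x < y \<and> y < v \<longrightarrow> \<not> le x y))" for x
  define L1 where "L1 x \<longleftrightarrow> (\<exists>v. v < x \<and> (\<forall>y. v < y \<and> y < x \<longrightarrow> \<not> le x y))" for x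
  define L2 where "L2 x \<longleftrightarrow> (\<exists>v. v < x \<and> (\<forall>y. v < y \<and> y < x \<longrightarrow> \<not> le y x))" for x
  have "dfn UNIV (\<lambda>e. R1 (e 0))" unfolding R1_def by (rule dfn)+
  then obtain c1 where c1: "a < c1" "c1 \<le> b" "(\<forall>y. a < y \<and> y < c1 \<longrightarrow> R1 y) \<or> (\<forall>y. a < y \<and> y < c1 \<longrightarrow> \<not> R1 y)"
    using ab by (rule refine_interval)
  have "dfn UNIV (\<lambda>e. R2 (e 0))" unfolding R2_def by (rule dfn)+
  then obtain c2 where c2: "a < c2" "c2 \<le> c1" "(\<forall>y. a < y \<and> y < c2 \<longrightarrow> R2 y) \<or> (\<forall>y. a < y \<and> y < c2 \<longrightarrow> \<not> R2 y)"
    using c1(1) by (rule refine_interval)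
  have "dfn UNIV (\<lambda>e. L1 (e 0))" unfolding L1_def by (rule dfn)+
  then obtain c3 where c3: "a < c3" "c3 \<le> c2" "(\<forall>y. a < y \<and> y < c3 \<longrightarrow> L1 y) \<or> (\<forall>y. a < y \<and> y < c3 \<longrightarrow> \<not> L1 y)"
    using c2(1) by (rule refine_interval)
  have "dfn UNIV (\<lambda>e. L2 (e 0))" unfolding L2_def by (rule dfn)+
  then obtain c where c: "a < c" "c \<le> c3" "(\<forall>y. a < y \<and> y < c \<longrightarrow> L2 y) \<or> (\<forall>y. a < y \<and> y < c \<longrightarrow> \<not> L2 y)"
    using c3(1) by (rule refine_interval)
  have cb: "c \<le> b" using c c1 c2 c3 by auto
  have all: "(\<forall>y. a < y \<and> y < c \<longrightarrow> P y) \<or> (\<forall>y. a < y \<and> y < c \<longrightarrow> \<not> P y)" if "P \<in> {R1, R2, L1, L2}" for P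
    using that c c1(3) c2(2,3) c3(2,3) by fastforce
  obtain x0 where x0: "a < x0" "x0 < c" using c dense_ex by blast
  have tot': "le x y \<or> le y x" if "a < x \<and> x < c" "a < y \<and> y < c" for x y
    using tot[of x y] that cb by auto
  have tr': "le x z" if "a < x \<and> x < c" "a < y \<and> y < c" "a < z \<and> z < c" "le x y" "le y z" for x y z
    using tr[of x y z] that cb by auto
  have eqv: thesis if p: "a \<le> p" "p < q" "q \<le> c" and e: "\<forall>y. p < y \<and> y < q \<longrightarrow> le x0 y \<and> le y x0" for p q
  proof (rule main[of p q])
    show "q \<le> b" using p cb by auto
    have "le x y" if xy: "p < x" "x < q" "p < y" "y < q" for x y
    proof -
      have "a < x \<and> x < c" "a < x0 \<and> x0 < c" "a < y \<and> y < c" using xy p x0 by auto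
      from tr'[OF this] show ?thesis using e xy by blast
    qed
    then show "(\<forall>x y. p < x \<and> x < y \<and> y < q \<longrightarrow> le x y \<and> le y x) \<or>
     (\<forall>x y. p < x \<and> x < y \<and> y < q \<longrightarrow> \<not> le y x) \<or> (\<forall>x y. p < x \<and> x < y \<and> y < q \<longrightarrow> \<not> le x y)" by auto
  qed (use p in auto)
  have dl: "dfn UNIV (\<lambda>e. le (e 0) x0)" and dr: "dfn UNIV (\<lambda>e. le x0 (e 0))" by (rule dfn)+
  show thesis
  proof (cases "R1 x0 \<or> R2 x0")
    case False
    then obtain p q where "x0 < p" "x0 < q" "\<forall>y. x0 < y \<and> y < p \<longrightarrow> le y x0" "\<forall>y. x0 < y \<and> y < q \<longrightarrow> le x0 y"
      using rgerm[OF dl, of x0] rgerm[OF dr, of x0] unfolding R1_def R2_def by blast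
    then show ?thesis using x0 by (intro eqv[of x0 "min c (min p q)"]) auto
  next
    case R: True
    show thesis
    proof (cases "L1 x0 \<or> L2 x0")
      case False
      then obtain p q where "p < x0" "q < x0" "\<forall>y. p < y \<and> y < x0 \<longrightarrow> le y x0" "\<forall>y. q < y \<and> y < x0 \<longrightarrow> le x0 y"
        using lgerm[OF dl, of x0] lgerm[OF dr, of x0] unfolding L1_def L2_def by blast
      then show ?thesis using x0 by (intro eqv[of "max a (max p q)" x0]) auto
    next
      case L: True
      have RR: "(\<forall>y. a < y \<and> y < c \<longrightarrow> R1 y) \<or> (\<forall>y. a < y \<and> y < c \<longrightarrow> R2 y)"
        using R all[of R1] all[of R2] x0 by blast
      have LL: "(\<forall>y. a < y \<and> y < c \<longrightarrow> L1 y) \<or> (\<forall>y. a < y \<and> y < c \<longrightarrow> L2 y)"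
        using L all[of L1] all[of L2] x0 by blast
      have d': "drel1 UNIV (\<lambda>_ x y. le y x)" by (rule dfn)+
      from RR LL consider
        (inc) "\<forall>y. a < y \<and> y < c \<longrightarrow> R1 y" "\<forall>y. a < y \<and> y < c \<longrightarrow> L1 y"
        | (min) "\<forall>y. a < y \<and> y < c \<longrightarrow> R1 y" "\<forall>y. a < y \<and> y < c \<longrightarrow> L2 y"
        | (max) "\<forall>y. a < y \<and> y < c \<longrightarrow> R2 y" "\<forall>y. a < y \<and> y < c \<longrightarrow> L1 y"
        | (dec) "\<forall>y. a < y \<and> y < c \<longrightarrow> R2 y" "\<forall>y. a < y \<and> y < c \<longrightarrow> L2 y" by blast
      then show thesis
      proof cases
        case inc
        have "\<not> le y x" if "a < x" "x < y" "y < c" for x y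
        proof (rule locally_increasing_imp_increasing[where J = "\<lambda>x. a < x \<and> x < c" and x = x and ?x1.0 = y, OF d])
          fix x assume "a < x \<and> x < c"
          then have "R1 x" "L1 x" using inc by auto
          then show "\<exists>v. x < v \<and> (\<forall>y. x < y \<and> y < v \<and> a < y \<and> y < c \<longrightarrow> \<not> le y x)"
            "\<exists>u. u < x \<and> (\<forall>y. u < y \<and> y < x \<and> a < y \<and> y < c \<longrightarrow> \<not> le x y)"
            unfolding R1_def L1_def by blast+
        next
          fix x y z assume "a < x \<and> x < c" "a < z \<and> z < c" "x < y" "y < z"
          then show "a < y \<and> y < c" by auto
        next
          show "a < x \<and> x < c" "a < y \<and> y < c" "x < y" using that by auto
        qed (fact tot' tr')+
        then show thesis using c(1) cb by (intro that[of a c]) auto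
      next
        case min
        have False
        proof (rule no_strict_local_minima[where a = a and b = c, OF d])
          fix x assume "a < x" "x < c"
          then have "R1 x" "L2 x" using min by auto
          then obtain u v where "u < x" "x < v" "\<forall>y. x < y \<and> y < v \<longrightarrow> \<not> le y x" "\<forall>y. u < y \<and> y < x \<longrightarrow> \<not> le y x"
            unfolding R1_def L2_def by blast
          then show "\<exists>u v. u < x \<and> x < v \<and> (\<forall>y. u < y \<and> y < v \<and> y \<noteq> x \<and> a < y \<and> y < c \<longrightarrow> \<not> le y x)"
            by (meson linorder_less_linear)
        qed (use tot' tr' c(1) in blast)+
        then show thesis ..
      next
        case max
        have False
        proof (rule no_strict_local_minima[where a = a and b = c, OF d'])
          fix x assume "a < x" "x < c"
          then have "R2 x" "L1 x" using max by auto
          then obtain u v where "u < x" "x < v" "\<forall>y. x < y \<and> y < v \<longrightarrow> \<not> le x y" "\<forall>y. u < y \<and> y < x \<longrightarrow> \<not> le x y"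
            unfolding R2_def L1_def by blast
          then show "\<exists>u v. u < x \<and> x < v \<and> (\<forall>y. u < y \<and> y < v \<and> y \<noteq> x \<and> a < y \<and> y < c \<longrightarrow> \<not> le x y)"
            by (meson linorder_less_linear)
        qed (use tot' tr' c(1) in blast)+
        then show thesis ..
      next
        case dec
        have "\<not> le x y" if "a < x" "x < y" "y < c" for x y
        proof (rule locally_increasing_imp_increasing[where J = "\<lambda>x. a < x \<and> x < c" and x = x and ?x1.0 = y, OF d'])
          fix x assume "a < x \<and> x < c"
          then have "R2 x" "L2 x" using dec by auto
          then show "\<exists>v. x < v \<and> (\<forall>y. x < y \<and> y < v \<and> a < y \<and> y < c \<longrightarrow> \<not> le x y)"
            "\<exists>u. u < x \<and> (\<forall>y. u < y \<and> y < x \<and> a < y \<and> y < c \<longrightarrow> \<not> le y x)"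
            unfolding R2_def L2_def by blast+
        next
          fix x y z assume "a < x \<and> x < c" "a < z \<and> z < c" "x < y" "y < z"
          then show "a < y \<and> y < c" by auto
        next
          show "a < x \<and> x < c" "a < y \<and> y < c" "x < y" using that by auto
        qed (use tot' tr' in blast)+
        then show thesis using c(1) cb by (intro that[of a c]) auto
      qed
    qed
  qed
qed

end

section \<open>Continuity and infinite fibres\<close>

context omin
begin

definition cont_at :: "('a \<Rightarrow> 'a) \<Rightarrow> 'a \<Rightarrow> bool" where
  "cont_at f x \<longleftrightarrow> (\<forall>y1 y2. y1 < f x \<and> f x < y2 \<longrightarrow>
     (\<exists>u v. u < x \<and> x < v \<and> (\<forall>z. u < z \<and> z < v \<longrightarrow> y1 < f z \<and> f z < y2)))"

lemma cont_atD:
  assumes "cont_at f x" "y1 < f x" "f x < y2"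
  obtains u v where "u < x" "x < v" "\<And>z. u < z \<Longrightarrow> z < v \<Longrightarrow> y1 < f z \<and> f z < y2"
  using assms unfolding cont_at_def by blast

lemma dfn_fun_less:
  assumes "drel1 UNIV (\<lambda>_ x y. y = f x)" "elt_term UNIV t" "elt_term UNIV s"
  shows "dfn UNIV (\<lambda>e. f (t e) < s e)" "dfn UNIV (\<lambda>e. s e < f (t e))"
    "dfn UNIV (\<lambda>e. f (t e) \<le> f (s e))" "dfn UNIV (\<lambda>e. s e = f (t e))"
proof -
  have *: "dfn UNIV (\<lambda>e. y e = f (x e))" if "elt_term UNIV x" "elt_term UNIV y" for x y
    using dsrel1D[OF assms(1) that] .
  have sh: "elt_term UNIV (\<lambda>e. x (\<lambda>i. e (Suc i)))" if "elt_term UNIV x" for x :: "(nat \<Rightarrow> 'a) \<Rightarrow> 'a"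
    by (rule elt_subst[OF that]) (rule dfn)+
  have "dfn UNIV (\<lambda>e. \<exists>z. z = f (t e) \<and> z < s e)" by (rule dfn * assms sh)+
  then show "dfn UNIV (\<lambda>e. f (t e) < s e)" by simp
  have "dfn UNIV (\<lambda>e. \<exists>z. z = f (t e) \<and> s e < z)" by (rule dfn * assms sh)+
  then show "dfn UNIV (\<lambda>e. s e < f (t e))" by simp
  have "dfn UNIV (\<lambda>e. \<exists>z. z = f (t e) \<and> (\<exists>w. w = f (s e) \<and> z \<le> w))" by (rule dfn * assms sh)+
  then show "dfn UNIV (\<lambda>e. f (t e) \<le> f (s e))" by simp
  show "dfn UNIV (\<lambda>e. s e = f (t e))" by (rule dfn * assms sh)+
qed

text \<open>Otherwise \<open>f\<close> is discontinuous on a whole interval, on part of which it is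
  constant or strictly monotone. In the monotone case the image contains an interval; over an
  interior point of it, values arbitrarily close on both sides are attained, and monotonicity turns
  this into continuity.\<close>

lemma finite_discontinuities:
  assumes d: "drel1 UNIV (\<lambda>_ x y. y = f x)"
  shows "finite {x. \<not> cont_at f x}"
proof (rule ccontr)
  note [dfn] = dfn_fun_less[OF d]
  assume inf: "infinite {x. \<not> cont_at f x}"
  have "dfn UNIV (\<lambda>e. \<not> cont_at f (e 0))" unfolding cont_at_def by (rule dfn)+
  then obtain a b where ab: "a < b" "\<And>x. a < x \<Longrightarrow> x < b \<Longrightarrow> \<not> cont_at f x"
    using inf by (rule interval_in_infinite) blast
  have dle: "drel1 UNIV (\<lambda>_ x y. f x \<le> f y)" by (rule dfn)+
  obtain c d where cd: "a \<le> c" "c < d" "d \<le> b" and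
    cases: "(\<forall>x y. c < x \<and> x < y \<and> y < d \<longrightarrow> f x \<le> f y \<and> f y \<le> f x) \<or>
     (\<forall>x y. c < x \<and> x < y \<and> y < d \<longrightarrow> \<not> f y \<le> f x) \<or> (\<forall>x y. c < x \<and> x < y \<and> y < d \<longrightarrow> \<not> f x \<le> f y)"
    by (rule preorder_monotone_on_subinterval[OF dle _ _ ab(1)]) auto
  have bad: "\<not> cont_at f x" if "c < x" "x < d" for x using ab(2)[of x] cd that by auto
  have image: "\<exists>x2. c < x2 \<and> x2 < d \<and> (\<forall>y1 y2. y1 < f x2 \<and> f x2 < y2 \<longrightarrow>
      (\<exists>u v. c < u \<and> u < d \<and> c < v \<and> v < d \<and> y1 < f u \<and> f u < f x2 \<and> f x2 < f v \<and> f v < y2))"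
    if inj: "\<And>x y. c < x \<Longrightarrow> x < y \<Longrightarrow> y < d \<Longrightarrow> f x \<noteq> f y"
  proof -
    define I where "I y \<longleftrightarrow> (\<exists>x. c < x \<and> x < d \<and> y = f x)" for y
    have dI: "dfn UNIV (\<lambda>e. I (e 0))" unfolding I_def by (rule dfn)+
    have "inj_on f {x. c < x \<and> x < d}" using inj by (auto simp: inj_on_def) (metis linorder_neqE)
    moreover have "{y. I y} = f ` {x. c < x \<and> x < d}" unfolding I_def by auto
    ultimately have "infinite {y. I y}" using infinite_interval[OF cd(2)] by (simp add: finite_image_iff)
    with dI obtain p q where pq: "p < q" "\<And>y. p < y \<Longrightarrow> y < q \<Longrightarrow> I y" by (rule interval_in_infinite) blast
    obtain r where r: "p < r" "r < q" using pq dense_ex by blast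
    obtain x2 where x2: "c < x2" "x2 < d" "r = f x2" using pq(2)[OF r] unfolding I_def by blast
    have "\<exists>u v. c < u \<and> u < d \<and> c < v \<and> v < d \<and> y1 < f u \<and> f u < f x2 \<and> f x2 < f v \<and> f v < y2"
      if y: "y1 < f x2" "f x2 < y2" for y1 y2
    proof -
      obtain r1 where r1: "max p y1 < r1" "r1 < r" using dense_ex[of "max p y1" r] y x2 r by auto
      obtain r2 where r2: "r < r2" "r2 < min q y2" using dense_ex[of r "min q y2"] y x2 r by auto
      have "p < r1" "r1 < q" "p < r2" "r2 < q" using r1 r2 r by auto
      then have "I r1" "I r2" using pq(2) by auto
      then obtain u v where "c < u" "u < d" "r1 = f u" "c < v" "v < d" "r2 = f v" unfolding I_def by blast
      then show ?thesis using r1 r2 x2 by (intro exI[of _ u] exI[of _ v]) auto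
    qed
    then show ?thesis using x2 by blast
  qed
  from cases show False
  proof (elim disjE)
    assume *: "\<forall>x y. c < x \<and> x < y \<and> y < d \<longrightarrow> f x \<le> f y \<and> f y \<le> f x"
    obtain x where x: "c < x" "x < d" using cd dense_ex by blast
    have "f z = f x" if "c < z" "z < d" for z
    proof -
      consider "z < x" | "z = x" | "x < z" by (rule linorder_cases)
      then show ?thesis
      proof cases
        case 1
        then have "f z \<le> f x \<and> f x \<le> f z" using * that x by blast
        then show ?thesis by (simp add: antisym)
      next
        case 3
        then have "f z \<le> f x \<and> f x \<le> f z" using * that x by blast
        then show ?thesis by (simp add: antisym)
      qed simp
    qed
    then have "\<forall>z. c < z \<and> z < d \<longrightarrow> f z = f x" by blast
    then have "y1 < f z \<and> f z < y2" if "y1 < f x \<and> f x < y2" "c < z \<and> z < d" for y1 y2 z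
      using that by metis
    then have "cont_at f x" unfolding cont_at_def using x by blast
    then show False using bad x by blast
  next
    assume *: "\<forall>x y. c < x \<and> x < y \<and> y < d \<longrightarrow> \<not> f y \<le> f x"
    then have mono: "f x < f y" if "c < x" "x < y" "y < d" for x y using that by (simp add: not_le)
    have mono': "x < y" if "f x < f y" "c < x" "x < d" "c < y" "y < d" for x y
      using that mono[where x = y and y = x] by (cases x y rule: linorder_cases) auto
    obtain x2 where x2: "c < x2" "x2 < d" "\<forall>y1 y2. y1 < f x2 \<and> f x2 < y2 \<longrightarrow>
      (\<exists>u v. c < u \<and> u < d \<and> c < v \<and> v < d \<and> y1 < f u \<and> f u < f x2 \<and> f x2 < f v \<and> f v < y2)"
    proof -
      have "f x \<noteq> f y" if "c < x" "x < y" "y < d" for x y using mono[OF that] by auto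
      from image[OF this] show ?thesis using that by blast
    qed
    have "cont_at f x2" unfolding cont_at_def
    proof (intro allI impI)
      fix y1 y2 assume "y1 < f x2 \<and> f x2 < y2"
      then obtain u v where uv: "c < u" "u < d" "c < v" "v < d" "y1 < f u" "f u < f x2" "f x2 < f v" "f v < y2"
        using x2(3) by blast
      have "u < x2" "x2 < v" using mono'[where x = u and y = x2] mono'[where x = x2 and y = v] uv x2 by auto
      moreover have "y1 < f z \<and> f z < y2" if z: "u < z" "z < v" for z
      proof -
        have "c < z" "z < d" using z uv by auto
        then have "f u < f z" "f z < f v" using mono[where x = u and y = z] mono[where x = z and y = v] z uv by auto
        then show ?thesis using uv by auto
      qed
      ultimately show "\<exists>u v. u < x2 \<and> x2 < v \<and> (\<forall>z. u < z \<and> z < v \<longrightarrow> y1 < f z \<and> f z < y2)" by blast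
    qed
    then show False using bad x2 by blast
  next
    assume *: "\<forall>x y. c < x \<and> x < y \<and> y < d \<longrightarrow> \<not> f x \<le> f y"
    then have mono: "f y < f x" if "c < x" "x < y" "y < d" for x y using that by (simp add: not_le)
    have mono': "x < y" if "f y < f x" "c < x" "x < d" "c < y" "y < d" for x y
      using that mono[where x = y and y = x] by (cases x y rule: linorder_cases) auto
    obtain x2 where x2: "c < x2" "x2 < d" "\<forall>y1 y2. y1 < f x2 \<and> f x2 < y2 \<longrightarrow>
      (\<exists>u v. c < u \<and> u < d \<and> c < v \<and> v < d \<and> y1 < f u \<and> f u < f x2 \<and> f x2 < f v \<and> f v < y2)"
    proof -
      have "f x \<noteq> f y" if "c < x" "x < y" "y < d" for x y using mono[OF that] by auto
      from image[OF this] show ?thesis using that by blast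
    qed
    have "cont_at f x2" unfolding cont_at_def
    proof (intro allI impI)
      fix y1 y2 assume "y1 < f x2 \<and> f x2 < y2"
      then obtain u v where uv: "c < u" "u < d" "c < v" "v < d" "y1 < f u" "f u < f x2" "f x2 < f v" "f v < y2"
        using x2(3) by blast
      have "v < x2" "x2 < u" using mono'[where x = v and y = x2] mono'[where x = x2 and y = u] uv x2 by auto
      moreover have "y1 < f z \<and> f z < y2" if z: "v < z" "z < u" for z
      proof -
        have "c < z" "z < d" using z uv by auto
        then have "f u < f z" "f z < f v" using mono[where x = z and y = u] mono[where x = v and y = z] z uv by auto
        then show ?thesis using uv by auto
      qed
      ultimately show "\<exists>u v. u < x2 \<and> x2 < v \<and> (\<forall>z. u < z \<and> z < v \<longrightarrow> y1 < f z \<and> f z < y2)" by blast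
    qed
    then show False using bad x2 by blast
  qed
qed

text \<open>Three functions at a time, because the regularity argument for finite sets follows a
  point together with its two neighbours in the set.\<close>

lemma continuity_point:
  assumes "drel1 UNIV (\<lambda>_ x y. y = f x)" "drel1 UNIV (\<lambda>_ x y. y = g x)" "drel1 UNIV (\<lambda>_ x y. y = h x)"
    and "dfn UNIV (\<lambda>e. S (e 0))" "infinite {x. S x}"
  obtains x p q where "p < x" "x < q" "\<And>z. p < z \<Longrightarrow> z < q \<Longrightarrow> S z" "cont_at f x" "cont_at g x" "cont_at h x"
proof -
  obtain p q where pq: "p < q" "\<And>z. p < z \<Longrightarrow> z < q \<Longrightarrow> S z" using assms(4,5) by (rule interval_in_infinite) blast
  let ?B = "{x. \<not> cont_at f x} \<union> {x. \<not> cont_at g x} \<union> {x. \<not> cont_at h x}"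
  have "finite ?B" using finite_discontinuities[OF assms(1)] finite_discontinuities[OF assms(2)] finite_discontinuities[OF assms(3)] by simp
  then have "infinite ({z. p < z \<and> z < q} - ?B)" using infinite_interval[OF pq(1)] by simp
  then obtain x where "x \<in> {z. p < z \<and> z < q} - ?B" by (metis (no_types, lifting) finite.emptyI equals0I)
  then show ?thesis using pq by (intro that[of p x q]) auto
qed

text \<open>A function defined on \<open>S\<close> is made total by the value \<open>x\<close>
  outside \<open>S\<close>, an arbitrary definable default.\<close>

lemma drel1_if:
  assumes g: "drel1 UNIV (\<lambda>_ x y. g x y)" and S: "dfn UNIV (\<lambda>e. S (e 0))" and f: "\<And>x y. S x \<Longrightarrow> y = f x \<longleftrightarrow> g x y"
  shows "drel1 UNIV (\<lambda>_ x y. y = (if S x then f x else x))"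
proof -
  have "dset1 {x. S x}" using S by (simp add: dfam1_def)
  note [dfn] = dset1D[OF this, unfolded mem_Collect_eq] dsrel1D[OF g]
  have "dfn UNIV (\<lambda>e. S (e 0) \<and> g (e 0) (e 1) \<or> \<not> S (e 0) \<and> e 1 = e 0)" by (rule dfn)+
  then show ?thesis unfolding drel1_def by (rule dfn_cong) (auto simp: f)
qed

lemma infinite_if_interval: "(u::'a) < v \<Longrightarrow> (\<And>z. u < z \<Longrightarrow> z < v \<Longrightarrow> Q z) \<Longrightarrow> infinite {z. Q z}"
  using infinite_interval[of u v] by (metis (mono_tags, lifting) infinite_super mem_Collect_eq subsetI)

text \<open>The ends of an interval in the fibre over \<open>x\<close> are definable functions of
  \<open>x\<close>, hence continuous at some \<open>x\<close>. An element strictly inside the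
  interval at that place stays inside for all nearby \<open>x\<close>. The cases differ in whether
  the interval is bounded below and above.\<close>

lemma infinite_fibre:
  assumes d: "drel1 UNIV (\<lambda>_. X)" and inf: "infinite {x. infinite {y. X x y}}"
  shows "\<exists>y. infinite {x. X x y}"
proof -
  note [dfn] = dsrel1D[OF d]
  define S where "S x \<longleftrightarrow> infinite {y. X x y}" for x
  define T where "T x \<longleftrightarrow> (\<exists>b. \<forall>y. y < b \<longrightarrow> X x y)" for x
  define W where "W x \<longleftrightarrow> (\<forall>y. X x y)" for x
  have dS: "dset1 {x. S x}" unfolding S_def by (rule dfn)+
  have dT: "dset1 {x. T x}" unfolding T_def by (rule dfn)+
  have dW: "dset1 {x. W x}" unfolding W_def by (rule dfn)+
  note [dfn] = dset1D[OF dS, unfolded mem_Collect_eq] dset1D[OF dT, unfolded mem_Collect_eq] dset1D[OF dW, unfolded mem_Collect_eq]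
  consider (1) "infinite {x. W x}" | (2) "infinite {x. T x \<and> \<not> W x}" | (3) "infinite {x. S x \<and> \<not> T x}"
  proof -
    have "{x. S x} \<subseteq> {x. W x} \<union> {x. T x \<and> \<not> W x} \<union> {x. S x \<and> \<not> T x}" by auto
    then have "infinite {x. W x} \<or> infinite {x. T x \<and> \<not> W x} \<or> infinite {x. S x \<and> \<not> T x}"
      using inf unfolding S_def[symmetric] by (meson finite_UnI finite_subset)
    then show ?thesis using that by blast
  qed
  then show ?thesis
  proof cases
    case 1
    obtain y :: 'a where True by blast
    have "{x. W x} \<subseteq> {x. X x y}" unfolding W_def by auto
    then show ?thesis using 1 infinite_super by blast
  next
    case 2
    define lub where "lub x s \<longleftrightarrow> (\<forall>b. (\<forall>y. y < b \<longrightarrow> X x y) \<longrightarrow> b \<le> s) \<and> (\<forall>v. (\<forall>b. (\<forall>y. y < b \<longrightarrow> X x y) \<longrightarrow> b \<le> v) \<longrightarrow> s \<le> v)" for x s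
    have dl: "drel1 UNIV (\<lambda>_ x s. lub x s)" unfolding lub_def by (rule dfn)+
    have dTW: "dfn UNIV (\<lambda>e. T (e 0) \<and> \<not> W (e 0))" by (rule dfn)+
    have ex: "\<exists>s. lub x s" if x: "T x \<and> \<not> W x" for x
    proof -
      have dd: "dfn UNIV (\<lambda>e. \<forall>y. y < e 0 \<longrightarrow> X x y)" by (rule dfn)+
      obtain b where b: "\<forall>y. y < b \<longrightarrow> X x y" using x unfolding T_def by blast
      obtain y0 where y0: "\<not> X x y0" using x unfolding W_def by blast
      have "\<forall>b. (\<forall>y. y < b \<longrightarrow> X x y) \<longrightarrow> b \<le> y0" using y0 not_le by blast
      from sup_ex[of "\<lambda>b. \<forall>y. y < b \<longrightarrow> X x y", OF dd b this] show ?thesis unfolding lub_def .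
    qed
    have uniq: "lub x s \<Longrightarrow> lub x s' \<Longrightarrow> s = s'" for x s s' unfolding lub_def by (meson antisym)
    define f where "f x = (if T x \<and> \<not> W x then (THE s. lub x s) else x)" for x
    have fx: "lub x (f x)" if "T x \<and> \<not> W x" for x
      using ex[OF that] uniq theI'[of "lub x"] that unfolding f_def by auto
    have df: "drel1 UNIV (\<lambda>_ x y. y = f x)"
      unfolding f_def
    proof (rule drel1_if[OF dl dTW])
      fix x y assume x: "T x \<and> \<not> W x"
      show "y = (THE s. lub x s) \<longleftrightarrow> lub x y" using fx[OF x] uniq x unfolding f_def by auto
    qed
    obtain x p q where x: "p < x" "x < q" "\<And>z. p < z \<Longrightarrow> z < q \<Longrightarrow> T z \<and> \<not> W z" "cont_at f x"
      by (rule continuity_point[where S = "\<lambda>x. T x \<and> \<not> W x", OF df df df dTW 2]) blast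
    obtain y y2 where y: "y < f x" "f x < y2" using lt_exa gt_exa by blast
    obtain u v where uv: "u < x" "x < v" "\<And>z. u < z \<Longrightarrow> z < v \<Longrightarrow> y < f z \<and> f z < y2"
      using cont_atD[OF x(4) y] by blast
    have "infinite {z. X z y}"
    proof (rule infinite_if_interval[of "max u p" "min v q"])
      fix z assume z: "max u p < z" "z < min v q"
      then have "lub z (f z)" "y < f z" using fx x(3) uv(3) by auto
      then obtain b where "\<forall>y. y < b \<longrightarrow> X z y" "y < b" unfolding lub_def by (meson not_le)
      then show "X z y" by blast
    qed (use uv x in auto)
    then show ?thesis by blast
  next
    case 3
    \<comment> \<open>The start of the first interval in the fibre, as the infimum of all left ends
      of intervals in it. Since \<open>T\<close> fails, the fibre avoids an initial segment of the
      line, and the infimum exists.\<close>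
    define glb where "glb x s \<longleftrightarrow> (\<forall>a. (\<exists>b. a < b \<and> (\<forall>y. a < y \<and> y < b \<longrightarrow> X x y)) \<longrightarrow> s \<le> a) \<and>
      (\<forall>v. (\<forall>a. (\<exists>b. a < b \<and> (\<forall>y. a < y \<and> y < b \<longrightarrow> X x y)) \<longrightarrow> v \<le> a) \<longrightarrow> v \<le> s)" for x s
    have dl: "drel1 UNIV (\<lambda>_ x s. glb x s)" unfolding glb_def by (rule dfn)+
    have dST: "dfn UNIV (\<lambda>e. S (e 0) \<and> \<not> T (e 0))" by (rule dfn)+
    have dX: "dfn UNIV (\<lambda>e. X x (e 0))" for x by (rule dfn)+
    have ex: "\<exists>s. glb x s" if x: "S x \<and> \<not> T x" for x
    proof -
      have dd: "dfn UNIV (\<lambda>e. \<exists>b. e 0 < b \<and> (\<forall>y. e 0 < y \<and> y < b \<longrightarrow> X x y))" by (rule dfn)+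
      obtain a0 b0 where a0: "a0 < b0" "\<And>y. a0 < y \<Longrightarrow> y < b0 \<Longrightarrow> X x y"
        using interval_in_infinite[OF dX, of x] x unfolding S_def by blast
      have "(\<exists>b. \<forall>y. y < b \<longrightarrow> X x y) \<or> (\<exists>b. \<forall>y. y < b \<longrightarrow> \<not> X x y)"
        using bgerm_set[of "{y. X x y}"] dX[of x] by (simp add: dfam1_def)
      then obtain w where w: "\<forall>y. y < w \<longrightarrow> \<not> X x y" using x unfolding T_def by blast
      have ex0: "\<exists>b. a0 < b \<and> (\<forall>y. a0 < y \<and> y < b \<longrightarrow> X x y)" using a0 by blast
      have "\<forall>a. (\<exists>b. a < b \<and> (\<forall>y. a < y \<and> y < b \<longrightarrow> X x y)) \<longrightarrow> w \<le> a"
      proof (intro allI impI, rule ccontr)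
        fix a assume "\<exists>b. a < b \<and> (\<forall>y. a < y \<and> y < b \<longrightarrow> X x y)" and "\<not> w \<le> a"
        then obtain b where b: "a < b" "\<forall>y. a < y \<and> y < b \<longrightarrow> X x y" "a < w" by auto
        then obtain y where "a < y" "y < min b w" using dense_ex[of a "min b w"] by auto
        then show False using b w by auto
      qed
      from inf_ex[of "\<lambda>a. \<exists>b. a < b \<and> (\<forall>y. a < y \<and> y < b \<longrightarrow> X x y)", OF dd ex0 this] show ?thesis unfolding glb_def .
    qed
    have uniq: "glb x s \<Longrightarrow> glb x s' \<Longrightarrow> s = s'" for x s s' unfolding glb_def by (meson antisym)
    define f where "f x = (if S x \<and> \<not> T x then (THE s. glb x s) else x)" for x
    have fx: "glb x (f x)" if "S x \<and> \<not> T x" for x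
      using ex[OF that] uniq theI'[of "glb x"] that unfolding f_def by auto
    have df: "drel1 UNIV (\<lambda>_ x y. y = f x)"
      unfolding f_def
    proof (rule drel1_if[OF dl dST])
      fix x y assume x: "S x \<and> \<not> T x"
      show "y = (THE s. glb x s) \<longleftrightarrow> glb x y" using fx[OF x] uniq x unfolding f_def by auto
    qed
    note [dfn] = dfn_fun_less[OF df]
    \<comment> \<open>The infimum is itself a left end: otherwise an interval right after
      \<open>f x\<close> would miss the fibre, although left ends come arbitrarily close to
      \<open>f x\<close>.\<close>
    have start: "\<exists>v. f x < v \<and> (\<forall>y. f x < y \<and> y < v \<longrightarrow> X x y)" if x: "S x \<and> \<not> T x" for x
    proof (rule ccontr)
      assume "\<not> ?thesis"
      then obtain v where v: "f x < v" "\<forall>y. f x < y \<and> y < v \<longrightarrow> \<not> X x y" using rgerm[OF dX, of "f x" x] by blast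
      have "\<not> (\<forall>a. (\<exists>b. a < b \<and> (\<forall>y. a < y \<and> y < b \<longrightarrow> X x y)) \<longrightarrow> v \<le> a)"
        using fx[OF x] v(1) unfolding glb_def by (meson not_le)
      then obtain a b where ab: "a < b" "\<forall>y. a < y \<and> y < b \<longrightarrow> X x y" "a < v" by (meson not_le)
      then obtain y where "a < y" "y < min b v" using dense_ex[of a "min b v"] by auto
      moreover have "f x \<le> a" using fx[OF x] ab unfolding glb_def by blast
      ultimately show False using ab v by auto
    qed
    define V where "V x \<longleftrightarrow> (\<forall>y. f x < y \<longrightarrow> X x y)" for x
    have dV: "dset1 {x. V x}" unfolding V_def by (rule dfn)+
    note [dfn] = dset1D[OF dV, unfolded mem_Collect_eq]
    have dA: "dfn UNIV (\<lambda>e. S (e 0) \<and> \<not> T (e 0) \<and> V (e 0))" by (rule dfn)+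
    have dB: "dfn UNIV (\<lambda>e. S (e 0) \<and> \<not> T (e 0) \<and> \<not> V (e 0))" by (rule dfn)+
    consider (a) "infinite {x. S x \<and> \<not> T x \<and> V x}" | (b) "infinite {x. S x \<and> \<not> T x \<and> \<not> V x}"
    proof -
      have "{x. S x \<and> \<not> T x} \<subseteq> {x. S x \<and> \<not> T x \<and> V x} \<union> {x. S x \<and> \<not> T x \<and> \<not> V x}" by auto
      then show ?thesis using 3 that by (meson finite_UnI finite_subset)
    qed
    then show ?thesis
    proof cases
      case a
      obtain x p q where x: "p < x" "x < q" "\<And>z. p < z \<Longrightarrow> z < q \<Longrightarrow> S z \<and> \<not> T z \<and> V z" "cont_at f x"
        by (rule continuity_point[where S = "\<lambda>x. S x \<and> \<not> T x \<and> V x", OF df df df dA a]) blast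
      obtain y y2 where y: "y2 < f x" "f x < y" using lt_exa gt_exa by blast
      obtain u v where uv: "u < x" "x < v" "\<And>z. u < z \<Longrightarrow> z < v \<Longrightarrow> y2 < f z \<and> f z < y"
        using cont_atD[OF x(4) y] by blast
      have "infinite {z. X z y}"
      proof (rule infinite_if_interval[of "max u p" "min v q"])
        fix z assume z: "max u p < z" "z < min v q"
        then have "V z" "f z < y" using x(3) uv(3) by auto
        then show "X z y" unfolding V_def by blast
      qed (use uv x in auto)
      then show ?thesis by blast
    next
      case b
      define lub where "lub x s \<longleftrightarrow> (\<forall>b. (\<forall>y. f x < y \<and> y < b \<longrightarrow> X x y) \<longrightarrow> b \<le> s) \<and>
        (\<forall>v. (\<forall>b. (\<forall>y. f x < y \<and> y < b \<longrightarrow> X x y) \<longrightarrow> b \<le> v) \<longrightarrow> s \<le> v)" for x s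
      have dl: "drel1 UNIV (\<lambda>_ x s. lub x s)" unfolding lub_def by (rule dfn)+
      have ex: "\<exists>s. lub x s" if x: "S x \<and> \<not> T x \<and> \<not> V x" for x
      proof -
        have dd: "dfn UNIV (\<lambda>e. \<forall>y. f x < y \<and> y < e 0 \<longrightarrow> X x y)" by (rule dfn)+
        obtain b where b: "\<forall>y. f x < y \<and> y < b \<longrightarrow> X x y" using start x by blast
        obtain y0 where y0: "f x < y0" "\<not> X x y0" using x unfolding V_def by blast
        have "\<forall>b. (\<forall>y. f x < y \<and> y < b \<longrightarrow> X x y) \<longrightarrow> b \<le> y0" using y0 by (meson not_le)
        from sup_ex[of "\<lambda>b. \<forall>y. f x < y \<and> y < b \<longrightarrow> X x y", OF dd b this] show ?thesis unfolding lub_def .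
      qed
      have uniq: "lub x s \<Longrightarrow> lub x s' \<Longrightarrow> s = s'" for x s s' unfolding lub_def by (meson antisym)
      define g where "g x = (if S x \<and> \<not> T x \<and> \<not> V x then (THE s. lub x s) else x)" for x
      have gx: "lub x (g x)" if "S x \<and> \<not> T x \<and> \<not> V x" for x
        using ex[OF that] uniq theI'[of "lub x"] that unfolding g_def by auto
      have dg: "drel1 UNIV (\<lambda>_ x y. y = g x)"
        unfolding g_def
      proof (rule drel1_if[OF dl dB])
        fix x y assume x: "S x \<and> \<not> T x \<and> \<not> V x"
        show "y = (THE s. lub x s) \<longleftrightarrow> lub x y" using gx[OF x] uniq x unfolding g_def by auto
      qed
      obtain x p q where x: "p < x" "x < q" "\<And>z. p < z \<Longrightarrow> z < q \<Longrightarrow> S z \<and> \<not> T z \<and> \<not> V z" "cont_at f x" "cont_at g x"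
        by (rule continuity_point[where S = "\<lambda>x. S x \<and> \<not> T x \<and> \<not> V x", OF df dg df dB b]) blast
      have "f x < g x"
        using start[of x] gx[of x] x(3)[OF x(1,2)] unfolding lub_def by (meson less_le_trans)
      then obtain y where y: "f x < y" "y < g x" using dense_ex by blast
      obtain y1 y2 where y12: "y1 < f x" "g x < y2" using lt_exa gt_exa by blast
      obtain u v where uv: "u < x" "x < v" "\<And>z. u < z \<Longrightarrow> z < v \<Longrightarrow> y1 < f z \<and> f z < y"
        using cont_atD[OF x(4) y12(1) y(1)] by blast
      obtain u' v' where uv': "u' < x" "x < v'" "\<And>z. u' < z \<Longrightarrow> z < v' \<Longrightarrow> y < g z \<and> g z < y2"
        using cont_atD[OF x(5) y(2) y12(2)] by blast
      have "infinite {z. X z y}"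
      proof (rule infinite_if_interval[of "max (max u u') p" "min (min v v') q"])
        fix z assume z: "max (max u u') p < z" "z < min (min v v') q"
        then have "f z < y" "y < g z" "lub z (g z)" using x(3) uv(3) uv'(3) gx by auto
        then obtain b where "\<forall>y. f z < y \<and> y < b \<longrightarrow> X z y" "y < b" unfolding lub_def by (meson not_le)
        then show "X z y" using \<open>f z < y\<close> by blast
      qed (use uv uv' x in auto)
      then show ?thesis by blast
    qed
  qed
qed

text \<open>If only finitely many \<open>y\<close> had an infinite fibre, they could be removed. All
  fibres over \<open>y\<close> would then be finite while those over \<open>x\<close> stay infinite,
  against \<open>infinite_fibre\<close>. This is the exchange of two coordinates on which the
  symmetry of dimension rests.\<close>

lemma infinite_fibres_swap:
  assumes d: "drel1 UNIV (\<lambda>_. X)" and inf: "infinite {x. infinite {y. X x y}}"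
  shows "infinite {y. infinite {x. X x y}}"
proof
  note [dfn] = dsrel1D[OF d]
  assume fin: "finite {y. infinite {x. X x y}}"
  define Z where "Z x y \<longleftrightarrow> X x y \<and> finite {x. X x y}" for x y
  have dZ: "drel1 UNIV (\<lambda>_. Z)" unfolding Z_def by (rule dfn)+
  have "infinite {y. Z x y}" if "infinite {y. X x y}" for x
  proof -
    have "{y. X x y} \<subseteq> {y. Z x y} \<union> {y. infinite {x. X x y}}" unfolding Z_def by auto
    then show ?thesis using that fin by (meson finite_UnI finite_subset)
  qed
  then have "{x. infinite {y. X x y}} \<subseteq> {x. infinite {y. Z x y}}" by auto
  then have "infinite {x. infinite {y. Z x y}}" using inf infinite_super by blast
  from infinite_fibre[OF dZ this] obtain y where y: "infinite {x. Z x y}" by blast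
  then obtain x where "Z x y" by (metis (mono_tags) Collect_empty_eq finite.emptyI)
  then have "finite {x. Z x y}" unfolding Z_def by auto
  then show False using y by blast
qed

end

section \<open>Dimension\<close>

text \<open>\<open>dge k d X\<close> expresses that the part of \<open>X\<close> consisting of lists of length \<open>k\<close> has dimension at least
  \<open>d\<close>; it is false for the empty set even if \<open>d = 0\<close>. A coordinate raises the dimension exactly over those
  points of the base whose fibre is infinite.\<close>

primrec dge :: "nat \<Rightarrow> nat \<Rightarrow> 'b list set \<Rightarrow> bool" where
  "dge 0 d X \<longleftrightarrow> d = 0 \<and> [] \<in> X"
| "dge (Suc k) d X \<longleftrightarrow> dge k d {u. \<exists>x. x # u \<in> X} \<or> d > 0 \<and> dge k (d - 1) {u. infinite {x. x # u \<in> X}}"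

lemma dge_mono: "dge k d X \<Longrightarrow> (\<And>u. length u = k \<Longrightarrow> u \<in> X \<Longrightarrow> u \<in> Y) \<Longrightarrow> dge k d Y"
proof (induction k arbitrary: d X Y)
  case (Suc k)
  have inf: "infinite {x. x # u \<in> Y}" if "infinite {x. x # u \<in> X}" "length u = k" for u
  proof -
    have "{x. x # u \<in> X} \<subseteq> {x. x # u \<in> Y}" using Suc.prems(2)[of "_ # u"] that by auto
    then show ?thesis using that infinite_super by blast
  qed
  from Suc.prems(1) show ?case unfolding dge.simps
  proof
    assume "dge k d {u. \<exists>x. x # u \<in> X}"
    then have "dge k d {u. \<exists>x. x # u \<in> Y}"
      by (rule Suc.IH) (use Suc.prems(2) in force)
    then show "dge k d {u. \<exists>x. x # u \<in> Y} \<or> 0 < d \<and> dge k (d - 1) {u. infinite {x. x # u \<in> Y}}" ..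
  next
    assume *: "0 < d \<and> dge k (d - 1) {u. infinite {x. x # u \<in> X}}"
    then have "dge k (d - 1) {u. infinite {x. x # u \<in> X}}" ..
    then have "dge k (d - 1) {u. infinite {x. x # u \<in> Y}}"
      by (rule Suc.IH) (use inf in blast)
    then show "dge k d {u. \<exists>x. x # u \<in> Y} \<or> 0 < d \<and> dge k (d - 1) {u. infinite {x. x # u \<in> Y}}" using * by blast
  qed
qed simp

lemma dge_cong: "(\<And>u. length u = k \<Longrightarrow> u \<in> X \<longleftrightarrow> u \<in> Y) \<Longrightarrow> dge k d X \<longleftrightarrow> dge k d Y"
  using dge_mono[of k d X Y] dge_mono[of k d Y X] by blast

lemma dge_le: "dge k d X \<Longrightarrow> d \<le> k"
  by (induction k arbitrary: d X) (auto, fastforce+)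

lemma dge_nonempty: "dge k d X \<Longrightarrow> \<exists>x. length x = k \<and> x \<in> X"
proof (induction k arbitrary: d X)
  case (Suc k)
  from Suc.prems have "\<exists>u. length u = k \<and> (\<exists>x. x # u \<in> X)"
    unfolding dge.simps
  proof
    assume "dge k d {u. \<exists>x. x # u \<in> X}"
    from Suc.IH[OF this] show ?thesis by simp
  next
    assume "0 < d \<and> dge k (d - 1) {u. infinite {x. x # u \<in> X}}"
    then obtain u where u: "length u = k" "infinite {x. x # u \<in> X}" using Suc.IH by blast
    then have "{x. x # u \<in> X} \<noteq> {}" by (intro notI) simp
    then show ?thesis using u(1) by blast
  qed
  then obtain u x where "length u = k" "x # u \<in> X" by blast
  then show ?case by (intro exI[of _ "x # u"]) simp
qed auto

lemma dge_zero: "dge k 0 X \<longleftrightarrow> (\<exists>x. length x = k \<and> x \<in> X)"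
proof
  assume "\<exists>x. length x = k \<and> x \<in> X"
  then show "dge k 0 X"
  proof (induction k arbitrary: X)
    case (Suc k)
    then obtain x u where "length u = k" "x # u \<in> X" by (auto simp: length_Suc_conv)
    then have "dge k 0 {u. \<exists>x. x # u \<in> X}" by (intro Suc.IH) auto
    then show ?case by simp
  qed auto
qed (rule dge_nonempty)

lemma dge_empty[simp]: "\<not> dge k d {}"
  using dge_nonempty[of k d "{}"] by blast

lemma dge_Suc_imp: "dge k (Suc d) X \<Longrightarrow> dge k d X"
proof (induction k arbitrary: d X)
  case (Suc k)
  then consider "dge k (Suc d) {u. \<exists>x. x # u \<in> X}" | "dge k d {u. infinite {x. x # u \<in> X}}" by auto
  then show ?case
  proof cases
    case 1
    then show ?thesis using Suc.IH by auto
  next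
    case 2
    have "dge k d {u. \<exists>x. x # u \<in> X}"
    proof (rule dge_mono[OF 2])
      fix u assume "u \<in> {u. infinite {x. x # u \<in> X}}"
      then have "{x. x # u \<in> X} \<noteq> {}" by (intro notI) simp
      then show "u \<in> {u. \<exists>x. x # u \<in> X}" by blast
    qed
    then show ?thesis by simp
  qed
qed simp

lemma dge_antimono: "dge k d X \<Longrightarrow> d' \<le> d \<Longrightarrow> dge k d' X"
  by (induction d) (auto simp: le_Suc_eq dest: dge_Suc_imp)

lemma dge_Un: "dge k d (X \<union> Y) \<longleftrightarrow> dge k d X \<or> dge k d Y"
proof
  show "dge k d (X \<union> Y) \<Longrightarrow> dge k d X \<or> dge k d Y"
  proof (induction k arbitrary: d X Y)
    case (Suc k)
    have 1: "{u. \<exists>x. x # u \<in> X \<union> Y} = {u. \<exists>x. x # u \<in> X} \<union> {u. \<exists>x. x # u \<in> Y}" by blast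
    have "{x. x # u \<in> X \<union> Y} = {x. x # u \<in> X} \<union> {x. x # u \<in> Y}" for u by blast
    then have 2: "{u. infinite {x. x # u \<in> X \<union> Y}} = {u. infinite {x. x # u \<in> X}} \<union> {u. infinite {x. x # u \<in> Y}}" by auto
    show ?case using Suc.prems unfolding dge.simps 1 2 using Suc.IH by blast
  qed auto
qed (auto elim: dge_mono)

lemma dge_UN: "finite I \<Longrightarrow> dge k d (\<Union>i\<in>I. X i) \<Longrightarrow> \<exists>i\<in>I. dge k d (X i)"
  by (induction I rule: finite_induct) (auto simp: dge_Un)

text \<open>Valid for arbitrary sets: a set of lists is finite iff its projection and all its fibres
  are.\<close>

lemma dge_one: "dge k 1 X \<longleftrightarrow> infinite {x \<in> X. length x = k}"
proof (induction k arbitrary: X)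
  case 0
  have "{x \<in> X. length x = 0} \<subseteq> {[]}" by auto
  then show ?case by (metis dge.simps(1) finite.emptyI finite_insert finite_subset zero_neq_one)
next
  case (Suc k)
  have eq: "{x \<in> X. length x = Suc k} = (\<lambda>(u, x). x # u) ` (SIGMA u:{u. length u = k \<and> (\<exists>x. x # u \<in> X)}. {x. x # u \<in> X})"
    by (auto simp: image_iff length_Suc_conv)
  have inj: "inj_on (\<lambda>(u, x). x # u) A" for A :: "('b list \<times> 'b) set" by (auto simp: inj_on_def)
  have "{u. length u = k \<and> (\<exists>x. x # u \<in> X)} = {u \<in> {u. \<exists>x. x # u \<in> X}. length u = k}" by auto
  then have fin: "finite {u. length u = k \<and> (\<exists>x. x # u \<in> X)} \<longleftrightarrow> \<not> dge k 1 {u. \<exists>x. x # u \<in> X}"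
    using Suc.IH[of "{u. \<exists>x. x # u \<in> X}"] by simp
  show ?case unfolding eq finite_image_iff[OF inj]
  proof
    assume "dge (Suc k) 1 X"
    then consider "dge k 1 {u. \<exists>x. x # u \<in> X}" | u where "length u = k" "infinite {x. x # u \<in> X}"
      by (auto simp: dge_zero)
    then show "infinite (SIGMA u:{u. length u = k \<and> (\<exists>x. x # u \<in> X)}. {x. x # u \<in> X})"
    proof cases
      case 1
      have "fst ` (SIGMA u:{u. length u = k \<and> (\<exists>x. x # u \<in> X)}. {x. x # u \<in> X}) = {u. length u = k \<and> (\<exists>x. x # u \<in> X)}"
        by (force simp: image_iff)
      then have "infinite (fst ` (SIGMA u:{u. length u = k \<and> (\<exists>x. x # u \<in> X)}. {x. x # u \<in> X}))"
        using 1 fin by simp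
      then show ?thesis using finite_imageI by blast
    next
      case 2
      have "Pair u ` {x. x # u \<in> X} \<subseteq> (SIGMA u:{u. length u = k \<and> (\<exists>x. x # u \<in> X)}. {x. x # u \<in> X})" using 2 by auto
      moreover have "infinite (Pair u ` {x. x # u \<in> X})" using 2 by (simp add: finite_image_iff inj_on_def)
      ultimately show ?thesis using infinite_super by blast
    qed
  next
    assume *: "infinite (SIGMA u:{u. length u = k \<and> (\<exists>x. x # u \<in> X)}. {x. x # u \<in> X})"
    show "dge (Suc k) 1 X"
    proof (rule ccontr)
      assume n: "\<not> dge (Suc k) 1 X"
      then have "finite {u. length u = k \<and> (\<exists>x. x # u \<in> X)}" using fin by auto
      moreover have "finite {x. x # u \<in> X}" if "length u = k" for u using n that by (auto simp: dge_zero)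
      ultimately have "finite (SIGMA u:{u. length u = k \<and> (\<exists>x. x # u \<in> X)}. {x. x # u \<in> X})"
        by (intro finite_SigmaI) simp_all
      then show False using * by blast
    qed
  qed
qed

text \<open>Additivity in the given order of coordinates, the first \<open>l\<close> being the fibre
  over the last \<open>m\<close>. It merely unfolds the recursion of \<open>dge\<close>; tameness
  enters when the order of the coordinates is changed.\<close>

lemma dge_fibre: "dge (l + m) d X \<longleftrightarrow> (\<exists>j\<le>d. dge m (d - j) {u. dge l j {v. v @ u \<in> X}})"
proof (induction l arbitrary: d X)
  case 0
  have "dge m (d - j) {u. dge 0 j {v. v @ u \<in> X}} \<longleftrightarrow> j = 0 \<and> dge m d X" for j by (cases "j = 0") auto
  then show ?case by auto
next
  case (Suc l)
  have un: "{u. dge (Suc l) j {v. v @ u \<in> X}} = {u. dge l j {v. \<exists>x. x # v @ u \<in> X}} \<union>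
      {u. j > 0 \<and> dge l (j - 1) {v. infinite {x. x # v @ u \<in> X}}}" for j by auto
  have "dge (Suc l + m) d X \<longleftrightarrow> (\<exists>j\<le>d. dge m (d - j) {u. dge l j {v. \<exists>x. x # v @ u \<in> X}}) \<or>
     d > 0 \<and> (\<exists>j\<le>d - 1. dge m (d - 1 - j) {u. dge l j {v. infinite {x. x # v @ u \<in> X}}})"
    by (simp add: Suc.IH)
  also have "\<dots> \<longleftrightarrow> (\<exists>j\<le>d. dge m (d - j) {u. dge l j {v. \<exists>x. x # v @ u \<in> X}}) \<or>
     (\<exists>j\<le>d. dge m (d - j) {u. j > 0 \<and> dge l (j - 1) {v. infinite {x. x # v @ u \<in> X}}})" (is "?A \<or> ?B \<longleftrightarrow> ?A \<or> ?C")
  proof -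
    have "?B \<longleftrightarrow> ?C"
    proof
      assume ?B
      then obtain j where "d > 0" "j \<le> d - 1" "dge m (d - 1 - j) {u. dge l j {v. infinite {x. x # v @ u \<in> X}}}" by blast
      then show ?C by (intro exI[of _ "Suc j"]) auto
    next
      assume ?C
      then obtain j where j: "j \<le> d" "dge m (d - j) {u. j > 0 \<and> dge l (j - 1) {v. infinite {x. x # v @ u \<in> X}}}" by blast
      then have "j > 0" by (cases j) auto
      then show ?B using j by (intro conjI exI[of _ "j - 1"]) auto
    qed
    then show ?thesis by blast
  qed
  also have "\<dots> \<longleftrightarrow> (\<exists>j\<le>d. dge m (d - j) {u. dge (Suc l) j {v. v @ u \<in> X}})"
    unfolding un dge_Un by blast
  finally show ?case .
qed

lemma dge_fibreI: "dge m i {u. dge l j {v. v @ u \<in> X}} \<Longrightarrow> dge (l + m) (j + i) X"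
  unfolding dge_fibre by (intro exI[of _ j]) auto

context omin
begin

lemma dfn_dge[dfn]:
  assumes "dfam A k X" shows "dfn A (\<lambda>e. dge k d (X e))"
  using assms
proof (induction k arbitrary: d X)
  case 0
  have "dfn A (\<lambda>e. [] \<in> X e)" using 0 by (simp add: dfam_def)
  then have "dfn A (\<lambda>e. d = 0 \<and> [] \<in> X e)" by - (rule dfn | assumption)+
  then show ?case by simp
next
  case (Suc k)
  note [dfn] = dfamD[OF Suc.prems]
  have 1: "dfam A k (\<lambda>e. {u. \<exists>x. x # u \<in> X e})" by (rule dfn)+
  have 2: "dfam A k (\<lambda>e. {u. infinite {x. x # u \<in> X e}})" by (rule dfn)+
  show ?case unfolding dge.simps by (rule dfn Suc.IH 1 2)+
qed

section \<open>Invariance of dimension under permutations of the coordinates\<close>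

definition swap2 :: "'b list set \<Rightarrow> 'b list set" where
  "swap2 X = {w. hd (tl w) # hd w # tl (tl w) \<in> X}"

definition rot :: "'b list set \<Rightarrow> 'b list set" where
  "rot X = {w. last w # butlast w \<in> X}"

lemma mem_swap2[simp]: "x # y # u \<in> swap2 X \<longleftrightarrow> y # x # u \<in> X"
  by (simp add: swap2_def)

lemma dset_swap2:
  assumes "dset (Suc (Suc k)) X" shows "dset (Suc (Suc k)) (swap2 X)"
proof -
  note [dfn] = dsetD[OF assms]
  show ?thesis unfolding swap2_def by (rule dfn)+
qed

lemma dset_rot:
  assumes "dset (Suc k) X" shows "dset (Suc k) (rot X)"
proof -
  note [dfn] = dsetD[OF assms]
  show ?thesis unfolding rot_def by (rule dfn)+
qed

text \<open>Arranged so that the first two disjuncts are symmetric in the two leading coordinates,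
  the second because a set of pairs is infinite iff its projection or one of its fibres is. Only the
  last disjunct depends on their order.\<close>

lemma dge_Suc_Suc:
  fixes X :: "'b list set"
  shows "dge (Suc (Suc k)) d X \<longleftrightarrow> dge k d {u. \<exists>x y. x # y # u \<in> X} \<or>
    d > 0 \<and> dge k (d - 1) {u. infinite {(x, y). x # y # u \<in> X}} \<or>
    d > 1 \<and> dge k (d - 2) {u. infinite {y. infinite {x. x # y # u \<in> X}}}"
proof -
  have pairs: "infinite {(x, y). Q x y} \<longleftrightarrow> infinite {y. \<exists>x. Q x y} \<or> (\<exists>y. infinite {x. Q x y})" for Q :: "'b \<Rightarrow> 'b \<Rightarrow> bool"
  proof
    assume *: "infinite {(x, y). Q x y}"
    show "infinite {y. \<exists>x. Q x y} \<or> (\<exists>y. infinite {x. Q x y})"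
    proof (rule ccontr)
      assume n: "\<not> ?thesis"
      have "{(x, y). Q x y} = prod.swap ` (SIGMA y:{y. \<exists>x. Q x y}. {x. Q x y})" by (auto simp: image_iff)
      then show False using * n by simp
    qed
  next
    assume "infinite {y. \<exists>x. Q x y} \<or> (\<exists>y. infinite {x. Q x y})"
    then show "infinite {(x, y). Q x y}"
    proof
      assume i: "infinite {y. \<exists>x. Q x y}"
      have "snd ` {(x, y). Q x y} = {y. \<exists>x. Q x y}" by (force simp: image_iff)
      then have "infinite (snd ` {(x, y). Q x y})" using i by simp
      then show ?thesis using finite_imageI by blast
    next
      assume "\<exists>y. infinite {x. Q x y}"
      then obtain y where i: "infinite {x. Q x y}" by blast
      have "{x. Q x y} \<subseteq> fst ` {(x, y). Q x y}" by (force simp: image_iff)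
      then show ?thesis using i by (meson finite_imageI finite_subset)
    qed
  qed
  have un: "{u. infinite {(x, y). x # y # u \<in> X}} = {u. infinite {y. \<exists>x. x # y # u \<in> X}} \<union> {u. \<exists>y. infinite {x. x # y # u \<in> X}}"
    unfolding pairs by blast
  have ex: "{u. \<exists>x y. x # y # u \<in> X} = {u. \<exists>y x. x # y # u \<in> X}" by blast
  have d2: "d - 1 - 1 = d - 2" "d - 1 > 0 \<longleftrightarrow> d > 1" by auto
  show ?thesis unfolding dge.simps un dge_Un ex mem_Collect_eq d2 by auto
qed

lemma dge_swap2:
  assumes X: "dset (Suc (Suc k)) X" shows "dge (Suc (Suc k)) d (swap2 X) \<longleftrightarrow> dge (Suc (Suc k)) d X"
proof -
  have 1: "{u. \<exists>x y. x # y # u \<in> swap2 X} = {u. \<exists>x y. x # y # u \<in> X}" by auto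
  have "{(x, y). x # y # u \<in> swap2 X} = prod.swap ` {(x, y). x # y # u \<in> X}" for u by (auto simp: image_iff)
  then have 2: "infinite {(x, y). x # y # u \<in> swap2 X} \<longleftrightarrow> infinite {(x, y). x # y # u \<in> X}" for u
    by (simp add: finite_image_iff)
  have 3: "infinite {y. infinite {x. x # y # u \<in> Y}}" if Y: "dset (Suc (Suc k)) Y" and u: "length u = k"
      and i: "infinite {y. infinite {x. x # y # u \<in> swap2 Y}}" for u Y
  proof -
    note [dfn] = dsetD[OF Y]
    have "drel1 UNIV (\<lambda>_ x y. y # x # u \<in> swap2 Y)" unfolding mem_swap2 using u by - (rule dfn | simp)+
    from infinite_fibres_swap[OF this] i show ?thesis by simp
  qed
  have inv: "swap2 (swap2 Y) \<inter> {w. length w \<ge> 2} = Y \<inter> {w. length w \<ge> 2}" for Y :: "'a list set"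
    by (auto simp: swap2_def Suc_le_length_iff numeral_2_eq_2)
  have 4: "infinite {y. infinite {x. x # y # u \<in> swap2 X}} \<longleftrightarrow> infinite {y. infinite {x. x # y # u \<in> X}}" if "length u = k" for u
    using 3[OF X that] 3[OF dset_swap2[OF X] that] by auto
  have "dge k d' {u. infinite {y. infinite {x. x # y # u \<in> swap2 X}}} \<longleftrightarrow> dge k d' {u. infinite {y. infinite {x. x # y # u \<in> X}}}" for d'
    by (rule dge_cong) (use 4 in auto)
  then show ?thesis unfolding dge_Suc_Suc 1 2 by simp
qed

text \<open>A rotation is a transposition of the first two coordinates combined with a rotation of
  the tail, to which the induction hypothesis applies.\<close>

lemma dge_rot: "dset (Suc k) X \<Longrightarrow> dge (Suc k) d (rot X) \<longleftrightarrow> dge (Suc k) d X"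
proof (induction k arbitrary: d X)
  case 0
  show ?case by (rule dge_cong) (auto simp: rot_def length_Suc_conv)
next
  case (Suc k)
  note [dfn] = dsetD[OF dset_swap2[OF Suc.prems]]
  have 1: "dset (Suc k) {w. \<exists>y. y # w \<in> swap2 X}" by (rule dfn)+
  have 2: "dset (Suc k) {w. infinite {y. y # w \<in> swap2 X}}" by (rule dfn)+
  have eq: "y # w \<in> rot X \<longleftrightarrow> y # last w # butlast w \<in> swap2 X" if "length w = Suc k" for y w
    using that by (auto simp: rot_def)
  have 3: "dge (Suc k) d' {w. \<exists>y. y # w \<in> rot X} \<longleftrightarrow> dge (Suc k) d' (rot {w. \<exists>y. y # w \<in> swap2 X})" for d'
    by (rule dge_cong) (simp add: eq, simp add: rot_def)
  have 4: "dge (Suc k) d' {w. infinite {y. y # w \<in> rot X}} \<longleftrightarrow> dge (Suc k) d' (rot {w. infinite {y. y # w \<in> swap2 X}})" for d'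
    by (rule dge_cong) (simp add: eq, simp add: rot_def)
  have "dge (Suc (Suc k)) d (rot X) \<longleftrightarrow> dge (Suc (Suc k)) d (swap2 X)"
    by (subst (1 2) dge.simps(2)) (simp only: 3 4 Suc.IH[OF 1] Suc.IH[OF 2])
  then show ?case using dge_swap2[OF Suc.prems] by blast
qed

text \<open>Rotating \<open>m\<close> times exchanges the two blocks.\<close>

lemma dge_block_swap:
  "dset (m + l) X \<Longrightarrow> dge (l + m) d {w. drop l w @ take l w \<in> X} \<longleftrightarrow> dge (m + l) d X"
proof (induction m arbitrary: l X)
  case 0
  show ?case unfolding add_0_left add_0_right by (rule dge_cong) auto
next
  case (Suc m)
  have X: "dset (Suc (m + l)) X" using Suc.prems by simp
  have "dge (Suc (m + l)) d X \<longleftrightarrow> dge (m + Suc l) d (rot X)" using dge_rot[OF X] by simp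
  also have "\<dots> \<longleftrightarrow> dge (Suc l + m) d {w. drop (Suc l) w @ take (Suc l) w \<in> rot X}"
    by (rule Suc.IH[symmetric]) (use dset_rot[OF X] in simp)
  also have "\<dots> \<longleftrightarrow> dge (l + Suc m) d {w. drop l w @ take l w \<in> X}"
    unfolding add_Suc_shift
  proof (rule dge_cong)
    fix w :: "'a list" assume "length w = l + Suc m"
    then have "take (Suc l) w = take l w @ [w ! l]" "drop l w = w ! l # drop (Suc l) w"
      by (simp_all add: take_Suc_conv_app_nth Cons_nth_drop_Suc)
    then show "w \<in> {w. drop (Suc l) w @ take (Suc l) w \<in> rot X} \<longleftrightarrow> w \<in> {w. drop l w @ take l w \<in> X}"
      by (simp add: rot_def butlast_append)
  qed
  finally show ?case by simp
qed

text \<open>Compute the dimension of \<open>G\<close> in both orders of its blocks. Over the second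
  block it is at least \<open>i + j\<close> by assumption; over the first block the fibres have at
  most one point and contribute 0. It will bound the number of classes of an equivalence and the
  dimension of sets with a definable injection.\<close>

lemma dge_functional_relation:
  assumes G: "dset (k + l) G"
    and fn: "\<And>x t t'. length x = k \<Longrightarrow> length t = l \<Longrightarrow> length t' = l \<Longrightarrow> x @ t \<in> G \<Longrightarrow> x @ t' \<in> G \<Longrightarrow> t = t'"
    and big: "dge l j {t. dge k i {x. x @ t \<in> G}}"
  shows "dge k (i + j) {x. \<exists>t. length t = l \<and> x @ t \<in> G}"
proof -
  have "dge (k + l) (i + j) G" by (rule dge_fibreI[OF big])
  then have "dge (l + k) (i + j) {w. drop l w @ take l w \<in> G}" using dge_block_swap[OF G] by blast
  then obtain j' where j': "j' \<le> i + j" "dge k (i + j - j') {u. dge l j' {v. v @ u \<in> {w. drop l w @ take l w \<in> G}}}"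
    unfolding dge_fibre by blast
  have le1: "finite {v. length v = l \<and> x @ v \<in> G}" if "length x = k" for x
  proof (cases "\<exists>t. length t = l \<and> x @ t \<in> G")
    case True
    then obtain t where "length t = l" "x @ t \<in> G" by blast
    then have "{v. length v = l \<and> x @ v \<in> G} \<subseteq> {t}" using fn[OF that] by auto
    then show ?thesis using finite_subset by blast
  next
    case False
    then have "{v. length v = l \<and> x @ v \<in> G} \<subseteq> {}" by blast
    then show ?thesis by (rule finite_subset) simp
  qed
  have eq: "dge l j' {v. v @ u \<in> {w. drop l w @ take l w \<in> G}} \<longleftrightarrow> dge l j' {v. length v = l \<and> u @ v \<in> G}" for u
    by (rule dge_cong) auto
  have "j' = 0"
  proof (rule ccontr)
    assume "j' \<noteq> 0"
    obtain u where u: "length u = k" "dge l j' {v. length v = l \<and> u @ v \<in> G}"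
      using dge_nonempty[OF j'(2)] unfolding eq by blast
    then have "dge l 1 {v. length v = l \<and> u @ v \<in> G}" using \<open>j' \<noteq> 0\<close> by (intro dge_antimono[OF u(2)]) auto
    then show False using le1[OF u(1)] unfolding dge_one by (metis (no_types, lifting) Collect_cong mem_Collect_eq)
  qed
  then show ?thesis using j'(2) unfolding eq by (simp add: dge_zero)
qed

text \<open>The box is built one side at a time. Every infinite fibre contains an interval, so the
  triples of two ends \<open>y < z\<close> and a base point whose fibre contains the interval form a
  set of dimension \<open>2 + d\<close>. Hence one fixed interval works for base points of full
  dimension \<open>d\<close>.\<close>

lemma has_interior_if_full_dim: "dset d Y \<Longrightarrow> dge d d Y \<Longrightarrow> has_interior d Y"
proof (induction d arbitrary: Y)
  case 0
  then show ?case by (simp add: has_interior_def tuples_def)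
next
  case (Suc d)
  note [dfn] = dsetD[OF Suc.prems(1)]
  have U: "dge d d {w. infinite {x. x # w \<in> Y}}" using Suc.prems(2) dge_le[of d "Suc d"] by auto
  define Z where "Z = {z. z ! 0 < z ! 1 \<and> (\<forall>x. z ! 0 < x \<and> x < z ! 1 \<longrightarrow> x # drop 2 z \<in> Y)}"
  have dZ: "dset (2 + d) Z" unfolding Z_def
    by (rule dfn elt_nth list_drop | simp)+
  have "dge 2 2 {v. v @ w \<in> Z}" if i: "infinite {x. x # w \<in> Y}" and w: "length w = d" for w
  proof -
    have dd: "dfn UNIV (\<lambda>e. e 0 # w \<in> Y)" using w by - (rule dfn | simp)+
    obtain a b where ab: "a < b" "\<And>x. a < x \<Longrightarrow> x < b \<Longrightarrow> x # w \<in> Y"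
      by (rule interval_in_infinite[where Q = "\<lambda>x. x # w \<in> Y", OF dd i]) blast
    have "infinite {y. infinite {x. x # y # [] \<in> {v. v @ w \<in> Z}}}"
    proof (rule infinite_if_interval[OF ab(1)])
      fix y assume y: "a < y" "y < b"
      show "infinite {x. x # y # [] \<in> {v. v @ w \<in> Z}}"
      proof (rule infinite_if_interval[OF y(1)])
        fix x assume "a < x" "x < y"
        moreover from this have "\<forall>z. x < z \<and> z < y \<longrightarrow> z # w \<in> Y" using ab(2) y(2) by (meson less_trans)
        ultimately show "x # y # [] \<in> {v. v @ w \<in> Z}" by (simp add: Z_def)
      qed
    qed
    then show ?thesis unfolding numeral_2_eq_2 dge_Suc_Suc by simp
  qed
  then have "dge d d {w. dge 2 2 {v. v @ w \<in> Z}}" by (intro dge_mono[OF U]) auto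
  then have "dge (2 + d) (2 + d) Z" by (rule dge_fibreI)
  then have "dge (d + 2) (2 + d) {z. drop d z @ take d z \<in> Z}" using dge_block_swap[OF dZ] by blast
  then obtain j where j: "j \<le> 2 + d" "dge 2 (2 + d - j) {yz. dge d j {w. w @ yz \<in> {z. drop d z @ take d z \<in> Z}}}"
    unfolding dge_fibre by blast
  have "2 + d - j \<le> 2" using dge_le[OF j(2)] .
  obtain yz where yz: "length yz = 2" "dge d j {w. w @ yz \<in> {z. drop d z @ take d z \<in> Z}}"
    using dge_nonempty[OF j(2)] by blast
  \<comment> \<open>The total \<open>2 + d\<close> splits only as 2 for the ends and
    \<open>d\<close> for the base, both maximal.\<close>
  have "j = d" using dge_le[OF yz(2)] \<open>2 + d - j \<le> 2\<close> by linarith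
  obtain y z where [simp]: "yz = [y, z]" using yz(1) by (auto simp: numeral_2_eq_2 length_Suc_conv)
  have dB: "dge d d {w. [y, z] @ w \<in> Z}" using yz(2) unfolding \<open>j = d\<close> by (rule dge_mono) auto
  then have "y < z" using dge_nonempty[OF dB] by (auto simp: Z_def)
  have dd: "dset d {w. \<forall>x. y < x \<and> x < z \<longrightarrow> x # w \<in> Y}" by (rule dfn)+
  have "dge d d {w. \<forall>x. y < x \<and> x < z \<longrightarrow> x # w \<in> Y}" by (rule dge_mono[OF dB]) (auto simp: Z_def)
  from Suc.IH[OF dd this] obtain lo hi where lh: "lo \<in> tuples d" "hi \<in> tuples d" "\<forall>j<d. lo ! j < hi ! j"
    "{y \<in> tuples d. \<forall>j<d. lo ! j < y ! j \<and> y ! j < hi ! j} \<subseteq> {w. \<forall>x. y < x \<and> x < z \<longrightarrow> x # w \<in> Y}"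
    unfolding has_interior_def by blast
  show ?case unfolding has_interior_def
  proof (rule bexI[of _ "y # lo"], rule bexI[of _ "z # hi"], intro conjI)
    show "\<forall>j<Suc d. (y # lo) ! j < (z # hi) ! j" using lh \<open>y < z\<close> by (auto simp: nth_Cons split: nat.splits)
    show "{ya \<in> tuples (Suc d). \<forall>j<Suc d. (y # lo) ! j < ya ! j \<and> ya ! j < (z # hi) ! j} \<subseteq> Y"
    proof
      fix v assume v: "v \<in> {ya \<in> tuples (Suc d). \<forall>j<Suc d. (y # lo) ! j < ya ! j \<and> ya ! j < (z # hi) ! j}"
      then obtain x w where xw: "v = x # w" "length w = d" by (auto simp: tuples_def length_Suc_conv)
      have a: "y < x" "x < z" using v xw by auto
      have "lo ! j < w ! j \<and> w ! j < hi ! j" if "j < d" for j using v xw that by auto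
      then have "w \<in> {y \<in> tuples d. \<forall>j<d. lo ! j < y ! j \<and> y ! j < hi ! j}" using xw by (simp add: tuples_def)
      then show "v \<in> Y" using lh(4) a xw by blast
    qed
  qed (use lh in \<open>auto simp: tuples_def\<close>)
qed

text \<open>The chosen coordinates are those at which the recursion of \<open>dge\<close> uses an
  infinite fibre. Indices are shifted by \<open>Suc\<close> because coordinates are added in
  front.\<close>

lemma dge_coordinates:
  fixes X :: "'b list set"
  shows "dge k d X \<Longrightarrow> \<exists>js. length js = d \<and> sorted_wrt (<) js \<and> set js \<subseteq> {..<k} \<and>
    dge d d ((\<lambda>x. map (nth x) js) ` {x \<in> X. length x = k})"
proof (induction k arbitrary: d X)
  case 0
  then show ?case by (intro exI[of _ "[]"]) auto
next
  case (Suc k)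
  have srt: "sorted_wrt (<) (map Suc js)" if "sorted_wrt (<) js" for js using that by (simp add: sorted_wrt_map)
  from Suc.prems consider "dge k d {u. \<exists>x. x # u \<in> X}" | "d > 0" "dge k (d - 1) {u. infinite {x. x # u \<in> X}}" by auto
  then show ?case
  proof cases
    case 1
    from Suc.IH[OF 1] obtain js where js: "length js = d" "sorted_wrt (<) js" "set js \<subseteq> {..<k}"
      "dge d d ((\<lambda>x. map (nth x) js) ` {x \<in> {u. \<exists>x. x # u \<in> X}. length x = k})" by blast
    have "dge d d ((\<lambda>x. map (nth x) (map Suc js)) ` {x \<in> X. length x = Suc k})"
    proof (rule dge_mono[OF js(4)])
      fix u assume "u \<in> (\<lambda>x. map (nth x) js) ` {x \<in> {u. \<exists>x. x # u \<in> X}. length x = k}"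
      then obtain w x where "u = map (nth w) js" "x # w \<in> X" "length w = k" by blast
      then show "u \<in> (\<lambda>x. map (nth x) (map Suc js)) ` {x \<in> X. length x = Suc k}" by (intro image_eqI[of _ _ "x # w"]) auto
    qed
    then show ?thesis using js srt by (intro exI[of _ "map Suc js"]) auto
  next
    case 2
    from Suc.IH[OF 2(2)] obtain js where js: "length js = d - 1" "sorted_wrt (<) js" "set js \<subseteq> {..<k}"
      "dge (d - 1) (d - 1) ((\<lambda>x. map (nth x) js) ` {x \<in> {u. infinite {x. x # u \<in> X}}. length x = k})" by blast
    obtain d' where d': "d = Suc d'" using 2(1) by (cases d) auto
    let ?Y = "(\<lambda>x. map (nth x) (0 # map Suc js)) ` {x \<in> X. length x = Suc k}"
    have "dge d' d' {u. infinite {x. x # u \<in> ?Y}}"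
    proof (rule dge_mono)
      show "dge d' d' ((\<lambda>x. map (nth x) js) ` {x \<in> {u. infinite {x. x # u \<in> X}}. length x = k})" using js(4) d' by simp
      fix u assume "u \<in> (\<lambda>x. map (nth x) js) ` {x \<in> {u. infinite {x. x # u \<in> X}}. length x = k}"
      then obtain w where w: "u = map (nth w) js" "infinite {x. x # w \<in> X}" "length w = k" by blast
      have "{x. x # w \<in> X} \<subseteq> {x. x # u \<in> ?Y}"
      proof
        fix x assume "x \<in> {x. x # w \<in> X}"
        then show "x \<in> {x. x # u \<in> ?Y}" using w by (auto intro!: image_eqI[of _ _ "x # w"])
      qed
      then show "u \<in> {u. infinite {x. x # u \<in> ?Y}}" using w(2) infinite_super by blast
    qed
    then have "dge d d ?Y" using d' by simp
    then show ?thesis using js srt d' by (intro exI[of _ "0 # map Suc js"]) auto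
  qed
qed

text \<open>Carries the dimension of the statement, defined by boxes in projections, over to
  \<open>dge\<close>: a projection of full dimension \<open>Suc n\<close> contains a box, and as the
  candidate dimensions are bounded by \<open>k\<close>, their supremum is at least
  \<open>Suc n\<close>.\<close>

lemma not_dge_if_o_dim:
  assumes X: "dset k X" "X \<subseteq> tuples k" and n: "o_dim k X = n" shows "\<not> dge k (Suc n) X"
proof
  assume "dge k (Suc n) X"
  then obtain js where js: "length js = Suc n" "sorted_wrt (<) js" "set js \<subseteq> {..<k}"
    "dge (Suc n) (Suc n) ((\<lambda>x. map (nth x) js) ` {x \<in> X. length x = k})" using dge_coordinates by blast
  have eq: "{x \<in> X. length x = k} = X" using X by (auto simp: tuples_def)
  note [dfn] = dsetD[OF X(1)]
  have "dset (Suc n) {w. \<exists>x. length x = k \<and> x \<in> X \<and> (\<forall>i<Suc n. w ! i = x ! (js ! i))}"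
    using js by - (rule dfn elt_nth | simp add: subset_iff)+
  moreover have "w \<in> (\<lambda>x. map (nth x) js) ` X \<longleftrightarrow> (\<exists>x. length x = k \<and> x \<in> X \<and> (\<forall>i<Suc n. w ! i = x ! (js ! i)))"
    if "length w = Suc n" for w
  proof -
    have "w = map (nth x) js \<longleftrightarrow> (\<forall>i<Suc n. w ! i = x ! (js ! i))" for x
      using that js(1) by (auto simp: list_eq_iff_nth_eq)
    then show ?thesis using X(2) by (auto simp: tuples_def image_iff)
  qed
  ultimately have d: "dset (Suc n) ((\<lambda>x. map (nth x) js) ` X)" unfolding dfam_def by simp
  have int: "has_interior (Suc n) ((\<lambda>x. map (nth x) js) ` X)"
    by (rule has_interior_if_full_dim[OF d]) (use js(4) in \<open>simp add: eq\<close>)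
  let ?D = "{d. \<exists>js. length js = d \<and> sorted_wrt (<) js \<and> set js \<subseteq> {..<k} \<and> has_interior d ((\<lambda>x. map (nth x) js) ` X)}"
  have "Suc n \<in> ?D" using js int by blast
  moreover have "?D \<subseteq> {..k}"
  proof
    fix d assume "d \<in> ?D"
    then obtain js where "length js = d" "sorted_wrt (<) js" "set js \<subseteq> {..<k}" by blast
    then have "distinct js" "card (set js) \<le> k" using card_mono[of "{..<k}" "set js"]
      by (auto simp: strict_sorted_iff)
    then show "d \<in> {..k}" using \<open>length js = d\<close> by (simp add: distinct_card)
  qed
  then have "bdd_above ?D" by (meson bdd_above_Iic bdd_above_mono)
  ultimately have "Suc n \<le> Sup ?D" by (rule cSup_upper)
  then show False using n unfolding o_dim_def by simp
qed

end

section \<open>Uniform finiteness\<close>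

context omin
begin

text \<open>Convex sets are definably connected: at the supremum of the points up to the right end
  where the predicate holds, local constancy makes it hold there and beyond. \<open>core\<close>
  moves to the right; moving to the left is moving to the right for the negation.\<close>

lemma locally_constant_imp_constant:
  assumes d: "dfn UNIV (\<lambda>e. Q (e 0))"
    and conv: "\<And>x y z. J x \<Longrightarrow> J z \<Longrightarrow> x < y \<Longrightarrow> y < z \<Longrightarrow> J y"
    and loc: "\<And>x. J x \<Longrightarrow> \<exists>u v. u < x \<and> x < v \<and> (\<forall>y. u < y \<and> y < v \<and> J y \<longrightarrow> (Q y \<longleftrightarrow> Q x))"
    and J: "J a" "J b" and Qa: "Q a"
  shows "Q b"
proof -
  have core: "R q" if d: "dfn UNIV (\<lambda>e. R (e 0))" and pq: "J p" "J q" "p < q" and Rp: "R p"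
    and loc: "\<And>x. J x \<Longrightarrow> \<exists>u v. u < x \<and> x < v \<and> (\<forall>y. u < y \<and> y < v \<and> J y \<longrightarrow> (R y \<longleftrightarrow> R x))" for R p q
  proof (rule ccontr)
    assume n: "\<not> R q"
    have dR: "dset1 {x. R x}" using d by (simp add: dfam1_def)
    note [dfn] = dset1D[OF dR, unfolded mem_Collect_eq]
    define S where "S y \<longleftrightarrow> p \<le> y \<and> y \<le> q \<and> R y" for y
    have dS: "dfn UNIV (\<lambda>e. S (e 0))" unfolding S_def by (rule dfn)+
    have Sp: "S p" using pq Rp by (simp add: S_def)
    have ub: "\<forall>y. S y \<longrightarrow> y \<le> q" by (simp add: S_def)
    obtain s where s: "\<forall>y. S y \<longrightarrow> y \<le> s" "\<forall>v. (\<forall>y. S y \<longrightarrow> y \<le> v) \<longrightarrow> s \<le> v" using sup_ex[OF dS Sp ub] by blast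
    have sq: "p \<le> s" "s \<le> q" using s ub Sp by auto
    have JJ: "J y" if "p \<le> y" "y \<le> q" for y
    proof (cases "y = p \<or> y = q")
      case False
      then have "p < y" "y < q" using that by auto
      then show ?thesis using conv[OF pq(1,2)] by blast
    qed (use pq in auto)
    obtain u v where uv: "u < s" "s < v" "\<forall>y. u < y \<and> y < v \<and> J y \<longrightarrow> (R y \<longleftrightarrow> R s)" using loc[OF JJ[OF sq]] by blast
    have "\<not> (\<forall>y. S y \<longrightarrow> y \<le> u)" using s(2) uv(1) by (meson not_le)
    then obtain y where y: "S y" "u < y" by (meson not_le)
    have "y \<le> s" using s y by blast
    then have "y < v" using uv by order
    have "J y" using y JJ unfolding S_def by blast
    then have "R s" using uv(3) y \<open>y < v\<close> unfolding S_def by blast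
    then have "s \<noteq> q" using n by auto
    then have "s < q" using sq by order
    then obtain z where z: "s < z" "z < min v q" using dense_ex[of s "min v q"] uv by auto
    have "p \<le> z" "z \<le> q" "u < z" "z < v" using z sq uv by auto
    then have "S z" using uv(3) JJ[of z] \<open>R s\<close> unfolding S_def by blast
    then show False using s(1) z by auto
  qed
  show ?thesis
  proof (rule ccontr)
    assume n: "\<not> Q b"
    consider "a < b" | "a = b" | "b < a" by (rule linorder_cases)
    then show False
    proof cases
      case 1
      then show ?thesis using core[OF d J(1,2) 1 Qa loc] n by blast
    next
      case 2
      then show ?thesis using Qa n by simp
    next
      case 3
      have "dfn UNIV (\<lambda>e. \<not> Q (e 0))" using d by (rule dfn_not)
      from core[of "\<lambda>x. \<not> Q x", OF this J(2,1) 3 n] loc Qa show ?thesis by blast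
    qed
  qed
qed

definition bd :: "'a set \<Rightarrow> 'a set" where
  "bd X = {x. \<not> (\<exists>u v. u < x \<and> x < v \<and> ((\<forall>y. u < y \<and> y < v \<longrightarrow> y \<in> X) \<or> (\<forall>y. u < y \<and> y < v \<longrightarrow> y \<notin> X)))}"

lemma finite_bd:
  assumes "dset1 X" shows "finite (bd X)"
proof (rule ccontr)
  note [dfn] = dset1D[OF assms]
  assume i: "infinite (bd X)"
  have "dset1 (bd X)" unfolding bd_def by (rule dfn)+
  from interval_in_infinite_set[OF this i] obtain a b where ab: "a < b" "\<And>x. a < x \<Longrightarrow> x < b \<Longrightarrow> x \<in> bd X" by blast
  have "dfn UNIV (\<lambda>e. e 0 \<in> X)" by (rule dfn)+
  from refine_interval[OF this ab(1)] obtain c where c: "a < c" "c \<le> b"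
    "(\<forall>y. a < y \<and> y < c \<longrightarrow> y \<in> X) \<or> (\<forall>y. a < y \<and> y < c \<longrightarrow> y \<notin> X)" by blast
  obtain x where x: "a < x" "x < c" using c dense_ex by blast
  then have "x \<notin> bd X" using c(3) unfolding bd_def by blast
  moreover have "x \<in> bd X" using ab(2) x c by auto
  ultimately show False by blast
qed

lemma not_bdD:
  assumes "x \<notin> bd X" obtains u v where "u < x" "x < v" "\<forall>y. u < y \<and> y < v \<longrightarrow> (y \<in> X \<longleftrightarrow> x \<in> X)"
proof -
  obtain u v where "u < x" "x < v" "(\<forall>y. u < y \<and> y < v \<longrightarrow> y \<in> X) \<or> (\<forall>y. u < y \<and> y < v \<longrightarrow> y \<notin> X)"
    using assms unfolding bd_def by blast
  then show ?thesis by (intro that[of u v]) auto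
qed

section \<open>Finite sets depending on one parameter\<close>

definition near :: "'a \<Rightarrow> ('a \<Rightarrow> bool) \<Rightarrow> bool" where
  "near t Q \<longleftrightarrow> (\<exists>t1 t2. t1 < t \<and> t < t2 \<and> (\<forall>t'. t1 < t' \<and> t' < t2 \<longrightarrow> Q t'))"

text \<open>For a family of finite sets \<open>X t\<close>, the point \<open>(t, y)\<close> is regular if near it the family is empty or
  the graph of a continuous function.\<close>

definition reg :: "('a \<Rightarrow> 'a set) \<Rightarrow> 'a \<Rightarrow> 'a \<Rightarrow> bool" where
  "reg X t y \<longleftrightarrow> (\<exists>y1 y2. y1 < y \<and> y < y2 \<and> (\<forall>z1 z2. y1 \<le> z1 \<and> z1 < y \<and> y < z2 \<and> z2 \<le> y2 \<longrightarrow>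
    near t (\<lambda>t'.
      (y \<in> X t \<longrightarrow> (\<exists>z. z \<in> X t' \<and> z1 < z \<and> z < z2 \<and> (\<forall>z'. z' \<in> X t' \<and> z1 < z' \<and> z' < z2 \<longrightarrow> z' = z))) \<and>
      (y \<notin> X t \<longrightarrow> (\<forall>z. z \<in> X t' \<longrightarrow> \<not> (z1 < z \<and> z < z2))))))"

definition reg_bot :: "('a \<Rightarrow> 'a set) \<Rightarrow> 'a \<Rightarrow> bool" where
  "reg_bot X t \<longleftrightarrow> (\<exists>y t1 t2. t1 < t \<and> t < t2 \<and> (\<forall>t'. t1 < t' \<and> t' < t2 \<longrightarrow> (\<forall>z. z \<in> X t' \<longrightarrow> \<not> z < y)))"

definition reg_top :: "('a \<Rightarrow> 'a set) \<Rightarrow> 'a \<Rightarrow> bool" where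
  "reg_top X t \<longleftrightarrow> (\<exists>y t1 t2. t1 < t \<and> t < t2 \<and> (\<forall>t'. t1 < t' \<and> t' < t2 \<longrightarrow> (\<forall>z. z \<in> X t' \<longrightarrow> \<not> y < z)))"

definition bad :: "('a \<Rightarrow> 'a set) \<Rightarrow> 'a set" where
  "bad X = {t. \<not> (reg_bot X t \<and> reg_top X t \<and> (\<forall>y. reg X t y))}"

text \<open>The least element of \<open>X t\<close> is a definable function of \<open>t\<close>;
  where it is continuous, no element escapes to minus infinity.\<close>

lemma finite_not_reg_bot:
  assumes d: "drel1 UNIV (\<lambda>_ t y. y \<in> X t)" and fin: "\<And>t. finite (X t)"
  shows "finite {t. \<not> reg_bot X t}"
proof -
  note [dfn] = dsrel1D[OF d]
  define f where "f t = (if \<exists>y. y \<in> X t then Min (X t) else t)" for t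
  have dX: "dfn UNIV (\<lambda>e. \<exists>y. y \<in> X (e 0))" by (rule dfn)+
  have g: "drel1 UNIV (\<lambda>_ t y. y \<in> X t \<and> (\<forall>z. z \<in> X t \<longrightarrow> y \<le> z))" by (rule dfn)+
  have df: "drel1 UNIV (\<lambda>_ t y. y = f t)" unfolding f_def
  proof (rule drel1_if[OF g dX])
    fix t y assume "\<exists>y. y \<in> X t"
    then have ne: "X t \<noteq> {}" by blast
    show "y = Min (X t) \<longleftrightarrow> y \<in> X t \<and> (\<forall>z. z \<in> X t \<longrightarrow> y \<le> z)"
      using Min_in[OF fin ne] Min_le[OF fin[of t]] by (meson antisym)
  qed
  have "reg_bot X t" if c: "cont_at f t" for t
  proof -
    obtain y1 y2 where y: "y1 < f t" "f t < y2" using lt_exa gt_exa by blast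
    obtain u v where uv: "u < t" "t < v" "\<And>z. u < z \<Longrightarrow> z < v \<Longrightarrow> y1 < f z \<and> f z < y2"
      by (rule cont_atD[OF c y]) blast
    have "\<not> z < y1" if "u < t'" "t' < v" "z \<in> X t'" for t' z
    proof -
      have "f t' \<le> z" unfolding f_def using that(3) Min_le[OF fin that(3)] by auto
      then show ?thesis using uv(3)[OF that(1,2)] by auto
    qed
    then show ?thesis unfolding reg_bot_def using uv(1,2) by blast
  qed
  then have "{t. \<not> reg_bot X t} \<subseteq> {t. \<not> cont_at f t}" by blast
  then show ?thesis using finite_discontinuities[OF df] finite_subset by blast
qed

lemma finite_not_reg_top:
  assumes d: "drel1 UNIV (\<lambda>_ t y. y \<in> X t)" and fin: "\<And>t. finite (X t)"
  shows "finite {t. \<not> reg_top X t}"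
proof -
  note [dfn] = dsrel1D[OF d]
  define f where "f t = (if \<exists>y. y \<in> X t then Max (X t) else t)" for t
  have dX: "dfn UNIV (\<lambda>e. \<exists>y. y \<in> X (e 0))" by (rule dfn)+
  have g: "drel1 UNIV (\<lambda>_ t y. y \<in> X t \<and> (\<forall>z. z \<in> X t \<longrightarrow> z \<le> y))" by (rule dfn)+
  have df: "drel1 UNIV (\<lambda>_ t y. y = f t)" unfolding f_def
  proof (rule drel1_if[OF g dX])
    fix t y assume "\<exists>y. y \<in> X t"
    then have ne: "X t \<noteq> {}" by blast
    show "y = Max (X t) \<longleftrightarrow> y \<in> X t \<and> (\<forall>z. z \<in> X t \<longrightarrow> z \<le> y)"
      using Max_in[OF fin ne] Max_ge[OF fin[of t]] by (meson antisym)
  qed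
  have "reg_top X t" if c: "cont_at f t" for t
  proof -
    obtain y1 y2 where y: "y1 < f t" "f t < y2" using lt_exa gt_exa by blast
    obtain u v where uv: "u < t" "t < v" "\<And>z. u < z \<Longrightarrow> z < v \<Longrightarrow> y1 < f z \<and> f z < y2"
      by (rule cont_atD[OF c y]) blast
    have "\<not> y2 < z" if "u < t'" "t' < v" "z \<in> X t'" for t' z
    proof -
      have "z \<le> f t'" unfolding f_def using that(3) Max_ge[OF fin that(3)] by auto
      then show ?thesis using uv(3)[OF that(1,2)] by auto
    qed
    then show ?thesis unfolding reg_top_def using uv(1,2) by blast
  qed
  then have "{t. \<not> reg_top X t} \<subseteq> {t. \<not> cont_at f t}" by blast
  then show ?thesis using finite_discontinuities[OF df] finite_subset by blast
qed

text \<open>Suppose infinitely many \<open>t\<close> have irregular points. All but finitely many of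
  these \<open>t\<close> have only finitely many; the least one \<open>f t\<close> and the nearest
  elements of \<open>X t\<close> above and below it are then definable functions. At a common point
  of continuity they show that \<open>f t\<close> is regular after all.\<close>

lemma finite_not_reg:
  assumes d: "drel1 UNIV (\<lambda>_ t y. y \<in> X t)" and fin: "\<And>t. finite (X t)"
  shows "finite {t. \<exists>y. \<not> reg X t y}"
proof (rule ccontr)
  note [dfn] = dsrel1D[OF d]
  assume i: "infinite {t. \<exists>y. \<not> reg X t y}"
  have dreg: "drel1 UNIV (\<lambda>_ t y. reg X t y)" unfolding reg_def near_def by (rule dfn)+
  note [dfn] = dsrel1D[OF dreg]
  \<comment> \<open>Otherwise the irregular points outside the sets \<open>X t\<close> have full
    dimension and contain a box. A box that misses all \<open>X t\<close> consists of regular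
    points, a contradiction.\<close>
  have f0: "finite {t. infinite {y. \<not> reg X t y}}"
  proof (rule ccontr)
    assume i: "infinite {t. infinite {y. \<not> reg X t y}}"
    define W where "W = {w. \<not> reg X (w ! 1) (w ! 0) \<and> w ! 0 \<notin> X (w ! 1)}"
    have dW: "dset 2 W" unfolding W_def by (rule dfn elt_nth | simp)+
    have "infinite {y. y # t # [] \<in> W}" if "infinite {y. \<not> reg X t y}" for t
    proof -
      have "{y. y # t # [] \<in> W} = {y. \<not> reg X t y} - X t" by (auto simp: W_def)
      then show ?thesis using that fin[of t] by simp
    qed
    then have "{t. infinite {y. \<not> reg X t y}} \<subseteq> {t. infinite {y. y # t # [] \<in> W}}" by blast
    then have "infinite {t. infinite {y. y # t # [] \<in> W}}" using i infinite_super by blast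
    then have "dge 2 2 W" unfolding numeral_2_eq_2 dge_Suc_Suc by simp
    from has_interior_if_full_dim[OF dW this] obtain lo hi where lh: "\<forall>j<2. lo ! j < hi ! j"
      "{y \<in> tuples 2. \<forall>j<2. lo ! j < y ! j \<and> y ! j < hi ! j} \<subseteq> W" unfolding has_interior_def by blast
    have box: "[y, t] \<in> W" if "lo ! 0 < y" "y < hi ! 0" "lo ! 1 < t" "t < hi ! 1" for y t
    proof -
      have "[y, t] \<in> {y \<in> tuples 2. \<forall>j<2. lo ! j < y ! j \<and> y ! j < hi ! j}"
        using that by (auto simp: tuples_def less_2_cases_iff)
      then show ?thesis using lh(2) by blast
    qed
    have "lo ! 0 < hi ! 0" "lo ! 1 < hi ! 1" using lh(1) by auto
    then obtain y t where yt: "lo ! 0 < y" "y < hi ! 0" "lo ! 1 < t" "t < hi ! 1" using dense_ex by blast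
    have "z \<notin> X t'" if "lo ! 0 < z" "z < hi ! 0" "lo ! 1 < t'" "t' < hi ! 1" for z t'
      using box[OF that] by (simp add: W_def)
    then have empty: "\<forall>t'. lo ! 1 < t' \<and> t' < hi ! 1 \<longrightarrow> (\<forall>z. z \<in> X t' \<longrightarrow> \<not> (lo ! 0 < z \<and> z < hi ! 0))" by blast
    obtain y1 y2 where y12: "lo ! 0 < y1" "y1 < y" "y < y2" "y2 < hi ! 0" using yt dense_ex by meson
    have "reg X t y" unfolding reg_def
    proof (rule exI[of _ y1], rule exI[of _ y2], intro conjI allI impI)
      fix z1 z2 assume z: "y1 \<le> z1 \<and> z1 < y \<and> y < z2 \<and> z2 \<le> y2"
      have "y \<notin> X t" using empty yt by blast
      moreover have "\<forall>t'. lo ! 1 < t' \<and> t' < hi ! 1 \<longrightarrow> (\<forall>z. z \<in> X t' \<longrightarrow> \<not> (z1 < z \<and> z < z2))"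
        using empty z y12 by (meson le_less_trans less_le_trans less_trans)
      ultimately show "near t (\<lambda>t'.
        (y \<in> X t \<longrightarrow> (\<exists>z. z \<in> X t' \<and> z1 < z \<and> z < z2 \<and> (\<forall>z'. z' \<in> X t' \<and> z1 < z' \<and> z' < z2 \<longrightarrow> z' = z))) \<and>
        (y \<notin> X t \<longrightarrow> (\<forall>z. z \<in> X t' \<longrightarrow> \<not> (z1 < z \<and> z < z2))))"
        unfolding near_def using yt by (intro exI[of _ "lo ! 1"] exI[of _ "hi ! 1"]) auto
    qed (use y12 in auto)
    then show False using box[OF yt] by (simp add: W_def)
  qed
  define N where "N t = {y. \<not> reg X t y}" for t
  define C where "C t \<longleftrightarrow> (\<exists>y. \<not> reg X t y) \<and> finite {y. \<not> reg X t y}" for t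
  have dC: "dfn UNIV (\<lambda>e. C (e 0))" unfolding C_def by (rule dfn)+
  have "{t. \<exists>y. \<not> reg X t y} \<subseteq> {t. C t} \<union> {t. infinite {y. \<not> reg X t y}}" unfolding C_def by auto
  then have iC: "infinite {t. C t}" using i f0 by (meson finite_UnI finite_subset)
  define f where "f t = (if C t then Min (N t) else t)" for t
  have g: "drel1 UNIV (\<lambda>_ t y. \<not> reg X t y \<and> (\<forall>z. \<not> reg X t z \<longrightarrow> y \<le> z))" by (rule dfn)+
  have CN: "finite (N t)" "N t \<noteq> {}" if "C t" for t using that unfolding C_def N_def by auto
  have df: "drel1 UNIV (\<lambda>_ t y. y = f t)" unfolding f_def
  proof (rule drel1_if[OF g dC])
    fix t y assume t: "C t"
    show "y = Min (N t) \<longleftrightarrow> \<not> reg X t y \<and> (\<forall>z. \<not> reg X t z \<longrightarrow> y \<le> z)"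
      using Min_in[OF CN[OF t]] Min_le[OF CN(1)[OF t]] unfolding N_def mem_Collect_eq by (meson antisym)
  qed
  note [dfn] = dfn_fun_less[OF df]
  have fN: "\<not> reg X t (f t)" if "C t" for t
    using Min_in[OF CN[OF that]] that unfolding f_def by (simp add: N_def)
  \<comment> \<open>Whether \<open>f t\<close> belongs to \<open>X t\<close>, and whether
    \<open>X t\<close> has elements above and below it, may vary with \<open>t\<close>; on a
    suitable interval all three are constant.\<close>
  define A1 where "A1 t \<longleftrightarrow> (\<exists>y. y = f t \<and> y \<in> X t)" for t
  define A2 where "A2 t \<longleftrightarrow> (\<exists>z. z \<in> X t \<and> f t < z)" for t
  define A3 where "A3 t \<longleftrightarrow> (\<exists>z. z \<in> X t \<and> z < f t)" for t
  have d1: "dfn UNIV (\<lambda>e. A1 (e 0))" unfolding A1_def by (rule dfn)+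
  have d2: "dfn UNIV (\<lambda>e. A2 (e 0))" unfolding A2_def by (rule dfn)+
  have d3: "dfn UNIV (\<lambda>e. A3 (e 0))" unfolding A3_def by (rule dfn)+
  obtain a b where ab: "a < b" "\<And>t. a < t \<Longrightarrow> t < b \<Longrightarrow> C t" by (rule interval_in_infinite[OF dC iC]) blast
  obtain c1 where c1: "a < c1" "c1 \<le> b" "(\<forall>t. a < t \<and> t < c1 \<longrightarrow> A1 t) \<or> (\<forall>t. a < t \<and> t < c1 \<longrightarrow> \<not> A1 t)"
    by (rule refine_interval[OF d1 ab(1)])
  obtain c2 where c2: "a < c2" "c2 \<le> c1" "(\<forall>t. a < t \<and> t < c2 \<longrightarrow> A2 t) \<or> (\<forall>t. a < t \<and> t < c2 \<longrightarrow> \<not> A2 t)"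
    by (rule refine_interval[OF d2 c1(1)])
  obtain c where c: "a < c" "c \<le> c2" "(\<forall>t. a < t \<and> t < c \<longrightarrow> A3 t) \<or> (\<forall>t. a < t \<and> t < c \<longrightarrow> \<not> A3 t)"
    by (rule refine_interval[OF d3 c2(1)])
  have A1c: "A1 t \<longleftrightarrow> A1 t'" if "a < t" "t < c" "a < t'" "t' < c" for t t'
  proof -
    have "t < c1" "t' < c1" using that c c2 by order+
    then show ?thesis using c1(3) that by blast
  qed
  have A2c: "A2 t \<longleftrightarrow> A2 t'" if "a < t" "t < c" "a < t'" "t' < c" for t t'
  proof -
    have "t < c2" "t' < c2" using that c by order+
    then show ?thesis using c2(3) that by blast
  qed
  have A3c: "A3 t \<longleftrightarrow> A3 t'" if "a < t" "t < c" "a < t'" "t' < c" for t t'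
    using c(3) that by blast
  define g where "g t = (if A2 t then Min {z \<in> X t. f t < z} else t)" for t
  define h where "h t = (if A3 t then Max {z \<in> X t. z < f t} else t)" for t
  have gg: "drel1 UNIV (\<lambda>_ t y. (y \<in> X t \<and> f t < y) \<and> (\<forall>z. z \<in> X t \<and> f t < z \<longrightarrow> y \<le> z))" by (rule dfn)+
  have hh: "drel1 UNIV (\<lambda>_ t y. (y \<in> X t \<and> y < f t) \<and> (\<forall>z. z \<in> X t \<and> z < f t \<longrightarrow> z \<le> y))" by (rule dfn)+
  have dg: "drel1 UNIV (\<lambda>_ t y. y = g t)" unfolding g_def
  proof (rule drel1_if[OF gg d2])
    fix t y assume t: "A2 t"
    have *: "finite {z \<in> X t. f t < z}" "{z \<in> X t. f t < z} \<noteq> {}" using t fin[of t] unfolding A2_def by auto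
    show "y = Min {z \<in> X t. f t < z} \<longleftrightarrow> (y \<in> X t \<and> f t < y) \<and> (\<forall>z. z \<in> X t \<and> f t < z \<longrightarrow> y \<le> z)"
      using Min_in[OF *] Min_le[OF *(1)] unfolding mem_Collect_eq by (meson antisym)
  qed
  have dh: "drel1 UNIV (\<lambda>_ t y. y = h t)" unfolding h_def
  proof (rule drel1_if[OF hh d3])
    fix t y assume t: "A3 t"
    have *: "finite {z \<in> X t. z < f t}" "{z \<in> X t. z < f t} \<noteq> {}" using t fin[of t] unfolding A3_def by auto
    show "y = Max {z \<in> X t. z < f t} \<longleftrightarrow> (y \<in> X t \<and> y < f t) \<and> (\<forall>z. z \<in> X t \<and> z < f t \<longrightarrow> z \<le> y)"
      using Max_in[OF *] Max_ge[OF *(1)] unfolding mem_Collect_eq by (meson antisym)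
  qed
  have g_le: "g t \<le> z" if "z \<in> X t" "f t < z" for t z
  proof -
    have "A2 t" using that unfolding A2_def by blast
    then show ?thesis unfolding g_def using that fin[of t] by auto
  qed
  have h_ge: "z \<le> h t" if "z \<in> X t" "z < f t" for t z
  proof -
    have "A3 t" using that unfolding A3_def by blast
    then show ?thesis unfolding h_def using that fin[of t] by auto
  qed
  have g_gt: "f t < g t" if "A2 t" for t
  proof -
    have "finite {z \<in> X t. f t < z}" "{z \<in> X t. f t < z} \<noteq> {}" using that fin[of t] unfolding A2_def by auto
    from Min_in[OF this] show ?thesis using that unfolding g_def by auto
  qed
  have h_lt: "h t < f t" if "A3 t" for t
  proof -
    have "finite {z \<in> X t. z < f t}" "{z \<in> X t. z < f t} \<noteq> {}" using that fin[of t] unfolding A3_def by auto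
    from Max_in[OF this] show ?thesis using that unfolding h_def by auto
  qed
  have dS: "dfn UNIV (\<lambda>e. a < e 0 \<and> e 0 < c)" by (rule dfn)+
  obtain t p q where t: "p < t" "t < q" "\<And>z. p < z \<Longrightarrow> z < q \<Longrightarrow> a < z \<and> z < c" "cont_at f t" "cont_at g t" "cont_at h t"
    by (rule continuity_point[where S = "\<lambda>t. a < t \<and> t < c", OF df dg dh dS infinite_interval[OF c(1)]]) blast
  have tac: "a < t" "t < c" using t by auto
  have "t < b" using tac c c1 c2 by order
  then have Ct: "C t" using ab(2)[of t] tac by blast
  \<comment> \<open>\<open>y1\<close> and \<open>y2\<close> separate \<open>f t\<close> from its
    neighbours in \<open>X t\<close> where these exist; on a side without a neighbour any bound will
    do.\<close>
  obtain y2 where y2: "f t < y2" "A2 t \<Longrightarrow> y2 < g t"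
  proof (cases "A2 t")
    case True
    then show ?thesis using dense_ex[OF g_gt[OF True]] that by blast
  next
    case False
    then show ?thesis using gt_exa[of "f t"] that by blast
  qed
  obtain y1 where y1: "y1 < f t" "A3 t \<Longrightarrow> h t < y1"
  proof (cases "A3 t")
    case True
    then show ?thesis using dense_ex[OF h_lt[OF True]] that by blast
  next
    case False
    then show ?thesis using lt_exa[of "f t"] that by blast
  qed
  have near_g: "\<exists>u v. u < t \<and> t < v \<and> (\<forall>t'. u < t' \<and> t' < v \<and> A2 t \<longrightarrow> y2 < g t')"
  proof (cases "A2 t")
    case True
    obtain w where w: "g t < w" using gt_exa by blast
    obtain u v where "u < t" "t < v" "\<And>z. u < z \<Longrightarrow> z < v \<Longrightarrow> y2 < g z \<and> g z < w"
      by (rule cont_atD[OF t(5) y2(2)[OF True] w]) blast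
    then show ?thesis by blast
  next
    case False
    then show ?thesis using t(1,2) by blast
  qed
  have near_h: "\<exists>u v. u < t \<and> t < v \<and> (\<forall>t'. u < t' \<and> t' < v \<and> A3 t \<longrightarrow> h t' < y1)"
  proof (cases "A3 t")
    case True
    obtain w where w: "w < h t" using lt_exa by blast
    obtain u v where "u < t" "t < v" "\<And>z. u < z \<Longrightarrow> z < v \<Longrightarrow> w < h z \<and> h z < y1"
      by (rule cont_atD[OF t(6) w y1(2)[OF True]]) blast
    then show ?thesis by blast
  next
    case False
    then show ?thesis using t(1,2) by blast
  qed
  obtain ug vg where g: "ug < t" "t < vg" "\<forall>t'. ug < t' \<and> t' < vg \<and> A2 t \<longrightarrow> y2 < g t'" using near_g by blast
  obtain uh vh where h: "uh < t" "t < vh" "\<forall>t'. uh < t' \<and> t' < vh \<and> A3 t \<longrightarrow> h t' < y1" using near_h by blast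
  have "reg X t (f t)" unfolding reg_def
  proof (rule exI[of _ y1], rule exI[of _ y2], intro conjI allI impI)
    fix z1 z2 assume z: "y1 \<le> z1 \<and> z1 < f t \<and> f t < z2 \<and> z2 \<le> y2"
    then have z1: "z1 < f t" and z2: "f t < z2" by auto
    obtain uf vf where f: "uf < t" "t < vf" "\<And>z. uf < z \<Longrightarrow> z < vf \<Longrightarrow> z1 < f z \<and> f z < z2"
      by (rule cont_atD[OF t(4) z1 z2]) blast
    let ?u = "max (max uf p) (max ug uh)" and ?v = "min (min vf q) (min vg vh)"
    have only: "w = f t'" if t': "?u < t'" "t' < ?v" and w: "w \<in> X t'" "z1 < w" "w < z2" for t' w
    proof -
      have ac: "a < t'" "t' < c" using t(3) t' by auto
      have "\<not> f t' < w"
      proof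
        assume *: "f t' < w"
        then have "A2 t" using w A2c[OF ac tac] unfolding A2_def by blast
        then have "y2 < g t'" using g(3) t' by auto
        then show False using g_le[OF w(1) *] w z by auto
      qed
      moreover have "\<not> w < f t'"
      proof
        assume *: "w < f t'"
        then have "A3 t" using w A3c[OF ac tac] unfolding A3_def by blast
        then have "h t' < y1" using h(3) t' by auto
        then show False using h_ge[OF w(1) *] w z by auto
      qed
      ultimately show ?thesis by order
    qed
    have mem: "f t' \<in> X t' \<longleftrightarrow> f t \<in> X t" if t': "?u < t'" "t' < ?v" for t'
    proof -
      have ac: "a < t'" "t' < c" using t(3) t' by auto
      show ?thesis using A1c[OF ac tac] unfolding A1_def by blast
    qed
    have rng: "z1 < f t' \<and> f t' < z2" if t': "?u < t'" "t' < ?v" for t' using f(3) t' by auto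
    show "near t (\<lambda>t'.
        (f t \<in> X t \<longrightarrow> (\<exists>z. z \<in> X t' \<and> z1 < z \<and> z < z2 \<and> (\<forall>z'. z' \<in> X t' \<and> z1 < z' \<and> z' < z2 \<longrightarrow> z' = z))) \<and>
        (f t \<notin> X t \<longrightarrow> (\<forall>z. z \<in> X t' \<longrightarrow> \<not> (z1 < z \<and> z < z2))))"
      unfolding near_def
    proof (rule exI[of _ ?u], rule exI[of _ ?v], intro conjI allI)
      show "?u < t" "t < ?v" using f g h t by auto
      fix t'
      show "?u < t' \<and> t' < ?v \<longrightarrow>
        (f t \<in> X t \<longrightarrow> (\<exists>z. z \<in> X t' \<and> z1 < z \<and> z < z2 \<and> (\<forall>z'. z' \<in> X t' \<and> z1 < z' \<and> z' < z2 \<longrightarrow> z' = z))) \<and>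
        (f t \<notin> X t \<longrightarrow> (\<forall>z. z \<in> X t' \<longrightarrow> \<not> (z1 < z \<and> z < z2)))"
        using only[of t'] mem[of t'] rng[of t'] by blast
    qed
  qed (use y1 y2 in auto)
  then show False using fN[OF Ct] by blast
qed

lemma finite_bad:
  assumes d: "drel1 UNIV (\<lambda>_ t y. y \<in> X t)" and fin: "\<And>t. finite (X t)"
  shows "finite (bad X)"
proof -
  have "bad X \<subseteq> {t. \<not> reg_bot X t} \<union> {t. \<not> reg_top X t} \<union> {t. \<exists>y. \<not> reg X t y}" unfolding bad_def by blast
  then show ?thesis using finite_not_reg_bot[OF d fin] finite_not_reg_top[OF d fin] finite_not_reg[OF d fin]
    by (meson finite_UnI finite_subset)
qed

lemma near_conj: "near t P \<Longrightarrow> near t Q \<Longrightarrow> near t (\<lambda>t'. P t' \<and> Q t')"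
proof -
  assume "near t P" "near t Q"
  then obtain u v u' v' where "u < t" "t < v" "\<forall>t'. u < t' \<and> t' < v \<longrightarrow> P t'"
    "u' < t" "t < v'" "\<forall>t'. u' < t' \<and> t' < v' \<longrightarrow> Q t'" unfolding near_def by blast
  then show ?thesis unfolding near_def by (intro exI[of _ "max u u'"] exI[of _ "min v v'"]) auto
qed

lemma near_mono: "near t P \<Longrightarrow> (\<And>t'. P t' \<Longrightarrow> Q t') \<Longrightarrow> near t Q"
  unfolding near_def by blast

lemma near_self: "near t P \<Longrightarrow> P t"
  unfolding near_def by blast

text \<open>Count the elements of \<open>X t\<close> below a moving level \<open>d\<close>. For low
  \<open>d\<close> the count is 0 near \<open>t\<close>, for high \<open>d\<close> it is the full
  cardinality, and regularity at every \<open>y\<close> shows that local constancy of the count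
  survives when \<open>d\<close> passes \<open>y\<close>.\<close>

lemma card_locally_constant:
  assumes d: "drel1 UNIV (\<lambda>_ t y. y \<in> X t)" and fin: "\<And>t. finite (X t)" and t: "t \<notin> bad X"
  shows "near t (\<lambda>t'. card (X t') = card (X t))"
proof -
  note [dfn] = dsrel1D[OF d]
  define good where "good d \<longleftrightarrow> near t (\<lambda>t'. card {y. y \<in> X t' \<and> y < d} = card {y. y \<in> X t \<and> y < d})" for d
  have fin': "finite {y. y \<in> X t' \<and> P y}" for t' P using fin[of t'] by simp
  have good_iff: "good d \<longleftrightarrow> (\<exists>j<Suc (card (X t)). ncard j {y. y \<in> X t \<and> y < d} \<and>
    (\<exists>t1 t2. t1 < t \<and> t < t2 \<and> (\<forall>t'. t1 < t' \<and> t' < t2 \<longrightarrow> ncard j {y. y \<in> X t' \<and> y < d})))" for d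
  proof -
    have "card {y. y \<in> X t \<and> y < d} < Suc (card (X t))" using card_mono[OF fin[of t], of "{y. y \<in> X t \<and> y < d}"] by auto
    then show ?thesis unfolding good_def near_def ncard_def using fin' by auto
  qed
  have dgood: "dset1 {d. good d}" unfolding good_iff by (rule dfn)+
  note [dfn] = dset1D[OF dgood, unfolded mem_Collect_eq]
  \<comment> \<open>At a level \<open>d\<close> that belongs to \<open>X t\<close> the count may
    jump, as the element crosses \<open>d\<close> when \<open>t\<close> moves. So the levels just
    after \<open>d\<close> are considered; this makes \<open>S\<close> locally constant in
    \<open>d\<close>.\<close>
  define S where "S d \<longleftrightarrow> (\<exists>d'. d < d' \<and> (\<forall>d''. d < d'' \<and> d'' < d' \<longrightarrow> good d''))" for d
  have dS: "dfn UNIV (\<lambda>e. S (e 0))" unfolding S_def by (rule dfn)+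
  have loc: "\<exists>u v. u < y \<and> y < v \<and> (\<forall>d. u < d \<and> d < v \<and> True \<longrightarrow> (S d \<longleftrightarrow> S y))" for y
  proof -
    have "reg X t y" using t unfolding bad_def by blast
    then obtain y1 y2 where y12: "y1 < y" "y < y2" and
      rg: "\<And>z1 z2. y1 \<le> z1 \<Longrightarrow> z1 < y \<Longrightarrow> y < z2 \<Longrightarrow> z2 \<le> y2 \<Longrightarrow> near t (\<lambda>t'.
      (y \<in> X t \<longrightarrow> (\<exists>z. z \<in> X t' \<and> z1 < z \<and> z < z2 \<and> (\<forall>z'. z' \<in> X t' \<and> z1 < z' \<and> z' < z2 \<longrightarrow> z' = z))) \<and>
      (y \<notin> X t \<longrightarrow> (\<forall>z. z \<in> X t' \<longrightarrow> \<not> (z1 < z \<and> z < z2))))"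
      unfolding reg_def by blast
    \<comment> \<open>Near \<open>y\<close> the count is the number of elements up to
      \<open>y1\<close>, plus 1 for the branch through \<open>y\<close> once \<open>d\<close> has
      passed it. Whether \<open>c\<close> is locally constant at \<open>t\<close> does not depend on
      \<open>d\<close>.\<close>
    define c where "c t' = card {z. z \<in> X t' \<and> z \<le> y1}" for t'
    have cnt: "near t (\<lambda>t'. card {z. z \<in> X t' \<and> z < d} = c t' + (if y < d \<and> y \<in> X t then 1 else 0))"
      if d: "y1 < d" "d < y2" "d \<noteq> y" for d
    proof (cases "d < y")
      case True
      obtain z1 where z1: "d < z1" "z1 < y" using dense_ex True by blast
      have n: "near t (\<lambda>t'. ((y \<in> X t \<longrightarrow> (\<exists>z. z \<in> X t' \<and> z1 < z \<and> z < y2 \<and> (\<forall>z'. z' \<in> X t' \<and> z1 < z' \<and> z' < y2 \<longrightarrow> z' = z))) \<and>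
          (y \<notin> X t \<longrightarrow> (\<forall>z. z \<in> X t' \<longrightarrow> \<not> (z1 < z \<and> z < y2)))) \<and>
         ((y \<in> X t \<longrightarrow> (\<exists>z. z \<in> X t' \<and> y1 < z \<and> z < y2 \<and> (\<forall>z'. z' \<in> X t' \<and> y1 < z' \<and> z' < y2 \<longrightarrow> z' = z))) \<and>
          (y \<notin> X t \<longrightarrow> (\<forall>z. z \<in> X t' \<longrightarrow> \<not> (y1 < z \<and> z < y2)))))"
        by (rule near_conj; rule rg) (use z1 d y12 in auto)
      show ?thesis
      proof (rule near_mono[OF n])
        fix t' assume *: "((y \<in> X t \<longrightarrow> (\<exists>z. z \<in> X t' \<and> z1 < z \<and> z < y2 \<and> (\<forall>z'. z' \<in> X t' \<and> z1 < z' \<and> z' < y2 \<longrightarrow> z' = z))) \<and>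
          (y \<notin> X t \<longrightarrow> (\<forall>z. z \<in> X t' \<longrightarrow> \<not> (z1 < z \<and> z < y2)))) \<and>
         ((y \<in> X t \<longrightarrow> (\<exists>z. z \<in> X t' \<and> y1 < z \<and> z < y2 \<and> (\<forall>z'. z' \<in> X t' \<and> y1 < z' \<and> z' < y2 \<longrightarrow> z' = z))) \<and>
          (y \<notin> X t \<longrightarrow> (\<forall>z. z \<in> X t' \<longrightarrow> \<not> (y1 < z \<and> z < y2))))"
        have none: "\<not> (y1 < z \<and> z < d)" if z: "z \<in> X t'" for z
        proof
          assume a: "y1 < z \<and> z < d"
          then have z2: "z < y2" using d(2) by auto
          show False
          proof (cases "y \<in> X t")
            case True
            then obtain w where w: "w \<in> X t'" "z1 < w" "w < y2" using * by blast
            have "y1 < w" using w z1 d by order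
            then have "w = z" using * True w z a z2 by blast
            then show False using w a z1 by auto
          next
            case False
            then show False using * z a z2 by blast
          qed
        qed
        have "{z. z \<in> X t' \<and> z < d} = {z. z \<in> X t' \<and> z \<le> y1}"
        proof (rule set_eqI)
          fix z
          show "z \<in> {z. z \<in> X t' \<and> z < d} \<longleftrightarrow> z \<in> {z. z \<in> X t' \<and> z \<le> y1}"
            using none[of z] d(1) by (cases "z \<le> y1") auto
        qed
        then show "card {z. z \<in> X t' \<and> z < d} = c t' + (if y < d \<and> y \<in> X t then 1 else 0)"
          using True unfolding c_def by (simp only: less_not_sym simp_thms if_False add_0_right)
      qed
    next
      case False
      then have yd: "y < d" using d by order
      obtain z2 where z2: "y < z2" "z2 < d" using dense_ex yd by blast
      have n: "near t (\<lambda>t'. ((y \<in> X t \<longrightarrow> (\<exists>z. z \<in> X t' \<and> y1 < z \<and> z < z2 \<and> (\<forall>z'. z' \<in> X t' \<and> y1 < z' \<and> z' < z2 \<longrightarrow> z' = z))) \<and>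
          (y \<notin> X t \<longrightarrow> (\<forall>z. z \<in> X t' \<longrightarrow> \<not> (y1 < z \<and> z < z2)))) \<and>
         ((y \<in> X t \<longrightarrow> (\<exists>z. z \<in> X t' \<and> y1 < z \<and> z < y2 \<and> (\<forall>z'. z' \<in> X t' \<and> y1 < z' \<and> z' < y2 \<longrightarrow> z' = z))) \<and>
          (y \<notin> X t \<longrightarrow> (\<forall>z. z \<in> X t' \<longrightarrow> \<not> (y1 < z \<and> z < y2)))))"
        by (rule near_conj; rule rg) (use z2 d y12 in auto)
      show ?thesis
      proof (rule near_mono[OF n])
        fix t' assume *: "((y \<in> X t \<longrightarrow> (\<exists>z. z \<in> X t' \<and> y1 < z \<and> z < z2 \<and> (\<forall>z'. z' \<in> X t' \<and> y1 < z' \<and> z' < z2 \<longrightarrow> z' = z))) \<and>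
          (y \<notin> X t \<longrightarrow> (\<forall>z. z \<in> X t' \<longrightarrow> \<not> (y1 < z \<and> z < z2)))) \<and>
         ((y \<in> X t \<longrightarrow> (\<exists>z. z \<in> X t' \<and> y1 < z \<and> z < y2 \<and> (\<forall>z'. z' \<in> X t' \<and> y1 < z' \<and> z' < y2 \<longrightarrow> z' = z))) \<and>
          (y \<notin> X t \<longrightarrow> (\<forall>z. z \<in> X t' \<longrightarrow> \<not> (y1 < z \<and> z < y2))))"
        show "card {z. z \<in> X t' \<and> z < d} = c t' + (if y < d \<and> y \<in> X t then 1 else 0)"
        proof (cases "y \<in> X t")
          case True
          then obtain w where w: "w \<in> X t'" "y1 < w" "w < z2" using * by blast
          have wd: "w < d" "w < y2" using w z2 d by order+
          have uniq: "z = w" if "z \<in> X t'" "y1 < z" "z < y2" for z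
            using * True that w wd by blast
          have "{z. z \<in> X t' \<and> z < d} = insert w {z. z \<in> X t' \<and> z \<le> y1}"
          proof (rule set_eqI)
            fix z
            show "z \<in> {z. z \<in> X t' \<and> z < d} \<longleftrightarrow> z \<in> insert w {z. z \<in> X t' \<and> z \<le> y1}"
              using uniq[of z] w(1) wd d(1,2) by (cases "z \<le> y1") auto
          qed
          moreover have "w \<notin> {z. z \<in> X t' \<and> z \<le> y1}" using w by auto
          ultimately show ?thesis using True yd fin' unfolding c_def by simp
        next
          case False
          have "{z. z \<in> X t' \<and> z < d} = {z. z \<in> X t' \<and> z \<le> y1}"
          proof (rule set_eqI)
            fix z
            have "\<not> (z \<in> X t' \<and> y1 < z \<and> z < y2)" using * False by blast
            then show "z \<in> {z. z \<in> X t' \<and> z < d} \<longleftrightarrow> z \<in> {z. z \<in> X t' \<and> z \<le> y1}"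
              using d(1,2) by (cases "z \<le> y1") auto
          qed
          then show ?thesis using False unfolding c_def by simp
        qed
      qed
    qed
    define g0 where "g0 \<longleftrightarrow> near t (\<lambda>t'. c t' = c t)"
    have gg: "good d \<longleftrightarrow> g0" if d: "y1 < d" "d < y2" "d \<noteq> y" for d
    proof
      assume "good d"
      from near_conj[OF this[unfolded good_def] cnt[OF d]] near_self[OF cnt[OF d]]
      show g0 unfolding g0_def by (elim near_mono) auto
    next
      assume g0
      from near_conj[OF this[unfolded g0_def] cnt[OF d]] near_self[OF cnt[OF d]]
      show "good d" unfolding good_def by (elim near_mono) auto
    qed
    have "S d \<longleftrightarrow> g0" if d: "y1 < d" "d < y2" for d
    proof
      assume "S d"
      then obtain d' where d': "d < d'" "\<forall>d''. d < d'' \<and> d'' < d' \<longrightarrow> good d''" unfolding S_def by blast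
      define m where "m = (if d < y then min (min d' y2) y else min d' y2)"
      have "d < m" using d d' unfolding m_def by auto
      then obtain d'' where d'': "d < d''" "d'' < m" using dense_ex by blast
      have "d'' < d'" "d'' < y2" "d'' \<noteq> y" using d'' unfolding m_def by (auto split: if_splits)
      then show g0 using gg[of d''] d' d'' d by auto
    next
      assume g0: g0
      show "S d" unfolding S_def
      proof (rule exI[of _ "if d < y then y else y2"], intro conjI allI impI)
        show "d < (if d < y then y else y2)" using d by auto
        fix d'' assume d'': "d < d'' \<and> d'' < (if d < y then y else y2)"
        then have "y1 < d''" "d'' < y2" "d'' \<noteq> y" using d y12 by (auto split: if_splits)
        then show "good d''" using gg g0 by blast
      qed
    qed
    then show ?thesis using y12 by (intro exI[of _ y1] exI[of _ y2]) simp
  qed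
  obtain lo where lo: "near t (\<lambda>t'. \<forall>z. z \<in> X t' \<longrightarrow> \<not> z < lo)"
    using t unfolding bad_def reg_bot_def near_def by blast
  obtain hi where hi: "near t (\<lambda>t'. \<forall>z. z \<in> X t' \<longrightarrow> \<not> hi < z)"
    using t unfolding bad_def reg_top_def near_def by blast
  have low: "good d" if "d < lo" for d unfolding good_def
  proof -
    have e: "{y. y \<in> X t' \<and> y < d} = {}" if "\<forall>z. z \<in> X t' \<longrightarrow> \<not> z < lo" for t'
      using that \<open>d < lo\<close> by (auto dest: less_trans)
    have e0: "{y. y \<in> X t \<and> y < d} = {}" by (rule e[OF near_self[OF lo]])
    show "near t (\<lambda>t'. card {y. y \<in> X t' \<and> y < d} = card {y. y \<in> X t \<and> y < d})"
      unfolding e0 by (rule near_mono[OF lo]) (simp only: e)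
  qed
  obtain l0 where "l0 < lo" using lt_exa by blast
  then have S0: "S l0" unfolding S_def using low by blast
  have "S hi" by (rule locally_constant_imp_constant[OF dS, where J = "\<lambda>_. True", OF _ loc _ _ S0]) auto
  then obtain d' where d': "hi < d'" "\<forall>d''. hi < d'' \<and> d'' < d' \<longrightarrow> good d''" unfolding S_def by blast
  obtain d where dd: "hi < d" "d < d'" using d' dense_ex by blast
  then have "good d" using d' by blast
  have e: "{y. y \<in> X t' \<and> y < d} = X t'" if "\<forall>z. z \<in> X t' \<longrightarrow> \<not> hi < z" for t'
    using that dd(1) by (auto simp: not_less intro: le_less_trans)
  show ?thesis
  proof (rule near_mono[OF near_conj[OF hi \<open>good d\<close>[unfolded good_def]]])
    fix t' assume *: "(\<forall>z. z \<in> X t' \<longrightarrow> \<not> hi < z) \<and> card {y. y \<in> X t' \<and> y < d} = card {y. y \<in> X t \<and> y < d}"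
    have e': "{y. y \<in> X t' \<and> y < d} = X t'" by (rule e) (use * in blast)
    show "card (X t') = card (X t)" using *[THEN conjunct2] unfolding e' e[OF near_self[OF hi]] .
  qed
qed

end

section \<open>Finite sets depending on several parameters\<close>

context omin
begin

lemma dge_full_Suc: "dge (Suc r) (Suc r) X \<Longrightarrow> dge r r {w. infinite {x. x # w \<in> X}}"
  using dge_le[of r "Suc r"] by auto

text \<open>For the first coordinate this is the recursion of \<open>dge\<close>. For a later one,
  an infinite line in the set of bases with infinite fibre would give an infinite line in
  \<open>Z\<close> by \<open>infinite_fibre\<close>. So this set of bases has finite lines too and
  is not of full dimension.\<close>

lemma not_full_dim_if_finite_lines:
  "dset m Z \<Longrightarrow> i < m \<Longrightarrow> (\<And>u. length u = m \<Longrightarrow> finite {t. u[i := t] \<in> Z}) \<Longrightarrow> \<not> dge m m Z"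
proof (induction i arbitrary: m Z)
  case 0
  then obtain m' where m: "m = Suc m'" by (cases m) auto
  show ?case
  proof
    assume "dge m m Z"
    then have "dge m' m' {w. infinite {x. x # w \<in> Z}}" using dge_le[of m' "Suc m'"] m by auto
    then obtain w where w: "length w = m'" "infinite {x. x # w \<in> Z}" using dge_nonempty by blast
    have "finite {t. (undefined # w)[0 := t] \<in> Z}" using 0(3)[of "undefined # w"] w m by simp
    then show False using w by simp
  qed
next
  case (Suc i)
  then obtain m' where m: "m = Suc m'" by (cases m) auto
  note [dfn] = dsetD[OF Suc.prems(1)[unfolded m]]
  define Y where "Y = {w. infinite {x. x # w \<in> Z}}"
  have dY: "dset m' Y" unfolding Y_def by (rule dfn)+
  have "finite {t. w[i := t] \<in> Y}" if w: "length w = m'" for w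
  proof (rule ccontr)
    assume "infinite {t. w[i := t] \<in> Y}"
    then have inf: "infinite {t. infinite {x. x # w[i := t] \<in> Z}}" by (simp add: Y_def)
    have "drel1 UNIV (\<lambda>_ t x. x # w[i := t] \<in> Z)" using w by - (rule dfn | simp)+
    from infinite_fibre[OF this inf] obtain x where x: "infinite {t. x # w[i := t] \<in> Z}" by blast
    have "finite {t. (x # w)[Suc i := t] \<in> Z}" using Suc.prems(3)[of "x # w"] w m by simp
    then show False using x by simp
  qed
  then have "\<not> dge m' m' Y" using Suc.IH[OF dY] Suc.prems(2) m by auto
  then show ?case using dge_le[of m' "Suc m'"] unfolding m Y_def by auto
qed

definition unif_fin :: "nat \<Rightarrow> bool" where
  "unif_fin m \<longleftrightarrow> (\<forall>X :: 'a list \<Rightarrow> 'a set. dcurve UNIV m (\<lambda>_ y u. y \<in> X u) \<longrightarrow> (\<forall>u. length u = m \<longrightarrow> finite (X u)) \<longrightarrow>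
     (\<exists>N. \<forall>u. length u = m \<longrightarrow> card (X u) \<le> N))"

lemma unif_finD:
  assumes "unif_fin m" "dcurve UNIV m (\<lambda>_ y u. y \<in> X u)" "\<And>u. length u = m \<Longrightarrow> finite (X u)"
  shows "\<exists>N. \<forall>u. length u = m \<longrightarrow> card (X u) \<le> N"
  using assms unfolding unif_fin_def by blast

text \<open>Over a small set one parameter can be absorbed. Where the fibre of \<open>V\<close> is
  finite, the sets above it are united into one finite set over \<open>m\<close> parameters. The
  bases with infinite fibre form a small set in fewer coordinates, and the released coordinate joins
  the unrestricted block \<open>v\<close>.\<close>

lemma bounded_over_small_set:
  assumes uf: "unif_fin m" and X: "dcurve UNIV (Suc m) (\<lambda>_ y u. y \<in> X u)"
    and fin: "\<And>u. length u = Suc m \<Longrightarrow> finite (X u)"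
  shows "dset r V \<Longrightarrow> \<not> dge r r V \<Longrightarrow> s + r = Suc m \<Longrightarrow>
    \<exists>N. \<forall>v w. length v = s \<and> length w = r \<and> w \<in> V \<longrightarrow> card (X (v @ w)) \<le> N"
proof (induction r arbitrary: s V)
  case 0
  then show ?case by auto
next
  case (Suc r)
  have sr: "s + r = m" using Suc.prems(3) by simp
  note [dfn] = dsetD[OF Suc.prems(1)] dscurveD[OF X]
  \<comment> \<open>The first conjunct empties \<open>Y u\<close> where the fibre is infinite, so
    that \<open>unif_fin m\<close> applies to all \<open>u\<close>.\<close>
  define Y where "Y u = {y. finite {x. x # drop s u \<in> V} \<and> (\<exists>x. x # drop s u \<in> V \<and> y \<in> X (take s u @ x # drop s u))}" for u
  have dY: "dcurve UNIV m (\<lambda>_ y u. y \<in> Y u)" unfolding Y_def using sr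
    by - (rule dfn list_take list_drop[where m = r] | simp)+
  have finY: "finite (Y u)" if "length u = m" for u
  proof (cases "finite {x. x # drop s u \<in> V}")
    case True
    have "Y u \<subseteq> (\<Union>x\<in>{x. x # drop s u \<in> V}. X (take s u @ x # drop s u))" unfolding Y_def by auto
    moreover have "finite (\<Union>x\<in>{x. x # drop s u \<in> V}. X (take s u @ x # drop s u))"
      using True that sr by (intro finite_UN_I fin) auto
    ultimately show ?thesis by (rule finite_subset)
  qed (simp add: Y_def)
  obtain N1 where N1: "\<forall>u. length u = m \<longrightarrow> card (Y u) \<le> N1" using unif_finD[OF uf dY finY] by blast
  define V' where "V' = {w. infinite {x. x # w \<in> V}}"
  have dV': "dset r V'" unfolding V'_def by (rule dfn)+
  have "\<not> dge r r V'" using Suc.prems(2) unfolding V'_def by auto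
  from Suc.IH[OF dV' this, of "Suc s"] sr obtain N2 where
    N2: "\<forall>v w. length v = Suc s \<and> length w = r \<and> w \<in> V' \<longrightarrow> card (X (v @ w)) \<le> N2" by auto
  have "card (X (v @ w)) \<le> max N1 N2" if vw: "length v = s" "length w = Suc r" "w \<in> V" for v w
  proof -
    obtain x w' where w: "w = x # w'" "length w' = r" using vw by (auto simp: length_Suc_conv)
    show ?thesis
    proof (cases "w' \<in> V'")
      case True
      then have "card (X ((v @ [x]) @ w')) \<le> N2" using N2 vw w by (metis length_append_singleton)
      then show ?thesis using w by simp
    next
      case False
      have l: "length (v @ w') = m" using vw w sr by simp
      have "X (v @ w) \<subseteq> Y (v @ w')" using False vw w unfolding V'_def Y_def by auto
      then have "card (X (v @ w)) \<le> card (Y (v @ w'))" by (rule card_mono[OF finY[OF l]])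
      also have "\<dots> \<le> N1" using N1 l by blast
      finally show ?thesis by simp
    qed
  qed
  then show ?case by blast
qed

text \<open>The part of the fibre over \<open>w\<close> that lies strictly between consecutive
  boundary points, \<open>j\<close> of which are below it. It is convex, possibly empty, and
  counting boundary points makes it definable uniformly in \<open>w\<close>.\<close>

definition gap :: "nat \<Rightarrow> 'a list set \<Rightarrow> 'a list \<Rightarrow> 'a set" where
  "gap j W w = {x. x # w \<in> W \<and> x \<notin> bd {x. x # w \<in> W} \<and> ncard j {b. b \<in> bd {x. x # w \<in> W} \<and> b < x}}"

text \<open>Points with equally many boundary points below them have the same ones below them. So
  none lies between the two, and membership in \<open>D\<close> is locally constant in
  between.\<close>

lemma convex_component:
  assumes D: "dset1 D" and x: "x \<in> D" "x \<notin> bd D" "x' \<in> D" "x' \<notin> bd D" and z: "x < z" "z < x'"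
    and n: "card {b. b \<in> bd D \<and> b < x} = card {b. b \<in> bd D \<and> b < x'}"
  shows "z \<in> D" "z \<notin> bd D" "{b. b \<in> bd D \<and> b < z} = {b. b \<in> bd D \<and> b < x}"
proof -
  have f: "finite {b. b \<in> bd D \<and> b < y}" for y using finite_bd[OF D] by simp
  have eq: "{b. b \<in> bd D \<and> b < x} = {b. b \<in> bd D \<and> b < x'}"
    by (rule card_subset_eq[OF f _ n]) (use z in auto)
  then have nob: "y \<notin> bd D" if "x \<le> y" "y \<le> x'" for y
    using that x(4) by (cases "y = x'") (auto dest!: set_eq_iff[THEN iffD1, rule_format, of _ _ y])
  show "z \<notin> bd D" using nob z by auto
  have dD: "dfn UNIV (\<lambda>e. e 0 \<in> D)" using D by (simp add: dfam1_def)
  show "z \<in> D"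
  proof (rule locally_constant_imp_constant[OF dD, where J = "\<lambda>y. x \<le> y \<and> y \<le> x'"])
    fix y assume "x \<le> y \<and> y \<le> x'"
    then have "y \<notin> bd D" using nob by blast
    then show "\<exists>u v. u < y \<and> y < v \<and> (\<forall>ya. u < ya \<and> ya < v \<and> x \<le> ya \<and> ya \<le> x' \<longrightarrow> (ya \<in> D \<longleftrightarrow> y \<in> D))"
      by (rule not_bdD) blast
  next
    show "x \<in> D" by fact
  qed (use z in auto)
  show "{b. b \<in> bd D \<and> b < z} = {b. b \<in> bd D \<and> b < x}"
  proof (rule set_eqI)
    fix b show "b \<in> {b. b \<in> bd D \<and> b < z} \<longleftrightarrow> b \<in> {b. b \<in> bd D \<and> b < x}"
    proof (cases "b < x")
      case False
      then have "\<not> (b \<in> bd D \<and> b < z)" using nob[of b] z by (meson less_imp_le less_trans not_less)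
      then show ?thesis using False by simp
    qed (use z in auto)
  qed
qed

lemma gap_convex:
  assumes W: "dset (Suc r) W" and w: "length w = r" and x: "x \<in> gap j W w" "x' \<in> gap j W w" and z: "x < z" "z < x'"
  shows "z \<in> gap j W w"
proof -
  note [dfn] = dsetD[OF W]
  have D: "dset1 {x. x # w \<in> W}" using w by - (rule dfn | simp)+
  have n: "card {b. b \<in> bd {x. x # w \<in> W} \<and> b < x} = card {b. b \<in> bd {x. x # w \<in> W} \<and> b < x'}"
    using x unfolding gap_def ncard_def by simp
  from convex_component[OF D _ _ _ _ z n] x show ?thesis unfolding gap_def by simp
qed

text \<open>Induction on \<open>r\<close>: on the gaps of \<open>W\<close> above a base point \<open>w\<close> the function \<open>\<nu>\<close> is constant, so it descends
  to the base; the descended function is locally constant along lines off a set of smaller dimension.\<close>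

lemma bounded_off_small_set:
  assumes "\<And>r'. r' < r \<Longrightarrow> unif_fin r'" "dset r W" "\<And>j. dset r {w. w \<in> W \<and> \<nu> w = (j :: nat)}"
    and "\<And>w i. length w = r \<Longrightarrow> w \<in> W \<Longrightarrow> i < r \<Longrightarrow> near (w ! i) (\<lambda>t. w[i := t] \<in> W \<longrightarrow> \<nu> (w[i := t]) = \<nu> w)"
  shows "\<exists>V N. dset r V \<and> \<not> dge r r V \<and> (\<forall>w. length w = r \<and> w \<in> W \<and> w \<notin> V \<longrightarrow> \<nu> w \<le> N)"
  using assms
proof (induction r arbitrary: W \<nu>)
  case 0
  have "dset 0 {w. False}" by (rule dfn)+
  then show ?case by (intro exI[of _ "{w. False}"] exI[of _ "\<nu> []"]) auto
next
  case (Suc r)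
  note W = Suc.prems(2) and lev = Suc.prems(3) and LC = Suc.prems(4)
  note [dfn] = dsetD[OF W]
  have D: "dset1 {x. x # w \<in> W}" if "length w = r" for w using that by - (rule dfn | simp)+
  have dbd: "dcurve UNIV r (\<lambda>_ x w. x \<in> bd {x. x # w \<in> W})" unfolding bd_def by (rule dfn)+
  note [dfn] = dscurveD[OF dbd]
  have dgap: "dcurve UNIV r (\<lambda>_ x w. x \<in> gap j W w)" for j unfolding gap_def by (rule dfn)+
  note [dfn] = dscurveD[OF dgap]
  have "\<exists>N. \<forall>w. length w = r \<longrightarrow> card (bd {x. x # w \<in> W}) \<le> N"
    by (rule unif_finD[OF Suc.prems(1)[OF lessI] dbd]) (rule finite_bd[OF D])
  then obtain N0 where N0: "\<forall>w. length w = r \<longrightarrow> card (bd {x. x # w \<in> W}) \<le> N0" by blast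
  have gap_ex: "\<exists>j<Suc N0. x \<in> gap j W w" if "length w = r" "x # w \<in> W" "x \<notin> bd {x. x # w \<in> W}" for x w
  proof -
    have f: "finite (bd {x. x # w \<in> W})" using finite_bd[OF D] that by blast
    then have "card {b. b \<in> bd {x. x # w \<in> W} \<and> b < x} \<le> card (bd {x. x # w \<in> W})" by (intro card_mono) auto
    then have "card {b. b \<in> bd {x. x # w \<in> W} \<and> b < x} < Suc N0" using N0[rule_format, OF that(1)] by linarith
    then show ?thesis using that f unfolding gap_def ncard_def by auto
  qed
  have gapW: "x # w \<in> W" if "x \<in> gap j W w" for x w j using that by (simp add: gap_def)
  have const: "\<nu> (x' # w) = \<nu> (x # w)" if w: "length w = r" and x: "x \<in> gap j W w" "x' \<in> gap j W w" for x x' w j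
  proof -
    note [dfn] = dsetD[OF lev, unfolded mem_Collect_eq]
    have dQ: "dfn UNIV (\<lambda>e. e 0 # w \<in> W \<and> \<nu> (e 0 # w) = \<nu> (x # w))" using w by - (rule dfn list_const | simp)+
    have "x' # w \<in> W \<and> \<nu> (x' # w) = \<nu> (x # w)"
    proof (rule locally_constant_imp_constant[of "\<lambda>y. y # w \<in> W \<and> \<nu> (y # w) = \<nu> (x # w)", OF dQ, where J = "\<lambda>y. y \<in> gap j W w" and a = x])
      fix y assume y: "y \<in> gap j W w"
      have "near y (\<lambda>t. t # w \<in> W \<longrightarrow> \<nu> (t # w) = \<nu> (y # w))"
        using LC[of "y # w" 0] gapW[OF y] w by simp
      then show "\<exists>u v. u < y \<and> y < v \<and> (\<forall>t. u < t \<and> t < v \<and> t \<in> gap j W w \<longrightarrow>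
        ((t # w \<in> W \<and> \<nu> (t # w) = \<nu> (x # w)) \<longleftrightarrow> (y # w \<in> W \<and> \<nu> (y # w) = \<nu> (x # w))))"
        unfolding near_def using gapW y by (metis (no_types, lifting))
    qed (use gap_convex[OF W w] x gapW in blast)+
    then show ?thesis by blast
  qed
  have step: "\<exists>V N. dset (Suc r) V \<and> \<not> dge (Suc r) (Suc r) V \<and>
      (\<forall>x w. length w = r \<and> x \<in> gap j W w \<and> x # w \<notin> V \<longrightarrow> \<nu> (x # w) \<le> N)" for j
  proof -
    define W' where "W' = {w. \<exists>x. x \<in> gap j W w}"
    define \<nu>' where "\<nu>' w = \<nu> ((SOME x. x \<in> gap j W w) # w)" for w
    have \<nu>': "\<nu>' w = \<nu> (x # w)" if "length w = r" "x \<in> gap j W w" for w x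
      unfolding \<nu>'_def by (rule const[OF that(1) that(2)]) (use that in \<open>auto intro: someI\<close>)
    have dW': "dset r W'" unfolding W'_def by (rule dfn)+
    note [dfn] = dsetD[OF dW']
    \<comment> \<open>\<open>Z i\<close> collects the points \<open>x\<close> of the gap over
      \<open>w\<close> that are missing from nonempty gaps over bases arbitrarily close to
      \<open>w\<close> in direction \<open>i\<close>. On a line in this direction that happens only
      at boundary points of a definable set, so \<open>Z i\<close> is small.\<close>
    define Z where "Z i = {v. hd v \<in> gap j W (tl v) \<and>
      \<not> near (tl v ! i) (\<lambda>t. (tl v)[i := t] \<in> W' \<longrightarrow> hd v \<in> gap j W ((tl v)[i := t]))}" for i
    have dZ: "dset (Suc r) (Z i)" if "i < r" for i unfolding Z_def near_def using that
      by - (rule dfn elt_nth[OF list_tl] | simp)+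
    have Zsmall: "\<not> dge (Suc r) (Suc r) (Z i)" if i: "i < r" for i
    proof (rule not_full_dim_if_finite_lines[OF dZ[OF i], of "Suc i"])
      fix u :: "'a list" assume "length u = Suc r"
      then obtain x w where u: "u = x # w" and w: "length w = r" by (auto simp: length_Suc_conv)
      have dA: "dset1 {t. x \<in> gap j W (w[i := t])}" using w by - (rule dfn | simp)+
      have "{t. u[Suc i := t] \<in> Z i} \<subseteq> bd {t. x \<in> gap j W (w[i := t])}"
      proof
        fix t assume t: "t \<in> {t. u[Suc i := t] \<in> Z i}"
        show "t \<in> bd {t. x \<in> gap j W (w[i := t])}"
        proof (rule ccontr)
          assume "t \<notin> bd {t. x \<in> gap j W (w[i := t])}"
          then obtain p q where pq: "p < t" "t < q" "\<forall>y. p < y \<and> y < q \<longrightarrow>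
            (y \<in> {t. x \<in> gap j W (w[i := t])} \<longleftrightarrow> t \<in> {t. x \<in> gap j W (w[i := t])})" by (rule not_bdD)
          have "x \<in> gap j W (w[i := t])" using t u unfolding Z_def by simp
          then have "near t (\<lambda>y. x \<in> gap j W (w[i := y]))" unfolding near_def using pq by blast
          then have "near t (\<lambda>y. w[i := y] \<in> W' \<longrightarrow> x \<in> gap j W (w[i := y]))" by (rule near_mono) simp
          then show False using t u w i unfolding Z_def by simp
        qed
      qed
      then show "finite {t. u[Suc i := t] \<in> Z i}" using finite_bd[OF dA] finite_subset by blast
    qed (use i in simp)
    \<comment> \<open>Kept are the bases with a point \<open>x\<close> of the gap that is stable in
      all directions; this \<open>x\<close> witnesses that \<nu>' is locally constant there.\<close>
    define W'' where "W'' = {w. w \<in> W' \<and> (\<exists>x. x \<in> gap j W w \<and> (\<forall>i<r. x # w \<notin> Z i))}"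
    have dZ': "dset (Suc r) {v. \<exists>i<r. v \<in> Z i}" by (rule dfn dsetD[OF dZ] | simp)+
    note [dfn] = dsetD[OF lev, unfolded mem_Collect_eq]
    have dW'': "dset r W''" unfolding W''_def by (rule dfn dsetD[OF dZ] | assumption)+
    note [dfn] = dsetD[OF dW'']
    have lev': "dset r {w. w \<in> W'' \<and> \<nu>' w = c}" for c
    proof -
      have "dset r {w. w \<in> W'' \<and> (\<exists>x. x \<in> gap j W w \<and> (x # w \<in> W \<and> \<nu> (x # w) = c))}" by (rule dfn)+
      then show ?thesis unfolding dfam_def
      proof (rule dfn_cong)
        fix e :: "nat \<Rightarrow> 'a"
        have l: "length (map e [0..<r]) = r" by simp
        show "map e [0..<r] \<in> {w. w \<in> W'' \<and> (\<exists>x. x \<in> gap j W w \<and> (x # w \<in> W \<and> \<nu> (x # w) = c))} \<longleftrightarrow>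
          map e [0..<r] \<in> {w. w \<in> W'' \<and> \<nu>' w = c}"
          using \<nu>'[OF l] gapW unfolding W''_def mem_Collect_eq by metis
      qed
    qed
    have LC': "near (w ! i) (\<lambda>t. w[i := t] \<in> W'' \<longrightarrow> \<nu>' (w[i := t]) = \<nu>' w)"
      if w: "length w = r" "w \<in> W''" "i < r" for w i
    proof -
      obtain x where x: "x \<in> gap j W w" "\<forall>i<r. x # w \<notin> Z i" using w(2) unfolding W''_def by blast
      have n1: "near (w ! i) (\<lambda>t. w[i := t] \<in> W' \<longrightarrow> x \<in> gap j W (w[i := t]))"
        using x w(3) unfolding Z_def by auto
      have n2: "near (w ! i) (\<lambda>t. x # w[i := t] \<in> W \<longrightarrow> \<nu> (x # w[i := t]) = \<nu> (x # w))"
        using LC[of "x # w" "Suc i"] gapW[OF x(1)] w by simp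
      show ?thesis
      proof (rule near_mono[OF near_conj[OF n1 n2]], intro impI)
        fix t assume *: "(w[i := t] \<in> W' \<longrightarrow> x \<in> gap j W (w[i := t])) \<and> (x # w[i := t] \<in> W \<longrightarrow> \<nu> (x # w[i := t]) = \<nu> (x # w))"
          and "w[i := t] \<in> W''"
        then have "x \<in> gap j W (w[i := t])" unfolding W''_def by blast
        then show "\<nu>' (w[i := t]) = \<nu>' w" using * gapW \<nu>'[of "w[i := t]" x] \<nu>'[of w x] x w by simp
      qed
    qed
    have "unif_fin r'" if "r' < r" for r' using Suc.prems(1) that by simp
    from Suc.IH[OF this dW'' lev' LC'] obtain V' N' where V': "dset r V'" "\<not> dge r r V'"
      "\<forall>w. length w = r \<and> w \<in> W'' \<and> w \<notin> V' \<longrightarrow> \<nu>' w \<le> N'" by blast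
    note [dfn] = dsetD[OF V'(1)] dsetD[OF dZ', unfolded mem_Collect_eq]
    \<comment> \<open>The points over the exceptional set of the induction hypothesis and the
      unstable points. Over a base outside \<open>W''\<close> every point of the gap is unstable, so
      nothing else has to be excluded.\<close>
    define V where "V = {v. tl v \<in> V'} \<union> {v. \<exists>i<r. v \<in> Z i}"
    have V_eq: "V = {v. tl v \<in> V' \<or> (\<exists>i<r. v \<in> Z i)}" unfolding V_def by blast
    have "dset (Suc r) V" unfolding V_eq by (rule dfn_mem_Collect dfamI dfn_disj dsetD[OF V'(1)] dsetD[OF dZ', unfolded mem_Collect_eq] dfn)+
    moreover have "\<not> dge (Suc r) (Suc r) V"
    proof -
      have "\<not> dge (Suc r) (Suc r) {v. tl v \<in> V'}"
      proof
        assume "dge (Suc r) (Suc r) {v. tl v \<in> V'}"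
        from dge_full_Suc[OF this] have "dge r r V'"
        proof (rule dge_mono)
          fix w assume "w \<in> {w. infinite {x. x # w \<in> {v. tl v \<in> V'}}}"
          then show "w \<in> V'" by (cases "w \<in> V'") simp_all
        qed
        then show False using V'(2) by blast
      qed
      moreover have "\<not> dge (Suc r) (Suc r) {v. \<exists>i<r. v \<in> Z i}"
      proof
        assume *: "dge (Suc r) (Suc r) {v. \<exists>i<r. v \<in> Z i}"
        have "{v. \<exists>i<r. v \<in> Z i} = (\<Union>i\<in>{..<r}. Z i)" by auto
        then show False using dge_UN[of "{..<r}"] * Zsmall by (metis finite_lessThan lessThan_iff)
      qed
      ultimately show ?thesis unfolding V_def dge_Un by blast
    qed
    moreover have "\<nu> (x # w) \<le> N'" if "length w = r" "x \<in> gap j W w" "x # w \<notin> V" for x w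
    proof -
      have "w \<in> W''" using that unfolding W''_def W'_def V_def by auto
      moreover have "w \<notin> V'" using that unfolding V_def by auto
      ultimately show ?thesis using V'(3) \<nu>'[OF that(1,2)] that by auto
    qed
    ultimately show ?thesis by blast
  qed
  then have "\<forall>j. \<exists>VN. dset (Suc r) (fst VN) \<and> \<not> dge (Suc r) (Suc r) (fst VN) \<and>
      (\<forall>x w. length w = r \<and> x \<in> gap j W w \<and> x # w \<notin> fst VN \<longrightarrow> \<nu> (x # w) \<le> snd VN)" by simp
  from choice[OF this] obtain VN where VN: "\<forall>j. dset (Suc r) (fst (VN j)) \<and> \<not> dge (Suc r) (Suc r) (fst (VN j)) \<and>
      (\<forall>x w. length w = r \<and> x \<in> gap j W w \<and> x # w \<notin> fst (VN j) \<longrightarrow> \<nu> (x # w) \<le> snd (VN j))"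
    by blast
  have dVN: "dset (Suc r) (fst (VN j))" for j using VN by blast
  define B where "B = {v. hd v \<in> bd {x. x # tl v \<in> W}}"
  \<comment> \<open>Boundary points, finitely many in each fibre, are added to the exceptional sets
    of the gaps. The uniform bound \<open>N0\<close> keeps the union over the gaps finite.\<close>
  define V where "V = B \<union> (\<Union>j\<in>{..<Suc N0}. fst (VN j))"
  have V_eq: "V = {v. hd v \<in> bd {x. x # tl v \<in> W} \<or> (\<exists>j<Suc N0. v \<in> fst (VN j))}" unfolding V_def B_def by auto
  have "dset (Suc r) V" unfolding V_eq
    by (rule dfamI dfn_mem_Collect dfn_disj dscurveD[OF dbd] dfn_ex_less dsetD[OF dVN] | rule dfn)+
  moreover have "\<not> dge (Suc r) (Suc r) V"
  proof
    assume "dge (Suc r) (Suc r) V"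
    then consider "dge (Suc r) (Suc r) B" | "dge (Suc r) (Suc r) (\<Union>j\<in>{..<Suc N0}. fst (VN j))" unfolding V_def dge_Un by blast
    then show False
    proof cases
      case 1
      then have "dge r r {w. infinite {x. x # w \<in> B}}" by (rule dge_full_Suc)
      then obtain w where w: "length w = r" "infinite {x. x # w \<in> B}" using dge_nonempty by blast
      then show False using finite_bd[OF D[OF w(1)]] unfolding B_def by simp
    next
      case 2
      then show False using dge_UN[of "{..<Suc N0}"] VN by blast
    qed
  qed
  moreover have "\<nu> v \<le> (\<Sum>j<Suc N0. snd (VN j))" if v: "length v = Suc r" "v \<in> W" "v \<notin> V" for v
  proof -
    obtain x w where xw: "v = x # w" "length w = r" using v by (auto simp: length_Suc_conv)
    have "x \<notin> bd {x. x # w \<in> W}" using v xw unfolding V_def B_def by auto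
    then obtain j where j: "j < Suc N0" "x \<in> gap j W w" using gap_ex xw v by blast
    then have "\<nu> v \<le> snd (VN j)" using VN xw v unfolding V_def by blast
    also have "\<dots> \<le> (\<Sum>j<Suc N0. snd (VN j))" using j by (intro member_le_sum) auto
    finally show ?thesis .
  qed
  ultimately show ?case by blast
qed

text \<open>Off the sets \<open>Bd i\<close> the cardinality is locally constant in each coordinate
  separately, and \<open>Bd i\<close> meets every line in direction \<open>i\<close> in a finite
  set. So the cardinality is bounded off a small set; over small sets the case of one parameter less
  gives a bound.\<close>

lemma uniform_finiteness: "unif_fin m"
proof (induction m rule: less_induct)
  case (less m)
  show ?case unfolding unif_fin_def
  proof (intro allI impI)
    fix X :: "'a list \<Rightarrow> 'a set"
    assume X: "dcurve UNIV m (\<lambda>_ y u. y \<in> X u)" and fin: "\<forall>u. length u = m \<longrightarrow> finite (X u)"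
    show "\<exists>N. \<forall>u. length u = m \<longrightarrow> card (X u) \<le> N"
    proof (cases m)
      case 0
      then show ?thesis by auto
    next
      case (Suc m')
      note [dfn] = dscurveD[OF X]
      define Bd where "Bd i = {u. u ! i \<in> bad (\<lambda>t. X (u[i := t]))}" for i
      have dB: "dset m (Bd i)" if "i < m" for i
        unfolding Bd_def bad_def reg_bot_def reg_top_def reg_def near_def using that by - (rule dfn elt_nth | simp)+
      have dl: "drel1 UNIV (\<lambda>_ t y. y \<in> X (u[i := t]))" if "length u = m" for u i
        using that by - (rule dfn | simp)+
      have fl: "finite (X (u[i := t]))" if "length u = m" for u i t using fin that by simp
      have small: "\<not> dge m m (Bd i)" if i: "i < m" for i
      proof (rule not_full_dim_if_finite_lines[OF dB[OF i] i])
        fix u :: "'a list" assume u: "length u = m"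
        have "{t. u[i := t] \<in> Bd i} = bad (\<lambda>t. X (u[i := t]))" unfolding Bd_def using u i by simp
        then show "finite {t. u[i := t] \<in> Bd i}" using finite_bad[OF dl[OF u] fl[OF u]] by simp
      qed
      define W where "W = {u. \<forall>i<m. u \<notin> Bd i}"
      have dW: "dset m W" unfolding W_def by (rule dfn dsetD[OF dB] | assumption)+
      note [dfn] = dsetD[OF dW]
      have lev: "dset m {w. w \<in> W \<and> card (X w) = j}" for j
      proof -
        have "dset m {w. w \<in> W \<and> ncard j {y. y \<in> X w}}" by (rule dfn)+
        then show ?thesis unfolding dfam_def by (rule dfn_cong) (use fin in \<open>simp add: ncard_def\<close>)
      qed
      have LC: "near (w ! i) (\<lambda>t. w[i := t] \<in> W \<longrightarrow> card (X (w[i := t])) = card (X w))"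
        if w: "length w = m" "w \<in> W" "i < m" for w i
      proof -
        have "w ! i \<notin> bad (\<lambda>t. X (w[i := t]))" using w unfolding W_def Bd_def by blast
        from card_locally_constant[OF dl[OF w(1)] fl[OF w(1)] this] show ?thesis
          by (rule near_mono) simp
      qed
      obtain V N where V: "dset m V" "\<not> dge m m V" "\<forall>w. length w = m \<and> w \<in> W \<and> w \<notin> V \<longrightarrow> card (X w) \<le> N"
        using bounded_off_small_set[OF less.IH dW lev LC] by blast
      have uf: "unif_fin m'" using less.IH Suc by simp
      have X': "dcurve UNIV (Suc m') (\<lambda>_ y u. y \<in> X u)" and fin': "\<And>u. length u = Suc m' \<Longrightarrow> finite (X u)" using X fin Suc by auto
      have sm: "\<exists>N. \<forall>w. length w = m \<and> w \<in> S \<longrightarrow> card (X w) \<le> N" if "dset m S" "\<not> dge m m S" for S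
        using bounded_over_small_set[OF uf X' fin', of m S 0] that Suc by auto
      obtain N1 where N1: "\<forall>w. length w = m \<and> w \<in> V \<longrightarrow> card (X w) \<le> N1" using sm V by blast
      have "\<forall>i\<in>{..<m}. \<exists>N. \<forall>w. length w = m \<and> w \<in> Bd i \<longrightarrow> card (X w) \<le> N" using sm dB small by blast
      from bchoice[OF this] obtain N2 where N2: "\<forall>i\<in>{..<m}. \<forall>w. length w = m \<and> w \<in> Bd i \<longrightarrow> card (X w) \<le> N2 i" by blast
      have "card (X w) \<le> N + N1 + (\<Sum>i<m. N2 i)" if w: "length w = m" for w
      proof (cases "w \<in> W")
        case True
        then show ?thesis using V(3) N1 w by (cases "w \<in> V") (auto intro: trans_le_add1)
      next
        case False
        then obtain i where i: "i < m" "w \<in> Bd i" unfolding W_def by blast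
        then have "card (X w) \<le> N2 i" using N2 w by blast
        also have "\<dots> \<le> (\<Sum>i<m. N2 i)" using i by (intro member_le_sum) auto
        finally show ?thesis by simp
      qed
      then show ?thesis by blast
    qed
  qed
qed

text \<open>The index is an environment, of which only \<open>q\<close> slots matter by
  \<open>dfn_finite_dep\<close>. Taking \<open>q\<close> as a successor provides
  \<open>u ! 0\<close> as a filler for the other slots.\<close>

lemma uniform_bound:
  assumes d: "dfam1 A X" and fin: "\<And>e. finite (X e)"
  obtains N where "\<And>e. card (X e) \<le> N"
proof -
  obtain q0 where q0: "\<And>e e'. (\<And>i. i < q0 \<Longrightarrow> e i = e' i) \<Longrightarrow> e 0 \<in> X (\<lambda>i. e (Suc i)) \<longleftrightarrow> e' 0 \<in> X (\<lambda>i. e' (Suc i))"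
    using dfn_finite_dep[OF d[unfolded dfam1_def]] by blast
  define q where "q = Suc q0"
  have dep: "X e = X e'" if "\<And>i. i < q \<Longrightarrow> e i = e' i" for e e'
  proof (rule set_eqI)
    fix x show "x \<in> X e \<longleftrightarrow> x \<in> X e'"
      using q0[of "case_nat x e" "case_nat x e'"] that unfolding q_def by (auto split: nat.splits)
  qed
  define Y where "Y u = X (\<lambda>i. if i < q then u ! i else u ! 0)" for u
  have dU: "dfam1 UNIV X" using d unfolding dfam1_def by (rule dfn_mono) simp
  have "env_term UNIV (\<lambda>(e :: nat \<Rightarrow> 'a) i. if i < q then e (Suc i) else e (Suc 0))"
    unfolding env_term_def
  proof
    fix i show "elt_term UNIV (\<lambda>(e :: nat \<Rightarrow> 'a). if i < q then e (Suc i) else e (Suc 0))" by (cases "i < q") (simp_all add: elt_var)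
  qed
  from dfam1D[OF dU elt_var this, of 0]
  have "dfn UNIV (\<lambda>e. e 0 \<in> X (\<lambda>i. if i < q then e (Suc i) else e (Suc 0)))" .
  moreover have "(\<lambda>i. if i < q then e (Suc i) else e (Suc 0)) = (\<lambda>i. if i < q then map (\<lambda>i. e (Suc i)) [0..<q] ! i else map (\<lambda>i. e (Suc i)) [0..<q] ! 0)" for e :: "nat \<Rightarrow> 'a"
    by (auto simp: q_def fun_eq_iff simp del: upt_Suc)
  ultimately have dY: "dcurve UNIV q (\<lambda>_ y u. y \<in> Y u)" unfolding dcurve_def Y_def by simp
  have "finite (Y u)" for u using fin unfolding Y_def by blast
  then obtain N where N: "\<forall>u. length u = q \<longrightarrow> card (Y u) \<le> N"
    using unif_finD[OF uniform_finiteness dY] by blast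
  have "card (X e) \<le> N" for e
  proof -
    have "X e = Y (map e [0..<q])" unfolding Y_def by (rule dep) (simp del: upt_Suc)
    then show ?thesis using N by simp
  qed
  then show ?thesis by (rule that)
qed

text \<open>The entries of all lists in \<open>X e\<close> form a finite set of elements, to which
  \<open>uniform_bound\<close> applies.\<close>

lemma uniform_bound_list:
  assumes d: "dfam A k X" and sub: "\<And>e. X e \<subseteq> tuples k" and fin: "\<And>e. finite (X e)"
  obtains N where "\<And>e. card (X e) \<le> N"
proof -
  note [dfn] = dfamD[OF d]
  define Y where "Y e = {t. \<exists>x. length x = k \<and> x \<in> X e \<and> t \<in> set x}" for e
  have dY: "dfam1 A Y" unfolding Y_def by (rule dfn)+
  have finY: "finite (Y e)" for e
  proof -
    have "Y e \<subseteq> (\<Union>x\<in>X e. set x)" unfolding Y_def by auto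
    then show ?thesis by (rule finite_subset) (simp add: fin)
  qed
  obtain N where N: "\<And>e. card (Y e) \<le> N" by (rule uniform_bound[OF dY finY]) blast
  have "card (X e) \<le> N ^ k" for e
  proof -
    have "X e \<subseteq> {xs. set xs \<subseteq> Y e \<and> length xs = k}" using sub[of e] unfolding Y_def tuples_def by auto
    then have "card (X e) \<le> card {xs. set xs \<subseteq> Y e \<and> length xs = k}"
      by (rule card_mono[OF finite_lists_length_eq[OF finY]])
    also have "\<dots> = card (Y e) ^ k" by (rule card_lists_length_eq[OF finY])
    also have "\<dots> \<le> N ^ k" by (rule power_mono[OF N]) simp
    finally show ?thesis .
  qed
  then show ?thesis by (rule that)
qed

end

section \<open>Linear orders and imaginaries\<close>

definition slo :: "'b set \<Rightarrow> ('b \<Rightarrow> 'b \<Rightarrow> bool) \<Rightarrow> bool" where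
  "slo P r \<longleftrightarrow> (\<forall>x\<in>P. \<not> r x x) \<and> (\<forall>x\<in>P. \<forall>y\<in>P. \<forall>z\<in>P. r x y \<longrightarrow> r y z \<longrightarrow> r x z) \<and>
     (\<forall>x\<in>P. \<forall>y\<in>P. x \<noteq> y \<longrightarrow> r x y \<or> r y x)"

lemma sloI:
  "(\<And>x. x \<in> P \<Longrightarrow> \<not> r x x) \<Longrightarrow> (\<And>x y z. x \<in> P \<Longrightarrow> y \<in> P \<Longrightarrow> z \<in> P \<Longrightarrow> r x y \<Longrightarrow> r y z \<Longrightarrow> r x z) \<Longrightarrow>
   (\<And>x y. x \<in> P \<Longrightarrow> y \<in> P \<Longrightarrow> x \<noteq> y \<Longrightarrow> r x y \<or> r y x) \<Longrightarrow> slo P r"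
  unfolding slo_def by blast

lemma slo_irrefl: "slo P r \<Longrightarrow> x \<in> P \<Longrightarrow> \<not> r x x"
  and slo_trans: "slo P r \<Longrightarrow> x \<in> P \<Longrightarrow> y \<in> P \<Longrightarrow> z \<in> P \<Longrightarrow> r x y \<Longrightarrow> r y z \<Longrightarrow> r x z"
  and slo_total: "slo P r \<Longrightarrow> x \<in> P \<Longrightarrow> y \<in> P \<Longrightarrow> x \<noteq> y \<Longrightarrow> r x y \<or> r y x"
  unfolding slo_def by blast+

lemma slo_asym: "slo P r \<Longrightarrow> x \<in> P \<Longrightarrow> y \<in> P \<Longrightarrow> r x y \<Longrightarrow> \<not> r y x"
  using slo_trans[of P r x y x] slo_irrefl[of P r x] by blast

lemma slo_subset: "slo P r \<Longrightarrow> S \<subseteq> P \<Longrightarrow> slo S r"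
  unfolding slo_def by blast

lemma slo_converse: "slo P r \<Longrightarrow> slo P (\<lambda>x y. r y x)"
  unfolding slo_def by blast

text \<open>Unoriented: the ends may be given in either order, which saves case distinctions, and
  reversing \<open>r\<close> does not change the segment.\<close>

definition seg :: "'b set \<Rightarrow> ('b \<Rightarrow> 'b \<Rightarrow> bool) \<Rightarrow> 'b \<Rightarrow> 'b \<Rightarrow> 'b set" where
  "seg P r x y = {z. z \<in> P \<and> ((z = x \<or> r x z) \<and> (z = y \<or> r z y) \<or> (z = y \<or> r y z) \<and> (z = x \<or> r z x))}"

lemma seg_subset: "seg P r x y \<subseteq> P" by (auto simp: seg_def)

lemma seg_commute: "seg P r x y = seg P r y x" by (auto simp: seg_def)

lemma seg_converse: "seg P (\<lambda>x y. r y x) x y = seg P r x y" by (auto simp: seg_def)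

lemma seg_self: "slo P r \<Longrightarrow> x \<in> P \<Longrightarrow> seg P r x x = {x}"
  using slo_asym[of P r x] by (auto simp: seg_def)

lemma seg_ends: "slo P r \<Longrightarrow> x \<in> P \<Longrightarrow> y \<in> P \<Longrightarrow> x \<in> seg P r x y \<and> y \<in> seg P r x y"
  using slo_total[of P r x y] by (auto simp: seg_def)

lemma seg_Un:
  assumes s: "slo P r" and p: "x \<in> P" "y \<in> P" "z \<in> P" shows "seg P r x z \<subseteq> seg P r x y \<union> seg P r y z"
proof
  fix w assume w: "w \<in> seg P r x z"
  then have wP: "w \<in> P" by (simp add: seg_def)
  show "w \<in> seg P r x y \<union> seg P r y z"
    using w wP slo_total[OF s wP p(2)] unfolding seg_def by blast
qed

lemma seg_order: "slo P r \<Longrightarrow> x \<in> P \<Longrightarrow> y \<in> P \<Longrightarrow> r x y \<Longrightarrow> z \<in> seg P r x y \<Longrightarrow> (z = x \<or> r x z) \<and> (z = y \<or> r z y)"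
  using slo_asym[of P r] slo_trans[of P r] unfolding seg_def by blast

lemma seg_trans:
  assumes s: "slo P r" and p: "x \<in> P" "y \<in> P" and z: "z \<in> seg P r x y" "w \<in> seg P r x y"
  shows "seg P r z w \<subseteq> seg P r x y"
proof -
  have *: "seg P r z w \<subseteq> seg P r x y" if xy: "r x y" and p: "x \<in> P" "y \<in> P" and z: "z \<in> seg P r x y" "w \<in> seg P r x y" for x y
  proof
    fix v assume v: "v \<in> seg P r z w"
    have vP: "v \<in> P" and zP: "z \<in> P" and wP: "w \<in> P" using v z by (auto simp: seg_def)
    have a: "(z = x \<or> r x z) \<and> (z = y \<or> r z y)" "(w = x \<or> r x w) \<and> (w = y \<or> r w y)"
      using seg_order[OF s p xy] z by auto
    have "(v = z \<or> r z v) \<and> (v = w \<or> r v w) \<or> (v = w \<or> r w v) \<and> (v = z \<or> r v z)" using v by (simp add: seg_def)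
    then have "(v = x \<or> r x v) \<and> (v = y \<or> r v y)"
      using a slo_trans[OF s p(1) zP vP] slo_trans[OF s p(1) wP vP] slo_trans[OF s vP wP p(2)] slo_trans[OF s vP zP p(2)] by blast
    then show "v \<in> seg P r x y" using vP by (simp add: seg_def)
  qed
  show ?thesis
  proof (cases "x = y")
    case True
    then have "z = x" "w = x" using z seg_self[OF s p(1)] by auto
    then show ?thesis using True by simp
  next
    case False
    then consider "r x y" | "r y x" using slo_total[OF s p] by blast
    then show ?thesis
    proof cases
      case 1
      then show ?thesis using * p z by blast
    next
      case 2
      then show ?thesis using *[OF 2 p(2,1)] z seg_commute[of P r x y] by simp
    qed
  qed
qed

definition cvx :: "'b set \<Rightarrow> ('b \<Rightarrow> 'b \<Rightarrow> bool) \<Rightarrow> 'b set \<Rightarrow> bool" where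
  "cvx P r C \<longleftrightarrow> C \<subseteq> P \<and> (\<forall>x\<in>C. \<forall>y\<in>C. seg P r x y \<subseteq> C)"

text \<open>The position of \<open>q\<close> relative to the convex sets in \<open>CC\<close>: those
  that contain it and those that lie above it. No convex set separates points of the segment between
  two points with the same pattern, and there are finitely many patterns.\<close>

definition pat :: "('b \<Rightarrow> 'b \<Rightarrow> bool) \<Rightarrow> 'b set set \<Rightarrow> 'b \<Rightarrow> 'b set set \<times> 'b set set" where
  "pat r CC q = ({C \<in> CC. q \<in> C}, {C \<in> CC. \<forall>z\<in>C. r q z})"

lemma finite_pat: "finite CC \<Longrightarrow> finite (range (pat r CC))"
proof -
  assume "finite CC"
  then have "finite (Pow CC \<times> Pow CC)" by simp
  moreover have "range (pat r CC) \<subseteq> Pow CC \<times> Pow CC" by (auto simp: pat_def)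
  ultimately show ?thesis by (rule finite_subset[rotated])
qed

lemma pat_eq_seg:
  assumes s: "slo P r" and C: "C \<in> CC" "cvx P r C" and q: "q \<in> P" "q' \<in> P" and eq: "pat r CC q = pat r CC q'"
    and z: "z \<in> seg P r q q'"
  shows "z \<in> C \<longleftrightarrow> q \<in> C"
proof -
  have mem: "q \<in> C \<longleftrightarrow> q' \<in> C" and below: "(\<forall>z\<in>C. r q z) \<longleftrightarrow> (\<forall>z\<in>C. r q' z)"
    using arg_cong[OF eq, of fst] arg_cong[OF eq, of snd] C(1) unfolding pat_def fst_conv snd_conv by blast+
  have CP: "C \<subseteq> P" using C(2) by (simp add: cvx_def)
  have zP: "z \<in> P" using z by (simp add: seg_def)
  \<comment> \<open>A convex set with a point inside the segment that avoids both ends lies entirely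
    above \<open>a\<close>. By equality of the patterns it lies above \<open>b\<close> as well, but
    one of its points is below \<open>b\<close>.\<close>
  have key: False if ab: "a \<in> P" "b \<in> P" "r a b" and z: "z \<in> seg P r a b" "z \<in> C" and n: "a \<notin> C" "b \<notin> C"
    and below: "(\<forall>z\<in>C. r a z) \<longleftrightarrow> (\<forall>z\<in>C. r b z)" for a b
  proof -
    have zab: "r a z" "r z b" using seg_order[OF s ab z(1)] z n by auto
    have "r a w" if w: "w \<in> C" for w
    proof (rule ccontr)
      assume "\<not> r a w"
      then have "r w a" using slo_total[OF s ab(1), of w] w n CP by blast
      then have "a \<in> seg P r w z" using ab zab by (simp add: seg_def)
      then show False using C(2) w z n unfolding cvx_def by blast
    qed
    then have "r b z" using below z by blast
    then show False using zab slo_asym[OF s ab(2) zP] by blast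
  qed
  show ?thesis
  proof
    assume "q \<in> C"
    then show "z \<in> C" using mem C(2) z unfolding cvx_def by blast
  next
    assume zC: "z \<in> C"
    show "q \<in> C"
    proof (rule ccontr)
      assume n: "q \<notin> C"
      then have n': "q' \<notin> C" using mem by blast
      show False
      proof (cases "q = q'")
        case True
        then show False using z zC n seg_self[OF s q(1)] by auto
      next
        case False
        then consider "r q q'" | "r q' q" using slo_total[OF s q] by blast
        then show False
        proof cases
          case 1
          then show False using key[OF q 1 z zC n n' below] by blast
        next
          case 2
          have "z \<in> seg P r q' q" using z by (simp add: seg_commute)
          then show False using key[OF q(2,1) 2 _ zC n' n below[symmetric]] by blast
        qed
      qed
    qed
  qed
qed

text \<open>Written with length-bounded quantifiers in the shape of the definability rules, because
  it becomes part of a definable relation in \<open>ei_family\<close>.\<close>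

definition equivrel :: "nat \<Rightarrow> ('b list \<Rightarrow> 'b list \<Rightarrow> bool) \<Rightarrow> bool" where
  "equivrel k E \<longleftrightarrow> (\<forall>x. length x = k \<longrightarrow> E x x) \<and>
    (\<forall>x. length x = k \<longrightarrow> (\<forall>y. length y = k \<longrightarrow> (E x y \<longrightarrow> E y x))) \<and>
    (\<forall>x. length x = k \<longrightarrow> (\<forall>y. length y = k \<longrightarrow> (\<forall>z. length z = k \<longrightarrow> (E x y \<longrightarrow> E y z \<longrightarrow> E x z))))"

lemma equivrelD:
  assumes "equivrel k E"
  shows "length x = k \<Longrightarrow> E x x" "length x = k \<Longrightarrow> length y = k \<Longrightarrow> E x y \<Longrightarrow> E y x"
    "length x = k \<Longrightarrow> length y = k \<Longrightarrow> length z = k \<Longrightarrow> E x y \<Longrightarrow> E y z \<Longrightarrow> E x z"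
  using assms[unfolded equivrel_def, THEN conjunct1] assms[unfolded equivrel_def, THEN conjunct2, THEN conjunct1]
    assms[unfolded equivrel_def, THEN conjunct2, THEN conjunct2] by blast+

lemma equivrelI:
  "(\<And>x. length x = k \<Longrightarrow> E x x) \<Longrightarrow> (\<And>x y. length x = k \<Longrightarrow> length y = k \<Longrightarrow> E x y \<Longrightarrow> E y x) \<Longrightarrow>
   (\<And>x y z. length x = k \<Longrightarrow> length y = k \<Longrightarrow> length z = k \<Longrightarrow> E x y \<Longrightarrow> E y z \<Longrightarrow> E x z) \<Longrightarrow> equivrel k E"
  unfolding equivrel_def by blast

section \<open>Elimination of imaginaries for families and with parameters\<close>

context fo
begin

lemma definable_over_if_dfn:
  assumes "dfn {} (\<lambda>e. G (map e [0..<k]))" "k > 0"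
  shows "definable_over M {} k {z \<in> tuples k. G z}"
proof -
  obtain \<chi> where \<chi>: "formula_in M k \<chi>" "\<And>xs. length xs = k \<Longrightarrow> sat M (nth xs) \<chi> \<longleftrightarrow> G xs"
    using dfn_formula[OF assms] by blast
  have "{z \<in> tuples k. G z} = solutions M \<chi> k []"
    using \<chi>(2) by (auto simp: solutions_def tuples_def)
  then show ?thesis unfolding definable_over_def using \<chi>(1) by (intro exI[of _ \<chi>] exI[of _ "[]"]) simp
qed

text \<open>Parameters are turned into variables: the original slots move to the even positions and
  the parameters are put at the odd ones.\<close>

lemma dfn_parameters:
  assumes "dfn UNIV P"
  obtains P' e0 where "dfn {} P'" "\<And>e. P e \<longleftrightarrow> P' (\<lambda>i. if even i then e (i div 2) else e0 (i div 2))"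
proof -
  obtain \<phi> \<rho> where 1: "wf_fml M \<phi>" "\<forall>i. \<rho> i \<in> atoms (UNIV :: 'a set)" "\<forall>e. P e \<longleftrightarrow> sat M (\<lambda>i. atom_val e (\<rho> i)) \<phi>"
    using assms by (elim dfnE)
  define e0 where "e0 i = (case \<rho> i of Inl _ \<Rightarrow> undefined | Inr a \<Rightarrow> a)" for i
  define \<rho>' where "\<rho>' i = (Inl (case \<rho> i of Inl j \<Rightarrow> 2 * j | Inr _ \<Rightarrow> 2 * i + 1) :: nat + 'a)" for i
  show ?thesis
  proof (rule that)
    show "dfn {} (\<lambda>e. sat M (\<lambda>i. atom_val e (\<rho>' i)) \<phi>)"
      using 1(1) by (intro dfnI[of \<phi> \<rho>']) (auto simp: \<rho>'_def)
    fix e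
    have "atom_val e (\<rho> i) = atom_val (\<lambda>i. if even i then e (i div 2) else e0 (i div 2)) (\<rho>' i)" for i
      by (cases "\<rho> i") (auto simp: \<rho>'_def e0_def)
    then show "P e \<longleftrightarrow> sat M (\<lambda>i. atom_val (\<lambda>i. if even i then e (i div 2) else e0 (i div 2)) (\<rho>' i)) \<phi>"
      using 1(3) by simp
  qed
qed

end

locale ngrp = omin M for M :: "('f, 'r, 'a::linorder) fo_structure" +
  assumes ei: "elim_imaginaries M"
begin

text \<open>Elimination of imaginaries concerns a single parameter-free equivalence relation. A
  family becomes one by adjoining to each point the finitely many relevant slots of its index and
  relating only points with the same index. Members that are not equivalence relations are replaced
  by equality; this is the purpose of \<open>E'\<close>.\<close>

lemma ei_family:
  assumes dE: "drel {} k k E"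
  obtains l F where "\<And>e x. length x = k \<Longrightarrow> length (F e x) = l" "drel {} k l (\<lambda>e x z. z = F e x)"
    "\<And>e x y. equivrel k (E e) \<Longrightarrow> length x = k \<Longrightarrow> length y = k \<Longrightarrow> F e x = F e y \<longleftrightarrow> E e x y"
proof -
  define E' where "E' e x y \<longleftrightarrow> x = y \<or> equivrel k (E e) \<and> E e x y" for e x y
  have dE': "drel {} k k E'" unfolding E'_def equivrel_def by (rule dfn drelD[OF dE])+
  obtain q0 where q0: "\<And>e e'. (\<And>i. i < q0 \<Longrightarrow> e i = e' i) \<Longrightarrow>
      E' (\<lambda>i. e (k + (k + i))) (map e [0..<k]) (map (\<lambda>i. e (k + i)) [0..<k]) \<longleftrightarrow>
      E' (\<lambda>i. e' (k + (k + i))) (map e' [0..<k]) (map (\<lambda>i. e' (k + i)) [0..<k])"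
    using dfn_finite_dep[OF dE'[unfolded drel_def]] by blast
  \<comment> \<open>A successor, so that \<open>a ! 0\<close> can fill the remaining slots in
    \<open>env\<close> and the length \<open>m\<close> is positive.\<close>
  define q where "q = Suc q0"
  have dep: "E' e x y \<longleftrightarrow> E' e' x y" if ee: "\<And>i. i < q \<Longrightarrow> e i = e' i" and l: "length x = k" "length y = k" for e e' x y
  proof -
    define g where "g e i = (if i < k then x ! i else if i < k + k then y ! (i - k) else e (i - k - k))" for e :: "nat \<Rightarrow> 'a" and i
    have 1: "(\<lambda>i. g e (k + (k + i))) = e" for e unfolding g_def by auto
    have 2: "map (g e) [0..<k] = x" "map (\<lambda>i. g e (k + i)) [0..<k] = y" for e using l unfolding g_def by (auto intro: nth_equalityI)
    have "g e i = g e' i" if "i < q0" for i using that ee unfolding g_def q_def by auto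
    from q0[of "g e" "g e'", OF this] show ?thesis unfolding 1 2 .
  qed
  define env where "env a i = (if i < q then a ! i else a ! 0)" for a :: "'a list" and i
  define m where "m = k + q"
  define R where "R w w' \<longleftrightarrow> drop k w = drop k w' \<and> E' (env (drop k w)) (take k w) (take k w')" for w w'
  have denv: "env_term A (\<lambda>e. env (L e))" if L: "list_term A q L" for A L
    unfolding env_term_def
  proof
    fix i show "elt_term A (\<lambda>e. env (L e) i)"
      unfolding env_def using elt_nth[OF L, of i] elt_nth[OF L, of 0] by (cases "i < q") (simp_all add: q_def)
  qed
  have dR: "dfn {} (\<lambda>e. R (take m (map e [0..<m + m])) (drop m (map e [0..<m + m])))"
    unfolding R_def
    by (rule dfn_conj dfn_list_eq[where k = q] list_drop[where m = q and k = m] list_drop[where m = m and k = "m + m"] list_take[where k = m]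
        list_take[where k = "m + m"] drelD[OF dE'] denv list_upt elt_var | simp add: m_def)+
  have "equiv (tuples m) {(w, w'). w \<in> tuples m \<and> w' \<in> tuples m \<and> R w w'}"
  proof (rule equivI)
    have len: "length (take k w) = k" if "w \<in> tuples m" for w :: "'a list" using that by (simp add: tuples_def m_def)
    show "{(w, w'). w \<in> tuples m \<and> w' \<in> tuples m \<and> R w w'} \<subseteq> tuples m \<times> tuples m" by auto
    show "refl_on (tuples m) {(w, w'). w \<in> tuples m \<and> w' \<in> tuples m \<and> R w w'}"
      by (auto simp: refl_on_def R_def E'_def)
    show "sym {(w, w'). w \<in> tuples m \<and> w' \<in> tuples m \<and> R w w'}"
    proof (rule symI, clarify)
      fix w w' assume w: "w \<in> tuples m" "w' \<in> tuples m" "R w w'"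
      then have "drop k w = drop k w'" "E' (env (drop k w)) (take k w) (take k w')" by (auto simp: R_def)
      moreover from this have "E' (env (drop k w)) (take k w') (take k w)"
        using equivrelD(2)[OF _ len[OF w(1)] len[OF w(2)]] unfolding E'_def by metis
      ultimately show "R w' w" unfolding R_def by simp
    qed
    show "trans {(w, w'). w \<in> tuples m \<and> w' \<in> tuples m \<and> R w w'}"
    proof (rule transI, clarify)
      fix w w' w'' assume w: "w \<in> tuples m" "w' \<in> tuples m" "w'' \<in> tuples m" "R w w'" "R w' w''"
      have eqs: "drop k w = drop k w'" "drop k w' = drop k w''" using w(4,5) by (auto simp: R_def)
      have "E' (env (drop k w)) (take k w) (take k w')" "E' (env (drop k w)) (take k w') (take k w'')"
        using w(4,5) unfolding R_def by auto
      then have "E' (env (drop k w)) (take k w) (take k w'')"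
        using equivrelD(3)[OF _ len[OF w(1)] len[OF w(2)] len[OF w(3)]] unfolding E'_def by metis
      then show "R w w''" using eqs unfolding R_def by simp
    qed
  qed
  moreover have "definable_over M {} (m + m) {x @ y |x y. (x, y) \<in> {(w, w'). w \<in> tuples m \<and> w' \<in> tuples m \<and> R w w'}}"
  proof -
    have "m + m > 0" by (simp add: m_def q_def)
    from definable_over_if_dfn[of "\<lambda>z. R (take m z) (drop m z)", OF dR this]
    have "definable_over M {} (m + m) {z \<in> tuples (m + m). R (take m z) (drop m z)}" .
    moreover have "{z \<in> tuples (m + m). R (take m z) (drop m z)} =
      {x @ y |x y. (x, y) \<in> {(w, w'). w \<in> tuples m \<and> w' \<in> tuples m \<and> R w w'}}"
    proof (intro set_eqI iffI)
      fix z assume z: "z \<in> {z \<in> tuples (m + m). R (take m z) (drop m z)}"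
      then have "z = take m z @ drop m z" "take m z \<in> tuples m" "drop m z \<in> tuples m" by (auto simp: tuples_def)
      then show "z \<in> {x @ y |x y. (x, y) \<in> {(w, w'). w \<in> tuples m \<and> w' \<in> tuples m \<and> R w w'}}" using z by blast
    qed (auto simp: tuples_def)
    ultimately show ?thesis by simp
  qed
  ultimately obtain l f where f: "definable_map_over M {} m (tuples m) l f"
    and fE: "\<forall>x\<in>tuples m. \<forall>y\<in>tuples m. (x, y) \<in> {(w, w'). w \<in> tuples m \<and> w' \<in> tuples m \<and> R w w'} \<longleftrightarrow> f x = f y"
    using ei unfolding elim_imaginaries_def by blast
  have fl: "length (f w) = l" if "length w = m" for w
    using f that by (auto simp: definable_map_over_def tuples_def)
  obtain \<phi> where \<phi>: "formula_in M (m + l) \<phi>" "graph_on (tuples m) f = solutions M \<phi> (m + l) []"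
    using f unfolding definable_map_over_def definable_over_def by auto
  have graph: "z = f w \<longleftrightarrow> sat M (nth (w @ z)) \<phi>" if "length w = m" "length z = l" for w z
  proof -
    have "z = f w \<longleftrightarrow> w @ z \<in> graph_on (tuples m) f"
    proof
      assume "z = f w"
      then show "w @ z \<in> graph_on (tuples m) f" using that(1) unfolding graph_on_def tuples_def by blast
    next
      assume "w @ z \<in> graph_on (tuples m) f"
      then obtain x where "w @ z = x @ f x" "length x = m" unfolding graph_on_def tuples_def by blast
      then show "z = f w" using that(1) by simp
    qed
    also have "\<dots> \<longleftrightarrow> sat M (nth (w @ z)) \<phi>" unfolding \<phi>(2) using that by (simp add: solutions_def tuples_def)
    finally show ?thesis .
  qed
  define F where "F e x = f (x @ map e [0..<q])" for e x
  show ?thesis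
  proof (rule that)
    fix e x assume "length (x :: 'a list) = k"
    then show "length (F e x) = l" unfolding F_def by (intro fl) (simp add: m_def)
  next
    let ?L = "\<lambda>e. (map e [0..<k] @ map (\<lambda>i. e (k + (l + i))) [0..<q]) @ map (\<lambda>i. e (k + i)) [0..<l]"
    have "list_term {} (m + l) ?L" by (rule dfn | simp add: m_def)+
    from dfn_sat[OF \<phi>(1) this] have "dfn {} (\<lambda>e. sat M (nth (?L e)) \<phi>)" .
    then show "drel {} k l (\<lambda>e x z. z = F e x)" unfolding drel_def F_def
    proof (rule dfn_cong)
      fix e :: "nat \<Rightarrow> 'a"
      show "sat M (nth (?L e)) \<phi> \<longleftrightarrow> map (\<lambda>i. e (k + i)) [0..<l] = f (map e [0..<k] @ map (\<lambda>i. e (k + (l + i))) [0..<q])"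
        by (rule graph[symmetric]) (simp_all add: m_def)
    qed
  next
    fix e and x y :: "'a list" assume eq: "equivrel k (E e)" and l: "length x = k" "length y = k"
    let ?a = "map e [0..<q]"
    have "length (x @ ?a) = m" "length (y @ ?a) = m" using l by (simp_all only: m_def length_append length_map length_upt diff_zero)
    then have t: "x @ ?a \<in> tuples m" "y @ ?a \<in> tuples m" unfolding tuples_def by blast+
    have "(x @ ?a, y @ ?a) \<in> {(w, w'). w \<in> tuples m \<and> w' \<in> tuples m \<and> R w w'} \<longleftrightarrow> R (x @ ?a) (y @ ?a)"
      using t by (simp only: mem_Collect_eq prod.case simp_thms)
    then have "F e x = F e y \<longleftrightarrow> R (x @ ?a) (y @ ?a)" using bspec[OF bspec[OF fE t(1)] t(2)] unfolding F_def by argo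
    also have "\<dots> \<longleftrightarrow> E' (env ?a) x y" using l by (simp add: R_def)
    also have "\<dots> \<longleftrightarrow> E' e x y" by (rule dep) (auto simp: env_def l simp del: upt_Suc)
    also have "\<dots> \<longleftrightarrow> E e x y" using eq equivrelD(1)[OF eq l(1)] unfolding E'_def by metis
    finally show "F e x = F e y \<longleftrightarrow> E e x y" .
  qed
qed

text \<open>The parameters become the index of a family, and the map is read off at the index
  holding their values.\<close>

lemma ei_parameters:
  assumes dE: "drel UNIV k k (\<lambda>_. E)" and eq: "equivrel k E"
  obtains l f where "\<And>x. length x = k \<Longrightarrow> length (f x) = l" "drel UNIV k l (\<lambda>_ x z. z = f x)"
    "\<And>x y. length x = k \<Longrightarrow> length y = k \<Longrightarrow> f x = f y \<longleftrightarrow> E x y"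
proof -
  obtain P' e0 where P': "dfn {} P'" "\<And>e. E (map e [0..<k]) (map (\<lambda>i. e (k + i)) [0..<k]) \<longleftrightarrow>
      P' (\<lambda>i. if even i then e (i div 2) else e0 (i div 2))"
    by (rule dfn_parameters[OF dE[unfolded drel_def]]) blast
  define G where "G e x y \<longleftrightarrow> P' (\<lambda>i. if even i then (if i div 2 < k then x ! (i div 2) else if i div 2 < k + k then y ! (i div 2 - k) else e 0) else e (i div 2))"
    for e x y
  have "drel {} k k G" unfolding G_def
  proof (rule drelI, rule dfn_subst[OF P'(1)])
    show "env_term {} (\<lambda>(e :: nat \<Rightarrow> 'a) i. if even i then (if i div 2 < k then map e [0..<k] ! (i div 2) else if i div 2 < k + k then map (\<lambda>i. e (k + i)) [0..<k] ! (i div 2 - k) else e (k + (k + 0))) else e (k + (k + i div 2)))"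
      unfolding env_term_def
    proof
      fix i show "elt_term {} (\<lambda>(e :: nat \<Rightarrow> 'a). if even i then (if i div 2 < k then map e [0..<k] ! (i div 2) else if i div 2 < k + k then map (\<lambda>i. e (k + i)) [0..<k] ! (i div 2 - k) else e (k + (k + 0))) else e (k + (k + i div 2)))"
        by (cases "even i"; cases "i div 2 < k"; cases "i div 2 < k + k") (simp_all add: elt_var)
    qed
  qed
  then obtain l F where F: "\<And>e x. length x = k \<Longrightarrow> length (F e x) = l" "drel {} k l (\<lambda>e x z. z = F e x)"
    "\<And>e x y. equivrel k (G e) \<Longrightarrow> length x = k \<Longrightarrow> length y = k \<Longrightarrow> F e x = F e y \<longleftrightarrow> G e x y"
    by (rule ei_family) blast
  have GE: "G e0 x y \<longleftrightarrow> E x y" if "length x = k" "length y = k" for x y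
  proof -
    define e where "e i = (if i < k then x ! i else if i < k + k then y ! (i - k) else e0 0)" for i
    have "map e [0..<k] = x" "map (\<lambda>i. e (k + i)) [0..<k] = y" using that unfolding e_def by (auto intro: nth_equalityI)
    moreover have "G e0 x y \<longleftrightarrow> P' (\<lambda>i. if even i then e (i div 2) else e0 (i div 2))" unfolding G_def e_def ..
    ultimately show ?thesis using P'(2)[of e] by simp
  qed
  have eqG: "equivrel k (G e0)"
  proof (rule equivrelI)
    fix x y z :: "'a list" assume l: "length x = k" "length y = k" "length z = k" and "G e0 x y" "G e0 y z"
    then have "E x y" "E y z" using GE by blast+
    then show "G e0 x z" using equivrelD(3)[OF eq l] GE l by blast
  next
    fix x y :: "'a list" assume l: "length x = k" "length y = k" and "G e0 x y"
    then have "E x y" using GE by blast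
    then show "G e0 y x" using equivrelD(2)[OF eq l] GE l by blast
  next
    fix x :: "'a list" assume l: "length x = k"
    then show "G e0 x x" using equivrelD(1)[OF eq l] GE by blast
  qed
  show ?thesis
  proof (rule that)
    show "drel UNIV k l (\<lambda>_ x z. z = F e0 x)" by (rule drel_inst[OF F(2)])
    fix x y :: "'a list" assume "length x = k" "length y = k"
    then show "F e0 x = F e0 y \<longleftrightarrow> E x y" using F(3)[OF eqG] GE by blast
  qed (rule F(1))
qed

end

section \<open>Quotients with fat segments\<close>

context omin
begin

text \<open>Let \<open>?T\<close> have dimension \<open>D \<ge> d\<close> and count the pairs
  \<open>z \<le> y\<close> in \<open>?T\<close> twice. Above each \<open>z\<close> the points
  \<open>y\<close> still have dimension \<open>D\<close>, since those below \<open>z\<close> form a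
  thin set; the pairs have dimension at least \<open>2 * D\<close>. But below each \<open>y\<close>
  the points \<open>z\<close> have dimension less than \<open>d\<close>, which leaves less than
  \<open>2 * D\<close> in total.\<close>

lemma upper_class_dim:
  assumes s: "slo Q r" and Ql: "Q \<subseteq> tuples l" and dQ: "dset l Q" and dr: "drel UNIV l l (\<lambda>_. r)"
    and dS: "dset l S" and SQ: "S \<subseteq> Q" and q0: "q0 \<in> Q"
  shows "\<not> dge l d {x. x \<in> S \<and> (x = q0 \<or> r q0 x) \<and> \<not> dge l d (S \<inter> seg Q r q0 x)}"
proof
  let ?T = "{x. x \<in> S \<and> (x = q0 \<or> r q0 x) \<and> \<not> dge l d (S \<inter> seg Q r q0 x)}"
  note [dfn] = dsetD[OF dQ] dsrelD[OF dr] dsetD[OF dS]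
  have lq0: "l = length q0" using q0 Ql by (auto simp: tuples_def)
  have lS: "length x = l" if "x \<in> S" for x using that SQ Ql by (auto simp: tuples_def)
  assume T: "dge l d ?T"
  define D where "D = Max {D. dge l D ?T}"
  have fin: "finite {D. dge l D ?T}" by (rule finite_subset[of _ "{..l}"]) (auto dest: dge_le)
  have DT: "dge l D ?T" and dD: "d \<le> D" using Max_in[OF fin] Max_ge[OF fin, of d] T unfolding D_def by auto
  have maxD: "m \<le> D" if "dge l m ?T" for m using Max_ge[OF fin, of m] that unfolding D_def by auto
  define Z where "Z = {w. take l w \<in> ?T \<and> drop l w \<in> ?T \<and> (drop l w = take l w \<or> r (drop l w) (take l w))}"
  have dT: "dset l ?T" unfolding seg_def by (rule dfn lq0)+
  note [dfn] = dsetD[OF dT]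
  have dZ: "dset (l + l) Z" unfolding Z_def
    by (rule dfamI dfn_mem_Collect[of UNIV _ "\<lambda>e. map e [0..<l + l]"] dfn_conj dfn_disj dfn_list_eq[where k = l] dsetD[OF dT] dsrelD[OF dr]
        list_take[where k = "l + l"] list_drop[where k = "l + l" and m = l] list_upt elt_var | simp)+
  have big: "dge l D {y. y @ z \<in> Z}" if z: "z \<in> ?T" for z
  proof -
    have lz: "length z = l" using z lS by blast
    have "dge l D ({y. y \<in> ?T \<and> (z = y \<or> r z y)} \<union> {y. y \<in> ?T \<and> r y z})"
    proof (rule dge_mono[OF DT])
      fix y assume y: "y \<in> ?T"
      then have "z = y \<or> r z y \<or> r y z" using slo_total[OF s, of z y] z SQ by blast
      then show "y \<in> {y. y \<in> ?T \<and> (z = y \<or> r z y)} \<union> {y. y \<in> ?T \<and> r y z}" using y by blast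
    qed
    moreover have "\<not> dge l D {y. y \<in> ?T \<and> r y z}"
    proof
      assume "dge l D {y. y \<in> ?T \<and> r y z}"
      then have "dge l D (S \<inter> seg Q r q0 z)" by (rule dge_mono) (use SQ in \<open>auto simp: seg_def\<close>)
      then show False using z dge_antimono dD by blast
    qed
    ultimately have "dge l D {y. y \<in> ?T \<and> (z = y \<or> r z y)}" unfolding dge_Un by blast
    then show ?thesis
    proof (rule dge_mono)
      fix y assume "length y = l" "y \<in> {y. y \<in> ?T \<and> (z = y \<or> r z y)}"
      then show "y \<in> {y. y @ z \<in> Z}" using z unfolding Z_def by simp
    qed
  qed
  have "dge l D {z. dge l D {y. y @ z \<in> Z}}" by (rule dge_mono[OF DT]) (use big in blast)
  then have "dge (l + l) (D + D) Z" by (rule dge_fibreI)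
  then have "dge (l + l) (D + D) {w. drop l w @ take l w \<in> Z}" using dge_block_swap[OF dZ] by blast
  then obtain j where j: "j \<le> D + D" "dge l (D + D - j) {y. dge l j {z. z @ y \<in> {w. drop l w @ take l w \<in> Z}}}"
    unfolding dge_fibre by blast
  have fib: "dge l j {z. z \<in> S \<and> z \<in> seg Q r q0 y} \<and> y \<in> ?T" if y: "length y = l" "dge l j {z. z @ y \<in> {w. drop l w @ take l w \<in> Z}}" for y
  proof
    have mem: "y \<in> ?T \<and> z \<in> ?T \<and> (z = y \<or> r z y)" if "length z = l" "z \<in> {z. z @ y \<in> {w. drop l w @ take l w \<in> Z}}" for z
      using that y(1) unfolding Z_def by simp
    show "dge l j {z. z \<in> S \<and> z \<in> seg Q r q0 y}"
    proof (rule dge_mono[OF y(2)])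
      fix z assume z: "length z = l" "z \<in> {z. z @ y \<in> {w. drop l w @ take l w \<in> Z}}"
      show "z \<in> {z. z \<in> S \<and> z \<in> seg Q r q0 y}" using mem[OF z] SQ by (auto simp: seg_def)
    qed
    show "y \<in> ?T" using dge_nonempty[OF y(2)] mem by blast
  qed
  \<comment> \<open>The base of the second count lies in \<open>?T\<close>, so
    \<open>D + D - j \<le> D\<close>, and the fibre dimension \<open>j\<close> is at least
    \<open>D\<close>.\<close>
  have "dge l (D + D - j) ?T" by (rule dge_mono[OF j(2)]) (use fib in blast)
  then have "d \<le> j" using maxD dD by fastforce
  obtain y where y: "length y = l" "dge l j {z. z @ y \<in> {w. drop l w @ take l w \<in> Z}}" using dge_nonempty[OF j(2)] by blast
  have "dge l d (S \<inter> seg Q r q0 y)" using dge_antimono[OF conjunct1[OF fib[OF y]] \<open>d \<le> j\<close>] by (rule dge_mono) blast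
  then show False using fib[OF y] by blast
qed

lemma class_dim:
  assumes s: "slo Q r" and Ql: "Q \<subseteq> tuples l" and dQ: "dset l Q" and dr: "drel UNIV l l (\<lambda>_. r)"
    and dS: "dset l S" and SQ: "S \<subseteq> Q" and q0: "q0 \<in> Q"
  shows "\<not> dge l d {x. x \<in> S \<and> \<not> dge l d (S \<inter> seg Q r q0 x)}"
proof
  note [dfn] = dsrelD[OF dr]
  have dr': "drel UNIV l l (\<lambda>_ x y. r y x)" by (rule dfn)+
  assume "dge l d {x. x \<in> S \<and> \<not> dge l d (S \<inter> seg Q r q0 x)}"
  then have "dge l d ({x. x \<in> S \<and> (x = q0 \<or> r q0 x) \<and> \<not> dge l d (S \<inter> seg Q r q0 x)} \<union>
     {x. x \<in> S \<and> (x = q0 \<or> r x q0) \<and> \<not> dge l d (S \<inter> seg Q (\<lambda>x y. r y x) q0 x)})"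
  proof (rule dge_mono)
    fix x assume x: "x \<in> {x. x \<in> S \<and> \<not> dge l d (S \<inter> seg Q r q0 x)}"
    then have "x = q0 \<or> r q0 x \<or> r x q0" using slo_total[OF s q0, of x] SQ by blast
    moreover have sc: "seg Q (\<lambda>x y. r y x) q0 x = seg Q r q0 x" by (rule seg_converse)
    ultimately show "x \<in> {x. x \<in> S \<and> (x = q0 \<or> r q0 x) \<and> \<not> dge l d (S \<inter> seg Q r q0 x)} \<union>
     {x. x \<in> S \<and> (x = q0 \<or> r x q0) \<and> \<not> dge l d (S \<inter> seg Q (\<lambda>x y. r y x) q0 x)}"
      using x unfolding Un_iff mem_Collect_eq sc by blast
  qed
  then show False
    using upper_class_dim[OF s Ql dQ dr dS SQ q0] upper_class_dim[OF slo_converse[OF s] Ql dQ dr' dS SQ q0]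
    unfolding dge_Un by blast
qed

text \<open>Makes the relation of being joined by a thin segment transitive, with convex
  classes.\<close>

lemma thin_equiv:
  assumes s: "slo Q r" and q: "x \<in> Q" "y \<in> Q" "z \<in> Q"
  shows "\<not> dge l d (S \<inter> seg Q r x y) \<Longrightarrow> \<not> dge l d (S \<inter> seg Q r y z) \<Longrightarrow> \<not> dge l d (S \<inter> seg Q r x z)"
    "w \<in> seg Q r x y \<Longrightarrow> \<not> dge l d (S \<inter> seg Q r x y) \<Longrightarrow> \<not> dge l d (S \<inter> seg Q r x w)"
proof -
  assume a: "\<not> dge l d (S \<inter> seg Q r x y)" "\<not> dge l d (S \<inter> seg Q r y z)"
  show "\<not> dge l d (S \<inter> seg Q r x z)"
  proof
    assume "dge l d (S \<inter> seg Q r x z)"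
    then have "dge l d ((S \<inter> seg Q r x y) \<union> (S \<inter> seg Q r y z))"
      by (rule dge_mono) (use seg_Un[OF s q] in blast)
    then show False using a unfolding dge_Un by blast
  qed
next
  assume w: "w \<in> seg Q r x y" and a: "\<not> dge l d (S \<inter> seg Q r x y)"
  have sub: "seg Q r x w \<subseteq> seg Q r x y" using seg_trans[OF s q(1,2) conjunct1[OF seg_ends[OF s q(1,2)]] w] .
  have "dge l d (S \<inter> seg Q r x y)" if "dge l d (S \<inter> seg Q r x w)" by (rule dge_mono[OF that]) (use sub in blast)
  then show "\<not> dge l d (S \<inter> seg Q r x w)" using a by blast
qed

end

text \<open>The points whose class is trivial for the relation of having finitely many points of
  \<open>S\<close> in between: \<open>dge l 1\<close> means infinite.\<close>

definition trv :: "nat \<Rightarrow> 'b list set \<Rightarrow> ('b list \<Rightarrow> 'b list \<Rightarrow> bool) \<Rightarrow> 'b list set \<Rightarrow> 'b list set" where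
  "trv l Q r S = {q. q \<in> Q \<and> (\<forall>q'. length q' = l \<longrightarrow> (q' \<in> Q \<and> q' \<noteq> q \<longrightarrow> dge l 1 (S \<inter> seg Q r q q')))}"

definition ordr :: "bool \<Rightarrow> ('b \<Rightarrow> 'b \<Rightarrow> bool) \<Rightarrow> 'b \<Rightarrow> 'b \<Rightarrow> bool" where
  "ordr sg r x y \<longleftrightarrow> sg \<and> r x y \<or> \<not> sg \<and> r y x"

definition curve :: "bool \<Rightarrow> 'b list set \<Rightarrow> ('b list \<Rightarrow> 'b list \<Rightarrow> bool) \<Rightarrow> ('b::linorder \<Rightarrow> 'b list \<Rightarrow> bool) \<Rightarrow> bool" where
  "curve sg Q r \<gamma> \<longleftrightarrow> (\<forall>t q. \<gamma> t q \<longrightarrow> q \<in> Q) \<and> (\<forall>t q q'. \<gamma> t q \<longrightarrow> \<gamma> t q' \<longrightarrow> q = q') \<and>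
     (\<forall>t t' q q'. \<gamma> t q \<longrightarrow> \<gamma> t' q' \<longrightarrow> t < t' \<longrightarrow> ordr sg r q q')"

definition cset :: "nat \<Rightarrow> bool \<Rightarrow> ('b list \<Rightarrow> 'b list \<Rightarrow> bool) \<Rightarrow> ('b::linorder \<Rightarrow> 'b list \<Rightarrow> bool) \<Rightarrow> 'b list \<Rightarrow> 'b set" where
  "cset l sg r \<gamma> q = {t. \<exists>q'. length q' = l \<and> (\<gamma> t q' \<and> (q' = q \<or> ordr sg r q' q))}"

text \<open>The last two conjuncts exclude points that lie below or above the whole curve, where the
  supremum is missing or carries no information.\<close>

definition cutv :: "nat \<Rightarrow> bool \<Rightarrow> ('b list \<Rightarrow> 'b list \<Rightarrow> bool) \<Rightarrow> ('b::linorder \<Rightarrow> 'b list \<Rightarrow> bool) \<Rightarrow> 'b list \<Rightarrow> 'b \<Rightarrow> bool" where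
  "cutv l sg r \<gamma> q t \<longleftrightarrow> (\<forall>t'. t' \<in> cset l sg r \<gamma> q \<longrightarrow> t' \<le> t) \<and> (\<forall>v. (\<forall>t'. t' \<in> cset l sg r \<gamma> q \<longrightarrow> t' \<le> v) \<longrightarrow> t \<le> v) \<and>
     (\<exists>t'. t' \<in> cset l sg r \<gamma> q) \<and> (\<exists>t'. (\<exists>q'. length q' = l \<and> \<gamma> t' q') \<and> t' \<notin> cset l sg r \<gamma> q)"

definition cdom :: "nat \<Rightarrow> bool \<Rightarrow> 'b list set \<Rightarrow> ('b list \<Rightarrow> 'b list \<Rightarrow> bool) \<Rightarrow> ('b::linorder \<Rightarrow> 'b list \<Rightarrow> bool) \<Rightarrow> 'b list set" where
  "cdom l sg Q r \<gamma> = {q. q \<in> trv l Q r {q. \<exists>t. \<gamma> t q} \<and> (\<exists>t. cutv l sg r \<gamma> q t)}"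

text \<open>The map \<open>F\<close> presents \<open>Q\<close> as the quotient of a set \<open>P\<close> of dimension at most \<open>n\<close> such that the preimage
  of every nontrivial segment of \<open>Q\<close> has dimension \<open>n\<close>.\<close>

locale quotient_order = ngrp M for M :: "('f, 'r, 'a::linorder) fo_structure" +
  fixes k l n :: nat and P Q :: "'a list set" and F :: "'a list \<Rightarrow> 'a list" and r :: "'a list \<Rightarrow> 'a list \<Rightarrow> bool"
  assumes dQ: "dset l Q" and Ql: "Q \<subseteq> tuples l" and dr: "drel UNIV l l (\<lambda>_. r)" and slo: "slo Q r"
    and dP: "dset k P" and dF: "drel UNIV k l (\<lambda>_ x z. z = F x)"
    and Fl: "\<And>x. length x = k \<Longrightarrow> length (F x) = l"
    and dimP: "\<not> dge k (Suc n) P"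
    and fat: "\<And>q q'. q \<in> Q \<Longrightarrow> q' \<in> Q \<Longrightarrow> q \<noteq> q' \<Longrightarrow> dge k n {x. x \<in> P \<and> F x \<in> seg Q r q q'}"
begin

lemma Q_length: "q \<in> Q \<Longrightarrow> length q = l" using Ql by (auto simp: tuples_def)

text \<open>Elimination of imaginaries turns the classes into tuples, so infinitely many of them
  form a set of dimension at least 1. The map from \<open>P\<close> to classes, whose fibres over
  nontrivial classes contain the preimage of a segment, is then a case of
  \<open>dge_functional_relation\<close>.\<close>

lemma finite_nontrivial_classes:
  assumes dE: "drel UNIV l l (\<lambda>_. E)" and E: "\<And>q. q \<in> Q \<Longrightarrow> E q q"
    "\<And>q q'. q \<in> Q \<Longrightarrow> q' \<in> Q \<Longrightarrow> E q q' \<Longrightarrow> E q' q"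
    "\<And>q q' q''. q \<in> Q \<Longrightarrow> q' \<in> Q \<Longrightarrow> q'' \<in> Q \<Longrightarrow> E q q' \<Longrightarrow> E q' q'' \<Longrightarrow> E q q''"
    and conv: "\<And>q q' z. q \<in> Q \<Longrightarrow> q' \<in> Q \<Longrightarrow> E q q' \<Longrightarrow> z \<in> seg Q r q q' \<Longrightarrow> E q z"
  shows "\<exists>R0. finite R0 \<and> R0 \<subseteq> Q \<and> {q. q \<in> Q \<and> (\<exists>q'. q' \<in> Q \<and> q' \<noteq> q \<and> E q q')} = (\<Union>q0\<in>R0. {q. q \<in> Q \<and> E q0 q})"
proof -
  note [dfn] = dsetD[OF dQ] dsrelD[OF dE] dsetD[OF dP] dsrelD[OF dF]
  define E' where "E' x y \<longleftrightarrow> x = y \<or> x \<in> Q \<and> y \<in> Q \<and> E x y" for x y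
  have dE': "drel UNIV l l (\<lambda>_. E')" unfolding E'_def by (rule dfn)+
  have eqE': "equivrel l E'"
  proof (rule equivrelI)
    fix x y z assume "E' x y" "E' y z"
    then show "E' x z" using E(3)[of x y z] unfolding E'_def by blast
  next
    fix x y assume "E' x y"
    then show "E' y x" using E(2)[of x y] unfolding E'_def by blast
  qed (simp add: E'_def)
  obtain s f where f: "\<And>x. length x = l \<Longrightarrow> length (f x) = s" "drel UNIV l s (\<lambda>_ x z. z = f x)"
    "\<And>x y. length x = l \<Longrightarrow> length y = l \<Longrightarrow> f x = f y \<longleftrightarrow> E' x y"
    by (rule ei_parameters[OF dE' eqE']) blast
  note [dfn] = dsrelD[OF f(2)]
  have fE: "f x = f y \<longleftrightarrow> E x y" if "x \<in> Q" "y \<in> Q" for x y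
    using f(3)[of x y] Q_length that E(1) unfolding E'_def by auto
  define N where "N = {q. q \<in> Q \<and> (\<exists>q'. length q' = l \<and> (q' \<in> Q \<and> q' \<noteq> q \<and> E q q'))}"
  have N_eq: "{q. q \<in> Q \<and> (\<exists>q'. q' \<in> Q \<and> q' \<noteq> q \<and> E q q')} = N" unfolding N_def using Q_length by auto
  have dN: "dset l N" unfolding N_def by (rule dfn)+
  note [dfn] = dsetD[OF dN]
  have "finite (f ` N)"
  proof (rule ccontr)
    assume inf: "infinite (f ` N)"
    define G where "G = {w. take k w \<in> P \<and> (\<exists>q. length q = l \<and> (q = F (take k w) \<and> q \<in> N \<and> drop k w = f q))}"
    have dG: "dset (k + s) G" unfolding G_def
      by (rule dfamI dfn_mem_Collect[of UNIV _ "\<lambda>e. map e [0..<k + s]"] dfn_conj dfn_exl dsetD[OF dP] dsetD[OF dN] dsrelD[OF dF] dsrelD[OF f(2)]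
        list_take[where k = "k + s"] list_drop[where k = "k + s" and m = s] list_upt elt_var | simp)+
    have mem: "x @ t \<in> G \<longleftrightarrow> x \<in> P \<and> F x \<in> N \<and> t = f (F x)" if "length x = k" for x t
      using that Fl[OF that] unfolding G_def by auto
    have "dge s 1 {t. dge k n {x. x @ t \<in> G}}"
    proof -
      have "dge s 1 (f ` N)" unfolding dge_one
      proof
        assume "finite {x \<in> f ` N. length x = s}"
        moreover have "{x \<in> f ` N. length x = s} = f ` N" using f(1) Q_length unfolding N_def by auto
        ultimately show False using inf by simp
      qed
      then show ?thesis
      proof (rule dge_mono)
        fix t assume "t \<in> f ` N"
        then obtain q where q: "q \<in> N" "t = f q" by blast
        then obtain q' where q': "q \<in> Q" "q' \<in> Q" "q' \<noteq> q" "E q q'" unfolding N_def by blast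
        have "dge k n {x. x \<in> P \<and> F x \<in> seg Q r q q'}" using fat q' by blast
        then have "dge k n {x. x @ t \<in> G}"
        proof (rule dge_mono)
          fix x assume x: "length x = k" "x \<in> {x. x \<in> P \<and> F x \<in> seg Q r q q'}"
          then have FQ: "F x \<in> Q" using seg_subset[of Q r q q'] by blast
          have qF: "E q (F x)" using conv[OF q'(1,2,4)] x by blast
          then have Fq: "E (F x) q" using E(2)[OF q'(1) FQ] by blast
          then have Fq': "E (F x) q'" using E(3)[OF FQ q'(1,2)] q'(4) by blast
          have "F x \<in> N" unfolding N_def using FQ Fq Fq' q' Q_length by (cases "F x = q") auto
          moreover have "t = f (F x)" using fE[OF q'(1) FQ] qF q(2) by simp
          ultimately show "x \<in> {x. x @ t \<in> G}" using mem[OF x(1)] x by blast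
        qed
        then show "t \<in> {t. dge k n {x. x @ t \<in> G}}" by blast
      qed
    qed
    then have "dge k (n + 1) {x. \<exists>t. length t = s \<and> x @ t \<in> G}"
    proof (rule dge_functional_relation[OF dG, rotated])
      fix x t t' assume "length x = k" "x @ t \<in> G" "x @ t' \<in> G"
      then show "t = t'" using mem[of x t] mem[of x t'] by blast
    qed
    then have "dge k (n + 1) P" by (rule dge_mono) (use mem in blast)
    then have "dge k (Suc n) P" by simp
    then show False using dimP by blast
  qed
  define R0 where "R0 = (\<lambda>t. SOME q. q \<in> N \<and> f q = t) ` f ` N"
  have some: "(SOME q'. q' \<in> N \<and> f q' = f q) \<in> N \<and> f (SOME q'. q' \<in> N \<and> f q' = f q) = f q" if "q \<in> N" for q
    by (rule someI[of "\<lambda>q'. q' \<in> N \<and> f q' = f q" q]) (use that in simp)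
  have NQ: "N \<subseteq> Q" unfolding N_def by blast
  have R0N: "R0 \<subseteq> N" unfolding R0_def using some by blast
  show ?thesis
  proof (intro exI[of _ R0] conjI)
    show "finite R0" unfolding R0_def using \<open>finite (f ` N)\<close> by blast
    show "R0 \<subseteq> Q" using R0N NQ by blast
    show "{q. q \<in> Q \<and> (\<exists>q'. q' \<in> Q \<and> q' \<noteq> q \<and> E q q')} = (\<Union>q0\<in>R0. {q. q \<in> Q \<and> E q0 q})"
      unfolding N_eq
    proof (intro set_eqI iffI)
      fix q assume q: "q \<in> N"
      let ?q0 = "SOME q'. q' \<in> N \<and> f q' = f q"
      have "?q0 \<in> R0" unfolding R0_def using q by blast
      moreover have "E ?q0 q" using fE[of ?q0 q] some[OF q] NQ q by blast
      ultimately show "q \<in> (\<Union>q0\<in>R0. {q. q \<in> Q \<and> E q0 q})" using q NQ by blast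
    next
      fix q assume "q \<in> (\<Union>q0\<in>R0. {q. q \<in> Q \<and> E q0 q})"
      then obtain q0 where q0: "q0 \<in> N" "q \<in> Q" "E q0 q" using R0N by blast
      then obtain q' where q': "q0 \<in> Q" "q' \<in> Q" "q' \<noteq> q0" "E q0 q'" unfolding N_def by blast
      have "E q q0" using E(2)[OF q'(1) q0(2,3)] .
      moreover from this have "E q q'" using E(3)[OF q0(2) q'(1,2)] q'(4) by blast
      ultimately show "q \<in> N" unfolding N_def using q0 q' Q_length by (cases "q = q0") auto
    qed
  qed
qed

text \<open>The classes of the relation of having finitely many points of \<open>S\<close> in
  between are convex and meet \<open>S\<close> in finite sets, by \<open>class_dim\<close> with
  \<open>d = 1\<close>. So after removing finitely many convex sets, and with them finitely many
  points of \<open>S\<close>, every nondegenerate segment starting at a remaining point meets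
  \<open>S\<close> in an infinite set.\<close>

lemma trivial_part:
  assumes dS: "dset l S" and SQ: "S \<subseteq> Q"
  obtains CC where "finite CC" "\<forall>C\<in>CC. cvx Q r C" "Q - trv l Q r S = \<Union> CC" "finite (S - trv l Q r S)"
proof -
  note [dfn] = dsetD[OF dQ] dsrelD[OF dr] dsetD[OF dS]
  define E where "E q q' \<longleftrightarrow> \<not> dge l 1 (S \<inter> seg Q r q q')" for q q'
  have dE: "drel UNIV l l (\<lambda>_. E)" unfolding E_def seg_def by (rule dfn)+
  have E1: "E q q" if "q \<in> Q" for q
  proof -
    have "finite {x \<in> S \<inter> {q}. length x = l}" by (rule finite_subset[of _ "{q}"]) auto
    then show ?thesis unfolding E_def seg_self[OF slo that] dge_one by simp
  qed
  have E2: "E q' q" if "E q q'" for q q' using that unfolding E_def by (simp add: seg_commute)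
  have E2': "E q' q" if "q \<in> Q" "q' \<in> Q" "E q q'" for q q' using E2 that by blast
  have E3: "E q q''" if "q \<in> Q" "q' \<in> Q" "q'' \<in> Q" "E q q'" "E q' q''" for q q' q''
    using thin_equiv(1)[OF slo that(1-3)] that(4,5) unfolding E_def by blast
  have E4: "E q z" if "q \<in> Q" "q' \<in> Q" "E q q'" "z \<in> seg Q r q q'" for q q' z
    using thin_equiv(2)[OF slo that(1,2) that(2) that(4)] that(3) unfolding E_def by blast
  obtain R0 where R0: "finite R0" "R0 \<subseteq> Q" "{q. q \<in> Q \<and> (\<exists>q'. q' \<in> Q \<and> q' \<noteq> q \<and> E q q')} = (\<Union>q0\<in>R0. {q. q \<in> Q \<and> E q0 q})"
  proof -
    have "\<exists>R0. finite R0 \<and> R0 \<subseteq> Q \<and> {q. q \<in> Q \<and> (\<exists>q'. q' \<in> Q \<and> q' \<noteq> q \<and> E q q')} = (\<Union>q0\<in>R0. {q. q \<in> Q \<and> E q0 q})"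
      by (rule finite_nontrivial_classes[OF dE]) (fact E1, fact E2', fact E3, fact E4)
    then show ?thesis using that by blast
  qed
  have trv_eq: "Q - trv l Q r S = (\<Union>q0\<in>R0. {q. q \<in> Q \<and> E q0 q})"
  proof -
    have "Q - trv l Q r S = {q. q \<in> Q \<and> (\<exists>q'. q' \<in> Q \<and> q' \<noteq> q \<and> E q q')}"
    proof (rule set_eqI)
      fix q
      show "q \<in> Q - trv l Q r S \<longleftrightarrow> q \<in> {q. q \<in> Q \<and> (\<exists>q'. q' \<in> Q \<and> q' \<noteq> q \<and> E q q')}"
        unfolding trv_def E_def using Q_length by auto
    qed
    then show ?thesis using R0(3) by simp
  qed
  show ?thesis
  proof (rule that[of "(\<lambda>q0. {q. q \<in> Q \<and> E q0 q}) ` R0"], rule_tac [2] ballI)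
    fix C assume "C \<in> (\<lambda>q0. {q. q \<in> Q \<and> E q0 q}) ` R0"
    then obtain q0 where q0: "q0 \<in> Q" "C = {q. q \<in> Q \<and> E q0 q}" using R0(2) by blast
    show "cvx Q r C" unfolding cvx_def
    proof (intro conjI ballI)
      show "C \<subseteq> Q" using q0 by blast
      fix x y assume "x \<in> C" "y \<in> C"
      then have xy: "x \<in> Q" "y \<in> Q" "E q0 x" "E q0 y" using q0 by auto
      have "E x y" using E3[OF xy(1) q0(1) xy(2) E2[OF xy(3)] xy(4)] .
      show "seg Q r x y \<subseteq> C"
      proof
        fix z assume z: "z \<in> seg Q r x y"
        then have zQ: "z \<in> Q" using seg_subset[of Q r x y] by blast
        have "E q0 z" using E3[OF q0(1) xy(1) zQ xy(3) E4[OF xy(1,2) \<open>E x y\<close> z]] .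
        then show "z \<in> C" using zQ q0 by blast
      qed
    qed
  next
    show "Q - trv l Q r S = \<Union> ((\<lambda>q0. {q. q \<in> Q \<and> E q0 q}) ` R0)" using trv_eq by simp
    have "finite (S \<inter> {q. q \<in> Q \<and> E q0 q})" if "q0 \<in> R0" for q0
    proof -
      have "\<not> dge l 1 {x. x \<in> S \<and> \<not> dge l 1 (S \<inter> seg Q r q0 x)}"
        by (rule class_dim[OF slo Ql dQ dr dS SQ]) (use that R0 in blast)
      then have "finite {x \<in> {x. x \<in> S \<and> \<not> dge l 1 (S \<inter> seg Q r q0 x)}. length x = l}" unfolding dge_one by simp
      moreover have "S \<inter> {q. q \<in> Q \<and> E q0 q} \<subseteq> {x \<in> {x. x \<in> S \<and> \<not> dge l 1 (S \<inter> seg Q r q0 x)}. length x = l}"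
        unfolding E_def using Q_length by blast
      ultimately show ?thesis by (rule finite_subset[rotated])
    qed
    then have "finite (\<Union>q0\<in>R0. S \<inter> {q. q \<in> Q \<and> E q0 q})" using R0(1) by blast
    moreover have "S - trv l Q r S \<subseteq> (\<Union>q0\<in>R0. S \<inter> {q. q \<in> Q \<and> E q0 q})" using trv_eq SQ by blast
    ultimately show "finite (S - trv l Q r S)" by (rule finite_subset[rotated])
  qed (use R0 in simp)
qed

end

section \<open>Cut maps along curves\<close>

lemma ordr_simps: "ordr True r = r" "ordr False r = (\<lambda>x y. r y x)"
  by (auto simp: ordr_def fun_eq_iff)

lemma slo_ordr: "slo Q r \<Longrightarrow> slo Q (ordr sg r)"
  by (cases sg) (simp_all add: ordr_simps slo_converse)

lemma seg_ordr: "seg Q (ordr sg r) x y = seg Q r x y"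
  unfolding seg_def ordr_def by (cases sg) auto

lemma slo_min:
  assumes "slo Q r" "finite A" "A \<noteq> {}" "A \<subseteq> Q" shows "\<exists>m\<in>A. \<forall>x\<in>A. m = x \<or> r m x"
  using assms(2-4)
proof (induction A rule: finite_ne_induct)
  case (insert a A)
  then obtain m where m: "m \<in> A" "\<forall>x\<in>A. m = x \<or> r m x" by auto
  have mQ: "m \<in> Q" and aQ: "a \<in> Q" using insert.prems m by auto
  show ?case
  proof (cases "r a m")
    case True
    have "a = x \<or> r a x" if x: "x \<in> insert a A" for x
    proof -
      have "x \<in> Q" using x insert.prems by auto
      then have "m = x \<or> r m x \<Longrightarrow> r a x" using True slo_trans[OF assms(1) aQ mQ, of x] by blast
      then show ?thesis using x m(2) by auto
    qed
    then show ?thesis by (intro bexI[of _ a]) auto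
  next
    case False
    then have "m = a \<or> r m a" using slo_total[OF assms(1) mQ aQ] by blast
    then have "m = x \<or> r m x" if "x \<in> insert a A" for x using that m(2) by auto
    then show ?thesis using m(1) by (intro bexI[of _ m]) auto
  qed
qed auto

context omin
begin

lemma dfam_trv:
  assumes "dfam A l Q" "drel A l l r" "dfam A l S" shows "dfam A l (\<lambda>e. trv l (Q e) (r e) (S e))"
proof -
  note [dfn] = dfamD[OF assms(1)] drelD[OF assms(2)] dfamD[OF assms(3)]
  show ?thesis unfolding trv_def seg_def by (rule dfn)+
qed

lemma dcurve_cset:
  assumes "drel A l l r" "dcurve A l \<gamma>" shows "dcurve A l (\<lambda>e t q. t \<in> cset l sg (r e) (\<gamma> e) q)"
proof -
  note [dfn] = drelD[OF assms(1)] dcurveD[OF assms(2)]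
  show ?thesis unfolding cset_def ordr_def by (rule dfn)+
qed

lemma dcurve_cutv:
  assumes "drel A l l r" "dcurve A l \<gamma>" shows "dcurve A l (\<lambda>e t q. cutv l sg (r e) (\<gamma> e) q t)"
proof -
  note [dfn] = dcurveD[OF assms(2)] dcurveD[OF dcurve_cset[OF assms]]
  show ?thesis unfolding cutv_def by (rule dfn)+
qed

lemma dfam_cdom:
  assumes "dfam A l Q" "drel A l l r" "dcurve A l \<gamma>" shows "dfam A l (\<lambda>e. cdom l sg (Q e) (r e) (\<gamma> e))"
proof -
  note [dfn] = dcurveD[OF assms(3)]
  have S: "dfam A l (\<lambda>e. {q. \<exists>t. \<gamma> e t q})" by (rule dfn)+
  note [dfn] = dfamD[OF dfam_trv[OF assms(1,2) S]] dcurveD[OF dcurve_cutv[OF assms(2,3)]]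
  show ?thesis unfolding cdom_def by (rule dfn)+
qed

text \<open>Finds a coordinate that can serve as a parameter: if some value of the first coordinate
  has an infinite slice, continue inside this slice; otherwise take the first coordinate.\<close>

lemma infinite_with_finite_slices:
  "dset l S \<Longrightarrow> infinite S \<Longrightarrow> S \<subseteq> tuples l \<Longrightarrow>
   \<exists>S1 i. dset l S1 \<and> S1 \<subseteq> S \<and> infinite S1 \<and> i < l \<and> (\<forall>t. finite {q \<in> S1. q ! i = t})"
proof (induction l arbitrary: S)
  case 0
  then have "S \<subseteq> {[]}" by (auto simp: tuples_def)
  then show ?case using 0 finite_subset by blast
next
  case (Suc l)
  note [dfn] = dsetD[OF Suc.prems(1)]
  show ?case
  proof (cases "\<exists>x. infinite {w. x # w \<in> S}")
    case True
    then obtain x where x: "infinite {w. x # w \<in> S}" by blast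
    have d: "dset l {w. x # w \<in> S}" by (rule dfn)+
    have "{w. x # w \<in> S} \<subseteq> tuples l" using Suc.prems(3) by (auto simp: tuples_def)
    from Suc.IH[OF d x this] obtain S1 i where S1: "dset l S1" "S1 \<subseteq> {w. x # w \<in> S}" "infinite S1" "i < l"
      "\<forall>t. finite {q \<in> S1. q ! i = t}" by blast
    note [dfn] = dsetD[OF S1(1)]
    define T where "T = {v. v \<in> S \<and> hd v = x \<and> tl v \<in> S1}"
    have dT: "dset (Suc l) T" unfolding T_def by (rule dfn)+
    have im: "T = Cons x ` S1"
    proof (intro set_eqI iffI)
      fix v assume v: "v \<in> T"
      then have "length v = Suc l" using Suc.prems(3) unfolding T_def tuples_def by blast
      then have "v = hd v # tl v" by (cases v) auto
      then show "v \<in> Cons x ` S1" using v unfolding T_def by (metis (mono_tags, lifting) image_eqI mem_Collect_eq)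
    qed (use S1(2) in \<open>auto simp: T_def\<close>)
    have "infinite T" unfolding im using S1(3) by (simp add: finite_image_iff)
    moreover have "finite {q \<in> T. q ! Suc i = t}" for t
    proof -
      have "{q \<in> T. q ! Suc i = t} \<subseteq> Cons x ` {q \<in> S1. q ! i = t}" unfolding im by auto
      then show ?thesis using S1(5) by (meson finite_imageI finite_subset)
    qed
    ultimately show ?thesis using dT S1(4) by (intro exI[of _ T] exI[of _ "Suc i"]) (auto simp: T_def)
  next
    case False
    have "finite {q \<in> S. q ! 0 = t}" for t
    proof -
      have "{q \<in> S. q ! 0 = t} \<subseteq> Cons t ` {w. t # w \<in> S}"
      proof
        fix q assume q: "q \<in> {q \<in> S. q ! 0 = t}"
        then have "length q = Suc l" using Suc.prems(3) unfolding tuples_def by blast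
        then obtain w where "q = t # w" using q by (cases q) auto
        then show "q \<in> Cons t ` {w. t # w \<in> S}" using q by blast
      qed
      then show ?thesis using False by (meson finite_imageI finite_subset)
    qed
    then show ?thesis using Suc.prems by (intro exI[of _ S] exI[of _ 0]) auto
  qed
qed

end

context quotient_order
begin

lemma curve_facts:
  assumes C: "curve sg Q r \<gamma>"
  shows "\<gamma> t q \<Longrightarrow> q \<in> Q" "\<gamma> t q \<Longrightarrow> length q = l" "\<gamma> t q \<Longrightarrow> \<gamma> t q' \<Longrightarrow> q = q'"
    "\<gamma> t q \<Longrightarrow> \<gamma> t' q' \<Longrightarrow> t < t' \<Longrightarrow> ordr sg r q q'" "\<gamma> t q \<Longrightarrow> \<gamma> t' q' \<Longrightarrow> ordr sg r q q' \<Longrightarrow> t < t'"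
proof -
  note c = C[unfolded curve_def]
  show 1: "q \<in> Q" if "\<gamma> t q" for t q using c[THEN conjunct1] that by blast
  show "\<gamma> t q \<Longrightarrow> length q = l" using 1 Q_length by blast
  show 3: "q = q'" if "\<gamma> t q" "\<gamma> t q'" for t q q' using c[THEN conjunct2, THEN conjunct1] that by blast
  show 4: "ordr sg r q q'" if "\<gamma> t q" "\<gamma> t' q'" "t < t'" for t t' q q'
    using c[THEN conjunct2, THEN conjunct2] that by blast
  assume a: "\<gamma> t q" "\<gamma> t' q'" "ordr sg r q q'"
  consider "t < t'" | "t = t'" | "t' < t" by (rule linorder_cases)
  then show "t < t'"
  proof cases
    case 2
    then have "q = q'" using a 3 by blast
    then show ?thesis using a slo_irrefl[OF slo_ordr[OF slo] 1[OF a(1)]] by blast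
  next
    case 3
    then have "ordr sg r q' q" using 4 a by blast
    then show ?thesis using a slo_asym[OF slo_ordr[OF slo] 1[OF a(1)] 1[OF a(2)]] by blast
  qed
qed

lemma cset_iff: "curve sg Q r \<gamma> \<Longrightarrow> \<gamma> t q' \<Longrightarrow> t \<in> cset l sg r \<gamma> q \<longleftrightarrow> q' = q \<or> ordr sg r q' q"
  using curve_facts(2,3) unfolding cset_def by blast

lemma cset_less:
  assumes C: "curve sg Q r \<gamma>" and q: "q \<in> Q" and t: "t \<in> cset l sg r \<gamma> q" and t0: "\<gamma> t0 q0" "t0 \<notin> cset l sg r \<gamma> q"
  shows "t < t0"
proof -
  note s = slo_ordr[OF slo, of sg]
  obtain q' where q': "\<gamma> t q'" "q' = q \<or> ordr sg r q' q" using t unfolding cset_def by blast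
  have Q: "q' \<in> Q" "q0 \<in> Q" using curve_facts(1)[OF C] q' t0 by blast+
  have "ordr sg r q q0" using cset_iff[OF C t0(1)] t0(2) slo_total[OF s Q(2) q] by blast
  then have "ordr sg r q' q0" using q' slo_trans[OF s Q(1) q Q(2)] by blast
  then show ?thesis using curve_facts(5)[OF C q'(1) t0(1)] by blast
qed

lemma cut_exists:
  assumes d: "dcurve UNIV l (\<lambda>_. \<gamma>)" and C: "curve sg Q r \<gamma>" and q: "q \<in> Q"
    and t: "t \<in> cset l sg r \<gamma> q" and t0: "\<gamma> t0 q0" "t0 \<notin> cset l sg r \<gamma> q"
  shows "\<exists>s. cutv l sg r \<gamma> q s"
proof -
  note [dfn] = dscurveD[OF dcurve_cset[OF dr d, of sg]]
  have lq: "l = length q" using Q_length[OF q] by simp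
  have dd: "dfn UNIV (\<lambda>e. e 0 \<in> cset l sg r \<gamma> q)" by (rule dfn lq)+
  have ub: "\<forall>t. t \<in> cset l sg r \<gamma> q \<longrightarrow> t \<le> t0" using cset_less[OF C q _ t0] by (meson less_imp_le)
  from sup_ex[of "\<lambda>t. t \<in> cset l sg r \<gamma> q", OF dd t ub] obtain s where
    "\<forall>y. y \<in> cset l sg r \<gamma> q \<longrightarrow> y \<le> s" "\<forall>v. (\<forall>y. y \<in> cset l sg r \<gamma> q \<longrightarrow> y \<le> v) \<longrightarrow> s \<le> v" by blast
  then show ?thesis unfolding cutv_def using t t0 curve_facts(2)[OF C t0(1)] by blast
qed

lemma trv_infinite: "q \<in> trv l Q r S \<Longrightarrow> q' \<in> Q \<Longrightarrow> q' \<noteq> q \<Longrightarrow> infinite (S \<inter> seg Q r q q')"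
proof
  assume a: "q \<in> trv l Q r S" "q' \<in> Q" "q' \<noteq> q" and fin: "finite (S \<inter> seg Q r q q')"
  then have "dge l 1 (S \<inter> seg Q r q q')" using Q_length unfolding trv_def by blast
  then show False unfolding dge_one using fin finite_subset[of "{x \<in> S \<inter> seg Q r q q'. length x = l}" "S \<inter> seg Q r q q'"] by blast
qed

text \<open>One curve point between \<open>q\<close> and \<open>q'\<close> would only give \<le> for
  the suprema. With two such points, the supremum for \<open>q\<close> is at most the first
  parameter and the one for \<open>q'\<close> at least the second.\<close>

lemma cut_strict:
  assumes C: "curve sg Q r \<gamma>" and q: "q \<in> cdom l sg Q r \<gamma>" "q' \<in> cdom l sg Q r \<gamma>" and qq': "ordr sg r q q'"
    and s: "cutv l sg r \<gamma> q s" "cutv l sg r \<gamma> q' s'"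
  shows "s < s'"
proof -
  note sl = slo_ordr[OF slo, of sg]
  have Q: "q \<in> Q" "q' \<in> Q" and tr: "q \<in> trv l Q r {q. \<exists>t. \<gamma> t q}" using q unfolding cdom_def trv_def by auto
  have ne: "q' \<noteq> q" using qq' slo_irrefl[OF sl Q(1)] by blast
  have "infinite ({q. \<exists>t. \<gamma> t q} \<inter> seg Q r q q' - {q, q'})" using trv_infinite[OF tr Q(2) ne] by simp
  then obtain a where a: "a \<in> {q. \<exists>t. \<gamma> t q} \<inter> seg Q r q q' - {q, q'}" by (metis ex_in_conv finite.emptyI)
  have "infinite ({q. \<exists>t. \<gamma> t q} \<inter> seg Q r q q' - {q, q', a})" using trv_infinite[OF tr Q(2) ne] by simp
  then obtain b where b: "b \<in> {q. \<exists>t. \<gamma> t q} \<inter> seg Q r q q' - {q, q', a}" by (metis ex_in_conv finite.emptyI)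
  have key: "s < s'" if x: "\<gamma> tx x" "x \<in> seg Q r q q'" "x \<noteq> q" and y: "\<gamma> ty y" "y \<in> seg Q r q q'" "y \<noteq> q'" and xy: "ordr sg r x y" for x y tx ty
  proof -
    have xQ: "x \<in> Q" "y \<in> Q" using x y curve_facts(1)[OF C] by blast+
    have qx: "ordr sg r q x" and yq: "ordr sg r y q'"
      using seg_order[OF sl Q qq'] x y unfolding seg_ordr by blast+
    have "tx \<notin> cset l sg r \<gamma> q" using cset_iff[OF C x(1)] slo_asym[OF sl Q(1) xQ(1) qx] x(3) by blast
    then have "\<forall>t. t \<in> cset l sg r \<gamma> q \<longrightarrow> t \<le> tx" using cset_less[OF C Q(1) _ x(1)] by (meson less_imp_le)
    then have "s \<le> tx" using s(1) unfolding cutv_def by blast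
    moreover have "tx < ty" using curve_facts(5)[OF C x(1) y(1) xy] .
    moreover have "ty \<in> cset l sg r \<gamma> q'" using cset_iff[OF C y(1)] yq by blast
    then have "ty \<le> s'" using s(2) unfolding cutv_def by blast
    ultimately show ?thesis by order
  qed
  have "a \<in> Q" "b \<in> Q" "a \<noteq> b" using a b seg_subset[of Q r q q'] by blast+
  then have "ordr sg r a b \<or> ordr sg r b a" using slo_total[OF sl] by blast
  then show ?thesis using key a b by blast
qed

lemma cut_inj:
  assumes C: "curve sg Q r \<gamma>" and q: "q \<in> cdom l sg Q r \<gamma>" "q' \<in> cdom l sg Q r \<gamma>"
    and s: "cutv l sg r \<gamma> q s" "cutv l sg r \<gamma> q' s"
  shows "q = q'"
proof (rule ccontr)
  assume "q \<noteq> q'"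
  moreover have "q \<in> Q" "q' \<in> Q" using q unfolding cdom_def trv_def by auto
  ultimately have "ordr sg r q q' \<or> ordr sg r q' q" using slo_total[OF slo_ordr[OF slo]] by blast
  then show False using cut_strict[OF C q _ s] cut_strict[OF C q(2,1) _ s(2,1)] by blast
qed

text \<open>Besides the classes from \<open>trivial_part\<close> at most two points are missing, one
  at each end of the curve: two points on the same side of all curve points would have at most one
  curve point in their segment, instead of infinitely many.\<close>

lemma cdom_cofinite:
  assumes d: "dcurve UNIV l (\<lambda>_. \<gamma>)" and C: "curve sg Q r \<gamma>"
  obtains CC where "finite CC" "\<forall>C\<in>CC. cvx Q r C" "Q - cdom l sg Q r \<gamma> = \<Union> CC" "finite ({q. \<exists>t. \<gamma> t q} - cdom l sg Q r \<gamma>)"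
proof -
  note sl = slo_ordr[OF slo, of sg]
  note [dfn] = dscurveD[OF d]
  let ?S = "{q. \<exists>t. \<gamma> t q}"
  have dS: "dset l ?S" by (rule dfn)+
  have SQ: "?S \<subseteq> Q" using curve_facts(1)[OF C] by blast
  obtain CC where CC: "finite CC" "\<forall>C\<in>CC. cvx Q r C" "Q - trv l Q r ?S = \<Union> CC" "finite (?S - trv l Q r ?S)"
    by (rule trivial_part[OF dS SQ])
  define A1 where "A1 = {q. q \<in> trv l Q r ?S \<and> (\<forall>s\<in>?S. q = s \<or> ordr sg r q s)}"
  define A2 where "A2 = {q. q \<in> trv l Q r ?S \<and> (\<forall>s\<in>?S. s = q \<or> ordr sg r s q)}"
  have trvQ: "trv l Q r ?S \<subseteq> Q" unfolding trv_def by blast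
  have one: False if q: "q \<in> trv l Q r ?S" "q' \<in> trv l Q r ?S" "ordr sg r q q'" and w: "w \<in> {q, q'}"
    and all: "\<And>s. s \<in> ?S \<Longrightarrow> s \<in> seg Q r q q' \<Longrightarrow> s = w" for q q' w
  proof -
    have "q' \<noteq> q" using q trvQ slo_irrefl[OF sl] by blast
    then have "infinite (?S \<inter> seg Q r q q')" using trv_infinite[OF q(1)] q(2) trvQ by blast
    moreover have "?S \<inter> seg Q r q q' \<subseteq> {w}" using all by blast
    ultimately show False using finite_subset by blast
  qed
  have "q = q'" if q: "q \<in> A1" "q' \<in> A1" for q q'
  proof (rule ccontr)
    assume n: "q \<noteq> q'"
    have *: False if q: "q \<in> A1" "q' \<in> A1" "ordr sg r q q'" for q q'
    proof (rule one[of q q' q'])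
      fix s assume s: "s \<in> ?S" "s \<in> seg Q r q q'"
      have Q: "q \<in> Q" "q' \<in> Q" "s \<in> Q" using q s SQ trvQ unfolding A1_def by blast+
      have "s = q' \<or> ordr sg r s q'" using seg_order[OF sl Q(1,2) q(3)] s(2) unfolding seg_ordr by blast
      moreover have "q' = s \<or> ordr sg r q' s" using q(2) s(1) unfolding A1_def by blast
      ultimately show "s = q'" using slo_asym[OF sl Q(2,3)] by blast
    qed (use q in \<open>auto simp: A1_def\<close>)
    have "q \<in> Q" "q' \<in> Q" using q trvQ unfolding A1_def by blast+
    then show False using * q slo_total[OF sl _ _ n] by blast
  qed
  then have f1: "finite A1" by (metis finite.emptyI finite_insert finite_subset subsetI singletonI insert_iff equals0I)
  have "q = q'" if q: "q \<in> A2" "q' \<in> A2" for q q'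
  proof (rule ccontr)
    assume n: "q \<noteq> q'"
    have *: False if q: "q \<in> A2" "q' \<in> A2" "ordr sg r q q'" for q q'
    proof (rule one[of q q' q])
      fix s assume s: "s \<in> ?S" "s \<in> seg Q r q q'"
      have Q: "q \<in> Q" "q' \<in> Q" "s \<in> Q" using q s SQ trvQ unfolding A2_def by blast+
      have "s = q \<or> ordr sg r q s" using seg_order[OF sl Q(1,2) q(3)] s(2) unfolding seg_ordr by blast
      moreover have "s = q \<or> ordr sg r s q" using q(1) s(1) unfolding A2_def by blast
      ultimately show "s = q" using slo_asym[OF sl Q(1,3)] by blast
    qed (use q in \<open>auto simp: A2_def\<close>)
    have "q \<in> Q" "q' \<in> Q" using q trvQ unfolding A2_def by blast+
    then show False using * q slo_total[OF sl _ _ n] by blast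
  qed
  then have f2: "finite A2" by (metis finite.emptyI finite_insert finite_subset subsetI singletonI insert_iff equals0I)
  have sub: "trv l Q r ?S - cdom l sg Q r \<gamma> \<subseteq> A1 \<union> A2"
  proof
    fix q assume q: "q \<in> trv l Q r ?S - cdom l sg Q r \<gamma>"
    then have qQ: "q \<in> Q" and nocut: "\<not> (\<exists>s. cutv l sg r \<gamma> q s)" using trvQ unfolding cdom_def by blast+
    show "q \<in> A1 \<union> A2"
    proof (cases "\<exists>t. t \<in> cset l sg r \<gamma> q")
      case False
      have "q = s \<or> ordr sg r q s" if sS: "s \<in> ?S" for s
      proof -
        obtain t where t: "\<gamma> t s" using sS by blast
        then have "\<not> (s = q \<or> ordr sg r s q)" using False cset_iff[OF C t] by blast
        then show ?thesis using slo_total[OF sl qQ, of s] sS SQ by blast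
      qed
      then show ?thesis using q unfolding A1_def by blast
    next
      case True
      have "s = q \<or> ordr sg r s q" if sS: "s \<in> ?S" for s
      proof -
        obtain t where t: "\<gamma> t s" using sS by blast
        then have "t \<in> cset l sg r \<gamma> q" using cut_exists[OF d C qQ _ t] True nocut by blast
        then show ?thesis using cset_iff[OF C t] by blast
      qed
      then show ?thesis using q unfolding A2_def by blast
    qed
  qed
  have fin: "finite (trv l Q r ?S - cdom l sg Q r \<gamma>)" using f1 f2 sub by (meson finite_UnI finite_subset)
  have cd: "cdom l sg Q r \<gamma> \<subseteq> trv l Q r ?S" unfolding cdom_def by blast
  show ?thesis
  proof (rule that[of "CC \<union> (\<lambda>q. {q}) ` (trv l Q r ?S - cdom l sg Q r \<gamma>)"])
    show "finite (CC \<union> (\<lambda>q. {q}) ` (trv l Q r ?S - cdom l sg Q r \<gamma>))" using CC(1) fin by blast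
    show "\<forall>C\<in>CC \<union> (\<lambda>q. {q}) ` (trv l Q r ?S - cdom l sg Q r \<gamma>). cvx Q r C"
    proof
      fix C assume "C \<in> CC \<union> (\<lambda>q. {q}) ` (trv l Q r ?S - cdom l sg Q r \<gamma>)"
      then show "cvx Q r C"
      proof
        assume "C \<in> (\<lambda>q. {q}) ` (trv l Q r ?S - cdom l sg Q r \<gamma>)"
        then obtain q where "q \<in> Q" "C = {q}" using trvQ by blast
        then show ?thesis using seg_self[OF slo] unfolding cvx_def by simp
      qed (use CC in blast)
    qed
    show "Q - cdom l sg Q r \<gamma> = \<Union> (CC \<union> (\<lambda>q. {q}) ` (trv l Q r ?S - cdom l sg Q r \<gamma>))"
      unfolding Union_Un_distrib CC(3)[symmetric] using cd trvQ by auto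
    have "?S - cdom l sg Q r \<gamma> \<subseteq> (?S - trv l Q r ?S) \<union> (trv l Q r ?S - cdom l sg Q r \<gamma>)" by blast
    then show "finite (?S - cdom l sg Q r \<gamma>)" using CC(4) fin by (meson finite_UnI finite_subset)
  qed
qed

text \<open>The minimum of each finite slice is a definable choice of a point for each value
  \<open>t\<close> of coordinate \<open>i\<close>. Different \<open>t\<close> give different points,
  which excludes the constant case of the monotonicity theorem.\<close>

lemma curve_in_infinite_set:
  assumes dS: "dset l S" and SQ: "S \<subseteq> Q" and inf: "infinite S"
  shows "\<exists>sg \<gamma>. dcurve UNIV l (\<lambda>_. \<gamma>) \<and> curve sg Q r \<gamma> \<and> (\<forall>t q. \<gamma> t q \<longrightarrow> q \<in> S) \<and> infinite {q. \<exists>t. \<gamma> t q}"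
proof -
  obtain S1 i where S1: "dset l S1" "S1 \<subseteq> S" "infinite S1" "i < l" "\<forall>t. finite {q \<in> S1. q ! i = t}"
    using infinite_with_finite_slices[OF dS inf] SQ Ql by blast
  note [dfn] = dsetD[OF S1(1)] dsrelD[OF dr]
  define m where "m t q \<longleftrightarrow> q \<in> S1 \<and> q ! i = t \<and> (\<forall>q'. length q' = l \<longrightarrow> (q' \<in> S1 \<and> q' ! i = t \<longrightarrow> q = q' \<or> r q q'))" for t q
  have dm: "dcurve UNIV l (\<lambda>_. m)" unfolding m_def by (rule dfn elt_nth S1(4))+
  note [dfn] = dscurveD[OF dm]
  define T where "T = {t. \<exists>q. length q = l \<and> (q \<in> S1 \<and> q ! i = t)}"
  have dT: "dset1 T" unfolding T_def by (rule dfn elt_nth S1(4))+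
  have S1Q: "S1 \<subseteq> Q" using S1 SQ by blast
  have "infinite T"
  proof
    assume "finite T"
    moreover have "S1 \<subseteq> (\<Union>t\<in>T. {q \<in> S1. q ! i = t})" unfolding T_def using S1Q Q_length by blast
    ultimately show False using S1(3,5) by (meson finite_UN_I finite_subset)
  qed
  from interval_in_infinite_set[OF dT this] obtain a b where ab: "a < b" "\<And>t. a < t \<Longrightarrow> t < b \<Longrightarrow> t \<in> T" by blast
  have m_ex: "\<exists>q. m t q" if "t \<in> T" for t
  proof -
    have "{q \<in> S1. q ! i = t} \<noteq> {}" using that unfolding T_def by blast
    moreover have "finite {q \<in> S1. q ! i = t}" "{q \<in> S1. q ! i = t} \<subseteq> Q" using S1(5) S1Q by blast+
    ultimately obtain q where "q \<in> {q \<in> S1. q ! i = t}" "\<forall>x\<in>{q \<in> S1. q ! i = t}. q = x \<or> r q x"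
      using slo_min[OF slo, of "{q \<in> S1. q ! i = t}"] by blast
    then show ?thesis unfolding m_def by blast
  qed
  have m_Q: "q \<in> Q" "length q = l" "q \<in> S" "q ! i = t" if "m t q" for t q
    using that S1Q S1(2) Q_length unfolding m_def by blast+
  have m_uniq: "q = q'" if "m t q" "m t q'" for t q q'
  proof (rule ccontr)
    assume "q \<noteq> q'"
    then have "r q q'" "r q' q" using that m_Q(2)[OF that(1)] m_Q(2)[OF that(2)] unfolding m_def by blast+
    then show False using slo_asym[OF slo] m_Q(1) that by blast
  qed
  define le where "le t t' \<longleftrightarrow> (\<exists>q. length q = l \<and> (\<exists>q'. length q' = l \<and> (m t q \<and> m t' q' \<and> (q = q' \<or> r q q'))))" for t t'
  have dle: "drel1 UNIV (\<lambda>_. le)" unfolding le_def by (rule dfn)+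
  have le_iff: "le t t' \<longleftrightarrow> q = q' \<or> r q q'" if "m t q" "m t' q'" for t t' q q'
    using that m_Q(2) m_uniq unfolding le_def by blast
  have tot: "le t t' \<or> le t' t" if t: "a < t" "t < b" "a < t'" "t' < b" for t t'
  proof -
    obtain q q' where m: "m t q" "m t' q'" using m_ex[OF ab(2)[OF t(1,2)]] m_ex[OF ab(2)[OF t(3,4)]] by blast
    then show ?thesis using le_iff[OF m] le_iff[OF m(2,1)] slo_total[OF slo m_Q(1)[OF m(1)] m_Q(1)[OF m(2)]] by blast
  qed
  have tr: "le t t''" if t: "a < t" "t < b" "a < t'" "t' < b" "a < t''" "t'' < b" "le t t'" "le t' t''" for t t' t''
  proof -
    obtain q q' q'' where m: "m t q" "m t' q'" "m t'' q''"
      using m_ex[OF ab(2)[OF t(1,2)]] m_ex[OF ab(2)[OF t(3,4)]] m_ex[OF ab(2)[OF t(5,6)]] by blast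
    have "q = q' \<or> r q q'" "q' = q'' \<or> r q' q''" using le_iff[OF m(1,2)] le_iff[OF m(2,3)] t by blast+
    then have "q = q'' \<or> r q q''" using slo_trans[OF slo m_Q(1)[OF m(1)] m_Q(1)[OF m(2)] m_Q(1)[OF m(3)]] by blast
    then show ?thesis using le_iff[OF m(1,3)] by blast
  qed
  obtain c d where cd: "a \<le> c" "c < d" "d \<le> b" and cases: "(\<forall>x y. c < x \<and> x < y \<and> y < d \<longrightarrow> le x y \<and> le y x) \<or>
     (\<forall>x y. c < x \<and> x < y \<and> y < d \<longrightarrow> \<not> le y x) \<or> (\<forall>x y. c < x \<and> x < y \<and> y < d \<longrightarrow> \<not> le x y)"
    by (rule preorder_monotone_on_subinterval[OF dle tot tr ab(1)])
  have inT: "t \<in> T" if "c < t" "t < d" for t using ab(2)[of t] that cd by auto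
  define \<gamma> where "\<gamma> t q \<longleftrightarrow> c < t \<and> t < d \<and> m t q" for t q
  have d\<gamma>: "dcurve UNIV l (\<lambda>_. \<gamma>)" unfolding \<gamma>_def by (rule dfn)+
  have rng: "infinite {q. \<exists>t. \<gamma> t q}"
  proof
    assume "finite {q. \<exists>t. \<gamma> t q}"
    then have "finite ((\<lambda>q. q ! i) ` {q. \<exists>t. \<gamma> t q})" by blast
    moreover have "{t. c < t \<and> t < d} \<subseteq> (\<lambda>q. q ! i) ` {q. \<exists>t. \<gamma> t q}"
    proof
      fix t assume t: "t \<in> {t. c < t \<and> t < d}"
      then obtain q where q: "m t q" using m_ex inT by blast
      then have "\<gamma> t q" "t = q ! i" using t m_Q(4) unfolding \<gamma>_def by blast+
      then show "t \<in> (\<lambda>q. q ! i) ` {q. \<exists>t. \<gamma> t q}" by blast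
    qed
    ultimately show False using infinite_interval[OF cd(2)] finite_subset by blast
  qed
  have base: "(\<forall>t q. \<gamma> t q \<longrightarrow> q \<in> Q) \<and> (\<forall>t q q'. \<gamma> t q \<longrightarrow> \<gamma> t q' \<longrightarrow> q = q')"
    using m_Q(1) m_uniq unfolding \<gamma>_def by blast
  have "\<exists>sg. curve sg Q r \<gamma>"
    using cases
  proof (elim disjE)
    assume *: "\<forall>x y. c < x \<and> x < y \<and> y < d \<longrightarrow> le x y \<and> le y x"
    obtain x where x: "c < x" "x < d" using cd dense_ex by blast
    obtain y where y: "x < y" "y < d" using x dense_ex by blast
    obtain q q' where m: "m x q" "m y q'" using m_ex inT x y by (meson less_trans)
    have "q = q' \<or> r q q'" "q' = q \<or> r q' q" using * x y le_iff[OF m] le_iff[OF m(2,1)] by blast+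
    then have "q = q'" using slo_asym[OF slo m_Q(1)[OF m(1)] m_Q(1)[OF m(2)]] by blast
    then have "x = y" using m_Q(4) m by blast
    then show ?thesis using y by blast
  next
    assume *: "\<forall>x y. c < x \<and> x < y \<and> y < d \<longrightarrow> \<not> le y x"
    have "r q q'" if "\<gamma> t q" "\<gamma> t' q'" "t < t'" for t t' q q'
    proof -
      have m: "m t q" "m t' q'" and n: "\<not> le t' t" using that * unfolding \<gamma>_def by blast+
      then show ?thesis using le_iff[OF m(2,1)] slo_total[OF slo m_Q(1)[OF m(1)] m_Q(1)[OF m(2)]] by blast
    qed
    then show ?thesis unfolding curve_def using base by (intro exI[of _ True]) (auto simp: ordr_simps)
  next
    assume *: "\<forall>x y. c < x \<and> x < y \<and> y < d \<longrightarrow> \<not> le x y"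
    have "r q' q" if "\<gamma> t q" "\<gamma> t' q'" "t < t'" for t t' q q'
    proof -
      have m: "m t q" "m t' q'" and n: "\<not> le t t'" using that * unfolding \<gamma>_def by blast+
      then show ?thesis using le_iff[OF m] slo_total[OF slo m_Q(1)[OF m(1)] m_Q(1)[OF m(2)]] by blast
    qed
    then show ?thesis unfolding curve_def using base by (intro exI[of _ False]) (auto simp: ordr_simps)
  qed
  then obtain sg where "curve sg Q r \<gamma>" by blast
  moreover have "\<forall>t q. \<gamma> t q \<longrightarrow> q \<in> S" using m_Q(3) unfolding \<gamma>_def by blast
  ultimately show ?thesis using d\<gamma> rng by blast
qed

text \<open>The relation that the segment has dimension at most 1 has finitely many nontrivial
  classes, themselves of dimension at most 1 by \<open>class_dim\<close>. The points outside them
  are finite in number: a curve through such points would contain two of them between which an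
  injective cut map is defined, and the segment would have dimension at most 1.\<close>

lemma dim_le_1: "\<not> dge l 2 Q"
proof
  note [dfn] = dsetD[OF dQ] dsrelD[OF dr]
  define E where "E q q' \<longleftrightarrow> \<not> dge l 2 (Q \<inter> seg Q r q q')" for q q'
  have dE: "drel UNIV l l (\<lambda>_. E)" unfolding E_def seg_def by (rule dfn)+
  note [dfn] = dsrelD[OF dE]
  have E1: "E q q" if "q \<in> Q" for q
  proof -
    have "finite {x \<in> Q \<inter> {q}. length x = l}" by (rule finite_subset[of _ "{q}"]) auto
    then have "\<not> dge l 1 (Q \<inter> {q})" unfolding dge_one by simp
    then show ?thesis unfolding E_def seg_self[OF slo that] using dge_antimono[of l 2 "Q \<inter> {q}" 1] by auto
  qed
  have E2: "E q' q" if "q \<in> Q" "q' \<in> Q" "E q q'" for q q' using that unfolding E_def by (simp add: seg_commute)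
  have E3: "E q q''" if "q \<in> Q" "q' \<in> Q" "q'' \<in> Q" "E q q'" "E q' q''" for q q' q''
    using thin_equiv(1)[OF slo that(1-3)] that(4,5) unfolding E_def by blast
  have E4: "E q z" if "q \<in> Q" "q' \<in> Q" "E q q'" "z \<in> seg Q r q q'" for q q' z
    using thin_equiv(2)[OF slo that(1,2) that(2) that(4)] that(3) unfolding E_def by blast
  have "\<exists>R0. finite R0 \<and> R0 \<subseteq> Q \<and> {q. q \<in> Q \<and> (\<exists>q'. q' \<in> Q \<and> q' \<noteq> q \<and> E q q')} = (\<Union>q0\<in>R0. {q. q \<in> Q \<and> E q0 q})"
    by (rule finite_nontrivial_classes[OF dE]) (fact E1, fact E2, fact E3, fact E4)
  then obtain R0 where R0: "finite R0" "R0 \<subseteq> Q" "{q. q \<in> Q \<and> (\<exists>q'. q' \<in> Q \<and> q' \<noteq> q \<and> E q q')} = (\<Union>q0\<in>R0. {q. q \<in> Q \<and> E q0 q})" by blast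
  define Y where "Y = {q. q \<in> Q \<and> (\<forall>q'. length q' = l \<longrightarrow> (q' \<in> Q \<and> q' \<noteq> q \<longrightarrow> \<not> E q q'))}"
  have dY: "dset l Y" unfolding Y_def by (rule dfn)+
  have YQ: "Y \<subseteq> Q" unfolding Y_def by blast
  have QY: "Q - Y = (\<Union>q0\<in>R0. {q. q \<in> Q \<and> E q0 q})" unfolding R0(3)[symmetric] Y_def using Q_length by auto
  have finY: "finite Y"
  proof (rule ccontr)
    assume "infinite Y"
    from curve_in_infinite_set[OF dY YQ this] obtain sg \<gamma> where g: "dcurve UNIV l (\<lambda>_. \<gamma>)" "curve sg Q r \<gamma>"
      "\<forall>t q. \<gamma> t q \<longrightarrow> q \<in> Y" "infinite {q. \<exists>t. \<gamma> t q}" by blast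
    obtain CC where CC: "finite CC" "\<forall>C\<in>CC. cvx Q r C" "Q - cdom l sg Q r \<gamma> = \<Union> CC" "finite ({q. \<exists>t. \<gamma> t q} - cdom l sg Q r \<gamma>)"
      by (rule cdom_cofinite[OF g(1,2)])
    let ?D = "cdom l sg Q r \<gamma>"
    have "infinite ({q. \<exists>t. \<gamma> t q} \<inter> ?D)"
    proof
      assume "finite ({q. \<exists>t. \<gamma> t q} \<inter> ?D)"
      then have "finite (({q. \<exists>t. \<gamma> t q} \<inter> ?D) \<union> ({q. \<exists>t. \<gamma> t q} - ?D))" using CC(4) by blast
      then show False using g(4) by (simp only: Int_Diff_Un)
    qed
    moreover have "finite (pat r CC ` ({q. \<exists>t. \<gamma> t q} \<inter> ?D))"
      by (rule finite_subset[OF _ finite_pat[OF CC(1), of r]]) auto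
    \<comment> \<open>Infinitely many curve points but finitely many patterns: two of the points are
      not separated by the convex sets outside the domain of the cut map.\<close>
    ultimately have "\<not> inj_on (pat r CC) ({q. \<exists>t. \<gamma> t q} \<inter> ?D)" using finite_imageD by blast
    then obtain a b where ab: "a \<in> {q. \<exists>t. \<gamma> t q} \<inter> ?D" "b \<in> {q. \<exists>t. \<gamma> t q} \<inter> ?D" "a \<noteq> b" "pat r CC a = pat r CC b"
      unfolding inj_on_def by blast
    have abQ: "a \<in> Q" "b \<in> Q" and aY: "a \<in> Y" using ab g(3) YQ by blast+
    have segD: "seg Q r a b \<subseteq> ?D"
    proof
      fix z assume z: "z \<in> seg Q r a b"
      then have zQ: "z \<in> Q" using seg_subset[of Q r a b] by blast
      show "z \<in> ?D"
      proof (rule ccontr)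
        assume "z \<notin> ?D"
        then obtain C where "C \<in> CC" "z \<in> C" using CC(3) zQ by blast
        then have "a \<in> C" using pat_eq_seg[OF slo _ _ abQ ab(4) z] CC(2) by blast
        then show False using CC(3) \<open>C \<in> CC\<close> ab(1) by blast
      qed
    qed
    have dD: "dset l ?D" by (rule dfam_cdom[OF dQ dr g(1)])
    have dc: "dcurve UNIV l (\<lambda>_ t q. cutv l sg r \<gamma> q t)" by (rule dcurve_cutv[OF dr g(1)])
    \<comment> \<open>The graph of the cut map with the value in front. The functionality required
      by \<open>dge_functional_relation\<close> is then the injectivity of the cut map.\<close>
    define G where "G = {w. tl w \<in> ?D \<and> cutv l sg r \<gamma> (tl w) (hd w)}"
    have "dset (Suc l) G" unfolding G_def
      by (rule dfamI dfn_mem_Collect dfn_conj dsetD[OF dD] dscurveD[OF dc] list_tl elt_hd list_upt elt_var)+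
    then have dG: "dset (1 + l) G" by simp
    have mem: "[t] @ q \<in> G \<longleftrightarrow> q \<in> ?D \<and> cutv l sg r \<gamma> q t" for t q unfolding G_def by simp
    have "\<not> dge l 2 (Q \<inter> seg Q r a b)"
    proof
      assume "dge l 2 (Q \<inter> seg Q r a b)"
      then have "dge l 2 {q. dge 1 0 {x. x @ q \<in> G}}"
      proof (rule dge_mono)
        fix q assume "q \<in> Q \<inter> seg Q r a b"
        then have "q \<in> ?D" using segD by blast
        then obtain t where "cutv l sg r \<gamma> q t" unfolding cdom_def by blast
        then have "[t] @ q \<in> G" using mem \<open>q \<in> ?D\<close> by blast
        then have "dge 1 0 {x. x @ q \<in> G}" unfolding dge_zero by (intro exI[of _ "[t]"]) simp
        then show "q \<in> {q. dge 1 0 {x. x @ q \<in> G}}" by blast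
      qed
      then have "dge 1 (0 + 2) {x. \<exists>t. length t = l \<and> x @ t \<in> G}"
      proof (rule dge_functional_relation[OF dG, rotated])
        fix x q q' assume "length x = 1" "x @ q \<in> G" "x @ q' \<in> G"
        then obtain t where "x = [t]" by (auto simp: length_Suc_conv)
        then have "q \<in> ?D" "q' \<in> ?D" "cutv l sg r \<gamma> q t" "cutv l sg r \<gamma> q' t" using \<open>x @ q \<in> G\<close> \<open>x @ q' \<in> G\<close> mem by blast+
        then show "q = q'" using cut_inj[OF g(2)] by blast
      qed
      then show False using dge_le by fastforce
    qed
    then have "E a b" unfolding E_def .
    then show False using aY abQ ab(3) Q_length unfolding Y_def by blast
  qed
  assume "dge l 2 Q"
  then have "dge l 2 (Y \<union> (\<Union>q0\<in>R0. {q. q \<in> Q \<and> E q0 q}))" by (rule dge_mono) (use QY in blast)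
  then consider "dge l 2 Y" | "dge l 2 (\<Union>q0\<in>R0. {q. q \<in> Q \<and> E q0 q})" unfolding dge_Un by blast
  then show False
  proof cases
    case 1
    then have "dge l 1 Y" using dge_antimono by fastforce
    then show False unfolding dge_one using finY by simp
  next
    case 2
    from dge_UN[OF R0(1) this] obtain q0 where "q0 \<in> R0" "dge l 2 {q. q \<in> Q \<and> E q0 q}" by blast
    then show False using class_dim[OF slo Ql dQ dr dQ subset_refl, of q0 2] R0(2) unfolding E_def by blast
  qed
qed

end

section \<open>Curves covering the quotient\<close>

context ngrp
begin

definition slice :: "'a list set \<Rightarrow> nat \<Rightarrow> 'a \<Rightarrow> 'a list set" where
  "slice Q i t = {q. q \<in> Q \<and> q ! i = t}"

text \<open>The point of a finite slice with exactly \<open>j\<close> predecessors in it; a partial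
  curve that is undefined over infinite slices.\<close>

definition nth_pt :: "nat \<Rightarrow> 'a list set \<Rightarrow> ('a list \<Rightarrow> 'a list \<Rightarrow> bool) \<Rightarrow> nat \<Rightarrow> nat \<Rightarrow> 'a \<Rightarrow> 'a list \<Rightarrow> bool" where
  "nth_pt l Q r i j t q \<longleftrightarrow> q \<in> Q \<and> q ! i = t \<and> \<not> dge l 1 (slice Q i t) \<and>
     ncard j {q'. length q' = l \<and> (q' \<in> Q \<and> q' ! i = t \<and> r q' q)}"

text \<open>Compares only the value at \<open>t\<close> with nearby values. Monotonicity on a whole
  component is obtained from it by \<open>locally_increasing_imp_increasing\<close>.\<close>

definition mono_pts :: "nat \<Rightarrow> bool \<Rightarrow> ('a list \<Rightarrow> 'a list \<Rightarrow> bool) \<Rightarrow> ('a \<Rightarrow> 'a list \<Rightarrow> bool) \<Rightarrow> 'a set" where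
  "mono_pts l sg r \<gamma> = {t. \<exists>q. length q = l \<and> (\<gamma> t q \<and> (\<exists>u v. u < t \<and> t < v \<and> (\<forall>t'. u < t' \<and> t' < v \<longrightarrow>
     (\<exists>q'. length q' = l \<and> (\<gamma> t' q' \<and> (t' < t \<longrightarrow> ordr sg r q' q) \<and> (t < t' \<longrightarrow> ordr sg r q q'))))))}"

text \<open>As in \<open>gap\<close>, a component of the parameter set is singled out by counting
  boundary points.\<close>

definition piece :: "nat \<Rightarrow> bool \<Rightarrow> ('a list \<Rightarrow> 'a list \<Rightarrow> bool) \<Rightarrow> ('a \<Rightarrow> 'a list \<Rightarrow> bool) \<Rightarrow> nat \<Rightarrow> 'a \<Rightarrow> 'a list \<Rightarrow> bool" where
  "piece l sg r \<gamma> m t q \<longleftrightarrow> \<gamma> t q \<and> t \<in> mono_pts l sg r \<gamma> \<and> t \<notin> bd (mono_pts l sg r \<gamma>) \<and>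
     ncard m {b. b \<in> bd (mono_pts l sg r \<gamma>) \<and> b < t}"

lemma dcurve_nth_pt:
  assumes "dfam A l Q" "drel A l l r" "i < l" shows "dcurve A l (\<lambda>e. nth_pt l (Q e) (r e) i j)"
proof -
  note [dfn] = dfamD[OF assms(1)] drelD[OF assms(2)]
  show ?thesis unfolding nth_pt_def slice_def by (rule dfn elt_nth assms(3))+
qed

lemma dfam1_mono_pts:
  assumes "drel A l l r" "dcurve A l \<gamma>" shows "dfam1 A (\<lambda>e. mono_pts l sg (r e) (\<gamma> e))"
proof -
  note [dfn] = drelD[OF assms(1)] dcurveD[OF assms(2)]
  show ?thesis unfolding mono_pts_def ordr_def by (rule dfn)+
qed

lemma dfam1_bd:
  assumes "dfam1 A X" shows "dfam1 A (\<lambda>e. bd (X e))"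
proof -
  note [dfn] = dfam1D[OF assms(1)]
  show ?thesis unfolding bd_def by (rule dfn)+
qed

lemma dcurve_piece:
  assumes "drel A l l r" "dcurve A l \<gamma>" shows "dcurve A l (\<lambda>e. piece l sg (r e) (\<gamma> e) m)"
proof -
  note [dfn] = dcurveD[OF assms(2)] dfam1D[OF dfam1_mono_pts[OF assms]] dfam1D[OF dfam1_bd[OF dfam1_mono_pts[OF assms]]]
  show ?thesis unfolding piece_def by (rule dfn)+
qed

end

context quotient_order
begin

lemma slice_finite: "\<not> dge l 1 (slice Q i t) \<longleftrightarrow> finite (slice Q i t)"
proof -
  have "{x \<in> slice Q i t. length x = l} = slice Q i t" using Q_length unfolding slice_def by blast
  then show ?thesis unfolding dge_one by simp
qed

text \<open>Infinitely many infinite slices, which are disjoint, would make \<open>Q\<close>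
  two-dimensional, against \<open>dim_le_1\<close>.\<close>

lemma finite_infinite_slices:
  assumes i: "i < l" shows "finite {t. dge l 1 (slice Q i t)}"
proof (rule ccontr)
  note [dfn] = dsetD[OF dQ]
  assume inf: "infinite {t. dge l 1 (slice Q i t)}"
  define G where "G = {w. butlast w \<in> Q \<and> butlast w ! i = last w}"
  have "dset (Suc l) G" unfolding G_def by (rule dfn elt_nth[OF list_butlast] i)+
  then have dG: "dset (l + 1) G" by simp
  have mem: "q @ [t] \<in> G \<longleftrightarrow> q \<in> Q \<and> q ! i = t" for q t unfolding G_def by simp
  have eq: "{q. q @ [t] \<in> G} = slice Q i t" for t unfolding mem slice_def ..
  have "infinite {x \<in> {w. dge l 1 {x. x @ w \<in> G}}. length x = 1}"
  proof
    assume "finite {x \<in> {w. dge l 1 {x. x @ w \<in> G}}. length x = 1}"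
    then have "finite (hd ` {x \<in> {w. dge l 1 {x. x @ w \<in> G}}. length x = 1})" by blast
    moreover have "{t. dge l 1 (slice Q i t)} \<subseteq> hd ` {x \<in> {w. dge l 1 {x. x @ w \<in> G}}. length x = 1}"
    proof
      fix t assume "t \<in> {t. dge l 1 (slice Q i t)}"
      then have "dge l 1 {q. q @ [t] \<in> G}" unfolding eq by blast
      then show "t \<in> hd ` {x \<in> {w. dge l 1 {x. x @ w \<in> G}}. length x = 1}" by (intro image_eqI[of _ _ "[t]"]) auto
    qed
    ultimately show False using inf finite_subset by blast
  qed
  then have "dge 1 1 {w. dge l 1 {x. x @ w \<in> G}}" unfolding dge_one .
  then have "dge l (1 + 1) {x. \<exists>t. length t = 1 \<and> x @ t \<in> G}"
  proof (rule dge_functional_relation[OF dG, rotated])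
    fix x t t' assume "length t = 1" "length t' = 1" "x @ t \<in> G" "x @ t' \<in> G"
    moreover obtain u u' where "t = [u]" "t' = [u']" using calculation(1,2) by (auto simp: length_Suc_conv)
    ultimately show "t = t'" using mem by simp
  qed
  then have "dge l 2 {x. \<exists>t. length t = 1 \<and> x @ t \<in> G}" by (simp add: numeral_2_eq_2)
  then have "dge l 2 Q"
  proof (rule dge_mono)
    fix x assume "x \<in> {x. \<exists>t. length t = 1 \<and> x @ t \<in> G}"
    then obtain u where "x @ [u] \<in> G" by (auto simp: length_Suc_conv)
    then show "x \<in> Q" using mem by blast
  qed
  then show False using dim_le_1 by blast
qed

lemma nth_pt_facts:
  shows "nth_pt l Q r i j t q \<Longrightarrow> q \<in> Q" "nth_pt l Q r i j t q \<Longrightarrow> length q = l" "nth_pt l Q r i j t q \<Longrightarrow> q ! i = t"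
    "nth_pt l Q r i j t q \<Longrightarrow> nth_pt l Q r i j t q' \<Longrightarrow> q = q'"
proof -
  show 1: "q \<in> Q" "q ! i = t" if "nth_pt l Q r i j t q" for q t using that unfolding nth_pt_def by blast+
  show "nth_pt l Q r i j t q \<Longrightarrow> length q = l" using 1 Q_length by blast
  assume a: "nth_pt l Q r i j t q" "nth_pt l Q r i j t q'"
  have *: False if a: "nth_pt l Q r i j t q" "nth_pt l Q r i j t q'" and lt: "r q q'" for q q'
  proof -
    let ?B = "\<lambda>q. {q'. length q' = l \<and> (q' \<in> Q \<and> q' ! i = t \<and> r q' q)}"
    have Q: "q \<in> Q" "q' \<in> Q" using a 1 by blast+
    have sub: "?B q \<subseteq> ?B q'" using slo_trans[OF slo _ Q _ lt] by blast
    moreover have "q \<in> ?B q'" using Q Q_length lt 1(2)[OF a(1)] by blast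
    moreover have "q \<notin> ?B q" using slo_irrefl[OF slo Q(1)] by blast
    ultimately have ps: "?B q \<subset> ?B q'" by blast
    have "finite (?B q')" "card (?B q) = card (?B q')" using a unfolding nth_pt_def ncard_def by simp_all
    with psubset_card_mono[OF _ ps] show False by simp
  qed
  show "q = q'"
  proof (rule ccontr)
    assume "q \<noteq> q'"
    then have "r q q' \<or> r q' q" using slo_total[OF slo 1(1)[OF a(1)] 1(1)[OF a(2)]] by blast
    then show False using *[OF a] *[OF a(2,1)] by blast
  qed
qed

lemma nth_pt_exists:
  assumes q: "q \<in> Q" and fin: "finite (slice Q i (q ! i))"
  shows "\<exists>j<card (slice Q i (q ! i)). nth_pt l Q r i j (q ! i) q"
proof -
  let ?B = "{q'. length q' = l \<and> (q' \<in> Q \<and> q' ! i = q ! i \<and> r q' q)}"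
  have "?B \<subset> slice Q i (q ! i)" using q slo_irrefl[OF slo q] unfolding slice_def by blast
  then have "finite ?B" "card ?B < card (slice Q i (q ! i))" using fin by (auto intro: finite_subset psubset_card_mono)
  then show ?thesis using q fin slice_finite unfolding nth_pt_def ncard_def by blast
qed

text \<open>The preorder on parameters pulled back from \<open>Q\<close>. Both the monotonicity
  theorem and the passage from local to global monotonicity need it as a definable relation on
  \<open>M\<close>.\<close>

lemma nth_pt_le:
  fixes i j sg
  defines "le \<equiv> \<lambda>t t'. \<exists>q. length q = l \<and> (\<exists>q'. length q' = l \<and> (nth_pt l Q r i j t q \<and> nth_pt l Q r i j t' q' \<and> (q = q' \<or> ordr sg r q q')))"
  assumes i: "i < l"
  shows "drel1 UNIV (\<lambda>_. le)"
    "nth_pt l Q r i j t q \<Longrightarrow> nth_pt l Q r i j t' q' \<Longrightarrow> le t t' \<longleftrightarrow> q = q' \<or> ordr sg r q q'"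
proof -
  note [dfn] = dscurveD[OF dcurve_nth_pt[OF dQ dr i, of j]] dsrelD[OF dr]
  show "drel1 UNIV (\<lambda>_. le)" unfolding le_def ordr_def by (rule dfn)+
  show "nth_pt l Q r i j t q \<Longrightarrow> nth_pt l Q r i j t' q' \<Longrightarrow> le t t' \<longleftrightarrow> q = q' \<or> ordr sg r q q'"
    unfolding le_def using nth_pt_facts(2,4) by blast
qed

lemma nth_pt_tot:
  assumes "nth_pt l Q r i j t q" "nth_pt l Q r i j t' q'" shows "q = q' \<or> ordr sg r q q' \<or> ordr sg r q' q"
  using slo_total[OF slo_ordr[OF slo, of sg] nth_pt_facts(1)[OF assms(1)] nth_pt_facts(1)[OF assms(2)]] by blast

lemma nth_pt_trans:
  assumes "nth_pt l Q r i j t q" "nth_pt l Q r i j t' q'" "nth_pt l Q r i j t'' q''"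
    "q = q' \<or> ordr sg r q q'" "q' = q'' \<or> ordr sg r q' q''"
  shows "q = q'' \<or> ordr sg r q q''"
  using slo_trans[OF slo_ordr[OF slo, of sg] nth_pt_facts(1)[OF assms(1)] nth_pt_facts(1)[OF assms(2)] nth_pt_facts(1)[OF assms(3)]] assms(4,5) by blast

text \<open>On an interval of exceptions the monotonicity theorem would provide a subinterval of
  strict monotonicity; the constant case cannot occur, as the \<open>i\<close>-th coordinate of the
  point at \<open>t\<close> is \<open>t\<close>.\<close>

lemma finite_not_monotone:
  assumes i: "i < l"
  shows "finite {t. (\<exists>q. nth_pt l Q r i j t q) \<and> t \<notin> mono_pts l True r (nth_pt l Q r i j) \<and> t \<notin> mono_pts l False r (nth_pt l Q r i j)}"
proof (rule ccontr)
  let ?\<gamma> = "nth_pt l Q r i j"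
  have d: "dcurve UNIV l (\<lambda>_. ?\<gamma>)" by (rule dcurve_nth_pt[OF dQ dr i])
  note [dfn] = dscurveD[OF d] dset1D[OF dfam1_mono_pts[OF dr d]]
  assume "infinite {t. (\<exists>q. ?\<gamma> t q) \<and> t \<notin> mono_pts l True r ?\<gamma> \<and> t \<notin> mono_pts l False r ?\<gamma>}"
  then have inf: "infinite {t. (\<exists>q. length q = l \<and> ?\<gamma> t q) \<and> t \<notin> mono_pts l True r ?\<gamma> \<and> t \<notin> mono_pts l False r ?\<gamma>}"
    using nth_pt_facts(2) by (elim infinite_super[rotated]) blast
  have dd: "dset1 {t. (\<exists>q. length q = l \<and> ?\<gamma> t q) \<and> t \<notin> mono_pts l True r ?\<gamma> \<and> t \<notin> mono_pts l False r ?\<gamma>}" by (rule dfn)+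
  obtain a b where ab0: "a < b" "\<forall>t. a < t \<and> t < b \<longrightarrow> t \<in> {t. (\<exists>q. length q = l \<and> ?\<gamma> t q) \<and> t \<notin> mono_pts l True r ?\<gamma> \<and> t \<notin> mono_pts l False r ?\<gamma>}"
    by (rule interval_in_infinite_set[OF dd inf]) blast
  note ab1 = ab0(2)[rule_format, unfolded mem_Collect_eq]
  have ab: "a < b"
    "\<And>t. a < t \<Longrightarrow> t < b \<Longrightarrow> (\<exists>q. ?\<gamma> t q) \<and> t \<notin> mono_pts l True r ?\<gamma> \<and> t \<notin> mono_pts l False r ?\<gamma>" using ab0(1) ab1 by blast+
  define le where "le t t' \<longleftrightarrow> (\<exists>q. length q = l \<and> (\<exists>q'. length q' = l \<and> (?\<gamma> t q \<and> ?\<gamma> t' q' \<and> (q = q' \<or> ordr True r q q'))))" for t t'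
  have le_eq: "le = (\<lambda>t t'. \<exists>q. length q = l \<and> (\<exists>q'. length q' = l \<and> (?\<gamma> t q \<and> ?\<gamma> t' q' \<and> (q = q' \<or> ordr True r q q'))))"
    by (intro ext) (simp only: le_def)
  have dle: "drel1 UNIV (\<lambda>_. le)" unfolding le_eq by (rule nth_pt_le(1)[OF i])
  have le_iff: "le t t' \<longleftrightarrow> q = q' \<or> r q q'" if "?\<gamma> t q" "?\<gamma> t' q'" for t t' q q'
    using nth_pt_le(2)[OF i that, of True] unfolding le_eq ordr_simps .
  have ex: "\<exists>q. ?\<gamma> t q" if "a < t" "t < b" for t using ab(2)[OF that] by blast
  have tot: "le t t' \<or> le t' t" if t: "a < t" "t < b" "a < t'" "t' < b" for t t'
  proof -
    obtain q q' where m: "?\<gamma> t q" "?\<gamma> t' q'" using ex[OF t(1,2)] ex[OF t(3,4)] by blast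
    then show ?thesis using le_iff[OF m] le_iff[OF m(2,1)] nth_pt_tot[OF m, of True] unfolding ordr_simps by blast
  qed
  have tr: "le t t''" if t: "a < t" "t < b" "a < t'" "t' < b" "a < t''" "t'' < b" "le t t'" "le t' t''" for t t' t''
  proof -
    obtain q q' q'' where m: "?\<gamma> t q" "?\<gamma> t' q'" "?\<gamma> t'' q''" using ex[OF t(1,2)] ex[OF t(3,4)] ex[OF t(5,6)] by blast
    have "q = q' \<or> r q q'" "q' = q'' \<or> r q' q''" using le_iff[OF m(1,2)] le_iff[OF m(2,3)] t by blast+
    then show ?thesis using le_iff[OF m(1,3)] nth_pt_trans[OF m, of True] unfolding ordr_simps by blast
  qed
  obtain c d where cd: "a \<le> c" "c < d" "d \<le> b" and cases: "(\<forall>x y. c < x \<and> x < y \<and> y < d \<longrightarrow> le x y \<and> le y x) \<or>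
     (\<forall>x y. c < x \<and> x < y \<and> y < d \<longrightarrow> \<not> le y x) \<or> (\<forall>x y. c < x \<and> x < y \<and> y < d \<longrightarrow> \<not> le x y)"
    by (rule preorder_monotone_on_subinterval[OF dle tot tr ab(1)])
  have in_ab: "a < t \<and> t < b" if "c < t" "t < d" for t using that cd by auto
  obtain x where x: "c < x" "x < d" using cd dense_ex by blast
  obtain qx where qx: "?\<gamma> x qx" using ex in_ab x by blast
  have mono: "x \<in> mono_pts l sg r ?\<gamma>" if *: "\<And>t q t' q'. c < t \<Longrightarrow> t < t' \<Longrightarrow> t' < d \<Longrightarrow> ?\<gamma> t q \<Longrightarrow> ?\<gamma> t' q' \<Longrightarrow> ordr sg r q q'" for sg
    unfolding mono_pts_def
  proof (rule CollectI, rule exI[of _ qx], intro conjI)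
    show "length qx = l" "?\<gamma> x qx" using qx nth_pt_facts(2) by blast+
    show "\<exists>u v. u < x \<and> x < v \<and> (\<forall>t'. u < t' \<and> t' < v \<longrightarrow>
     (\<exists>q'. length q' = l \<and> (?\<gamma> t' q' \<and> (t' < x \<longrightarrow> ordr sg r q' qx) \<and> (x < t' \<longrightarrow> ordr sg r qx q'))))"
    proof (rule exI[of _ c], rule exI[of _ d], intro conjI allI impI)
      fix t' assume t': "c < t' \<and> t' < d"
      then obtain q' where q': "?\<gamma> t' q'" using ex in_ab by blast
      then show "\<exists>q'. length q' = l \<and> (?\<gamma> t' q' \<and> (t' < x \<longrightarrow> ordr sg r q' qx) \<and> (x < t' \<longrightarrow> ordr sg r qx q'))"
        using *[OF _ _ x(2) q' qx] *[OF x(1) _ _ qx q'] t' nth_pt_facts(2)[OF q'] by blast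
    qed (use x in auto)
  qed
  from cases show False
  proof (elim disjE)
    assume *: "\<forall>x y. c < x \<and> x < y \<and> y < d \<longrightarrow> le x y \<and> le y x"
    obtain y where y: "x < y" "y < d" using x dense_ex by blast
    have "c < y" using x y by order
    then obtain qy where qy: "?\<gamma> y qy" using ex in_ab y by blast
    have "qx = qy \<or> r qx qy" "qy = qx \<or> r qy qx" using * x y le_iff[OF qx qy] le_iff[OF qy qx] by blast+
    then have "qx = qy" using slo_asym[OF slo nth_pt_facts(1)[OF qx] nth_pt_facts(1)[OF qy]] by blast
    then have "x = y" using nth_pt_facts(3)[OF qx] nth_pt_facts(3)[OF qy] by simp
    then show False using y by simp
  next
    assume *: "\<forall>x y. c < x \<and> x < y \<and> y < d \<longrightarrow> \<not> le y x"
    have "ordr True r q q'" if "c < t" "t < t'" "t' < d" "?\<gamma> t q" "?\<gamma> t' q'" for t q t' q'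
      using * that(1-3) le_iff[OF that(5,4)] nth_pt_tot[OF that(4,5), of True] unfolding ordr_simps by blast
    then have "x \<in> mono_pts l True r ?\<gamma>" by - (rule mono)
    then show False using ab(2)[OF in_ab[OF x, THEN conjunct1] in_ab[OF x, THEN conjunct2]] by blast
  next
    assume *: "\<forall>x y. c < x \<and> x < y \<and> y < d \<longrightarrow> \<not> le x y"
    have "ordr False r q q'" if "c < t" "t < t'" "t' < d" "?\<gamma> t q" "?\<gamma> t' q'" for t q t' q'
      using * that(1-3) le_iff[OF that(4,5)] nth_pt_tot[OF that(4,5), of True] unfolding ordr_simps by blast
    then have "x \<in> mono_pts l False r ?\<gamma>" by - (rule mono)
    then show False using ab(2)[OF in_ab[OF x, THEN conjunct1] in_ab[OF x, THEN conjunct2]] by blast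
  qed
qed

text \<open>The component is convex by \<open>convex_component\<close>, and on a convex set of
  parameters local monotonicity is global.\<close>

lemma curve_piece:
  assumes i: "i < l" shows "curve sg Q r (piece l sg r (nth_pt l Q r i j) m)"
proof -
  let ?\<gamma> = "nth_pt l Q r i j"
  let ?D = "mono_pts l sg r ?\<gamma>"
  have d: "dcurve UNIV l (\<lambda>_. ?\<gamma>)" by (rule dcurve_nth_pt[OF dQ dr i])
  have dD: "dset1 ?D" by (rule dfam1_mono_pts[OF dr d])
  define J where "J t \<longleftrightarrow> t \<in> ?D \<and> t \<notin> bd ?D \<and> ncard m {b. b \<in> bd ?D \<and> b < t}" for t
  have pieceJ: "piece l sg r ?\<gamma> m t q \<longleftrightarrow> ?\<gamma> t q \<and> J t" for t q unfolding piece_def J_def by blast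
  define le where "le = (\<lambda>t t'. \<exists>q. length q = l \<and> (\<exists>q'. length q' = l \<and> (?\<gamma> t q \<and> ?\<gamma> t' q' \<and> (q = q' \<or> ordr sg r q q'))))"
  have dle: "drel1 UNIV (\<lambda>_. le)" unfolding le_def by (rule nth_pt_le(1)[OF i])
  have le_iff: "le t t' \<longleftrightarrow> q = q' \<or> ordr sg r q q'" if "?\<gamma> t q" "?\<gamma> t' q'" for t t' q q'
    using nth_pt_le(2)[OF i that] unfolding le_def .
  have ex: "\<exists>q. ?\<gamma> t q" if "J t" for t using that unfolding J_def mono_pts_def by blast
  have loc: "\<exists>u v. u < t \<and> t < v \<and> (\<forall>t' q'. u < t' \<longrightarrow> t' < v \<longrightarrow> ?\<gamma> t' q' \<longrightarrow> (t' < t \<longrightarrow> ordr sg r q' q) \<and> (t < t' \<longrightarrow> ordr sg r q q'))"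
    if "J t" and g: "?\<gamma> t q" for t q
  proof -
    have "t \<in> ?D" using that unfolding J_def by blast
    then obtain q0 u v where q0: "?\<gamma> t q0" and uv: "u < t" "t < v" "\<forall>t'. u < t' \<and> t' < v \<longrightarrow>
       (\<exists>q'. length q' = l \<and> (?\<gamma> t' q' \<and> (t' < t \<longrightarrow> ordr sg r q' q0) \<and> (t < t' \<longrightarrow> ordr sg r q0 q')))"
      unfolding mono_pts_def by blast
    have "q0 = q" using nth_pt_facts(4)[OF q0 g] .
    then have "(t' < t \<longrightarrow> ordr sg r q' q) \<and> (t < t' \<longrightarrow> ordr sg r q q')" if "u < t'" "t' < v" "?\<gamma> t' q'" for t' q'
      using uv(3) that nth_pt_facts(4)[OF that(3)] by blast
    then show ?thesis using uv(1,2) by blast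
  qed
  note sl = slo_ordr[OF slo, of sg]
  have asym: "\<not> (q' = q \<or> ordr sg r q' q)" if "?\<gamma> t q" "?\<gamma> t' q'" "ordr sg r q q'" for t t' q q'
    using slo_asym[OF sl nth_pt_facts(1)[OF that(1)] nth_pt_facts(1)[OF that(2)] that(3)]
      slo_irrefl[OF sl nth_pt_facts(1)[OF that(1)]] that(3) by blast
  have main: "\<not> le t' t" if JJ: "J t" "J t'" "t < t'" for t t'
  proof (rule locally_increasing_imp_increasing[OF dle, where J = J])
    fix x y z assume a: "J x" "J z" "x < y" "y < z"
    then have xz: "x \<in> ?D" "x \<notin> bd ?D" "z \<in> ?D" "z \<notin> bd ?D" and
      nx: "finite {b. b \<in> bd ?D \<and> b < x}" "card {b. b \<in> bd ?D \<and> b < x} = m" and nz: "card {b. b \<in> bd ?D \<and> b < z} = m"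
      unfolding J_def ncard_def by blast+
    have n: "card {b. b \<in> bd ?D \<and> b < x} = card {b. b \<in> bd ?D \<and> b < z}" using nx nz by simp
    note cc = convex_component[OF dD xz a(3,4) n]
    show "J y" unfolding J_def ncard_def using cc(1,2) nx unfolding cc(3) by blast
  next
    fix x y assume "J x" "J y"
    then obtain q q' where m: "?\<gamma> x q" "?\<gamma> y q'" using ex by blast
    show "le x y \<or> le y x" using le_iff[OF m] le_iff[OF m(2,1)] nth_pt_tot[OF m, of sg] by blast
  next
    fix x y z assume J: "J x" "J y" "J z" and le: "le x y" "le y z"
    obtain q q' q'' where m: "?\<gamma> x q" "?\<gamma> y q'" "?\<gamma> z q''" using ex[OF J(1)] ex[OF J(2)] ex[OF J(3)] by blast
    show "le x z" using le_iff[OF m(1,2)] le_iff[OF m(2,3)] le_iff[OF m(1,3)] le nth_pt_trans[OF m, of sg] by blast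
  next
    fix x assume Jx: "J x"
    obtain q where q: "?\<gamma> x q" using ex[OF Jx] by blast
    obtain u v where uv: "u < x" "x < v" and
      lo: "\<forall>t' q'. u < t' \<longrightarrow> t' < v \<longrightarrow> ?\<gamma> t' q' \<longrightarrow> (t' < x \<longrightarrow> ordr sg r q' q) \<and> (x < t' \<longrightarrow> ordr sg r q q')"
      using loc[OF Jx q] by blast
    have "\<not> le y x" if y: "x < y" "y < v" "J y" for y
    proof -
      obtain q' where q': "?\<gamma> y q'" using ex[OF y(3)] by blast
      have "u < y" using uv y by order
      then have "ordr sg r q q'" using lo q' y by blast
      then show ?thesis using le_iff[OF q' q] asym[OF q q'] by blast
    qed
    then show "\<exists>v. x < v \<and> (\<forall>y. x < y \<and> y < v \<and> J y \<longrightarrow> \<not> le y x)" using uv by blast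
    have "\<not> le x y" if y: "u < y" "y < x" "J y" for y
    proof -
      obtain q' where q': "?\<gamma> y q'" using ex[OF y(3)] by blast
      have "y < v" using uv y by order
      then have "ordr sg r q' q" using lo q' y by blast
      then show ?thesis using le_iff[OF q q'] asym[OF q' q] by blast
    qed
    then show "\<exists>u. u < x \<and> (\<forall>y. u < y \<and> y < x \<and> J y \<longrightarrow> \<not> le x y)" using uv by blast
  qed (fact JJ)+
  have "ordr sg r q q'" if "?\<gamma> t q" "J t" "?\<gamma> t' q'" "J t'" "t < t'" for t t' q q'
    using main[OF that(2,4,5)] le_iff[OF that(3,1)] nth_pt_tot[OF that(1,3), of sg] by blast
  then show ?thesis unfolding curve_def pieceJ using nth_pt_facts(1,4) by blast
qed

end

context ngrp
begin

text \<open>One finite list of parameter-free families serves all \<open>e\<close>. It is indexed by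
  direction, coordinate, rank in the slice and component, and the uniform bounds \<open>N1\<close>
  and \<open>N2\<close> on the last two keep it finite. Left over are points all of whose
  coordinates lie in the finite set \<open>I1\<close>, and points at the exceptional parameters
  \<open>I2\<close>.\<close>

lemma curves_cover:
  fixes Q :: "(nat \<Rightarrow> 'a) \<Rightarrow> 'a list set"
  assumes qo: "\<And>e. quotient_order M k l n (P e) (Q e) (F e) (r e)" and dQ: "dfam {} l Q" and dr: "drel {} l l r"
  obtains Cs where "\<forall>c\<in>set Cs. dcurve {} l (snd c) \<and> (\<forall>e. curve (fst c) (Q e) (r e) (snd c e))"
    "\<forall>e. finite (Q e - (\<Union>c\<in>set Cs. {q. \<exists>t. snd c e t q}))"
proof -
  note [dfn] = dfamD[OF dQ]
  have Qt: "Q e \<subseteq> tuples l" for e using quotient_order.Ql[OF qo] .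
  have Ql: "length q = l" if "q \<in> Q e" for q e using quotient_order.Q_length[OF qo that] .
  have "\<exists>N. \<forall>e t. finite (slice (Q e) i t) \<longrightarrow> card (slice (Q e) i t) \<le> N" if i: "i < l" for i
  proof -
    \<comment> \<open>The value that defines the slice is slot 0 of the index. Infinite slices are
      replaced by the empty set, since \<open>uniform_bound_list\<close> requires all members to be
      finite.\<close>
    define X where "X e = {q. q \<in> Q (\<lambda>i. e (Suc i)) \<and> q ! i = e 0 \<and> \<not> dge l 1 {q. q \<in> Q (\<lambda>i. e (Suc i)) \<and> q ! i = e 0}}" for e
    have dX: "dfam {} l X" unfolding X_def by (rule dfn elt_nth i)+
    have X_eq: "X e = (if finite (slice (Q (\<lambda>i. e (Suc i))) i (e 0)) then slice (Q (\<lambda>i. e (Suc i))) i (e 0) else {})" for e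
      using quotient_order.slice_finite[OF qo, of "\<lambda>i. e (Suc i)" i "e 0"] unfolding X_def slice_def by auto
    have "X e \<subseteq> tuples l" for e using Qt[of "\<lambda>i. e (Suc i)"] unfolding X_def by blast
    moreover have "finite (X e)" for e unfolding X_eq by simp
    ultimately obtain N where N: "\<And>e. card (X e) \<le> N" using uniform_bound_list[OF dX] by blast
    have "card (slice (Q e) i t) \<le> N" if "finite (slice (Q e) i t)" for e t
      using N[of "case_nat t e"] that unfolding X_eq by simp
    then show ?thesis by blast
  qed
  then have "\<forall>i\<in>{..<l}. \<exists>N. \<forall>e t. finite (slice (Q e) i t) \<longrightarrow> card (slice (Q e) i t) \<le> N" by blast
  from bchoice[OF this] obtain N1 where
    N1: "\<forall>i\<in>{..<l}. \<forall>e t. finite (slice (Q e) i t) \<longrightarrow> card (slice (Q e) i t) \<le> N1 i" by blast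
  have d0: "dcurve {} l (\<lambda>e. nth_pt l (Q e) (r e) i j)" if "i < l" for i j by (rule dcurve_nth_pt[OF dQ dr that])
  have dmp: "dfam1 {} (\<lambda>e. mono_pts l sg (r e) (nth_pt l (Q e) (r e) i j))" if "i < l" for sg i j
    by (rule dfam1_mono_pts[OF dr d0[OF that]])
  have fbd: "finite (bd (mono_pts l sg (r e) (nth_pt l (Q e) (r e) i j)))" if "i < l" for sg i j e
    by (rule finite_bd[OF dfam1_inst[OF dmp[OF that]]])
  have "\<exists>N. \<forall>e. card (bd (mono_pts l sg (r e) (nth_pt l (Q e) (r e) i j))) \<le> N" if i: "i < l" for sg i j
    using uniform_bound[OF dfam1_bd[OF dmp[OF i]] fbd[OF i], of sg j] by blast
  then have "\<forall>x\<in>{(sg, i, j). i < l}. \<exists>N. \<forall>e. card (bd (mono_pts l (fst x) (r e) (nth_pt l (Q e) (r e) (fst (snd x)) (snd (snd x))))) \<le> N"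
    by auto
  from bchoice[OF this] obtain N2 where
    "\<forall>x\<in>{(sg, i, j). i < l}. \<forall>e. card (bd (mono_pts l (fst x) (r e) (nth_pt l (Q e) (r e) (fst (snd x)) (snd (snd x))))) \<le> N2 x" by blast
  then have N2: "card (bd (mono_pts l sg (r e) (nth_pt l (Q e) (r e) i j))) \<le> N2 (sg, i, j)" if "i < l" for sg i j e
    using that by fastforce
  define Idx where "Idx = (SIGMA sg:UNIV::bool set. SIGMA i:{..<l}. SIGMA j:{..<N1 i}. {..N2 (sg, i, j)})"
  have "finite Idx" unfolding Idx_def by (intro finite_SigmaI) auto
  then obtain ix where ix: "set ix = Idx" using finite_list by blast
  define cv where "cv x = (case x of (sg, i, j, m) \<Rightarrow> (sg, \<lambda>e. piece l sg (r e) (nth_pt l (Q e) (r e) i j) m))" for x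
  show ?thesis
  proof (rule that[of "map cv ix"])
    show "\<forall>c\<in>set (map cv ix). dcurve {} l (snd c) \<and> (\<forall>e. curve (fst c) (Q e) (r e) (snd c e))"
    proof
      fix c assume "c \<in> set (map cv ix)"
      then obtain sg i j m where c: "c = cv (sg, i, j, m)" "i < l" unfolding set_map ix Idx_def by auto
      show "dcurve {} l (snd c) \<and> (\<forall>e. curve (fst c) (Q e) (r e) (snd c e))"
        unfolding c cv_def using dcurve_piece[OF dr d0[OF c(2)]] quotient_order.curve_piece[OF qo c(2)] by simp
    qed
    show "\<forall>e. finite (Q e - (\<Union>c\<in>set (map cv ix). {q. \<exists>t. snd c e t q}))"
    proof
      fix e
      define I1 where "I1 = (\<Union>i<l. {t. dge l 1 (slice (Q e) i t)})"
      define I2 where "I2 i j = {t. (\<exists>q. nth_pt l (Q e) (r e) i j t q) \<and> t \<notin> mono_pts l True (r e) (nth_pt l (Q e) (r e) i j) \<and> t \<notin> mono_pts l False (r e) (nth_pt l (Q e) (r e) i j)}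
         \<union> bd (mono_pts l True (r e) (nth_pt l (Q e) (r e) i j)) \<union> bd (mono_pts l False (r e) (nth_pt l (Q e) (r e) i j))" for i j
      define B where "B = {q. set q \<subseteq> I1 \<and> length q = l} \<union> (\<Union>i<l. \<Union>j<N1 i. \<Union>t\<in>I2 i j. {q. nth_pt l (Q e) (r e) i j t q})"
      have "finite I1" unfolding I1_def using quotient_order.finite_infinite_slices[OF qo] by blast
      moreover have "finite (I2 i j)" if "i < l" for i j
        unfolding I2_def using quotient_order.finite_not_monotone[OF qo that] fbd[OF that] by blast
      moreover have "finite {q. nth_pt l (Q e) (r e) i j t q}" for i j t
      proof -
        have "{q. nth_pt l (Q e) (r e) i j t q} \<subseteq> {SOME q. nth_pt l (Q e) (r e) i j t q}"
          using quotient_order.nth_pt_facts(4)[OF qo] by (blast intro: someI)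
        then show ?thesis using finite_subset by blast
      qed
      ultimately have "finite B" unfolding B_def
        by (intro finite_UnI finite_lists_length_eq finite_UN_I) auto
      moreover have "Q e - (\<Union>c\<in>set (map cv ix). {q. \<exists>t. snd c e t q}) \<subseteq> B"
      proof
        fix q assume q: "q \<in> Q e - (\<Union>c\<in>set (map cv ix). {q. \<exists>t. snd c e t q})"
        then have qQ: "q \<in> Q e" by blast
        show "q \<in> B"
        proof (cases "\<exists>i<l. finite (slice (Q e) i (q ! i))")
          case False
          have "set q \<subseteq> I1"
          proof
            fix t assume "t \<in> set q"
            then obtain i where i: "i < l" "q ! i = t" using Ql[OF qQ] by (auto simp: in_set_conv_nth)
            then have "dge l 1 (slice (Q e) i t)" using False quotient_order.slice_finite[OF qo] by blast
            then show "t \<in> I1" unfolding I1_def using i by blast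
          qed
          then show ?thesis unfolding B_def using Ql[OF qQ] by blast
        next
          case True
          then obtain i where i: "i < l" and fin: "finite (slice (Q e) i (q ! i))" by blast
          obtain j where j: "j < card (slice (Q e) i (q ! i))" "nth_pt l (Q e) (r e) i j (q ! i) q"
            using quotient_order.nth_pt_exists[OF qo qQ fin] by blast
          have jN: "j < N1 i" using j(1) N1 i fin by (meson lessThan_iff order_less_le_trans)
          let ?\<gamma> = "nth_pt l (Q e) (r e) i j" and ?t = "q ! i"
          have "?t \<in> I2 i j"
          proof (rule ccontr)
            assume n: "?t \<notin> I2 i j"
            then obtain sg where sg: "?t \<in> mono_pts l sg (r e) ?\<gamma>" unfolding I2_def using j(2) by blast
            have nb: "?t \<notin> bd (mono_pts l sg (r e) ?\<gamma>)" using n unfolding I2_def by (cases sg) auto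
            let ?m = "card {b. b \<in> bd (mono_pts l sg (r e) ?\<gamma>) \<and> b < ?t}"
            have "?m \<le> card (bd (mono_pts l sg (r e) ?\<gamma>))" by (rule card_mono[OF fbd[OF i]]) blast
            then have "?m \<le> N2 (sg, i, j)" using N2[OF i] order_trans by blast
            then have ixm: "(sg, i, j, ?m) \<in> set ix" unfolding ix Idx_def using i jN by simp
            have "piece l sg (r e) ?\<gamma> ?m ?t q"
              unfolding piece_def ncard_def using j(2) sg nb fbd[OF i] by simp
            then have "snd (cv (sg, i, j, ?m)) e ?t q" unfolding cv_def by simp
            then show False using q ixm by fastforce
          qed
          then show ?thesis unfolding B_def using i jN j(2) by blast
        qed
      qed
      ultimately show "finite (Q e - (\<Union>c\<in>set (map cv ix). {q. \<exists>t. snd c e t q}))" by (rule finite_subset[rotated])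
    qed
  qed
qed

end

section \<open>Embedding the quotient into the plane\<close>

lemma lex_less_Cons:
  assumes "length xs = m" "length ys = m"
  shows "(x # xs, y # ys) \<in> lex_less (Suc m) \<longleftrightarrow> x < y \<or> x = y \<and> (xs, ys) \<in> lex_less m"
proof -
  have "(us, vs) \<in> lex_less k \<longleftrightarrow> (us, vs) \<in> lex {(a, b). a < b} \<and> length us = k" for us vs :: "'a list" and k
    unfolding lex_less_def lexn_conv lex_conv by auto
  then show ?thesis using assms by simp
qed

lemma lex_less_append:
  assumes "length xs = m" "length ys = m" "length us = n" "length vs = n" "(xs, ys) \<in> lex_less m \<or> xs = ys \<and> (us, vs) \<in> lex_less n"
  shows "(xs @ us, ys @ vs) \<in> lex_less (m + n)"
  using assms
proof (induction m arbitrary: xs ys)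
  case (Suc m)
  then obtain x xs' y ys' where "xs = x # xs'" "ys = y # ys'" "length xs' = m" "length ys' = m" by (auto simp: length_Suc_conv)
  then show ?case using Suc by (auto simp: lex_less_Cons)
qed (auto simp: lex_less_def)

lemma lex_less_asym: "(xs, ys) \<in> lex_less m \<Longrightarrow> (ys, xs) \<notin> lex_less m"
proof (induction m arbitrary: xs ys)
  case (Suc m)
  have "length xs = Suc m" "length ys = Suc m" using Suc.prems unfolding lex_less_def by (auto simp del: lexn.simps dest: lexn_length)
  then obtain x xs' y ys' where "xs = x # xs'" "ys = y # ys'" "length xs' = m" "length ys' = m" by (auto simp: length_Suc_conv)
  then show ?case using Suc by (auto simp: lex_less_Cons)
qed (simp add: lex_less_def)

text \<open>The number of classes below that of \<open>q\<close> will serve as the position of its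
  class: it is constant on a class and increases strictly from one class to a later one. A class is
  represented by its value under \<kappa>, which makes the count definable.\<close>

lemma class_index:
  assumes s: "slo Q r" and E: "\<And>x. x \<in> Q \<Longrightarrow> E x x" "\<And>x y. x \<in> Q \<Longrightarrow> y \<in> Q \<Longrightarrow> E x y \<Longrightarrow> E y x"
      "\<And>x y z. x \<in> Q \<Longrightarrow> y \<in> Q \<Longrightarrow> z \<in> Q \<Longrightarrow> E x y \<Longrightarrow> E y z \<Longrightarrow> E x z"
    and conv: "\<And>x y z. x \<in> Q \<Longrightarrow> y \<in> Q \<Longrightarrow> E x y \<Longrightarrow> z \<in> seg Q r x y \<Longrightarrow> E x z"
    and \<kappa>: "\<And>x y. x \<in> Q \<Longrightarrow> y \<in> Q \<Longrightarrow> \<kappa> x = \<kappa> y \<longleftrightarrow> E x y"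
    and q: "q \<in> Q" "q' \<in> Q" "r q q'"
  shows "E q q' \<Longrightarrow> {\<kappa> z |z. z \<in> Q \<and> r z q \<and> \<not> E z q} = {\<kappa> z |z. z \<in> Q \<and> r z q' \<and> \<not> E z q'}"
    and "\<not> E q q' \<Longrightarrow> {\<kappa> z |z. z \<in> Q \<and> r z q \<and> \<not> E z q} \<subset> {\<kappa> z |z. z \<in> Q \<and> r z q' \<and> \<not> E z q'}"
proof -
  assume e: "E q q'"
  have e': "E q' q" using E(2)[OF q(1,2) e] .
  have "z \<in> Q \<and> r z q \<and> \<not> E z q \<longleftrightarrow> z \<in> Q \<and> r z q' \<and> \<not> E z q'" for z
  proof (cases "z \<in> Q")
    case z: True
    have 1: "E z q \<longleftrightarrow> E z q'" using E(3)[OF z q(1,2) _ e] E(3)[OF z q(2,1) _ e'] by blast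
    have 2: "r z q'" if "r z q" using slo_trans[OF s z q(1,2) that q(3)] .
    have 3: "r z q" if a: "r z q'" "\<not> E z q"
    proof (rule ccontr)
      assume n: "\<not> r z q"
      have "z \<noteq> q" using a(2) E(1) q by blast
      then have "r q z" using n slo_total[OF s z q(1)] by blast
      then have "z \<in> seg Q r q q'" using z a(1) unfolding seg_def by blast
      then show False using conv[OF q(1,2) e] E(2)[OF q(1) z] a(2) by blast
    qed
    show ?thesis using 1 2 3 by blast
  qed blast
  then show "{\<kappa> z |z. z \<in> Q \<and> r z q \<and> \<not> E z q} = {\<kappa> z |z. z \<in> Q \<and> r z q' \<and> \<not> E z q'}" by simp
next
  assume e: "\<not> E q q'"
  have "z \<in> Q \<and> r z q' \<and> \<not> E z q'" if z: "z \<in> Q" "r z q" "\<not> E z q" for z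
  proof -
    have "r z q'" using slo_trans[OF s z(1) q(1,2) z(2) q(3)] .
    moreover have "q \<in> seg Q r z q'" using z q unfolding seg_def by blast
    then have "\<not> E z q'" using conv[OF z(1) q(2)] z(3) by blast
    ultimately show ?thesis using z(1) by blast
  qed
  moreover have "\<kappa> q \<in> {\<kappa> z |z. z \<in> Q \<and> r z q' \<and> \<not> E z q'}" using q e by blast
  moreover have "\<kappa> q \<notin> {\<kappa> z |z. z \<in> Q \<and> r z q \<and> \<not> E z q}"
  proof
    assume "\<kappa> q \<in> {\<kappa> z |z. z \<in> Q \<and> r z q \<and> \<not> E z q}"
    then obtain z where z: "z \<in> Q" "\<not> E z q" "\<kappa> q = \<kappa> z" by blast
    then show False using \<kappa>[OF z(1) q(1)] by simp
  qed
  ultimately show "{\<kappa> z |z. z \<in> Q \<and> r z q \<and> \<not> E z q} \<subset> {\<kappa> z |z. z \<in> Q \<and> r z q' \<and> \<not> E z q'}" by blast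
qed

lemma finite_image_if_factors:
  assumes "finite (range p)" "\<And>x y. x \<in> Q \<Longrightarrow> y \<in> Q \<Longrightarrow> p x = p y \<Longrightarrow> \<kappa> x = \<kappa> y" shows "finite (\<kappa> ` Q)"
proof -
  have "\<kappa> x = \<kappa> (SOME y. y \<in> Q \<and> p y = p x)" if "x \<in> Q" for x
  proof -
    have "(SOME y. y \<in> Q \<and> p y = p x) \<in> Q \<and> p (SOME y. y \<in> Q \<and> p y = p x) = p x"
      by (rule someI[of "\<lambda>y. y \<in> Q \<and> p y = p x" x]) (use that in blast)
    then show ?thesis using assms(2)[OF that] by metis
  qed
  then have "\<kappa> ` Q \<subseteq> (\<lambda>z. \<kappa> (SOME y. y \<in> Q \<and> p y = z)) ` range p" by blast
  then show ?thesis using assms(1) finite_subset by blast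
qed

locale near = ngrp M for M :: "('f, 'r, 'a::linorder) fo_structure" +
  fixes \<theta> :: "'a \<Rightarrow> 'a"
  assumes inj_\<theta>: "inj \<theta>" and anti_\<theta>: "antimono \<theta>" and d\<theta>: "drel1 {} (\<lambda>_ x y. y = \<theta> x)"
begin

lemma \<theta>_less: "x < y \<Longrightarrow> \<theta> y < \<theta> x"
  using antimonoD[OF anti_\<theta>, of x y] injD[OF inj_\<theta>, of x y] by (simp add: order.order_iff_strict) auto

text \<open>The equivalence \<open>Er\<close> cuts \<open>Q e\<close> into finitely many convex pieces, on each of which one curve \<open>\<gamma> \<alpha>\<close> gives
  a strictly monotone cut map to \<open>M\<close>; \<open>\<theta>\<close> corrects the direction of decreasing curves.\<close>

lemma quotient_embedding:
  fixes Q :: "(nat \<Rightarrow> 'a) \<Rightarrow> 'a list set"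
  assumes qo: "\<And>e. quotient_order M k l n (P e) (Q e) (F e) (r e)" and dQ: "dfam {} l Q" and dr: "drel {} l l r"
  shows "\<exists>N G. drel {} (N + l) 2 (\<lambda>e w z. drop N w \<in> Q e \<and> z = G e (take N w) (drop N w)) \<and>
    (\<forall>e c q. length c = N \<longrightarrow> q \<in> Q e \<longrightarrow> (\<exists>x y. G e c q = [x, y] \<and> x \<in> set c)) \<and>
    (\<forall>e c q q'. length c = N \<longrightarrow> sorted_wrt (<) c \<longrightarrow> q \<in> Q e \<longrightarrow> q' \<in> Q e \<longrightarrow> r e q q' \<longrightarrow>
       (G e c q, G e c q') \<in> lex_less 2)"
proof -
  have slo: "slo (Q e) (r e)" for e using quotient_order.slo[OF qo] .
  have Ql: "length q = l" if "q \<in> Q e" for q e using quotient_order.Q_length[OF qo that] .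
  obtain Cs where Cs: "\<forall>c\<in>set Cs. dcurve {} l (snd c) \<and> (\<forall>e. curve (fst c) (Q e) (r e) (snd c e))"
    and cover: "\<forall>e. finite (Q e - (\<Union>c\<in>set Cs. {q. \<exists>t. snd c e t q}))"
    by (rule curves_cover[OF qo dQ dr])
  define L where "L = length Cs"
  define sg where "sg \<alpha> = fst (Cs ! \<alpha>)" for \<alpha>
  define \<gamma> where "\<gamma> \<alpha> = snd (Cs ! \<alpha>)" for \<alpha>
  have d\<gamma>: "dcurve {} l (\<gamma> \<alpha>)" and C\<gamma>: "curve (sg \<alpha>) (Q e) (r e) (\<gamma> \<alpha> e)" if "\<alpha> < L" for \<alpha> e
    using Cs that unfolding L_def sg_def \<gamma>_def by simp_all
  define D where "D \<alpha> e = cdom l (sg \<alpha>) (Q e) (r e) (\<gamma> \<alpha> e)" for \<alpha> e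
  have dD: "dfam {} l (D \<alpha>)" if "\<alpha> < L" for \<alpha>
    unfolding D_def by (rule dfam_cdom[OF dQ dr d\<gamma>[OF that]])
  have dcut: "dcurve {} l (\<lambda>e t q. cutv l (sg \<alpha>) (r e) (\<gamma> \<alpha> e) q t)" if "\<alpha> < L" for \<alpha>
    by (rule dcurve_cutv[OF dr d\<gamma>[OF that]])
  note [dfn] = dfamD[OF dQ] drelD[OF dr] dfamD[OF dD] dcurveD[OF dcut]
  have "\<exists>CC. finite CC \<and> (\<forall>C\<in>CC. cvx (Q e) (r e) C) \<and> Q e - D \<alpha> e = \<Union> CC \<and> finite ({q. \<exists>t. \<gamma> \<alpha> e t q} - D \<alpha> e)"
    if a: "\<alpha> < L" for \<alpha> e
    unfolding D_def
    by (rule quotient_order.cdom_cofinite[OF qo[of e] dcurve_inst[OF d\<gamma>[OF a], of e] C\<gamma>[OF a, of e]]) blast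
  then have "\<forall>x\<in>{(\<alpha>, e). \<alpha> < L}. \<exists>CC. finite CC \<and> (\<forall>C\<in>CC. cvx (Q (snd x)) (r (snd x)) C) \<and>
    Q (snd x) - D (fst x) (snd x) = \<Union> CC \<and> finite ({q. \<exists>t. \<gamma> (fst x) (snd x) t q} - D (fst x) (snd x))" by auto
  from bchoice[OF this] obtain CC0 where CC0: "\<forall>x\<in>{(\<alpha>, e). \<alpha> < L}. finite (CC0 x) \<and> (\<forall>C\<in>CC0 x. cvx (Q (snd x)) (r (snd x)) C) \<and>
    Q (snd x) - D (fst x) (snd x) = \<Union> (CC0 x) \<and> finite ({q. \<exists>t. \<gamma> (fst x) (snd x) t q} - D (fst x) (snd x))" by blast
  have CC: "finite (CC0 (\<alpha>, e))" "\<forall>C\<in>CC0 (\<alpha>, e). cvx (Q e) (r e) C" "Q e - D \<alpha> e = \<Union> (CC0 (\<alpha>, e))"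
    "finite ({q. \<exists>t. \<gamma> \<alpha> e t q} - D \<alpha> e)" if "\<alpha> < L" for \<alpha> e
    using CC0[rule_format, of "(\<alpha>, e)"] that by simp_all
  \<comment> \<open>The points in no domain. There are finitely many: almost all points lie on some
    curve, and each curve has finitely many points outside its own domain.\<close>
  define Fin where "Fin e = {q. q \<in> Q e \<and> \<not> (\<exists>\<alpha><L. q \<in> D \<alpha> e)}" for e
  have finFin: "finite (Fin e)" for e
  proof (rule finite_subset)
    show "Fin e \<subseteq> (Q e - (\<Union>c\<in>set Cs. {q. \<exists>t. snd c e t q})) \<union> (\<Union>\<alpha><L. {q. \<exists>t. \<gamma> \<alpha> e t q} - D \<alpha> e)"
    proof
      fix q assume q: "q \<in> Fin e"
      show "q \<in> (Q e - (\<Union>c\<in>set Cs. {q. \<exists>t. snd c e t q})) \<union> (\<Union>\<alpha><L. {q. \<exists>t. \<gamma> \<alpha> e t q} - D \<alpha> e)"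
      proof (cases "\<exists>\<alpha><L. \<exists>t. \<gamma> \<alpha> e t q")
        case True
        then show ?thesis using q unfolding Fin_def by blast
      next
        case False
        then have "\<nexists>c. c \<in> set Cs \<and> (\<exists>t. snd c e t q)" unfolding L_def \<gamma>_def by (metis in_set_conv_nth)
        then show ?thesis using q unfolding Fin_def by blast
      qed
    qed
    show "finite ((Q e - (\<Union>c\<in>set Cs. {q. \<exists>t. snd c e t q})) \<union> (\<Union>\<alpha><L. {q. \<exists>t. \<gamma> \<alpha> e t q} - D \<alpha> e))"
      using cover CC(4) by blast
  qed
  \<comment> \<open>Different points are related if the whole segment between them lies in the same
    domains, and in at least one. So the points of \<open>Fin\<close> form singleton classes, and on
    any other class the first domain containing it provides one cut map.\<close>
  define Er where "Er e q q' \<longleftrightarrow> q = q' \<or> q \<in> Q e \<and> q' \<in> Q e \<and> (\<forall>z. length z = l \<longrightarrow> (z \<in> seg (Q e) (r e) q q' \<longrightarrow>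
     (\<exists>\<alpha><L. z \<in> D \<alpha> e) \<and> (\<forall>\<alpha><L. z \<in> D \<alpha> e \<longleftrightarrow> q \<in> D \<alpha> e)))" for e q q'
  have dEr: "drel {} l l Er" unfolding Er_def seg_def by (rule dfn | assumption)+
  have ErD: "(\<exists>\<alpha><L. z \<in> D \<alpha> e) \<and> (\<forall>\<alpha><L. z \<in> D \<alpha> e \<longleftrightarrow> q \<in> D \<alpha> e)"
    if "Er e q q'" "q \<noteq> q'" "z \<in> seg (Q e) (r e) q q'" for e q q' z
  proof -
    have "z \<in> Q e" using that(3) seg_subset[of "Q e" "r e" q q'] by blast
    then show ?thesis using that Ql unfolding Er_def by blast
  qed
  have ErI: "Er e q q'" if "q \<in> Q e" "q' \<in> Q e"
    "\<And>z. z \<in> seg (Q e) (r e) q q' \<Longrightarrow> (\<exists>\<alpha><L. z \<in> D \<alpha> e) \<and> (\<forall>\<alpha><L. z \<in> D \<alpha> e \<longleftrightarrow> q \<in> D \<alpha> e)" for e q q'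
    using that unfolding Er_def by blast
  have ErQ: "q \<in> Q e \<and> q' \<in> Q e" if "Er e q q'" "q \<noteq> q'" for e q q' using that unfolding Er_def by blast
  have Er1: "Er e q q" for e q unfolding Er_def by blast
  have Er2: "Er e q' q" if E: "Er e q q'" for e q q'
  proof (cases "q = q'")
    case False
    note Q = ErQ[OF E False]
    show ?thesis
    proof (rule ErI)
      fix z assume "z \<in> seg (Q e) (r e) q' q"
      then have "z \<in> seg (Q e) (r e) q q'" unfolding seg_commute[of "Q e" "r e" q' q] .
      moreover have "q' \<in> seg (Q e) (r e) q q'" using seg_ends[OF slo] Q by blast
      ultimately show "(\<exists>\<alpha><L. z \<in> D \<alpha> e) \<and> (\<forall>\<alpha><L. z \<in> D \<alpha> e \<longleftrightarrow> q' \<in> D \<alpha> e)" using ErD[OF E False] by blast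
    qed (use Q in blast)+
  qed (use Er1 in simp)
  have Er3: "Er e q q''" if E: "Er e q q'" "Er e q' q''" for e q q' q''
  proof (cases "q = q' \<or> q' = q''")
    case False
    then have ne: "q \<noteq> q'" "q' \<noteq> q''" by blast+
    note Q = ErQ[OF E(1) ne(1)] ErQ[OF E(2) ne(2)]
    have Qs: "q \<in> Q e" "q' \<in> Q e" "q'' \<in> Q e" using Q by blast+
    show ?thesis
    proof (rule ErI[OF Qs(1,3)])
      fix z assume "z \<in> seg (Q e) (r e) q q''"
      then consider "z \<in> seg (Q e) (r e) q q'" | "z \<in> seg (Q e) (r e) q' q''" using seg_Un[OF slo Qs] by blast
      then show "(\<exists>\<alpha><L. z \<in> D \<alpha> e) \<and> (\<forall>\<alpha><L. z \<in> D \<alpha> e \<longleftrightarrow> q \<in> D \<alpha> e)"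
      proof cases
        case 1
        then show ?thesis by (rule ErD[OF E(1) ne(1)])
      next
        case 2
        have "q' \<in> seg (Q e) (r e) q q'" using seg_ends[OF slo Qs(1,2)] by blast
        then show ?thesis using ErD[OF E(2) ne(2) 2] ErD[OF E(1) ne(1)] by blast
      qed
    qed
  qed (use E in auto)
  have Er4: "Er e q z" if Q: "q \<in> Q e" "q' \<in> Q e" and E: "Er e q q'" and z: "z \<in> seg (Q e) (r e) q q'" for e q q' z
  proof (cases "q = q'")
    case True
    then show ?thesis using z seg_self[OF slo Q(1)] Er1 by simp
  next
    case False
    have "z \<in> Q e" using z seg_subset[of "Q e" "r e" q q'] by blast
    moreover have "seg (Q e) (r e) q z \<subseteq> seg (Q e) (r e) q q'"
      by (rule seg_trans[OF slo Q _ z]) (use seg_ends[OF slo Q] in blast)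
    ultimately show ?thesis using ErI[OF Q(1)] ErD[OF E False] by blast
  qed
  obtain s \<kappa> where \<kappa>l: "\<And>e x. length x = l \<Longrightarrow> length (\<kappa> e x) = s" and d\<kappa>: "drel {} l s (\<lambda>e x z. z = \<kappa> e x)"
    and \<kappa>0: "\<And>e x y. equivrel l (Er e) \<Longrightarrow> length x = l \<Longrightarrow> length y = l \<Longrightarrow> \<kappa> e x = \<kappa> e y \<longleftrightarrow> Er e x y"
    by (rule ei_family[OF dEr]) blast
  have eqEr: "equivrel l (Er e)" for e by (rule equivrelI) (use Er1 Er2 Er3 in blast)+
  have \<kappa>: "\<kappa> e x = \<kappa> e y \<longleftrightarrow> Er e x y" if "x \<in> Q e" "y \<in> Q e" for e x y
    using \<kappa>0[OF eqEr Ql[OF that(1)] Ql[OF that(2)]] .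
  note [dfn] = drelD[OF dEr] drelD[OF d\<kappa>]
  \<comment> \<open>Take as \<open>CC\<close> the convex sets outside the domains together with the
    points of \<open>Fin\<close> as singletons. Points with the same pattern are related, and
    patterns are finite in number.\<close>
  have fin\<kappa>: "finite (\<kappa> e ` Q e)" for e
  proof -
    define CC where "CC = (\<Union>\<alpha><L. CC0 (\<alpha>, e)) \<union> (\<lambda>q. {q}) ` Fin e"
    have finCC: "finite CC" unfolding CC_def using CC(1) finFin by blast
    have cvxCC: "cvx (Q e) (r e) C" if "C \<in> CC" for C
      using that unfolding CC_def
    proof
      assume "C \<in> (\<lambda>q. {q}) ` Fin e"
      then obtain q where "q \<in> Q e" "C = {q}" unfolding Fin_def by blast
      then show ?thesis using seg_self[OF slo] unfolding cvx_def by simp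
    qed (use CC(2) in blast)
    show ?thesis
    proof (rule finite_image_if_factors[OF finite_pat[OF finCC, of "r e"]])
      fix q q' assume q: "q \<in> Q e" "q' \<in> Q e" and pat: "pat (r e) CC q = pat (r e) CC q'"
      have same: "z \<in> C \<longleftrightarrow> q \<in> C" "z \<in> C \<longleftrightarrow> q' \<in> C" if "C \<in> CC" "z \<in> seg (Q e) (r e) q q'" for z C
        using pat_eq_seg[OF slo that(1) cvxCC[OF that(1)] q pat that(2)]
          pat_eq_seg[OF slo that(1) cvxCC[OF that(1)] q(2,1) pat[symmetric]] that(2) seg_commute[of "Q e" "r e" q q'] by blast+
      have "Er e q q'"
      proof (cases "q = q'")
        case False
        show ?thesis
        proof (rule ErI[OF q])
          fix z assume z: "z \<in> seg (Q e) (r e) q q'"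
          then have zQ: "z \<in> Q e" using seg_subset[of "Q e" "r e" q q'] by blast
          have "z \<notin> Fin e"
          proof
            assume "z \<in> Fin e"
            then have "{z} \<in> CC" unfolding CC_def by blast
            from same[OF this z] show False using False by simp
          qed
          then have "\<exists>\<alpha><L. z \<in> D \<alpha> e" using zQ unfolding Fin_def by blast
          moreover have "z \<in> D \<alpha> e \<longleftrightarrow> q \<in> D \<alpha> e" if a: "\<alpha> < L" for \<alpha>
          proof -
            have "z \<in> \<Union> (CC0 (\<alpha>, e)) \<longleftrightarrow> q \<in> \<Union> (CC0 (\<alpha>, e))" using same(1)[OF _ z] a unfolding CC_def by blast
            then show ?thesis unfolding CC(3)[OF a, symmetric] using zQ q(1) by blast
          qed
          ultimately show "(\<exists>\<alpha><L. z \<in> D \<alpha> e) \<and> (\<forall>\<alpha><L. z \<in> D \<alpha> e \<longleftrightarrow> q \<in> D \<alpha> e)" by blast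
        qed
      qed (use Er1 in simp)
      then show "\<kappa> e q = \<kappa> e q'" using \<kappa>[OF q] by blast
    qed
  qed
  define K where "K e = {z. \<exists>q. length q = l \<and> (q \<in> Q e \<and> z = \<kappa> e q)}" for e
  have dK: "dfam {} s K" unfolding K_def by (rule dfn)+
  have KQ: "K e = \<kappa> e ` Q e" for e unfolding K_def using Ql by blast
  have "K e \<subseteq> tuples s" for e unfolding K_def tuples_def using \<kappa>l by auto
  then obtain N0 where N0: "\<And>e. card (K e) \<le> N0" using uniform_bound_list[OF dK] fin\<kappa> unfolding KQ by blast
  \<comment> \<open>One more than the bound on the number of classes, so that every count of lower
    classes is an index into \<open>c\<close> and \<open>c ! 0\<close> exists.\<close>
  define N where "N = Suc N0"
  define B where "B e q = {z. length z = s \<and> (\<exists>q'. length q' = l \<and> (q' \<in> Q e \<and> r e q' q \<and> z = \<kappa> e q' \<and> \<not> Er e q' q))}" for e q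
  have B_eq: "B e q = {\<kappa> e z |z. z \<in> Q e \<and> r e z q \<and> \<not> Er e z q}" for e q unfolding B_def using Ql \<kappa>l by blast
  have BK: "B e q \<subseteq> K e" for e q unfolding B_eq KQ by blast
  have finB: "finite (B e q)" for e q using finite_subset[OF BK] fin\<kappa> unfolding KQ by blast
  have cardB: "card (B e q) < N" for e q
    using card_mono[OF _ BK, of e q] fin\<kappa>[of e] N0[of e] unfolding KQ N_def by simp
  have B_idx: "Er e q q' \<Longrightarrow> card (B e q) = card (B e q')" "\<not> Er e q q' \<Longrightarrow> card (B e q) < card (B e q')"
    if q: "q \<in> Q e" "q' \<in> Q e" "r e q q'" for e q q'
  proof -
    note ci = class_index[where Q = "Q e" and r = "r e" and E = "Er e" and \<kappa> = "\<kappa> e", OF slo Er1 Er2 Er3 Er4 \<kappa> q]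
    show "card (B e q) = card (B e q')" if "Er e q q'" unfolding B_eq using ci(1) that by simp
    show "card (B e q) < card (B e q')" if n: "\<not> Er e q q'"
    proof (rule psubset_card_mono[OF finB])
      show "B e q \<subset> B e q'" unfolding B_eq using ci(2) n by simp
    qed
  qed
  \<comment> \<open>The cut value along the first curve whose domain contains \<open>q\<close>.
    Membership in the domains is constant on a class, so all its points use the same curve; if that
    curve is decreasing, \<theta> reverses the values.\<close>
  define W where "W e q y \<longleftrightarrow> (\<exists>\<alpha><L. q \<in> D \<alpha> e \<and> (\<forall>\<beta><L. \<beta> < \<alpha> \<longrightarrow> q \<notin> D \<beta> e) \<and>
     ((sg \<alpha> \<and> cutv l (sg \<alpha>) (r e) (\<gamma> \<alpha> e) q y) \<or> (\<not> sg \<alpha> \<and> (\<exists>t. cutv l (sg \<alpha>) (r e) (\<gamma> \<alpha> e) q t \<and> y = \<theta> t))))" for e q y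
  have dW: "dcurve {} l (\<lambda>e y q. W e q y)" unfolding W_def by (rule dfn drel1D[OF d\<theta>] | assumption)+
  define first where "first e q = (LEAST \<alpha>. \<alpha> < L \<and> q \<in> D \<alpha> e)" for e q
  have first: "first e q < L" "q \<in> D (first e q) e" "\<forall>\<beta><L. \<beta> < first e q \<longrightarrow> q \<notin> D \<beta> e" if "\<exists>\<alpha><L. q \<in> D \<alpha> e" for e q
  proof -
    from that obtain \<alpha> where "\<alpha> < L \<and> q \<in> D \<alpha> e" by blast
    from LeastI[where P = "\<lambda>\<alpha>. \<alpha> < L \<and> q \<in> D \<alpha> e", OF this] show "first e q < L" "q \<in> D (first e q) e" unfolding first_def by blast+
    show "\<forall>\<beta><L. \<beta> < first e q \<longrightarrow> q \<notin> D \<beta> e" unfolding first_def using not_less_Least by blast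
  qed
  have W_iff: "W e q y \<longleftrightarrow> (if sg (first e q) then cutv l (sg (first e q)) (r e) (\<gamma> (first e q) e) q y
     else \<exists>t. cutv l (sg (first e q)) (r e) (\<gamma> (first e q) e) q t \<and> y = \<theta> t)" if ex: "\<exists>\<alpha><L. q \<in> D \<alpha> e" for e q y
  proof -
    have "\<alpha> = first e q" if "\<alpha> < L" "q \<in> D \<alpha> e" "\<forall>\<beta><L. \<beta> < \<alpha> \<longrightarrow> q \<notin> D \<beta> e" for \<alpha>
      using first[OF ex] that by (meson linorder_less_linear)
    then have "W e q y \<longleftrightarrow> ((sg (first e q) \<and> cutv l (sg (first e q)) (r e) (\<gamma> (first e q) e) q y) \<or>
      (\<not> sg (first e q) \<and> (\<exists>t. cutv l (sg (first e q)) (r e) (\<gamma> (first e q) e) q t \<and> y = \<theta> t)))"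
      unfolding W_def using first[OF ex] by blast
    then show ?thesis by simp
  qed
  have cut_unique: "t = t'" if "cutv l sg r' \<gamma>' q t" "cutv l sg r' \<gamma>' q t'" for sg r' \<gamma>' q and t t' :: 'a
    using that unfolding cutv_def by (meson antisym)
  have cut_ex: "\<exists>t. cutv l (sg \<alpha>) (r e) (\<gamma> \<alpha> e) q t" if "q \<in> D \<alpha> e" for \<alpha> e q using that unfolding D_def cdom_def by blast
  have W_ex: "\<exists>y. W e q y" if ex: "\<exists>\<alpha><L. q \<in> D \<alpha> e" for e q
    using cut_ex[OF first(2)[OF ex]] unfolding W_iff[OF ex] by (cases "sg (first e q)") auto
  have W_uniq: "y = y'" if ex: "\<exists>\<alpha><L. q \<in> D \<alpha> e" and w: "W e q y" "W e q y'" for e q y y'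
    using w cut_unique unfolding W_iff[OF ex] by (cases "sg (first e q)") (auto dest: cut_unique)
  \<comment> \<open>The class of a point of \<open>Fin\<close> is a singleton, so its second
    coordinate is never compared with another one; the default is \<open>c ! 0\<close>.\<close>
  define V where "V e c q y \<longleftrightarrow> (q \<in> Q e \<and> \<not> (\<exists>\<alpha><L. q \<in> D \<alpha> e) \<and> y = c ! 0) \<or> ((\<exists>\<alpha><L. q \<in> D \<alpha> e) \<and> W e q y)" for e c q y
  define v where "v e c q = (THE y. V e c q y)" for e c q
  have V_iff: "V e c q y \<longleftrightarrow> y = v e c q" if q: "q \<in> Q e" for e c q y
  proof -
    have "\<exists>!y. V e c q y"
    proof (cases "\<exists>\<alpha><L. q \<in> D \<alpha> e")
      case True
      have "V e c q = W e q" using True unfolding V_def by blast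
      then show ?thesis using W_ex[OF True] W_uniq[OF True] by auto
    next
      case False
      then show ?thesis using q unfolding V_def by blast
    qed
    from theI'[OF this] this show ?thesis unfolding v_def by blast
  qed
  define G where "G e c q = [c ! card (B e q), v e c q]" for e c q
  have "drel {} (N + l) 2 (\<lambda>e w z. drop N w \<in> Q e \<and> z = G e (take N w) (drop N w))"
  proof -
    have dt: "list_term A l (\<lambda>e. drop N (f e))" "list_term A N (\<lambda>e. take N (f e))" if "list_term A (N + l) f" for A and f :: "(nat \<Rightarrow> 'a) \<Rightarrow> 'a list"
      using list_drop[OF that, of l N] list_take[OF that, of N] by simp_all
    have "drel {} (N + l) 2 (\<lambda>e w z. drop N w \<in> Q e \<and> (\<exists>x y. z = [x, y] \<and> (\<exists>j<N. ncard j (B e (drop N w)) \<and> x = take N w ! j) \<and>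
        V e (take N w) (drop N w) y))"
      unfolding B_def V_def
      by (rule dfn dt dcurveD[OF dW] elt_nth | assumption | simp add: N_def)+
    moreover have "(d \<in> Q e \<and> (\<exists>x y. z = [x, y] \<and> (\<exists>j<N. ncard j (B e d) \<and> x = c ! j) \<and> V e c d y)) \<longleftrightarrow>
      (d \<in> Q e \<and> z = G e c d)" for e d c z
    proof -
      have 1: "(\<exists>j<N. ncard j (B e d) \<and> x = c ! j) \<longleftrightarrow> x = c ! card (B e d)" for x
        unfolding ncard_def using finB cardB by blast
      show ?thesis unfolding 1 G_def using V_iff by blast
    qed
    ultimately show ?thesis by (simp only:)
  qed
  moreover have "\<exists>x y. G e c q = [x, y] \<and> x \<in> set c" if "length c = N" "q \<in> Q e" for e c q
    unfolding G_def using cardB[of e q] that(1) by simp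
  moreover have "(G e c q, G e c q') \<in> lex_less 2"
    if c: "length c = N" "sorted_wrt (<) c" and q: "q \<in> Q e" "q' \<in> Q e" and qq': "r e q q'" for e c q q'
  proof -
    have "c ! card (B e q) < c ! card (B e q') \<or> c ! card (B e q) = c ! card (B e q') \<and> v e c q < v e c q'"
    proof (cases "Er e q q'")
      case False
      have "c ! card (B e q) < c ! card (B e q')"
        using sorted_wrt_nth_less[OF c(2) B_idx(2)[OF q qq' False]] cardB[of e q'] c(1) by blast
      then show ?thesis by blast
    next
      case True
      have ne: "q \<noteq> q'" using slo_irrefl[OF slo q(1)] qq' by blast
      have ends: "q \<in> seg (Q e) (r e) q q'" "q' \<in> seg (Q e) (r e) q q'" using seg_ends[OF slo q] by blast+
      have ex: "\<exists>\<alpha><L. q \<in> D \<alpha> e" "\<exists>\<alpha><L. q' \<in> D \<alpha> e" and same: "\<forall>\<alpha><L. q' \<in> D \<alpha> e \<longleftrightarrow> q \<in> D \<alpha> e"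
        using ErD[OF True ne ends(1)] ErD[OF True ne ends(2)] by blast+
      have "(\<lambda>\<alpha>. \<alpha> < L \<and> q' \<in> D \<alpha> e) = (\<lambda>\<alpha>. \<alpha> < L \<and> q \<in> D \<alpha> e)" using same by blast
      then have f: "first e q' = first e q" unfolding first_def by simp
      let ?a = "first e q"
      have a: "?a < L" "q \<in> D ?a e" "q' \<in> D ?a e" using first(1,2)[OF ex(1)] same by blast+
      have V: "V e c q (v e c q)" "V e c q' (v e c q')" using V_iff q by blast+
      then have W: "W e q (v e c q)" "W e q' (v e c q')" using ex unfolding V_def by blast+
      note cs = quotient_order.cut_strict[OF qo C\<gamma>[OF a(1)]]
      have "v e c q < v e c q'"
      proof (cases "sg ?a")
        case True
        then have w: "cutv l (sg ?a) (r e) (\<gamma> ?a e) q (v e c q)" "cutv l (sg ?a) (r e) (\<gamma> ?a e) q' (v e c q')"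
          using W unfolding W_iff[OF ex(1)] W_iff[OF ex(2)] f by simp_all
        show ?thesis by (rule cs[OF a(2,3)[unfolded D_def] _ w]) (use True qq' in \<open>simp add: ordr_simps\<close>)
      next
        case False
        then obtain t t' where w: "cutv l (sg ?a) (r e) (\<gamma> ?a e) q t" "cutv l (sg ?a) (r e) (\<gamma> ?a e) q' t'"
          and v: "v e c q = \<theta> t" "v e c q' = \<theta> t'"
          using W unfolding W_iff[OF ex(1)] W_iff[OF ex(2)] f by auto
        \<comment> \<open>For a decreasing curve \<open>cut_strict\<close> refers to the converse
          order, so \<open>q'\<close> comes first.\<close>
        have "t' < t" by (rule cs[OF a(3,2)[unfolded D_def] _ w(2,1)]) (use False qq' in \<open>simp add: ordr_simps\<close>)
        then show ?thesis unfolding v by (rule \<theta>_less)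
      qed
      then show ?thesis using B_idx(1)[OF q qq' True] by simp
    qed
    then show ?thesis unfolding G_def by (simp add: numeral_2_eq_2 lex_less_Cons) blast
  qed
  ultimately show ?thesis by blast
qed

end

section \<open>Embedding by induction on the dimension\<close>

text \<open>Puts a point of the quotient in front of an index, so that its fibre becomes a member of
  a family indexed by environments.\<close>

definition prepend :: "nat \<Rightarrow> 'b list \<Rightarrow> (nat \<Rightarrow> 'b) \<Rightarrow> nat \<Rightarrow> 'b" where
  "prepend l q e i = (if i < l then q ! i else e (i - l))"

lemma prepend_simps: "length q = l \<Longrightarrow> map (prepend l q e) [0..<l] = q" "prepend l q e (l + i) = e i"
  unfolding prepend_def by (auto intro: nth_equalityI)

lemma env_prepend:
  assumes "list_term A l L" "env_term A s" shows "env_term A (\<lambda>e. prepend l (L e) (s e))"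
  unfolding env_term_def
proof
  fix i show "elt_term A (\<lambda>e. prepend l (L e) (s e) i)"
    using assms(2) elt_nth[OF assms(1), of i] unfolding prepend_def env_term_def by (cases "i < l") simp_all
qed

context near
begin

text \<open>An element is labelled by the number of its predecessors. The labels come from
  \<open>c\<close>, whose length exceeds all cardinalities by uniform finiteness.\<close>

lemma finite_embedding:
  assumes dP: "dfam {} k P" and dr: "drel {} k k r" and Pk: "\<And>e. P e \<subseteq> tuples k"
    and slo: "\<And>e. slo (P e) (r e)" and fin: "\<And>e. finite (P e)"
  shows "\<exists>N g. 0 < N \<and> drel {} (N + k) 1 (\<lambda>e w z. drop N w \<in> P e \<and> z = [g e (take N w) (drop N w)]) \<and>
    (\<forall>e c x. length c = N \<longrightarrow> x \<in> P e \<longrightarrow> g e c x \<in> set c) \<and>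
    (\<forall>e c x y. length c = N \<longrightarrow> sorted_wrt (<) c \<longrightarrow> x \<in> P e \<longrightarrow> y \<in> P e \<longrightarrow> r e x y \<longrightarrow> g e c x < g e c y)"
proof -
  have Pl: "length x = k" if "x \<in> P e" for x e using that Pk by (auto simp: tuples_def)
  obtain N0 where N0: "\<And>e. card (P e) \<le> N0" using uniform_bound_list[OF dP Pk fin] by blast
  define N where "N = Suc N0"
  define B where "B e x = {y. length y = k \<and> (y \<in> P e \<and> r e y x)}" for e x
  have BP: "B e x \<subseteq> P e" for e x unfolding B_def by blast
  have finB: "finite (B e x)" for e x using finite_subset[OF BP fin] .
  have cardB: "card (B e x) < N" for e x using card_mono[OF fin BP, of e x] N0[of e] unfolding N_def by simp
  note [dfn] = dfamD[OF dP] drelD[OF dr]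
  have dt: "list_term A k (\<lambda>e. drop N (f e))" "list_term A N (\<lambda>e. take N (f e))" if "list_term A (N + k) f" for A and f :: "(nat \<Rightarrow> 'a) \<Rightarrow> 'a list"
    using list_drop[OF that, of k N] list_take[OF that, of N] by simp_all
  have "drel {} (N + k) 1 (\<lambda>e w z. drop N w \<in> P e \<and> (\<exists>j<N. ncard j (B e (drop N w)) \<and> z = [take N w ! j]))"
    unfolding B_def by (rule dfn dt elt_nth | assumption)+
  moreover have "(\<exists>j<N. ncard j (B e d) \<and> z = [c ! j]) \<longleftrightarrow> z = [c ! card (B e d)]" for e d z and c :: "'a list"
    unfolding ncard_def using finB cardB by blast
  ultimately have "drel {} (N + k) 1 (\<lambda>e w z. drop N w \<in> P e \<and> z = [take N w ! card (B e (drop N w))])" by (simp only:)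
  moreover have "c ! card (B e x) < c ! card (B e y)" if c: "length c = N" "sorted_wrt (<) c" and xy: "x \<in> P e" "y \<in> P e" "r e x y" for e c x y
  proof (rule sorted_wrt_nth_less[OF c(2)])
    have "B e x \<subset> B e y"
      using slo_trans[OF slo _ xy(1,2) _ xy(3)] slo_irrefl[OF slo xy(1)] xy Pl unfolding B_def by blast
    then show "card (B e x) < card (B e y)" by (rule psubset_card_mono[OF finB])
    show "card (B e y) < length c" using cardB c by simp
  qed
  moreover have "c ! card (B e x) \<in> set c" if "length c = N" for e c x using cardB[of e x] that by simp
  moreover have "0 < N" unfolding N_def by simp
  ultimately show ?thesis by (intro exI[of _ N] exI[of _ "\<lambda>e c x. c ! card (B e x)"]) blast
qed

text \<open>Provides the locale \<open>quotient_order\<close> for all members of a family, by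
  identifying points joined by a segment of dimension less than \<open>n\<close>. Segments between
  distinct classes are then fat by construction, and the fibres have dimension less than
  \<open>n\<close> by \<open>class_dim\<close>.\<close>

lemma thin_quotient:
  fixes P :: "(nat \<Rightarrow> 'a) \<Rightarrow> 'a list set"
  assumes dP: "dfam {} k P" and dr: "drel {} k k r" and Pk: "\<And>e. P e \<subseteq> tuples k"
    and slo: "\<And>e. slo (P e) (r e)" and dim: "\<And>e. \<not> dge k (Suc n) (P e)" and n: "0 < n"
  shows "\<exists>l F Q rq. drel {} k l (\<lambda>e x z. z = F e x) \<and> dfam {} l Q \<and> drel {} l l rq \<and>
    (\<forall>e. quotient_order M k l n (P e) (Q e) (F e) (rq e)) \<and> (\<forall>e x. x \<in> P e \<longrightarrow> length (F e x) = l \<and> F e x \<in> Q e) \<and>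
    (\<forall>e x y. x \<in> P e \<longrightarrow> y \<in> P e \<longrightarrow> r e x y \<longrightarrow> F e x \<noteq> F e y \<longrightarrow> rq e (F e x) (F e y)) \<and>
    (\<forall>e q. \<not> dge k n {x. x \<in> P e \<and> q = F e x})"
proof -
  have Pl: "length x = k" if "x \<in> P e" for x e using that Pk by (auto simp: tuples_def)
  note [dfn] = dfamD[OF dP] drelD[OF dr]
  define E where "E e x y \<longleftrightarrow> x = y \<or> x \<in> P e \<and> y \<in> P e \<and> \<not> dge k n (P e \<inter> seg (P e) (r e) x y)" for e x y
  have dE: "drel {} k k E" unfolding E_def seg_def by (rule dfn)+
  \<comment> \<open>Here \<open>0 < n\<close> enters: a singleton has dimension 0 and has to count
    as thin.\<close>
  have thin1: "\<not> dge k n (P e \<inter> seg (P e) (r e) x x)" if "x \<in> P e" for e x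
  proof
    assume "dge k n (P e \<inter> seg (P e) (r e) x x)"
    then have "dge k 1 (P e \<inter> {x})" unfolding seg_self[OF slo that] by (rule dge_antimono) (use n in simp)
    moreover have "finite {y \<in> P e \<inter> {x}. length y = k}" by (rule finite_subset[of _ "{x}"]) auto
    ultimately show False unfolding dge_one by blast
  qed
  have E_iff: "E e x y \<longleftrightarrow> \<not> dge k n (P e \<inter> seg (P e) (r e) x y)" if "x \<in> P e" "y \<in> P e" for e x y
    using that thin1 unfolding E_def by blast
  have eqE: "equivrel k (E e)" for e
  proof (rule equivrelI)
    fix x y z assume xy: "E e x y" "E e y z"
    show "E e x z"
    proof (cases "x = y \<or> y = z")
      case False
      then have "x \<in> P e" "y \<in> P e" "z \<in> P e" using xy unfolding E_def by blast+
      then show ?thesis using xy E_iff thin_equiv(1)[OF slo, of x e y z k n "P e"] by blast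
    qed (use xy in auto)
  next
    fix x y assume "E e x y"
    then show "E e y x" unfolding E_def seg_commute[of "P e" "r e" y x] by blast
  qed (simp add: E_def)
  obtain l F where Fl: "\<And>e x. length x = k \<Longrightarrow> length (F e x) = l" and dF: "drel {} k l (\<lambda>e x z. z = F e x)"
    and F0: "\<And>e x y. equivrel k (E e) \<Longrightarrow> length x = k \<Longrightarrow> length y = k \<Longrightarrow> F e x = F e y \<longleftrightarrow> E e x y"
    by (rule ei_family[OF dE]) blast
  have F: "F e x = F e y \<longleftrightarrow> \<not> dge k n (P e \<inter> seg (P e) (r e) x y)" if "x \<in> P e" "y \<in> P e" for e x y
    using F0[OF eqE Pl[OF that(1)] Pl[OF that(2)]] E_iff[OF that] by blast
  have conv: "F e x = F e z" if "x \<in> P e" "y \<in> P e" "F e x = F e y" "z \<in> seg (P e) (r e) x y" for e x y z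
  proof -
    have "z \<in> P e" using that(4) seg_subset[of "P e" "r e" x y] by blast
    then show ?thesis using that F thin_equiv(2)[OF slo that(1,2,2,4)] by blast
  qed
  note [dfn] = drelD[OF dF]
  define Q where "Q e = {q. \<exists>x. length x = k \<and> (x \<in> P e \<and> q = F e x)}" for e
  define rq where "rq e q q' \<longleftrightarrow> q \<noteq> q' \<and> (\<exists>x. length x = k \<and> (\<exists>y. length y = k \<and>
    (x \<in> P e \<and> y \<in> P e \<and> q = F e x \<and> q' = F e y \<and> r e x y)))" for e q q'
  have dQ: "dfam {} l Q" unfolding Q_def by (rule dfn)+
  have drq: "drel {} l l rq" unfolding rq_def by (rule dfn)+
  have QE: "\<exists>x. x \<in> P e \<and> q = F e x" if "q \<in> Q e" for e q using that unfolding Q_def by blast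
  \<comment> \<open>The order of two different classes does not depend on the representatives:
    otherwise a point of one class would lie between two points of the other, which is
    convex.\<close>
  have rq_iff: "rq e (F e x) (F e y) \<longleftrightarrow> F e x \<noteq> F e y \<and> r e x y" if xy: "x \<in> P e" "y \<in> P e" for e x y
  proof
    assume "F e x \<noteq> F e y \<and> r e x y"
    then show "rq e (F e x) (F e y)" using xy Pl unfolding rq_def by blast
  next
    assume "rq e (F e x) (F e y)"
    then obtain x' y' where x': "x' \<in> P e" "F e x = F e x'" and y': "y' \<in> P e" "F e y = F e y'" and r': "r e x' y'"
      and ne: "F e x \<noteq> F e y" unfolding rq_def by blast
    have "r e x y"
    proof (rule ccontr)
      assume "\<not> r e x y"
      then have yx: "r e y x" using slo_total[OF slo xy] ne by auto
      consider "x' = y" | "r e x' y" | "r e y x'" using slo_total[OF slo x'(1) xy(2)] by blast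
      then show False
      proof cases
        case 1
        then show False using x' ne by simp
      next
        case 2
        then have "y \<in> seg (P e) (r e) x' x" using yx xy unfolding seg_def by blast
        then show False using conv[OF x'(1) xy(1) x'(2)[symmetric]] x'(2) ne by simp
      next
        case 3
        then have "x' \<in> seg (P e) (r e) y y'" using r' x' unfolding seg_def by blast
        then show False using conv[OF xy(2) y'(1,2)] x'(2) ne by simp
      qed
    qed
    then show "F e x \<noteq> F e y \<and> r e x y" using ne by blast
  qed
  have 1: "quotient_order M k l n (P e) (Q e) (F e) (rq e)" for e
  proof (intro quotient_order.intro ngrp_axioms quotient_order_axioms.intro)
    show "dset l (Q e)" by (rule dfam_inst[OF dQ])
    show "Q e \<subseteq> tuples l" unfolding Q_def tuples_def using Fl by blast
    show "drel UNIV l l (\<lambda>_. rq e)" by (rule drel_inst[OF drq])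
    show "dset k (P e)" by (rule dfam_inst[OF dP])
    show "drel UNIV k l (\<lambda>_ x z. z = F e x)" by (rule drel_inst[OF dF])
    show "length (F e x) = l" if "length x = k" for x using Fl[OF that] .
    show "\<not> dge k (Suc n) (P e)" by (rule dim)
    show "slo (Q e) (rq e)"
    proof (rule sloI)
      show "\<not> rq e q q" for q unfolding rq_def by blast
    next
      fix q q' q'' assume q: "q \<in> Q e" "q' \<in> Q e" "q'' \<in> Q e" and rr: "rq e q q'" "rq e q' q''"
      obtain x y z where x: "x \<in> P e" "q = F e x" and y: "y \<in> P e" "q' = F e y" and z: "z \<in> P e" "q'' = F e z"
        using QE[OF q(1)] QE[OF q(2)] QE[OF q(3)] by blast
      have r1: "F e x \<noteq> F e y" "r e x y" "r e y z" using rr rq_iff[OF x(1) y(1)] rq_iff[OF y(1) z(1)] unfolding x y z by blast+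
      then have "r e x z" using slo_trans[OF slo x(1) y(1) z(1)] by blast
      moreover have "F e x \<noteq> F e z"
      proof
        assume eq: "F e x = F e z"
        have "y \<in> seg (P e) (r e) x z" using r1 y unfolding seg_def by blast
        then show False using conv[OF x(1) z(1) eq] r1 by blast
      qed
      ultimately show "rq e q q''" unfolding x(2) z(2) rq_iff[OF x(1) z(1)] by blast
    next
      fix q q' assume q: "q \<in> Q e" "q' \<in> Q e" and ne: "q \<noteq> q'"
      obtain x y where x: "x \<in> P e" "q = F e x" and y: "y \<in> P e" "q' = F e y" using QE[OF q(1)] QE[OF q(2)] by blast
      then show "rq e q q' \<or> rq e q' q"
        using ne slo_total[OF slo x(1) y(1)] unfolding x(2) y(2) rq_iff[OF x(1) y(1)] rq_iff[OF y(1) x(1)] by auto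
    qed
    fix q q' assume q: "q \<in> Q e" "q' \<in> Q e" and ne: "q \<noteq> q'"
    obtain x y where x: "x \<in> P e" "q = F e x" and y: "y \<in> P e" "q' = F e y" using QE[OF q(1)] QE[OF q(2)] by blast
    then have "dge k n (P e \<inter> seg (P e) (r e) x y)" using F[OF x(1) y(1)] ne by blast
    then show "dge k n {x. x \<in> P e \<and> F e x \<in> seg (Q e) (rq e) q q'}"
    proof (rule dge_mono)
      fix z assume z: "z \<in> P e \<inter> seg (P e) (r e) x y"
      then have zP: "z \<in> P e" by blast
      have tr: "F e u = F e v \<or> rq e (F e u) (F e v)" if "u \<in> P e" "v \<in> P e" "u = v \<or> r e u v" for u v
        using that rq_iff by blast
      have zQ: "F e z \<in> Q e" using zP Pl unfolding Q_def by blast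
      have "(z = x \<or> r e x z) \<and> (z = y \<or> r e z y) \<or> (z = y \<or> r e y z) \<and> (z = x \<or> r e z x)"
        using z unfolding seg_def by blast
      then have "F e z \<in> seg (Q e) (rq e) (F e x) (F e y)"
        using tr[OF x(1) zP] tr[OF zP y(1)] tr[OF y(1) zP] tr[OF zP x(1)] zQ unfolding seg_def by auto
      then show "z \<in> {x. x \<in> P e \<and> F e x \<in> seg (Q e) (rq e) q q'}" using zP unfolding x(2) y(2) by blast
    qed
  qed
  have 2: "\<not> dge k n {x. x \<in> P e \<and> q = F e x}" for e q
  proof
    assume d: "dge k n {x. x \<in> P e \<and> q = F e x}"
    then obtain x0 where x0: "x0 \<in> P e" "q = F e x0" using dge_zero[of k "{x. x \<in> P e \<and> q = F e x}"] dge_antimono[OF d, of 0] by blast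
    from d have "dge k n {x. x \<in> P e \<and> \<not> dge k n (P e \<inter> seg (P e) (r e) x0 x)}"
    proof (rule dge_mono)
      fix x assume "x \<in> {x. x \<in> P e \<and> q = F e x}"
      then have "x \<in> P e" "F e x0 = F e x" using x0(2) by simp_all
      then show "x \<in> {x. x \<in> P e \<and> \<not> dge k n (P e \<inter> seg (P e) (r e) x0 x)}" using F[OF x0(1), of x] by blast
    qed
    then show False using class_dim[OF slo[of e] Pk[of e] dfam_inst[OF dP, of e] drel_inst[OF dr, of e] dfam_inst[OF dP, of e] subset_refl x0(1), of n] by blast
  qed
  have 3: "length (F e x) = l \<and> F e x \<in> Q e" if "x \<in> P e" for e x using Fl Pl[OF that] that unfolding Q_def by blast
  have 4: "rq e (F e x) (F e y)" if "x \<in> P e" "y \<in> P e" "r e x y" "F e x \<noteq> F e y" for e x y using rq_iff that by blast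
  have "\<forall>e. quotient_order M k l n (P e) (Q e) (F e) (rq e)" "\<forall>e x. x \<in> P e \<longrightarrow> length (F e x) = l \<and> F e x \<in> Q e"
    "\<forall>e x y. x \<in> P e \<longrightarrow> y \<in> P e \<longrightarrow> r e x y \<longrightarrow> F e x \<noteq> F e y \<longrightarrow> rq e (F e x) (F e y)"
    "\<forall>e q. \<not> dge k n {x. x \<in> P e \<and> q = F e x}"
    by (intro allI 1, intro allI impI 3, assumption, intro allI impI 4, assumption+, intro allI 2)
  then show ?thesis using dF dQ drq by (intro exI[of _ l] exI[of _ F] exI[of _ Q] exI[of _ rq] conjI)
qed

text \<open>The dimension is only bounded from above, because the classes that the induction meets
  may have different dimensions and some members of their family are empty. The list
  \<open>c\<close> is a variable, so that the quotient and the classes can take their labels from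
  different parts of one list.\<close>

lemma order_embedding:
  "dfam {} k P \<Longrightarrow> drel {} k k r \<Longrightarrow> (\<And>e. P e \<subseteq> tuples k) \<Longrightarrow> (\<And>e. slo (P e) (r e)) \<Longrightarrow> (\<And>e. \<not> dge k (Suc n) (P e)) \<Longrightarrow>
   \<exists>N g. 0 < N \<and> drel {} (N + k) (2 * n + 1) (\<lambda>e w z. drop N w \<in> P e \<and> z = g e (take N w) (drop N w)) \<and>
    (\<forall>e c x. length c = N \<longrightarrow> x \<in> P e \<longrightarrow> length (g e c x) = 2 * n + 1 \<and> (\<forall>i\<le>n. g e c x ! (2 * i) \<in> set c)) \<and>
    (\<forall>e c x y. length c = N \<longrightarrow> sorted_wrt (<) c \<longrightarrow> x \<in> P e \<longrightarrow> y \<in> P e \<longrightarrow> r e x y \<longrightarrow>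
       (g e c x, g e c y) \<in> lex_less (2 * n + 1))"
proof (induction n arbitrary: k P r)
  case 0
  have fin: "finite (P e)" for e
  proof -
    have "{x \<in> P e. length x = k} = P e" using 0(3)[of e] by (auto simp: tuples_def)
    moreover have "\<not> dge k 1 (P e)" using 0(5)[of e] by simp
    ultimately show ?thesis unfolding dge_one by simp
  qed
  obtain N g where g: "0 < N" "drel {} (N + k) 1 (\<lambda>e w z. drop N w \<in> P e \<and> z = [g e (take N w) (drop N w)])"
    "\<forall>e c x. length c = N \<longrightarrow> x \<in> P e \<longrightarrow> g e c x \<in> set c"
    "\<forall>e c x y. length c = N \<longrightarrow> sorted_wrt (<) c \<longrightarrow> x \<in> P e \<longrightarrow> y \<in> P e \<longrightarrow> r e x y \<longrightarrow> g e c x < g e c y"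
    using finite_embedding[OF 0(1,2,3,4) fin] by blast
  show ?case
  proof (rule exI[of _ N], rule exI[of _ "\<lambda>e c x. [g e c x]"], intro conjI)
    show "drel {} (N + k) (2 * 0 + 1) (\<lambda>e w z. drop N w \<in> P e \<and> z = [g e (take N w) (drop N w)])" using g(2) by simp
    show "\<forall>e c x y. length c = N \<longrightarrow> sorted_wrt (<) c \<longrightarrow> x \<in> P e \<longrightarrow> y \<in> P e \<longrightarrow> r e x y \<longrightarrow>
       ([g e c x], [g e c y]) \<in> lex_less (2 * 0 + 1)" using g(4) by (simp add: lex_less_Cons)
  qed (use g(1,3) in auto)
next
  case (Suc n)
  have Pl: "length x = k" if "x \<in> P e" for x e using that Suc.prems(3) by (auto simp: tuples_def)
  from thin_quotient[OF Suc.prems zero_less_Suc] obtain l F Q rq where dF: "drel {} k l (\<lambda>e x z. z = F e x)"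
    and dQ: "dfam {} l Q" and drq: "drel {} l l rq" and qo: "\<forall>e. quotient_order M k l (Suc n) (P e) (Q e) (F e) (rq e)"
    and FQ: "\<forall>e x. x \<in> P e \<longrightarrow> length (F e x) = l \<and> F e x \<in> Q e"
    and F_less: "\<forall>e x y. x \<in> P e \<longrightarrow> y \<in> P e \<longrightarrow> r e x y \<longrightarrow> F e x \<noteq> F e y \<longrightarrow> rq e (F e x) (F e y)"
    and thin: "\<forall>e q. \<not> dge k (Suc n) {x. x \<in> P e \<and> q = F e x}" by blast
  from quotient_embedding[OF qo[rule_format] dQ drq] obtain N1 G where
    dG: "drel {} (N1 + l) 2 (\<lambda>e w z. drop N1 w \<in> Q e \<and> z = G e (take N1 w) (drop N1 w))"
    and G1: "\<forall>e c q. length c = N1 \<longrightarrow> q \<in> Q e \<longrightarrow> (\<exists>x y. G e c q = [x, y] \<and> x \<in> set c)"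
    and G2: "\<forall>e c q q'. length c = N1 \<longrightarrow> sorted_wrt (<) c \<longrightarrow> q \<in> Q e \<longrightarrow> q' \<in> Q e \<longrightarrow> rq e q q' \<longrightarrow> (G e c q, G e c q') \<in> lex_less 2"
    by blast
  note [dfn] = dfamD[OF Suc.prems(1)] drelD[OF Suc.prems(2)] drelD[OF dF]
  \<comment> \<open>The class over \<open>q\<close> in the order with index \<open>e\<close>, as a
    family whose index is \<open>q\<close> followed by \<open>e\<close>; for tuples that are no
    values of \<open>F\<close> the member is empty. In this form the induction hypothesis embeds all
    classes uniformly.\<close>
  define Pc where "Pc e = {x. x \<in> P (\<lambda>i. e (l + i)) \<and> map e [0..<l] = F (\<lambda>i. e (l + i)) x}" for e
  define rc where "rc e = r (\<lambda>i. e (l + i))" for e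
  have dPc: "dfam {} k Pc" unfolding Pc_def by (rule dfn)+
  have drc: "drel {} k k rc" unfolding rc_def by (rule dfn)+
  have PcP: "Pc e \<subseteq> P (\<lambda>i. e (l + i))" for e unfolding Pc_def by blast
  have Pck: "Pc e \<subseteq> tuples k" for e using PcP Suc.prems(3) by blast
  have sloc: "slo (Pc e) (rc e)" for e unfolding rc_def using slo_subset[OF Suc.prems(4) PcP] .
  have dimc: "\<not> dge k (Suc n) (Pc e)" for e unfolding Pc_def using thin by blast
  obtain N2 g where N2: "0 < N2" and
    dg: "drel {} (N2 + k) (2 * n + 1) (\<lambda>e w z. drop N2 w \<in> Pc e \<and> z = g e (take N2 w) (drop N2 w))"
    and g1: "\<forall>e c x. length c = N2 \<longrightarrow> x \<in> Pc e \<longrightarrow> length (g e c x) = 2 * n + 1 \<and> (\<forall>i\<le>n. g e c x ! (2 * i) \<in> set c)"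
    and g2: "\<forall>e c x y. length c = N2 \<longrightarrow> sorted_wrt (<) c \<longrightarrow> x \<in> Pc e \<longrightarrow> y \<in> Pc e \<longrightarrow> rc e x y \<longrightarrow>
       (g e c x, g e c y) \<in> lex_less (2 * n + 1)"
    using Suc.IH[OF dPc drc Pck sloc dimc] by blast
  \<comment> \<open>The first \<open>N1\<close> entries of \<open>c\<close> label the pieces of the
    quotient, the remaining \<open>N2\<close> are passed on to the classes.\<close>
  define N where "N = N1 + N2"
  define g' where "g' e c x = G e (take N1 c) (F e x) @ g (prepend l (F e x) e) (drop N1 c) x" for e c x
  have Pc: "x \<in> Pc (prepend l (F e y) e)" if "x \<in> P e" "y \<in> P e" "F e x = F e y" for e x y
    unfolding Pc_def prepend_simps using FQ that by (simp add: prepend_simps)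
  have len: "length (take N1 c) = N1" "length (drop N1 c) = N2" if "length c = N" for c :: "'a list" using that unfolding N_def by simp_all
  have Gl: "length (G e (take N1 c) (F e x)) = 2" if c: "length c = N" "x \<in> P e" for e c x
  proof -
    obtain u v where "G e (take N1 c) (F e x) = [u, v]" using G1 FQ c len(1)[OF c(1)] by blast
    then show ?thesis by simp
  qed
  have gl: "length (g (prepend l (F e x) e) (drop N1 c) x) = 2 * n + 1" if "length c = N" "x \<in> P e" for e c x
    using g1 len(2)[OF that(1)] Pc[OF that(2,2) refl] by blast
  show ?case
  proof (rule exI[of _ N], rule exI[of _ g'], intro conjI allI impI)
    show "0 < N" unfolding N_def using N2 by simp
    have dt: "list_term A k (\<lambda>e. drop N (f e))" "list_term A N1 (\<lambda>e. take N1 (f e))" "list_term A (N2 + k) (\<lambda>e. drop N1 (f e))"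
      if "list_term A (N + k) f" for A and f :: "(nat \<Rightarrow> 'a) \<Rightarrow> 'a list"
      using list_drop[OF that, of k N] list_drop[OF that, of "N2 + k" N1] list_take[OF that, of N1] by (simp_all add: N_def)
    \<comment> \<open>Names for the two graphs, so that the definability rules treat each of them as
      a single relation.\<close>
    define H where "H e w z \<longleftrightarrow> drop N1 w \<in> Q e \<and> z = G e (take N1 w) (drop N1 w)" for e w z
    define H' where "H' e w z \<longleftrightarrow> drop N2 w \<in> Pc e \<and> z = g e (take N2 w) (drop N2 w)" for e w z
    have dH: "drel {} (N1 + l) 2 H" unfolding H_def by (rule dG)
    have dH': "drel {} (N2 + k) (2 * n + 1) H'" unfolding H'_def by (rule dg)
    have "drel {} (N + k) (2 * Suc n + 1) (\<lambda>e w z. drop N w \<in> P e \<and> (\<exists>q. length q = l \<and> (q = F e (drop N w) \<and>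
      (\<exists>u. length u = 2 \<and> (\<exists>v. length v = 2 * n + 1 \<and> (H e (take N1 w @ q) u \<and> H' (prepend l q e) (drop N1 w) v \<and> z = u @ v))))))"
      by (rule dfn dt drelD[OF dH] drelD[OF dH'] env_prepend refl | assumption | simp)+
    then show "drel {} (N + k) (2 * Suc n + 1) (\<lambda>e w z. drop N w \<in> P e \<and> z = g' e (take N w) (drop N w))"
      unfolding drel_def
    proof (rule dfn_cong)
      fix e0 :: "nat \<Rightarrow> 'a"
      define e where "e = (\<lambda>i. e0 (N + k + (2 * Suc n + 1 + i)))"
      define w where "w = map e0 [0..<N + k]"
      define z where "z = map (\<lambda>i. e0 (N + k + i)) [0..<2 * Suc n + 1]"
      have lw: "length w = N + k" unfolding w_def by simp
      define x where "x = drop N w"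
      have dw: "drop N2 (drop N1 w) = x" "take N1 (take N w) = take N1 w" "take N2 (drop N1 w) = drop N1 (take N w)" "length (take N1 w) = N1"
        using lw unfolding x_def N_def by (simp_all add: take_drop drop_drop add.commute)
      have "(x \<in> P e \<and> (\<exists>q. length q = l \<and> (q = F e x \<and>
      (\<exists>u. length u = 2 \<and> (\<exists>v. length v = 2 * n + 1 \<and> (H e (take N1 w @ q) u \<and> H' (prepend l q e) (drop N1 w) v \<and> z = u @ v)))))) \<longleftrightarrow>
        (x \<in> P e \<and> z = g' e (take N w) x)"
      proof (cases "x \<in> P e")
        case True
        have F: "length (F e x) = l" "F e x \<in> Q e" using FQ True by blast+
        have tw: "length (take N w) = N" using lw by simp
        have H: "H e (take N1 w @ F e x) u \<longleftrightarrow> u = G e (take N1 w) (F e x)" for u unfolding H_def using F dw by simp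
        have H': "H' (prepend l (F e x) e) (drop N1 w) v \<longleftrightarrow> v = g (prepend l (F e x) e) (drop N1 (take N w)) x" for v
          unfolding H'_def dw using Pc[OF True True refl] by blast
        have eq: "g' e (take N w) x = G e (take N1 w) (F e x) @ g (prepend l (F e x) e) (drop N1 (take N w)) x"
          unfolding g'_def dw ..
        show ?thesis
        proof
          assume "x \<in> P e \<and> z = g' e (take N w) x"
          then show "x \<in> P e \<and> (\<exists>q. length q = l \<and> (q = F e x \<and> (\<exists>u. length u = 2 \<and> (\<exists>v. length v = 2 * n + 1 \<and>
            (H e (take N1 w @ q) u \<and> H' (prepend l q e) (drop N1 w) v \<and> z = u @ v)))))"
            using True F(1) Gl[OF tw True, unfolded dw] gl[OF tw True] by (simp add: H H' eq)
        qed (auto simp: H H' eq)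
      qed blast
      then show "(drop N w \<in> P e \<and> (\<exists>q. length q = l \<and> (q = F e (drop N w) \<and>
      (\<exists>u. length u = 2 \<and> (\<exists>v. length v = 2 * n + 1 \<and> (H e (take N1 w @ q) u \<and> H' (prepend l q e) (drop N1 w) v \<and> z = u @ v)))))) \<longleftrightarrow>
        (drop N w \<in> P e \<and> z = g' e (take N w) (drop N w))" unfolding x_def .
    qed
  next
    fix e x and c :: "'a list" assume c: "length c = N" and x: "x \<in> P e"
    show "length (g' e c x) = 2 * Suc n + 1" unfolding g'_def using Gl[OF c x] gl[OF c x] by simp
    fix i assume i: "i \<le> Suc n"
    obtain u v where uv: "G e (take N1 c) (F e x) = [u, v]" "u \<in> set (take N1 c)" using G1 FQ x len(1)[OF c] by blast
    show "g' e c x ! (2 * i) \<in> set c"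
    proof (cases i)
      case 0
      then show ?thesis unfolding g'_def uv using uv(2) in_set_takeD by fastforce
    next
      \<comment> \<open>The two leading coordinates shift positions by 2: position
        \<open>2 * i\<close> here is position \<open>2 * j\<close> in the embedding of the
        class.\<close>
      case (Suc j)
      have "g (prepend l (F e x) e) (drop N1 c) x ! (2 * j) \<in> set (drop N1 c)"
        using g1 len(2)[OF c] Pc[OF x x refl] i Suc by simp
      then show ?thesis unfolding g'_def uv Suc using in_set_dropD by fastforce
    qed
  next
    fix e x y and c :: "'a list" assume c: "length c = N" "sorted_wrt (<) c" and xy: "x \<in> P e" "y \<in> P e" "r e x y"
    have s: "sorted_wrt (<) (take N1 c)" "sorted_wrt (<) (drop N1 c)" using c(2) sorted_wrt_take sorted_wrt_drop by blast+
    have e2: "2 * Suc n + 1 = 2 + (2 * n + 1)" by simp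
    show "(g' e c x, g' e c y) \<in> lex_less (2 * Suc n + 1)"
      unfolding g'_def e2
    \<comment> \<open>Points of different classes are separated by the first two coordinates, points
      of the same class by the others.\<close>
    proof (rule lex_less_append[OF Gl[OF c(1) xy(1)] Gl[OF c(1) xy(2)] gl[OF c(1) xy(1)] gl[OF c(1) xy(2)]])
      show "(G e (take N1 c) (F e x), G e (take N1 c) (F e y)) \<in> lex_less 2 \<or> G e (take N1 c) (F e x) = G e (take N1 c) (F e y) \<and>
        (g (prepend l (F e x) e) (drop N1 c) x, g (prepend l (F e y) e) (drop N1 c) y) \<in> lex_less (2 * n + 1)"
      proof (cases "F e x = F e y")
        case True
        have "rc (prepend l (F e x) e) x y" unfolding rc_def prepend_simps using xy(3) .
        then have "(g (prepend l (F e x) e) (drop N1 c) x, g (prepend l (F e x) e) (drop N1 c) y) \<in> lex_less (2 * n + 1)"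
          using g2 len(2)[OF c(1)] s(2) Pc[OF xy(1,1) refl] Pc[OF xy(2,1) True[symmetric]] by blast
        then show ?thesis using True by simp
      next
        case False
        then have "rq e (F e x) (F e y)" using F_less xy by blast
        then show ?thesis using G2 len(1)[OF c(1)] s(1) FQ xy(1,2) by blast
      qed
    qed
  qed
qed

end

text \<open>Uniformity is the order of the quantifiers: \<chi> and \<open>c\<close> come before
  \<open>a\<close>, so one formula defines the graph for all orders of dimension \<open>n\<close>
  that \<phi> and \<psi> define. Besides \<open>a\<close> it uses the constants \<open>c\<close>,
  from which the odd coordinates take their values and which may be found in any prescribed infinite
  set \<open>C\<close>.\<close>

theorem theoremA:
  fixes M :: "('f, 'r, 'a::linorder) fo_structure"
    and \<phi> \<psi> :: "('f, 'r) fml" and k p n :: nat and C :: "'a set"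
  assumes "o_minimal M" and "near_group M"
    and "formula_in M (k + p) \<phi>" and "formula_in M (k + k + p) \<psi>"
    and "infinite C"
  shows "\<exists>\<chi> c. set c \<subseteq> C \<and> formula_in M (k + (2 * n + 1) + (p + length c)) \<chi> \<and>
    (\<forall>a P R. a \<in> tuples p \<and>
       P = solutions M \<phi> k a \<and>
       R = {(x, y). x \<in> P \<and> y \<in> P \<and> x @ y \<in> solutions M \<psi> (k + k) a} \<and>
       strict_linear_order_on P R \<and>
       o_dim k P = n \<longrightarrow>
       (\<exists>g. definable_map_over M UNIV k P (2 * n + 1) g \<and>
          graph_on P g = solutions M \<chi> (k + (2 * n + 1)) (a @ c) \<and>
          (\<forall>x\<in>P. \<forall>y\<in>P. (x, y) \<in> R \<longleftrightarrow> (g x, g y) \<in> lex_less (2 * n + 1)) \<and>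
          (\<forall>i\<in>{1..2 * n + 1}. odd i \<longrightarrow> finite ((\<lambda>x. g x ! (i - 1)) ` P))))"
proof -
  note \<phi> = assms(3) and \<psi> = assms(4)
  interpret fo M .
  obtain \<theta> :: "'a \<Rightarrow> 'a" where \<theta>: "inj \<theta>" "antimono \<theta>" "definable_over M {} 2 {[x, \<theta> x] |x. True}"
    using assms(2) unfolding near_group_def by blast
  have d\<theta>: "drel1 {} (\<lambda>_ x y. y = \<theta> x)"
  proof -
    obtain \<tau> as where as: "set as \<subseteq> {}" "formula_in M (2 + length as) \<tau>" "{[x, \<theta> x] |x. True} = solutions M \<tau> 2 as"
      using \<theta>(3) unfolding definable_over_def by blast
    then have \<tau>: "formula_in M 2 \<tau>" "{[x, \<theta> x] |x. True} = solutions M \<tau> 2 []" by simp_all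
    have "y = \<theta> x \<longleftrightarrow> sat M (nth [x, y]) \<tau>" for x y
    proof -
      have "y = \<theta> x \<longleftrightarrow> [x, y] \<in> {[x, \<theta> x] |x. True}" by auto
      also have "\<dots> \<longleftrightarrow> sat M (nth [x, y]) \<tau>" unfolding \<tau>(2) by (simp add: solutions_def tuples_def)
      finally show ?thesis .
    qed
    moreover have "drel1 {} (\<lambda>_ x y. sat M (nth [x, y]) \<tau>)" by (rule drel1I, rule dfn_sat[OF \<tau>(1)]) (rule dfn)+
    ultimately show ?thesis by (simp only:)
  qed
  interpret near M \<theta>
    by unfold_locales (use assms(1,2) \<theta> d\<theta> in \<open>auto simp: near_group_def\<close>)
  define P1 where "P1 e = {x. sat M (nth (x @ map e [0..<p])) \<phi>}" for e
  define R1 where "R1 e x y \<longleftrightarrow> sat M (nth ((x @ y) @ map e [0..<p])) \<psi>" for e x y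
  have dP1: "dfam {} k P1" unfolding P1_def by (rule dfamI dfn_mem_Collect dfn_sat[OF \<phi>] list_append list_upt elt_var refl)+
  have dR1: "drel {} k k R1" unfolding R1_def by (rule drelI dfn_sat[OF \<psi>] list_append list_upt elt_var refl)+
  note [dfn] = dfamD[OF dP1] drelD[OF dR1]
  \<comment> \<open>The condition that \<phi> and \<psi> define at \<open>e\<close> a linear order
    of dimension at most \<open>n\<close>. Where it fails \<open>P'\<close> is empty, so that
    \<open>order_embedding\<close> applies to the whole family.\<close>
  define good where "good e \<longleftrightarrow> (\<forall>x. length x = k \<longrightarrow> (x \<in> P1 e \<longrightarrow> \<not> R1 e x x)) \<and>
    (\<forall>x. length x = k \<longrightarrow> (\<forall>y. length y = k \<longrightarrow> (\<forall>z. length z = k \<longrightarrow>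
      (x \<in> P1 e \<and> y \<in> P1 e \<and> z \<in> P1 e \<and> R1 e x y \<and> R1 e y z \<longrightarrow> R1 e x z)))) \<and>
    (\<forall>x. length x = k \<longrightarrow> (\<forall>y. length y = k \<longrightarrow> (x \<in> P1 e \<and> y \<in> P1 e \<and> x \<noteq> y \<longrightarrow> R1 e x y \<or> R1 e y x))) \<and>
    \<not> dge k (Suc n) (P1 e)" for e
  define P' where "P' e = {x. length x = k \<and> x \<in> P1 e \<and> good e}" for e
  have "dfam {} k (\<lambda>e. {x. x \<in> P1 e \<and> good e})" unfolding good_def by (rule dfn)+
  then have dP': "dfam {} k P'" unfolding dfam_def P'_def by (rule dfn_cong) simp
  have P'k: "P' e \<subseteq> tuples k" for e unfolding P'_def tuples_def by blast
  have slo': "slo (P' e) (R1 e)" for e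
  proof (cases "good e")
    case True
    then show ?thesis unfolding slo_def P'_def good_def by blast
  next
    case False
    then show ?thesis unfolding slo_def P'_def by blast
  qed
  have dim': "\<not> dge k (Suc n) (P' e)" for e
  proof
    assume d: "dge k (Suc n) (P' e)"
    then have "good e" using dge_antimono[OF d, of 0] unfolding dge_zero P'_def by blast
    moreover have "dge k (Suc n) (P1 e)" using d by (rule dge_mono) (simp add: P'_def)
    ultimately show False unfolding good_def by blast
  qed
  obtain N g where N: "0 < N" and dg: "drel {} (N + k) (2 * n + 1) (\<lambda>e w z. drop N w \<in> P' e \<and> z = g e (take N w) (drop N w))"
    and g1: "\<forall>e c x. length c = N \<longrightarrow> x \<in> P' e \<longrightarrow> length (g e c x) = 2 * n + 1 \<and> (\<forall>i\<le>n. g e c x ! (2 * i) \<in> set c)"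
    and g2: "\<forall>e c x y. length c = N \<longrightarrow> sorted_wrt (<) c \<longrightarrow> x \<in> P' e \<longrightarrow> y \<in> P' e \<longrightarrow> R1 e x y \<longrightarrow>
       (g e c x, g e c y) \<in> lex_less (2 * n + 1)"
    using order_embedding[OF dP' dR1 P'k slo' dim'] by blast
  obtain C0 where C0: "finite C0" "card C0 = N" "C0 \<subseteq> C" using infinite_arbitrarily_large[OF assms(5)] by blast
  define c where "c = sorted_list_of_set C0"
  have c: "length c = N" "sorted_wrt (<) c" "set c \<subseteq> C" unfolding c_def using C0 by auto
  define m where "m = 2 * n + 1"
  \<comment> \<open>The index is an infinite environment, but \<chi> has access to \<open>a\<close>
    and \<open>c\<close> only. So the slots from \<open>p\<close> on are filled with the first entry
    of \<open>c\<close>, which exists because \<open>0 < N\<close>.\<close>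
  define env where "env b i = (if i < p then b ! i else b ! p)" for b :: "'a list" and i
  define H where "H e w z \<longleftrightarrow> drop N w \<in> P' e \<and> z = g e (take N w) (drop N w)" for e w z
  \<comment> \<open>The variables of \<chi> are ordered as point, value, \<open>a\<close>,
    \<open>c\<close>, whereas \<open>H\<close> expects \<open>c\<close> in front of the
    point.\<close>
  define \<Gamma> where "\<Gamma> w \<longleftrightarrow> H (env (drop (k + m) w)) (drop (k + m + p) w @ take k w) (drop k (take (k + m) w))" for w
  have dH: "drel {} (N + k) m H" unfolding H_def m_def by (rule dg)
  have denv: "env_term A (\<lambda>e. env (L e))" if L: "list_term A (p + N) L" for A L
    unfolding env_term_def
  proof
    fix i show "elt_term A (\<lambda>e. env (L e) i)"
      unfolding env_def using elt_nth[OF L, of i] elt_nth[OF L, of p] N by (cases "i < p") simp_all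
  qed
  have "dfn {} (\<lambda>e. \<Gamma> (map e [0..<k + m + (p + N)]))"
    unfolding \<Gamma>_def
  proof (rule drelD[OF dH])
    let ?L = "\<lambda>e :: nat \<Rightarrow> 'a. map e [0..<k + m + (p + N)]"
    have L: "list_term {} (k + m + (p + N)) ?L" by (rule dfn)+
    show "list_term {} (N + k) (\<lambda>e. drop (k + m + p) (?L e) @ take k (?L e))"
      by (rule list_append[OF list_drop[OF L, of N] list_take[OF L, of k]]) simp_all
    have "list_term {} (k + m) (\<lambda>e. take (k + m) (?L e))" by (rule list_take[OF L]) simp
    from list_drop[OF this, of m k] show "list_term {} m (\<lambda>e. drop k (take (k + m) (?L e)))" by simp
    show "env_term {} (\<lambda>e. env (drop (k + m) (?L e)))" by (rule denv, rule list_drop[OF L]) simp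
  qed
  from dfn_formula[OF this] obtain \<chi> where \<chi>: "formula_in M (k + m + (p + N)) \<chi>"
    "\<And>xs. length xs = k + m + (p + N) \<Longrightarrow> sat M (nth xs) \<chi> \<longleftrightarrow> \<Gamma> xs" using N by auto
  show ?thesis
  proof (rule exI[of _ \<chi>], rule exI[of _ c], intro conjI allI impI)
    show "set c \<subseteq> C" by (rule c)
    show "formula_in M (k + (2 * n + 1) + (p + length c)) \<chi>" using \<chi>(1) unfolding c(1) m_def .
    fix a P R
    assume "a \<in> tuples p \<and> P = solutions M \<phi> k a \<and> R = {(x, y). x \<in> P \<and> y \<in> P \<and> x @ y \<in> solutions M \<psi> (k + k) a} \<and>
       strict_linear_order_on P R \<and> o_dim k P = n"
    then have a: "length a = p" and P: "P = solutions M \<phi> k a"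
      and R: "R = {(x, y). x \<in> P \<and> y \<in> P \<and> x @ y \<in> solutions M \<psi> (k + k) a}"
      and lin: "strict_linear_order_on P R" and dim: "o_dim k P = n" by (auto simp: tuples_def)
    define e where "e = env (a @ c)"
    have ea: "map e [0..<p] = a" unfolding e_def env_def using a by (auto intro!: nth_equalityI simp: nth_append)
    have PP1: "x \<in> P \<longleftrightarrow> length x = k \<and> x \<in> P1 e" for x unfolding P P1_def ea by (simp add: solutions_def tuples_def)
    have Pk: "P \<subseteq> tuples k" unfolding P solutions_def by blast
    have RR1: "(x, y) \<in> R \<longleftrightarrow> R1 e x y" if "x \<in> P" "y \<in> P" for x y
      using that PP1 unfolding R R1_def ea by (auto simp: solutions_def tuples_def)
    have tot: "trans R" "irrefl R" "total_on P R" using lin unfolding strict_linear_order_on_def by blast+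
    have sloP: "slo P (\<lambda>x y. (x, y) \<in> R)"
      by (rule sloI) (use tot in \<open>auto simp: irrefl_def total_on_def dest: transD\<close>)
    have g4: "\<not> dge k (Suc n) (P1 e)"
    proof
      assume "dge k (Suc n) (P1 e)"
      then have "dge k (Suc n) P" by (rule dge_mono) (simp add: PP1)
      moreover have "dset k P"
        using dfam_inst[OF dP1, of e] unfolding dfam_def by (rule dfn_cong) (simp add: PP1)
      ultimately show False using not_dge_if_o_dim[OF _ Pk dim] by blast
    qed
    have g1': "\<not> R1 e x x" if "x \<in> P" for x using slo_irrefl[OF sloP that] RR1[OF that that] by blast
    have g2': "R1 e x z" if "x \<in> P" "y \<in> P" "z \<in> P" "R1 e x y" "R1 e y z" for x y z
      using slo_trans[OF sloP that(1-3)] that RR1 by blast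
    have g3: "R1 e x y \<or> R1 e y x" if "x \<in> P" "y \<in> P" "x \<noteq> y" for x y
      using slo_total[OF sloP that] RR1 that by blast
    have "good e"
      unfolding good_def
    proof (intro conjI allI impI)
      fix x assume "length x = k" "x \<in> P1 e"
      then show "\<not> R1 e x x" using g1'[of x] PP1[of x] by blast
    next
      fix x y z assume "length x = k" "length y = k" "length z = k" "x \<in> P1 e \<and> y \<in> P1 e \<and> z \<in> P1 e \<and> R1 e x y \<and> R1 e y z"
      then show "R1 e x z" using g2'[of x y z] PP1[of x] PP1[of y] PP1[of z] by blast
    next
      fix x y assume "length x = k" "length y = k" "x \<in> P1 e \<and> y \<in> P1 e \<and> x \<noteq> y"
      then show "R1 e x y \<or> R1 e y x" using g3[of x y] PP1[of x] PP1[of y] by blast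
    qed (rule g4)
    then have PP': "P = P' e" unfolding P'_def using PP1 by blast
    define h where "h x = g e c x" for x
    have hl: "length (h x) = 2 * n + 1" if "x \<in> P" for x using g1 c(1) that unfolding h_def PP' by blast
    have graph: "graph_on P h = solutions M \<chi> (k + (2 * n + 1)) (a @ c)"
    proof (intro set_eqI)
      fix w
      have "w \<in> solutions M \<chi> (k + m) (a @ c) \<longleftrightarrow> length w = k + m \<and> take k w \<in> P \<and> drop k w = h (take k w)"
      proof (cases "length w = k + m")
        case True
        then have "w \<in> solutions M \<chi> (k + m) (a @ c) \<longleftrightarrow> \<Gamma> (w @ a @ c)"
          using \<chi>(2)[of "w @ a @ c"] a c(1) unfolding solutions_def tuples_def by simp
        also have "\<dots> \<longleftrightarrow> H e (c @ take k w) (drop k w)" unfolding \<Gamma>_def e_def using True a by simp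
        also have "\<dots> \<longleftrightarrow> take k w \<in> P \<and> drop k w = h (take k w)" unfolding H_def PP' h_def using c(1) by simp
        finally show ?thesis using True by blast
      qed (simp add: solutions_def tuples_def)
      moreover have "w \<in> graph_on P h \<longleftrightarrow> length w = k + m \<and> take k w \<in> P \<and> drop k w = h (take k w)"
      proof
        assume "w \<in> graph_on P h"
        then obtain x where x: "x \<in> P" "w = x @ h x" unfolding graph_on_def by blast
        then show "length w = k + m \<and> take k w \<in> P \<and> drop k w = h (take k w)" using hl PP1 unfolding m_def by simp
      next
        assume "length w = k + m \<and> take k w \<in> P \<and> drop k w = h (take k w)"
        then show "w \<in> graph_on P h" unfolding graph_on_def using append_take_drop_id[of k w] by (metis (mono_tags, lifting) mem_Collect_eq)
      qed
      ultimately show "w \<in> graph_on P h \<longleftrightarrow> w \<in> solutions M \<chi> (k + (2 * n + 1)) (a @ c)" unfolding m_def by blast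
    qed
    have mono: "(h x, h y) \<in> lex_less (2 * n + 1)" if "x \<in> P" "y \<in> P" "(x, y) \<in> R" for x y
      using g2 c(1,2) that RR1[OF that(1,2)] unfolding h_def PP' by blast
    show "\<exists>g. definable_map_over M UNIV k P (2 * n + 1) g \<and>
          graph_on P g = solutions M \<chi> (k + (2 * n + 1)) (a @ c) \<and>
          (\<forall>x\<in>P. \<forall>y\<in>P. (x, y) \<in> R \<longleftrightarrow> (g x, g y) \<in> lex_less (2 * n + 1)) \<and>
          (\<forall>i\<in>{1..2 * n + 1}. odd i \<longrightarrow> finite ((\<lambda>x. g x ! (i - 1)) ` P))"
    proof (rule exI[of _ h], intro conjI ballI impI)
      have "definable_over M UNIV (k + (2 * n + 1)) (graph_on P h)"
        unfolding definable_over_def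
        by (rule exI[of _ \<chi>], rule exI[of _ "a @ c"]) (use \<chi>(1) a c(1) graph in \<open>simp add: m_def\<close>)
      then show "definable_map_over M UNIV k P (2 * n + 1) h"
        unfolding definable_map_over_def using Pk hl by (auto simp: tuples_def)
      show "graph_on P h = solutions M \<chi> (k + (2 * n + 1)) (a @ c)" by (rule graph)
    next
      fix x y assume xy: "x \<in> P" "y \<in> P"
      show "(x, y) \<in> R \<longleftrightarrow> (h x, h y) \<in> lex_less (2 * n + 1)"
      proof
        \<comment> \<open>That the order is reflected follows from totality of \<open>R\<close> and
          asymmetry of the lexicographic order.\<close>
        assume l: "(h x, h y) \<in> lex_less (2 * n + 1)"
        have "x \<noteq> y" using l lex_less_asym by blast
        moreover have "(y, x) \<notin> R" using mono[OF xy(2,1)] l lex_less_asym by blast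
        ultimately show "(x, y) \<in> R" using slo_total[OF sloP xy] by blast
      qed (rule mono[OF xy])
    next
      fix i assume i: "i \<in> {1..2 * n + 1}" "odd i"
      \<comment> \<open>Coordinates are counted from 1 in the statement and from 0 in lists: an odd
        \<open>i\<close> is position \<open>2 * j\<close>, which holds an entry of
        \<open>c\<close>.\<close>
      then obtain j where j: "i - 1 = 2 * j" "j \<le> n" by (auto elim!: oddE)
      have "(\<lambda>x. h x ! (i - 1)) ` P \<subseteq> set c" unfolding j h_def PP' using g1 c(1) j(2) by blast
      then show "finite ((\<lambda>x. h x ! (i - 1)) ` P)" using finite_subset by blast
    qed
  qed
qed

end
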